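(* Let $\beta\in\mathfrak p$. Then: (1) if $x\in X$ and $G^{\beta+}\cdot x$ is compact, then $\mathcal O:=G\cdot x$ is compact and $G^{\beta+}\cdot x$ is a finite union of connected components of $\max_{\mathcal O}(\beta)=\{p\in\mathcal O:\ \mu_{\mathfrak p}^\beta(p)=\max_{z\in\mathcal O}\mu_{\mathfrak p}^\beta(z)\}$; (2) if $\mathcal O\subset X$ is a compact $G$-orbit, then $\max_{\mathcal O}(\beta)$ is a finite union of compact $G^{\beta+}$-orbits. In particular, the number of compact $G^{\beta+}$-orbits in $X$ is equal to or bigger than the number of compact $G$-orbits in $X$.
   Context: Let $U$ be a compact connected Lie group with Lie algebra $\mathfrak u$ and let $U^{\mathbb C}$ be its complexification, with Lie algebra $\mathfrak u^{\mathbb C}=\mathfrak u\oplus i\mathfrak u$. Let $G\subset U^{\mathbb C}$ be a connected compatible subgroup with Lie algebra $\mathfrak g$; compatible means that $G$ is closed and, with $K:=G\cap U$ and $\mathfrak p:=\mathfrak g\cap i\mathfrak u$, the map $K\times\mathfrak p\to G$, $(k,\beta)\mapsto k\exp(\beta)$, is a diffeomorphism. Then $\mathfrak g=\mathfrak k\oplus\mathfrak p$, where $\mathfrak k$ is the Lie algebra of $K$. Let $(Z,\omega)$ be a Kähler manifold with complex structure $J$ and Kähler metric $(v,w)=\omega(v,Jw)$, with a holomorphic action of $U^{\mathbb C}$ such that $\omega$ is $U$-invariant, and let $\mu:Z\to\mathfrak u^*$ be a $U$-equivariant momentum map: $d\mu^\xi=i_{\xi_Z}\omega$ for all $\xi\in\mathfrak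 u$, where $\mu^\xi(z)=\langle\mu(z),\xi\rangle$ and $\xi_Z(z)=\frac{d}{dt}\big|_{t=0}\exp(t\xi)\cdot z$. Fix an $\mathrm{Ad}(U)$-invariant inner product on $\mathfrak u$, identify $\mathfrak u^*$ with $\mathfrak u$, and transport the inner product to $i\mathfrak u$ by multiplication by $i$. The gradient map $\mu_{\mathfrak p}:Z\to\mathfrak p$ is defined by $\langle\mu_{\mathfrak p}(z),\beta\rangle=\mu_{\mathfrak p}^\beta(z):=\mu^{-i\beta}(z)$ for $\beta\in\mathfrak p$. Let $X\subset Z$ be a $G$-stable locally closed real submanifold; $\mu_{\mathfrak p}$ and $\mu_{\mathfrak p}^\beta$ also denote the restrictions to $X$. For $\beta\in\mathfrak p$, $G^{\beta+}:=\{g\in G:\ \lim_{t\to-\infty}\exp(t\beta)\,g\,\exp(-t\beta)\text{ exists (in }G)\}$, which is a parabolic subgroup of $G$. The number of orbits means the cardinality of the set of such orbits. *)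

theory Defs
  imports "HOL-Analysis.Analysis" "HOL-Algebra.Group_Action" "HOL-Library.Equipollence"
begin

section \<open>Smooth and complex manifolds\<close>

text \<open>
  The model space of a manifold is a finite-dimensional real normed space (rather than a
  \<^class>\<open>euclidean_space\<close>, whose dimension is always positive), so that manifolds and Lie groups
  of dimension 0 are included.
\<close>

definition finite_dimensional :: "'e::real_normed_vector itself \<Rightarrow> bool" where
  "finite_dimensional _ \<longleftrightarrow> (\<exists>B::'e set. finite B \<and> span B = UNIV)"

text \<open>The following two notions are meant for open \<open>S\<close> and finite-dimensional \<open>'e\<close>.\<close>

primrec Ck_on :: "nat \<Rightarrow> 'e::real_normed_vector set \<Rightarrow> ('e \<Rightarrow> 'f::real_normed_vector) \<Rightarrow> bool" where
  "Ck_on 0 S f \<longleftrightarrow> continuous_on S f"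
| "Ck_on (Suc k) S f \<longleftrightarrow>
     (\<forall>x\<in>S. f differentiable (at x)) \<and> (\<forall>v. Ck_on k S (\<lambda>x. frechet_derivative f (at x) v))"

definition smooth_on :: "'e::real_normed_vector set \<Rightarrow> ('e \<Rightarrow> 'f::real_normed_vector) \<Rightarrow> bool" where
  "smooth_on S f \<longleftrightarrow> (\<forall>k. Ck_on k S f)"

type_synonym ('a, 'e) chart = "'a set \<times> ('a \<Rightarrow> 'e)"

text \<open>
  The carrier of a manifold is the \<^const>\<open>topspace\<close> of its topology; the field \<open>i_mult\<close> is
  multiplication by the imaginary unit on the model space.
\<close>

record ('a, 'e) cmanifold =
  mtop :: "'a topology"
  atlas :: "('a, 'e) chart set"
  i_mult :: "'e \<Rightarrow> 'e"

definition local_rep :: "('a, 'e) chart \<Rightarrow> ('b, 'f) chart \<Rightarrow> ('a \<Rightarrow> 'b) \<Rightarrow> 'e \<Rightarrow> 'f" where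
  "local_rep c d f = snd d \<circ> f \<circ> inv_into (fst c) (snd c)"

definition smooth_chart ::
  "('a, 'e::real_normed_vector) cmanifold \<Rightarrow> ('a, 'e) chart \<Rightarrow> bool" where
  "smooth_chart M c \<longleftrightarrow>
     openin (mtop M) (fst c) \<and> open (snd c ` fst c) \<and>
     homeomorphic_map (subtopology (mtop M) (fst c)) (top_of_set (snd c ` fst c)) (snd c) \<and>
     (\<forall>d\<in>atlas M. smooth_on (snd c ` (fst c \<inter> fst d)) (local_rep c d (\<lambda>p. p)) \<and>
                  smooth_on (snd d ` (fst c \<inter> fst d)) (local_rep d c (\<lambda>p. p)))"

text \<open>
  Smoothness of a map defined on an arbitrary subset \<open>S\<close>, by local smooth extension. On an
  embedded submanifold this is smoothness with respect to its manifold structure.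
\<close>

definition smooth_map_on ::
  "('a, 'e::real_normed_vector) cmanifold \<Rightarrow> 'a set \<Rightarrow>
   ('b, 'f::real_normed_vector) cmanifold \<Rightarrow> ('a \<Rightarrow> 'b) \<Rightarrow> bool" where
  "smooth_map_on M S N f \<longleftrightarrow>
     f ` S \<subseteq> topspace (mtop N) \<and>
     (\<forall>p\<in>S. \<exists>W F. openin (mtop M) W \<and> p \<in> W \<and> (\<forall>q\<in>W \<inter> S. F q = f q) \<and>
        continuous_map (subtopology (mtop M) W) (mtop N) F \<and>
        (\<forall>c\<in>atlas M. \<forall>d\<in>atlas N.
           smooth_on (snd c ` {q \<in> fst c \<inter> W. F q \<in> fst d}) (local_rep c d F)))"

definition diffeomorphism_on ::
  "('a, 'e::real_normed_vector) cmanifold \<Rightarrow> 'a set \<Rightarrow>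
   ('b, 'f::real_normed_vector) cmanifold \<Rightarrow> 'b set \<Rightarrow> ('a \<Rightarrow> 'b) \<Rightarrow> bool" where
  "diffeomorphism_on M S N R f \<longleftrightarrow>
     bij_betw f S R \<and> smooth_map_on M S N f \<and> smooth_map_on N R M (inv_into S f)"

definition holomorphic_map ::
  "('a, 'e::real_normed_vector) cmanifold \<Rightarrow>
   ('b, 'f::real_normed_vector) cmanifold \<Rightarrow> ('a \<Rightarrow> 'b) \<Rightarrow> bool" where
  "holomorphic_map M N f \<longleftrightarrow>
     smooth_map_on M (topspace (mtop M)) N f \<and>
     (\<forall>c\<in>atlas M. \<forall>d\<in>atlas N. \<forall>p\<in>fst c. f p \<in> fst d \<longrightarrow>
        (\<forall>v. frechet_derivative (local_rep c d f) (at (snd c p)) (i_mult M v) =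
             i_mult N (frechet_derivative (local_rep c d f) (at (snd c p)) v)))"

text \<open>Holomorphy of the identity map says that all changes of charts are holomorphic.\<close>

definition complex_manifold :: "('a, 'e::real_normed_vector) cmanifold \<Rightarrow> bool" where
  "complex_manifold M \<longleftrightarrow>
     finite_dimensional TYPE('e) \<and>
     linear (i_mult M) \<and> (\<forall>v. i_mult M (i_mult M v) = - v) \<and>
     Hausdorff_space (mtop M) \<and> second_countable (mtop M) \<and>
     (\<forall>c\<in>atlas M. smooth_chart M c) \<and> \<Union>(fst ` atlas M) = topspace (mtop M) \<and>
     holomorphic_map M M (\<lambda>p. p)"

definition prod_manifold ::
  "('a, 'e) cmanifold \<Rightarrow> ('b, 'f) cmanifold \<Rightarrow> ('a \<times> 'b, 'e \<times> 'f) cmanifold" where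
  "prod_manifold M N =
     \<lparr>mtop = prod_topology (mtop M) (mtop N),
      atlas = {(fst c \<times> fst d, map_prod (snd c) (snd d)) | c d. c \<in> atlas M \<and> d \<in> atlas N},
      i_mult = map_prod (i_mult M) (i_mult N)\<rparr>"

definition vector_manifold ::
  "('e \<Rightarrow> 'e) \<Rightarrow> ('e::real_normed_vector, 'e) cmanifold" where
  "vector_manifold j = \<lparr>mtop = euclidean, atlas = {(UNIV, \<lambda>v. v)}, i_mult = j\<rparr>"

text \<open>
  Embedded real submanifolds, by slice charts; an embedded submanifold is automatically
  locally closed. The dimension of the slice may depend on the point.
\<close>

definition locally_closed_submanifold ::
  "('a, 'e::real_normed_vector) cmanifold \<Rightarrow> 'a set \<Rightarrow> bool" where
  "locally_closed_submanifold M X \<longleftrightarrow>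
     (\<exists>V C. openin (mtop M) V \<and> closedin (mtop M) C \<and> X = V \<inter> C) \<and>
     (\<forall>x\<in>X. \<exists>c. smooth_chart M c \<and> x \<in> fst c \<and>
        (\<exists>S. subspace S \<and> snd c ` (fst c \<inter> X) = snd c ` fst c \<inter> S))"


section \<open>Complex Lie groups\<close>

text \<open>
  The Lie algebra, i.e. the tangent space at the identity, is identified with the model space
  \<open>'e\<close> by means of the chart \<open>id_chart\<close> around the identity. Its complex structure is
  \<open>i_mult (mfd L)\<close>.
\<close>

record ('g, 'e) lie_group = "'g monoid" +
  mfd :: "('g, 'e) cmanifold"
  id_chart :: "('g, 'e) chart"

abbreviation ltop :: "('g, 'e) lie_group \<Rightarrow> 'g topology" where
  "ltop L \<equiv> mtop (mfd L)"

abbreviation i_lie :: "('g, 'e) lie_group \<Rightarrow> 'e \<Rightarrow> 'e" where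
  "i_lie L \<equiv> i_mult (mfd L)"

definition complex_lie_group :: "('g, 'e::real_normed_vector) lie_group \<Rightarrow> bool" where
  "complex_lie_group L \<longleftrightarrow>
     group L \<and> complex_manifold (mfd L) \<and> carrier L = topspace (ltop L) \<and>
     id_chart L \<in> atlas (mfd L) \<and> \<one>\<^bsub>L\<^esub> \<in> fst (id_chart L) \<and>
     holomorphic_map (prod_manifold (mfd L) (mfd L)) (mfd L) (\<lambda>(g, h). g \<otimes>\<^bsub>L\<^esub> h) \<and>
     holomorphic_map (mfd L) (mfd L) (\<lambda>g. inv\<^bsub>L\<^esub> g)"

definition one_parameter_subgroup ::
  "('g, 'e::real_normed_vector) lie_group \<Rightarrow> 'e \<Rightarrow> (real \<Rightarrow> 'g) \<Rightarrow> bool" where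
  "one_parameter_subgroup L \<xi> \<gamma> \<longleftrightarrow>
     continuous_map euclideanreal (ltop L) \<gamma> \<and>
     (\<forall>s t. \<gamma> (s + t) = \<gamma> s \<otimes>\<^bsub>L\<^esub> \<gamma> t) \<and> \<gamma> 0 = \<one>\<^bsub>L\<^esub> \<and>
     ((\<lambda>t. snd (id_chart L) (\<gamma> t)) has_vector_derivative \<xi>) (at 0)"

definition lie_exp :: "('g, 'e::real_normed_vector) lie_group \<Rightarrow> 'e \<Rightarrow> 'g" where
  "lie_exp L \<xi> = (THE \<gamma>. one_parameter_subgroup L \<xi> \<gamma>) 1"

text \<open>The Lie algebra of a closed subgroup \<open>H\<close>.\<close>

definition lie_algebra :: "('g, 'e::real_normed_vector) lie_group \<Rightarrow> 'g set \<Rightarrow> 'e set" where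
  "lie_algebra L H = {\<xi>. \<forall>t. lie_exp L (t *\<^sub>R \<xi>) \<in> H}"

definition Ad :: "('g, 'e::real_normed_vector) lie_group \<Rightarrow> 'g \<Rightarrow> 'e \<Rightarrow> 'e" where
  "Ad L g = frechet_derivative
     (local_rep (id_chart L) (id_chart L) (\<lambda>h. g \<otimes>\<^bsub>L\<^esub> h \<otimes>\<^bsub>L\<^esub> inv\<^bsub>L\<^esub> g))
     (at (snd (id_chart L) \<one>\<^bsub>L\<^esub>))"

definition polar_decomposition ::
  "('g, 'e::real_normed_vector) lie_group \<Rightarrow> 'g set \<Rightarrow> 'e set \<Rightarrow> 'g set \<Rightarrow> bool" where
  "polar_decomposition L K \<pp> G \<longleftrightarrow>
     diffeomorphism_on (prod_manifold (mfd L) (vector_manifold (i_lie L))) (K \<times> \<pp>) (mfd L) G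
       (\<lambda>(k, \<beta>). k \<otimes>\<^bsub>L\<^esub> lie_exp L \<beta>)"

text \<open>
  \<open>L\<close> is the complexification of its compact connected subgroup \<open>U\<close>: the Lie algebra of \<open>L\<close> is
  the direct sum of \<open>\<uu>\<close> and \<open>i\<uu>\<close>, and \<open>L = U exp(i\<uu>)\<close> diffeomorphically.
\<close>

definition complexification ::
  "('g, 'e::real_normed_vector) lie_group \<Rightarrow> 'g set \<Rightarrow> bool" where
  "complexification L U \<longleftrightarrow>
     complex_lie_group L \<and> subgroup U L \<and> compactin (ltop L) U \<and> connectedin (ltop L) U \<and>
     lie_algebra L U \<inter> i_lie L ` lie_algebra L U = {0} \<and>
     (\<forall>\<zeta>. \<exists>\<xi>\<in>lie_algebra L U. \<exists>\<eta>\<in>lie_algebra L U. \<zeta> = \<xi> + i_lie L \<eta>) \<and>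
     polar_decomposition L U (i_lie L ` lie_algebra L U) (carrier L)"

definition p_part :: "('g, 'e::real_normed_vector) lie_group \<Rightarrow> 'g set \<Rightarrow> 'g set \<Rightarrow> 'e set" where
  "p_part L U G = lie_algebra L G \<inter> i_lie L ` lie_algebra L U"

definition compatible_subgroup ::
  "('g, 'e::real_normed_vector) lie_group \<Rightarrow> 'g set \<Rightarrow> 'g set \<Rightarrow> bool" where
  "compatible_subgroup L U G \<longleftrightarrow>
     subgroup G L \<and> closedin (ltop L) G \<and> polar_decomposition L (G \<inter> U) (p_part L U G) G"

definition parabolic_plus ::
  "('g, 'e::real_normed_vector) lie_group \<Rightarrow> 'g set \<Rightarrow> 'e \<Rightarrow> 'g set" where
  "parabolic_plus L G \<beta> =
     {g \<in> G. \<exists>h\<in>G. limitin (ltop L)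
        (\<lambda>t::real. lie_exp L (t *\<^sub>R \<beta>) \<otimes>\<^bsub>L\<^esub> g \<otimes>\<^bsub>L\<^esub> lie_exp L ((- t) *\<^sub>R \<beta>)) h at_bot}"

definition invariant_inner_product ::
  "('g, 'e::real_normed_vector) lie_group \<Rightarrow> 'g set \<Rightarrow> ('e \<Rightarrow> 'e \<Rightarrow> real) \<Rightarrow> bool" where
  "invariant_inner_product L U ip \<longleftrightarrow>
     (\<forall>\<xi>\<in>lie_algebra L U. \<forall>\<eta>\<in>lie_algebra L U. ip \<xi> \<eta> = ip \<eta> \<xi>) \<and>
     (\<forall>\<xi>\<in>lie_algebra L U. \<forall>\<eta>\<in>lie_algebra L U. \<forall>\<zeta>\<in>lie_algebra L U. \<forall>a b.
        ip (a *\<^sub>R \<xi> + b *\<^sub>R \<eta>) \<zeta> = a * ip \<xi> \<zeta> + b * ip \<eta> \<zeta>) \<and>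
     (\<forall>\<xi>\<in>lie_algebra L U. \<xi> \<noteq> 0 \<longrightarrow> ip \<xi> \<xi> > 0) \<and>
     (\<forall>u\<in>U. \<forall>\<xi>\<in>lie_algebra L U. \<forall>\<eta>\<in>lie_algebra L U. ip (Ad L u \<xi>) (Ad L u \<eta>) = ip \<xi> \<eta>)"

text \<open>The inner product on \<open>i\<uu>\<close> for which multiplication by \<open>i\<close> is an isometry \<open>\<uu> \<rightarrow> i\<uu>\<close>.\<close>

definition transported_ip ::
  "('g, 'e::real_normed_vector) lie_group \<Rightarrow> ('e \<Rightarrow> 'e \<Rightarrow> real) \<Rightarrow> 'e \<Rightarrow> 'e \<Rightarrow> real" where
  "transported_ip L ip \<alpha> \<beta> = ip (- i_lie L \<alpha>) (- i_lie L \<beta>)"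


section \<open>Kaehler forms, momentum maps and gradient maps\<close>

text \<open>
  A 2-form is given by its coordinate representations: \<open>\<omega> c y v w\<close> is the value, in the chart
  \<open>c\<close> and at the point with coordinates \<open>y\<close>, on the tangent vectors with coordinates \<open>v\<close>, \<open>w\<close>.
\<close>

type_synonym ('z, 'f) two_form = "('z, 'f) chart \<Rightarrow> 'f \<Rightarrow> 'f \<Rightarrow> 'f \<Rightarrow> real"

definition preserves_form ::
  "('z, 'f::real_normed_vector) cmanifold \<Rightarrow> ('z, 'f) two_form \<Rightarrow> ('z \<Rightarrow> 'z) \<Rightarrow> bool" where
  "preserves_form Z \<omega> f \<longleftrightarrow>
     (\<forall>c\<in>atlas Z. \<forall>d\<in>atlas Z. \<forall>p\<in>fst c. f p \<in> fst d \<longrightarrow>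
        (\<forall>v w. \<omega> d (snd d (f p))
                  (frechet_derivative (local_rep c d f) (at (snd c p)) v)
                  (frechet_derivative (local_rep c d f) (at (snd c p)) w)
               = \<omega> c (snd c p) v w))"

text \<open>
  Preservation under the identity map says that the coordinate representations fit together.
  The last three conditions are closedness, \<open>J\<close>-invariance, and positivity of the metric
  \<open>(v, w) = \<omega>(v, Jw)\<close>.
\<close>

definition kaehler_manifold ::
  "('z, 'f::real_normed_vector) cmanifold \<Rightarrow> ('z, 'f) two_form \<Rightarrow> bool" where
  "kaehler_manifold Z \<omega> \<longleftrightarrow>
     complex_manifold Z \<and> preserves_form Z \<omega> (\<lambda>p. p) \<and>
     (\<forall>c\<in>atlas Z.
        (\<forall>v w. smooth_on (snd c ` fst c) (\<lambda>y. \<omega> c y v w)) \<and>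
        (\<forall>y\<in>snd c ` fst c.
           (\<forall>w. linear (\<lambda>v. \<omega> c y v w)) \<and> (\<forall>v w. \<omega> c y v w = - \<omega> c y w v) \<and>
           (\<forall>u v w. frechet_derivative (\<lambda>x. \<omega> c x v w) (at y) u
                  + frechet_derivative (\<lambda>x. \<omega> c x w u) (at y) v
                  + frechet_derivative (\<lambda>x. \<omega> c x u v) (at y) w = 0) \<and>
           (\<forall>v w. \<omega> c y (i_mult Z v) (i_mult Z w) = \<omega> c y v w) \<and>
           (\<forall>v. v \<noteq> 0 \<longrightarrow> \<omega> c y v (i_mult Z v) > 0)))"

definition holomorphic_action ::
  "('g, 'e::real_normed_vector) lie_group \<Rightarrow> ('z, 'f::real_normed_vector) cmanifold \<Rightarrow>
   ('g \<Rightarrow> 'z \<Rightarrow> 'z) \<Rightarrow> bool" where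
  "holomorphic_action L Z act \<longleftrightarrow>
     group_action L (topspace (mtop Z)) act \<and>
     holomorphic_map (prod_manifold (mfd L) Z) Z (\<lambda>(g, z). act g z)"

definition fundamental_vector ::
  "('g, 'e::real_normed_vector) lie_group \<Rightarrow> ('g \<Rightarrow> 'z \<Rightarrow> 'z) \<Rightarrow> 'e \<Rightarrow>
   ('z, 'f::real_normed_vector) chart \<Rightarrow> 'z \<Rightarrow> 'f" where
  "fundamental_vector L act \<xi> c z =
     vector_derivative (\<lambda>t. snd c (act (lie_exp L (t *\<^sub>R \<xi>)) z)) (at 0)"

text \<open>
  \<open>\<mu> z\<close> is a linear functional on \<open>\<uu>\<close>, so \<open>\<mu> z \<xi>\<close> is \<open>\<mu>\<^sup>\<xi>(z)\<close>; its values outside \<open>\<uu>\<close> are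
  irrelevant. The third condition is equivariance for the coadjoint action.
\<close>

definition momentum_map ::
  "('g, 'e::real_normed_vector) lie_group \<Rightarrow> 'g set \<Rightarrow> ('z, 'f::real_normed_vector) cmanifold \<Rightarrow>
   ('z, 'f) two_form \<Rightarrow> ('g \<Rightarrow> 'z \<Rightarrow> 'z) \<Rightarrow> ('z \<Rightarrow> 'e \<Rightarrow> real) \<Rightarrow> bool" where
  "momentum_map L U Z \<omega> act \<mu> \<longleftrightarrow>
     (\<forall>z\<in>topspace (mtop Z). \<forall>\<xi>\<in>lie_algebra L U. \<forall>\<eta>\<in>lie_algebra L U. \<forall>a b.
        \<mu> z (a *\<^sub>R \<xi> + b *\<^sub>R \<eta>) = a * \<mu> z \<xi> + b * \<mu> z \<eta>) \<and>
     (\<forall>\<xi>\<in>lie_algebra L U. \<forall>c\<in>atlas Z.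
        smooth_on (snd c ` fst c) (\<lambda>y. \<mu> (inv_into (fst c) (snd c) y) \<xi>)) \<and>
     (\<forall>u\<in>U. \<forall>z\<in>topspace (mtop Z). \<forall>\<xi>\<in>lie_algebra L U.
        \<mu> (act u z) \<xi> = \<mu> z (Ad L (inv\<^bsub>L\<^esub> u) \<xi>)) \<and>
     (\<forall>\<xi>\<in>lie_algebra L U. \<forall>c\<in>atlas Z. \<forall>z\<in>fst c. \<forall>v.
        frechet_derivative (\<lambda>y. \<mu> (inv_into (fst c) (snd c) y) \<xi>) (at (snd c z)) v
        = \<omega> c (snd c z) (fundamental_vector L act \<xi> c z) v)"

definition gradient_map ::
  "('g, 'e::real_normed_vector) lie_group \<Rightarrow> 'g set \<Rightarrow> 'g set \<Rightarrow>
   ('z, 'f::real_normed_vector) cmanifold \<Rightarrow> ('z \<Rightarrow> 'e \<Rightarrow> real) \<Rightarrow> ('e \<Rightarrow> 'e \<Rightarrow> real) \<Rightarrow>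
   ('z \<Rightarrow> 'e) \<Rightarrow> bool" where
  "gradient_map L U G Z \<mu> ip \<mu>p \<longleftrightarrow>
     (\<forall>z\<in>topspace (mtop Z). \<mu>p z \<in> p_part L U G \<and>
        (\<forall>\<beta>\<in>p_part L U G. transported_ip L ip (\<mu>p z) \<beta> = \<mu> z (- i_lie L \<beta>)))"

definition max_set ::
  "('g, 'e::real_normed_vector) lie_group \<Rightarrow> ('e \<Rightarrow> 'e \<Rightarrow> real) \<Rightarrow> ('z \<Rightarrow> 'e) \<Rightarrow> 'e \<Rightarrow>
   'z set \<Rightarrow> 'z set" where
  "max_set L ip \<mu>p \<beta> Y =
     {p \<in> Y. \<forall>z\<in>Y. transported_ip L ip (\<mu>p z) \<beta> \<le> transported_ip L ip (\<mu>p p) \<beta>}"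

definition sub_orbit :: "('g, 'e) lie_group \<Rightarrow> 'g set \<Rightarrow> ('g \<Rightarrow> 'z \<Rightarrow> 'z) \<Rightarrow> 'z \<Rightarrow> 'z set" where
  "sub_orbit L H act x = orbit (L\<lparr>carrier := H\<rparr>) act x"

definition compact_orbits ::
  "('g, 'e) lie_group \<Rightarrow> 'g set \<Rightarrow> ('z, 'f) cmanifold \<Rightarrow> ('g \<Rightarrow> 'z \<Rightarrow> 'z) \<Rightarrow> 'z set \<Rightarrow> 'z set set"
where
  "compact_orbits L H Z act X =
     {Y \<in> orbits (L\<lparr>carrier := H\<rparr>) X act. compactin (mtop Z) Y}"

end

theory Submission
  imports Defs "HOL-Complex_Analysis.Complex_Analysis"
begin

text \<open>
  Write \<open>P = G\<^sup>\<beta>\<^sup>+\<close> and \<open>f = \<mu>\<^sub>\<pp>\<^sup>\<beta>\<close>. Along \<open>t \<mapsto> exp (t \<beta>) z\<close> the derivative of \<open>f\<close> is \<open>|\<beta>\<^sub>Z|\<^sup>2\<close>, so the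
  maximum set of \<open>f\<close> on a \<open>G\<close>-orbit consists of zeros of \<open>\<beta>\<^sub>Z\<close>.

  The group \<open>P\<close> is \<open>G\<^sup>\<beta> R\<^sup>+\<close>, and the big cell \<open>\<Omega> = R\<^sup>- P\<close> is dense in \<open>G\<close>: membership in \<open>\<Omega>\<close> is the solvability
  of a linear system whose coefficients are entire along one-parameter groups. Density of \<open>\<Omega>\<close> places a compact
  \<open>P\<close>-orbit in the maximum set of its \<open>G\<close>-orbit.

  If \<open>P x\<close> is compact, then so is \<open>K P x\<close>; since \<open>\<pp> \<subseteq> \<kk> + Lie P\<close>, approximation by polygons shows that \<open>K P x\<close> is
  \<open>G\<close>-stable, hence equal to \<open>G x\<close>. By Baire's theorem the \<open>P\<close>-orbits in the maximum set of a compact \<open>G\<close>-orbit are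
  open in it, hence finite in number.
\<close>

section \<open>Finite-dimensional normed spaces\<close>

text \<open>The group is given only through charts, so its Lie theory is derived from one estimate:
  in a chart centred at the identity, product minus sum has a small Lipschitz constant
  (\<open>mul_close\<close>). Products of many small factors are then governed by the sum of their
  coordinates, whatever their number (\<open>telescope\<close>, \<open>product_limit\<close>).
  Existence, uniqueness and continuity of the exponential map and the polygon argument reduce to
  this. Where the inverse function theorem would give local surjectivity,
  \<open>minimize_to_one\<close> is used: a closed set with enough admissible moves contains the
  identity.

  The parabolic group is studied through the vector \<open>Ad L g \<beta>\<close>. Adding to \<beta>
  all vectors of positive weight gives the orbit of \<beta> under R^+, and negative weights give the
  orbit under R^-. This turns membership in the big cell into a linear system and membership in P
  into a closed condition. Connectedness of \<open>G\<close> enters where the closure of the big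
  cell is shown to be open and closed. The polar decomposition enters twice: for G = K exp(\<pp>),
  and to see that \<open>f\<close> is constant on orbits of the possibly disconnected centraliser of
  \<beta>.\<close>

lemma finite_dimensional_basis:
  assumes "finite_dimensional TYPE('e::real_normed_vector)"
  obtains B :: "'e::real_normed_vector set" where "finite B" "independent B" "span B = UNIV"
proof -
  obtain A :: "'e set" where A: "finite A" "span A = UNIV"
    using assms unfolding finite_dimensional_def by blast
  obtain B where B: "B \<subseteq> A" "independent B" "A \<subseteq> span B"
    using maximal_independent_subset by metis
  have "span B = UNIV"
    by (metis A(2) B(1,3) span_mono span_span subset_antisym)
  then show ?thesis using that A B finite_subset by blast
qed

text \<open>Tychonoff's theorem. Coefficient families are functions on the whole index type, also
  outside a basis, hence the product over all indices.\<close>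

lemma compact_cube:
  fixes B :: "'i set"
  shows "compact {c :: 'i => real. \<forall>b. \<bar>c b\<bar> \<le> R}"
proof -
  have "compactin (product_topology (\<lambda>i::'i. euclidean :: real topology) UNIV) (PiE UNIV (\<lambda>i. {-R..R}))"
    by (subst compactin_PiE) auto
  moreover have "PiE UNIV (\<lambda>i. {-R..R}) = {c :: 'i => real. \<forall>b. \<bar>c b\<bar> \<le> R}"
    by (auto simp: PiE_def Pi_def abs_le_iff) (metis minus_le_iff)+
  ultimately show ?thesis
    by (simp add: euclidean_product_topology)
qed

text \<open>On the compact set of normalised coefficient families the norm of the linear combination
  attains a minimum, which is positive because \<open>B\<close> is independent; homogeneity does the
  rest.\<close>

lemma coordinates_bounded:
  fixes B :: "'e::real_normed_vector set"
  assumes fin: "finite B" and ind: "independent B"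
  obtains C where "C > 0" "\<And>c. (\<Sum>b\<in>B. \<bar>c b\<bar>) \<le> C * norm (\<Sum>b\<in>B. c b *\<^sub>R b)"
proof (cases "B = {}")
  case True
  then show ?thesis by (intro that[of 1]) auto
next
  case False
  define T :: "('e => real) => 'e" where "T = (\<lambda>c. \<Sum>b\<in>B. c b *\<^sub>R b)"
  \<comment> \<open>The sum sees only the coefficients on \<open>B\<close>; the cube keeps the
    remaining ones bounded, so that \<open>S\<close> is compact.\<close>
  define S :: "('e => real) set" where "S = {c. \<forall>b. \<bar>c b\<bar> \<le> 1} \<inter> {c. (\<Sum>b\<in>B. \<bar>c b\<bar>) = 1}"
  have contT: "continuous_on A T" for A
    unfolding T_def by (intro continuous_intros continuous_on_subset[OF continuous_on_product_coordinates]) auto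
  have cl: "closed {c :: 'e => real. (\<Sum>b\<in>B. \<bar>c b\<bar>) = 1}"
    by (intro closed_Collect_eq continuous_intros continuous_on_product_coordinates)
  have "compact S" unfolding S_def by (rule compact_Int_closed[OF compact_cube cl])
  obtain b0 where b0: "b0 \<in> B" using False by blast
  have "(\<lambda>b. if b = b0 then 1 else 0) \<in> S"
    using b0 fin unfolding S_def by (auto simp: if_distrib cong: if_cong)
  then have "S \<noteq> {}" by blast
  then obtain c0 where c0: "c0 \<in> S" "\<And>c. c \<in> S ==> norm (T c0) \<le> norm (T c)"
    using continuous_attains_inf[OF \<open>compact S\<close>, of "\<lambda>c. norm (T c)"] contT continuous_on_norm by metis
  have "T c0 \<noteq> 0"
  proof
    assume "T c0 = 0"
    then have "\<forall>b\<in>B. c0 b = 0"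
      using ind fin unfolding T_def by (auto simp: dependent_finite)
    then show False using c0(1) unfolding S_def by auto
  qed
  define d where "d = norm (T c0)"
  have d: "d > 0" using \<open>T c0 \<noteq> 0\<close> unfolding d_def by simp
  have "(\<Sum>b\<in>B. \<bar>c b\<bar>) \<le> (1/d) * norm (T c)" for c
  proof (cases "(\<Sum>b\<in>B. \<bar>c b\<bar>) = 0")
    case True
    then show ?thesis using d by simp
  next
    case nz: False
    define s where "s = (\<Sum>b\<in>B. \<bar>c b\<bar>)"
    have s: "s > 0" using nz unfolding s_def by (metis abs_ge_zero less_le sum_nonneg)
    \<comment> \<open>Set to 0 outside \<open>B\<close> in order to lie in the cube.\<close>
    define c' where "c' = (\<lambda>b. if b \<in> B then c b / s else 0)"
    have c's: "(\<Sum>b\<in>B. \<bar>c' b\<bar>) = 1"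
      using s unfolding c'_def by (simp add: abs_divide sum_divide_distrib[symmetric] s_def[symmetric])
    have "\<bar>c' b\<bar> \<le> 1" for b
    proof (cases "b \<in> B")
      case True
      then have "\<bar>c' b\<bar> \<le> (\<Sum>b\<in>B. \<bar>c' b\<bar>)" using fin by (intro member_le_sum) auto
      then show ?thesis using c's by simp
    qed (simp add: c'_def)
    then have "c' \<in> S" using c's unfolding S_def by auto
    then have "d \<le> norm (T c')" using c0(2) d_def by blast
    also have "T c' = (1/s) *\<^sub>R T c"
      unfolding T_def c'_def by (simp add: scaleR_sum_right)
    finally show ?thesis using s d unfolding s_def[symmetric] by (simp add: field_simps)
  qed
  then show ?thesis using d by (intro that[of "1/d"]) (auto simp: T_def)
qed

lemma finite_dimensional_coordinates:
  fixes B :: "'e::real_normed_vector set"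
  assumes "finite B" "independent B" "span B = UNIV"
  shows "v = (\<Sum>b\<in>B. representation B v b *\<^sub>R b)"
  using sum_representation_eq[of B v B] assms by simp

lemma finite_dimensional_bounded_linear:
  fixes f :: "'e::real_normed_vector => 'h::real_normed_vector"
  assumes fd: "finite_dimensional TYPE('e)" and lin: "linear f"
  shows "bounded_linear f"
proof -
  obtain B :: "'e set" where B: "finite B" "independent B" "span B = UNIV"
    using finite_dimensional_basis[OF fd] .
  obtain C where C: "C > 0" "\<And>c. (\<Sum>b\<in>B. \<bar>c b\<bar>) \<le> C * norm (\<Sum>b\<in>B. c b *\<^sub>R b)"
    using coordinates_bounded[OF B(1,2)] by blast
  define M where "M = (\<Sum>b\<in>B. norm (f b))"
  show ?thesis
  proof (rule bounded_linear_intro)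
    show "f (x + y) = f x + f y" for x y using lin by (rule linear_add)
    show "f (r *\<^sub>R x) = r *\<^sub>R f x" for r x using lin by (rule linear_scale)
    fix x
    define c where "c = representation B x"
    have x: "x = (\<Sum>b\<in>B. c b *\<^sub>R b)" unfolding c_def by (rule finite_dimensional_coordinates[OF B])
    have "norm (f x) = norm (\<Sum>b\<in>B. c b *\<^sub>R f b)"
      by (subst x) (simp add: linear_sum[OF lin] linear_scale[OF lin])
    also have "\<dots> \<le> (\<Sum>b\<in>B. \<bar>c b\<bar> * norm (f b))"
      by (rule order_trans[OF norm_sum]) simp
    also have "\<dots> \<le> (\<Sum>b\<in>B. \<bar>c b\<bar> * M)"
      unfolding M_def using B(1) by (intro sum_mono mult_left_mono member_le_sum) auto
    also have "\<dots> = (\<Sum>b\<in>B. \<bar>c b\<bar>) * M" by (simp add: sum_distrib_right)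
    also have "\<dots> \<le> (C * norm x) * M"
      using C(2)[of c] x unfolding M_def by (intro mult_right_mono sum_nonneg) auto
    finally show "norm (f x) \<le> norm x * (C * M)" by (simp add: mult_ac)
  qed
qed

lemma finite_dimensional_compact_cball:
  assumes fd: "finite_dimensional TYPE('e::real_normed_vector)"
  shows "compact (cball (a::'e::real_normed_vector) r)"
proof -
  obtain B :: "'e set" where B: "finite B" "independent B" "span B = UNIV"
    using finite_dimensional_basis[OF fd] .
  obtain C where C: "C > 0" "\<And>c. (\<Sum>b\<in>B. \<bar>c b\<bar>) \<le> C * norm (\<Sum>b\<in>B. c b *\<^sub>R b)"
    using coordinates_bounded[OF B(1,2)] by blast
  define R where "R = C * (norm a + \<bar>r\<bar>)"
  define T :: "('e => real) => 'e" where "T = (\<lambda>c. \<Sum>b\<in>B. c b *\<^sub>R b)"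
  have contT: "continuous_on A T" for A
    unfolding T_def by (intro continuous_intros continuous_on_subset[OF continuous_on_product_coordinates]) auto
  have comp: "compact (T ` {c. \<forall>b. \<bar>c b\<bar> \<le> R})"
    by (rule compact_continuous_image[OF contT compact_cube])
  have "cball a r \<subseteq> T ` {c. \<forall>b. \<bar>c b\<bar> \<le> R}"
  proof
    fix x assume x: "x \<in> cball a r"
    define c where "c = (\<lambda>b. if b \<in> B then representation B x b else 0)"
    have xe: "x = T c" unfolding T_def c_def using finite_dimensional_coordinates[OF B, of x] by simp
    have "norm (x - a) \<le> r" using x by (simp add: dist_norm norm_minus_commute)
    then have nx: "norm x \<le> norm a + \<bar>r\<bar>" using norm_triangle_ineq[of "x - a" a] by simp
    have "\<bar>c b\<bar> \<le> R" for b
    proof (cases "b \<in> B")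
      case True
      then have "\<bar>c b\<bar> \<le> (\<Sum>b\<in>B. \<bar>c b\<bar>)" using B(1) by (intro member_le_sum) auto
      also have "\<dots> \<le> C * norm x" using C(2)[of c] xe unfolding T_def by simp
      also have "\<dots> \<le> R" unfolding R_def using C(1) nx by simp
      finally show ?thesis .
    next
      case False
      then show ?thesis using C(1) unfolding c_def R_def by simp
    qed
    then show "x \<in> T ` {c. \<forall>b. \<bar>c b\<bar> \<le> R}" using xe by blast
  qed
  moreover have "closed (cball a r)" by simp
  ultimately show ?thesis
    by (metis compact_Int_closed comp inf.absorb_iff2)
qed

lemma finite_dimensional_prod:
  assumes "finite_dimensional TYPE('e::real_normed_vector)" "finite_dimensional TYPE('h::real_normed_vector)"
  shows "finite_dimensional TYPE('e::real_normed_vector \<times> 'h::real_normed_vector)"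
proof -
  obtain A :: "'e set" where A: "finite A" "span A = UNIV" using assms(1) unfolding finite_dimensional_def by blast
  obtain B :: "'h set" where B: "finite B" "span B = UNIV" using assms(2) unfolding finite_dimensional_def by blast
  let ?S = "(\<lambda>a. (a, 0)) ` A \<union> (\<lambda>b. (0, b)) ` B"
  have l1: "linear (\<lambda>a::'e. (a, 0::'h))" and l2: "linear (\<lambda>b::'h. (0::'e, b))"
    by (auto intro!: linearI)
  have 1: "(a, 0) \<in> span ?S" for a
    using span_mono[of "(\<lambda>a. (a, 0)) ` A" ?S] linear_span_image[OF l1, of A] A(2) by auto
  have 2: "(0, b) \<in> span ?S" for b
    using span_mono[of "(\<lambda>b. (0, b)) ` B" ?S] linear_span_image[OF l2, of B] B(2) by auto
  have "(a, b) \<in> span ?S" for a b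
    using span_add[OF 1[of a] 2[of b]] by simp
  then have "span ?S = UNIV" by auto
  then show ?thesis unfolding finite_dimensional_def using A(1) B(1) by (metis finite_UnI finite_imageI)
qed

text \<open>The subspace is the common kernel of the coordinate functionals outside a basis adapted
  to it, and these functionals are continuous.\<close>

lemma finite_dimensional_closed_subspace:
  fixes S :: "'e::real_normed_vector set"
  assumes fd: "finite_dimensional TYPE('e)" and sub: "subspace S"
  shows "closed S"
proof -
  obtain A where A: "A \<subseteq> S" "independent A" "S \<subseteq> span A"
    using maximal_independent_subset by metis
  define B where "B = extend_basis A"
  have B: "A \<subseteq> B" "independent B" "span B = UNIV"
    using extend_basis_superset[OF A(2)] independent_extend_basis[OF A(2)] span_extend_basis[OF A(2)]
    by (auto simp: B_def)
  obtain B' :: "'e set" where B': "finite B'" "span B' = UNIV" using fd unfolding finite_dimensional_def by blast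
  have finB: "finite B"
    using independent_span_bound[OF B'(1) B(2)] B'(2) by simp
  have eq: "S = (\<Inter>b\<in>B-A. {v. representation B v b = 0})"
  proof (intro equalityI subsetI)
    fix v assume "v \<in> S"
    then have "v \<in> span A" using A by blast
    then have "representation B v = representation A v"
      using representation_extend[OF B(2) _ B(1)] by metis
    then show "v \<in> (\<Inter>b\<in>B-A. {v. representation B v b = 0})"
      using representation_ne_zero by fastforce
  next
    fix v assume v: "v \<in> (\<Inter>b\<in>B-A. {v. representation B v b = 0})"
    have "v = (\<Sum>b\<in>B. representation B v b *\<^sub>R b)" by (rule finite_dimensional_coordinates[OF finB B(2,3)])
    also have "\<dots> = (\<Sum>b\<in>A. representation B v b *\<^sub>R b)"
      using v finB B(1) by (intro sum.mono_neutral_right) auto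
    also have "\<dots> \<in> S" using A(1) sub by (intro subspace_sum subspace_scale) auto
    finally show "v \<in> S" .
  qed
  have "bounded_linear (\<lambda>v. representation B v b)" for b
  proof (rule finite_dimensional_bounded_linear[OF fd])
    show "linear (\<lambda>v. representation B v b)"
      using representation_add[OF B(2)] representation_scale[OF B(2)] B(3) by (auto intro!: linearI)
  qed
  then have "closed {v. representation B v b = 0}" for b
    by (intro closed_Collect_eq continuous_on_const linear_continuous_on)
  then show ?thesis unfolding eq by blast
qed

section \<open>Differentiability classes and charts\<close>

lemma frechet_derivative_cong_open:
  assumes "open S" "x \<in> S" "\<And>y. y \<in> S ==> f y = g y"
  shows "f differentiable (at x) \<longleftrightarrow> g differentiable (at x)"
    and "frechet_derivative f (at x) = frechet_derivative g (at x)"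
proof -
  have *: "(f has_derivative D) (at x) \<longleftrightarrow> (g has_derivative D) (at x)" for D
    using has_derivative_transform_within_open[OF _ assms(1,2), of f D UNIV g]
      has_derivative_transform_within_open[OF _ assms(1,2), of g D UNIV f] assms(3) by auto
  show "f differentiable (at x) \<longleftrightarrow> g differentiable (at x)"
    unfolding differentiable_def using * by simp
  show "frechet_derivative f (at x) = frechet_derivative g (at x)"
    unfolding frechet_derivative_def using * by simp
qed

lemma Ck_on_cong:
  assumes "open S" "\<And>x. x \<in> S ==> f x = g x" "Ck_on k S f"
  shows "Ck_on k S g"
  using assms
proof (induction k arbitrary: f g)
  case 0
  then show ?case by (simp cong: continuous_on_cong)
next
  case (Suc k)
  have d: "frechet_derivative f (at x) = frechet_derivative g (at x)"
    "f differentiable (at x) \<longleftrightarrow> g differentiable (at x)" if "x \<in> S" for x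
    using frechet_derivative_cong_open[OF Suc.prems(1) that] Suc.prems(2) by auto
  have "Ck_on k S (\<lambda>x. frechet_derivative g (at x) v)" for v
  proof (rule Suc.IH[OF Suc.prems(1)])
    show "frechet_derivative f (at x) v = frechet_derivative g (at x) v" if "x \<in> S" for x using d(1)[OF that] by simp
    show "Ck_on k S (\<lambda>x. frechet_derivative f (at x) v)" using Suc.prems(3) by simp
  qed
  then show ?case using Suc.prems(3) d(2) by simp
qed

text \<open>\<open>smooth_map_on\<close> supplies a different local extension at each point; this
  lemma glues the resulting statements.\<close>

lemma Ck_on_local:
  assumes "\<And>x. x \<in> S ==> \<exists>T. open T \<and> x \<in> T \<and> Ck_on k T f"
  shows "Ck_on k S f"
  using assms
proof (induction k arbitrary: f)
  case 0
  have "isCont f x" if "x \<in> S" for x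
    using 0[OF that] by (auto simp: continuous_on_eq_continuous_at)
  then show ?case by (simp add: continuous_at_imp_continuous_on)
next
  case (Suc k)
  show ?case
  proof (simp, intro conjI ballI allI)
    show "f differentiable at x" if "x \<in> S" for x using Suc.prems[OF that] by auto
    show "Ck_on k S (\<lambda>x. frechet_derivative f (at x) v)" for v
    proof (rule Suc.IH)
      fix x assume "x \<in> S"
      from Suc.prems[OF this] show "\<exists>T. open T \<and> x \<in> T \<and> Ck_on k T (\<lambda>x. frechet_derivative f (at x) v)"
        by auto
    qed
  qed
qed

lemma frechet_linear:
  "f differentiable (at x) ==> linear (frechet_derivative f (at x))"
  by (simp add: frechet_derivative_works has_derivative_linear)

text \<open>Strict differentiability. \<open>Ck_on\<close> gives continuity of the derivative only
  for each fixed direction; a basis makes it uniform in the direction, and the mean value inequality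
  for \<open>F\<close> minus its linear part gives the Lipschitz bound.\<close>

lemma Ck1_strict:
  fixes F :: "'a::real_normed_vector => 'b::real_normed_vector"
  assumes fd: "finite_dimensional TYPE('a)" and S: "open S" "p \<in> S"
    and C1: "Ck_on (Suc 0) S F" and e: "\<epsilon> > 0"
  obtains \<delta> where "\<delta> > 0" "ball p \<delta> \<subseteq> S"
    "\<And>x y. x \<in> ball p \<delta> ==> y \<in> ball p \<delta> ==>
       norm (F x - F y - frechet_derivative F (at p) (x - y)) \<le> \<epsilon> * norm (x - y)"
proof -
  let ?D = "\<lambda>x. frechet_derivative F (at x)"
  have diff: "F differentiable (at x)" if "x \<in> S" for x using C1 that by simp
  have contD: "isCont (\<lambda>x. ?D x v) p" for v
    using C1 S by (simp add: continuous_on_eq_continuous_at)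
  obtain B :: "'a set" where B: "finite B" "independent B" "span B = UNIV"
    using finite_dimensional_basis[OF fd] .
  obtain C where C: "C > 0" "\<And>c. (\<Sum>b\<in>B. \<bar>c b\<bar>) \<le> C * norm (\<Sum>b\<in>B. c b *\<^sub>R b)"
    using coordinates_bounded[OF B(1,2)] by blast
  have "\<forall>\<^sub>F x in at p. \<forall>b\<in>B. norm (?D x b - ?D p b) < \<epsilon> / C"
  proof (rule eventually_ball_finite[OF B(1)], intro ballI)
    fix b assume "b \<in> B"
    have "((\<lambda>x. ?D x b) \<longlongrightarrow> ?D p b) (at p)" using contD[of b] by (simp add: isCont_def)
    then show "\<forall>\<^sub>F x in at p. norm (?D x b - ?D p b) < \<epsilon> / C"
      using tendstoD[of "\<lambda>x. ?D x b" "?D p b" "at p" "\<epsilon> / C"] e C(1) by (simp add: dist_norm)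
  qed
  moreover have "\<forall>\<^sub>F x in at p. x \<in> S"
    using S by (simp add: eventually_at_topological) blast
  ultimately have "\<forall>\<^sub>F x in at p. x \<in> S \<and> (\<forall>b\<in>B. norm (?D x b - ?D p b) < \<epsilon> / C)"
    by (simp add: eventually_conj)
  then obtain \<delta> where \<delta>: "\<delta> > 0" "\<And>x. x \<noteq> p ==> dist x p < \<delta> ==> x \<in> S \<and> (\<forall>b\<in>B. norm (?D x b - ?D p b) < \<epsilon> / C)"
    unfolding eventually_at by auto
  have \<delta>S: "ball p \<delta> \<subseteq> S" using \<delta>(2) S(2) by (auto simp: dist_commute) metis
  have near: "norm (?D x b - ?D p b) \<le> \<epsilon> / C" if "x \<in> ball p \<delta>" "b \<in> B" for x b
    using \<delta>(2)[of x] that e C(1) by (cases "x = p") (auto simp: dist_commute intro: less_imp_le)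
  have lin: "linear (?D x)" if "x \<in> S" for x using frechet_linear[OF diff[OF that]] .
  \<comment> \<open>The coefficients of \<open>v\<close> sum up to at most
    \<open>C * norm v\<close>, which the bound \<open>\<epsilon> / C\<close> on each basis vector
    compensates.\<close>
  have est: "norm (?D x v - ?D p v) \<le> \<epsilon> * norm v" if x: "x \<in> ball p \<delta>" for x v
  proof -
    define c where "c = representation B v"
    have v: "v = (\<Sum>b\<in>B. c b *\<^sub>R b)" unfolding c_def by (rule finite_dimensional_coordinates[OF B])
    have l1: "linear (?D x)" and l2: "linear (?D p)" using lin x \<delta>S S(2) by auto
    have "?D x v - ?D p v = (\<Sum>b\<in>B. c b *\<^sub>R (?D x b - ?D p b))"
      by (subst (1 2) v) (simp add: linear_sum[OF l1] linear_sum[OF l2] linear_scale[OF l1] linear_scale[OF l2]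
          sum_subtractf scaleR_diff_right)
    also have "norm \<dots> \<le> (\<Sum>b\<in>B. \<bar>c b\<bar> * (\<epsilon> / C))"
      using near[OF x] by (intro order_trans[OF norm_sum] sum_mono) (simp del: times_divide_eq_right add: mult_left_mono)
    also have "\<dots> = (\<Sum>b\<in>B. \<bar>c b\<bar>) * (\<epsilon> / C)" by (rule sum_distrib_right[symmetric])
    also have "\<dots> \<le> (C * norm v) * (\<epsilon> / C)"
      using C(2)[of c] v e C(1) by (intro mult_right_mono) auto
    also have "\<dots> = \<epsilon> * norm v" using C(1) by simp
    finally show ?thesis .
  qed
  have blp: "bounded_linear (?D p)" using diff[OF S(2)] by (simp add: frechet_derivative_works has_derivative_bounded_linear)
  show ?thesis
  proof (rule that[OF \<delta>(1) \<delta>S])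
    fix x y assume xy: "x \<in> ball p \<delta>" "y \<in> ball p \<delta>"
    let ?H = "\<lambda>z. F z - ?D p z"
    have "norm (?H x - ?H y) \<le> \<epsilon> * norm (x - y)"
    proof (rule differentiable_bound[OF convex_ball _ _ xy])
      fix z assume z: "z \<in> ball p \<delta>"
      have Fd: "(F has_derivative ?D z) (at z within ball p \<delta>)"
        using diff[of z, unfolded frechet_derivative_works] z \<delta>S has_derivative_at_withinI by blast
      show "(?H has_derivative (\<lambda>v. ?D z v - ?D p v)) (at z within ball p \<delta>)"
        by (intro has_derivative_diff Fd bounded_linear.has_derivative[OF blp] has_derivative_ident)
      show "onorm (\<lambda>v. ?D z v - ?D p v) \<le> \<epsilon>"
        using e est[OF z] by (intro onorm_bound) auto
    qed
    moreover have "?H x - ?H y = F x - F y - ?D p (x - y)"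
      using linear_diff[OF bounded_linear.linear[OF blp], of x y] by (simp add: algebra_simps)
    ultimately show "norm (F x - F y - ?D p (x - y)) \<le> \<epsilon> * norm (x - y)" by simp
  qed
qed

text \<open>The topological half of \<open>smooth_chart\<close>. It mentions no atlas and passes to
  products of charts.\<close>

definition topological_chart :: "'a topology => ('a, 'e::real_normed_vector) chart => bool" where
  "topological_chart T c \<longleftrightarrow> openin T (fst c) \<and> open (snd c ` fst c) \<and>
     homeomorphic_map (subtopology T (fst c)) (top_of_set (snd c ` fst c)) (snd c)"

lemma topological_chart_topspace: "topological_chart T c ==> topspace (subtopology T (fst c)) = fst c"
  unfolding topological_chart_def using openin_subset by fastforce

lemma topological_chart_inj: "topological_chart T c ==> inj_on (snd c) (fst c)"
  using homeomorphic_imp_injective_map topological_chart_topspace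
  unfolding topological_chart_def by fastforce

lemma topological_chart_inv:
  "topological_chart T c ==> p \<in> fst c ==> inv_into (fst c) (snd c) (snd c p) = p"
  by (simp add: topological_chart_inj)

lemma topological_chart_cont:
  "topological_chart T c ==> continuous_map (subtopology T (fst c)) euclidean (snd c)"
  using homeomorphic_imp_continuous_map continuous_map_in_subtopology
  unfolding topological_chart_def by blast

lemma topological_chart_open_image:
  assumes c: "topological_chart T c" and W: "openin T W" "W \<subseteq> fst c"
  shows "open (snd c ` W)"
proof -
  have "openin (subtopology T (fst c)) W" using W by (metis openin_subset_topspace_eq openin_subtopology_Int2 inf.absorb_iff2 inf_commute)
  then have "openin (top_of_set (snd c ` fst c)) (snd c ` W)"
    using c homeomorphic_imp_open_map unfolding topological_chart_def open_map_def by blast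
  then show ?thesis using c openin_open_trans unfolding topological_chart_def by blast
qed

lemma topological_chart_inv_cont:
  assumes c: "topological_chart T c"
  shows "continuous_map (top_of_set (snd c ` fst c)) T (inv_into (fst c) (snd c))"
proof -
  have "homeomorphic_maps (subtopology T (fst c)) (top_of_set (snd c ` fst c)) (snd c) (inv_into (fst c) (snd c))"
    unfolding homeomorphic_maps_map
  proof (intro conjI ballI)
    show h: "homeomorphic_map (subtopology T (fst c)) (top_of_set (snd c ` fst c)) (snd c)"
      using c unfolding topological_chart_def by blast
    obtain g where g: "homeomorphic_maps (subtopology T (fst c)) (top_of_set (snd c ` fst c)) (snd c) g"
      using h homeomorphic_map_maps by blast
    then have gh: "homeomorphic_map (top_of_set (snd c ` fst c)) (subtopology T (fst c)) g"
      by (simp add: homeomorphic_maps_map)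
    show "homeomorphic_map (top_of_set (snd c ` fst c)) (subtopology T (fst c)) (inv_into (fst c) (snd c))"
    proof (rule homeomorphic_map_eq[OF gh])
      fix y assume "y \<in> topspace (top_of_set (snd c ` fst c))"
      then obtain p where p: "p \<in> fst c" "y = snd c p" by auto
      have "g y = p" using g p topological_chart_topspace[OF c] unfolding homeomorphic_maps_def by auto
      then show "g y = inv_into (fst c) (snd c) y" using p topological_chart_inv[OF c] by simp
    qed
  qed (use topological_chart_topspace[OF c] topological_chart_inv[OF c] in \<open>auto simp: f_inv_into_f\<close>)
  then show ?thesis unfolding homeomorphic_maps_def using continuous_map_in_subtopology by blast
qed

text \<open>This is how topological limits in the group turn into norm estimates for
  coordinates.\<close>

lemma topological_chart_limitin:
  assumes c: "topological_chart T c" and p: "p \<in> fst c"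
  shows "limitin T f p F \<longleftrightarrow> (\<forall>\<^sub>F n in F. f n \<in> fst c) \<and> ((\<lambda>n. snd c (f n)) \<longlongrightarrow> snd c p) F"
proof (intro iffI conjI)
  assume l: "limitin T f p F"
  show ev: "\<forall>\<^sub>F n in F. f n \<in> fst c" using l p c limitinD unfolding topological_chart_def by metis
  have "limitin (subtopology T (fst c)) f p F" using l ev p by (simp add: limitin_subtopology)
  then have "limitin euclidean (snd c \<circ> f) (snd c p) F"
    using continuous_map_limit[OF topological_chart_cont[OF c]] by blast
  then show "((\<lambda>n. snd c (f n)) \<longlongrightarrow> snd c p) F" by (simp add: o_def)
next
  assume a: "(\<forall>\<^sub>F n in F. f n \<in> fst c) \<and> ((\<lambda>n. snd c (f n)) \<longlongrightarrow> snd c p) F"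
  let ?S = "snd c ` fst c"
  have "limitin (top_of_set ?S) (\<lambda>n. snd c (f n)) (snd c p) F"
    using a p by (auto simp: limitin_subtopology elim: eventually_mono)
  then have "limitin T (inv_into (fst c) (snd c) \<circ> (\<lambda>n. snd c (f n))) (inv_into (fst c) (snd c) (snd c p)) F"
    using continuous_map_limit[OF topological_chart_inv_cont[OF c]] by blast
  then have "limitin T (inv_into (fst c) (snd c) \<circ> (\<lambda>n. snd c (f n))) p F"
    using topological_chart_inv[OF c p] by simp
  moreover have "\<forall>\<^sub>F n in F. (inv_into (fst c) (snd c) \<circ> (\<lambda>n. snd c (f n))) n = f n"
    using a by (auto elim!: eventually_mono simp: topological_chart_inv[OF c])
  ultimately show "limitin T f p F" by (rule limitin_transform_eventually[rotated])
qed

lemma topological_chart_prod: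
  assumes c: "topological_chart T c" and d: "topological_chart T' d"
  shows "topological_chart (prod_topology T T') (fst c \<times> fst d, map_prod (snd c) (snd d))"
proof -
  have im: "map_prod (snd c) (snd d) ` (fst c \<times> fst d) = (snd c ` fst c) \<times> (snd d ` fst d)" by auto
  obtain g h where "homeomorphic_maps (subtopology T (fst c)) (top_of_set (snd c ` fst c)) (snd c) g"
     "homeomorphic_maps (subtopology T' (fst d)) (top_of_set (snd d ` fst d)) (snd d) h"
    using c d unfolding topological_chart_def homeomorphic_map_maps by blast
  then have "homeomorphic_maps (prod_topology (subtopology T (fst c)) (subtopology T' (fst d)))
     (prod_topology (top_of_set (snd c ` fst c)) (top_of_set (snd d ` fst d))) (\<lambda>(x,y). (snd c x, snd d y))
     (\<lambda>(x,y). (g x, h y))"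
    by (simp add: homeomorphic_maps_prod del: prod_topology_subtopology_eu)
  then have "homeomorphic_map (prod_topology (subtopology T (fst c)) (subtopology T' (fst d)))
     (prod_topology (top_of_set (snd c ` fst c)) (top_of_set (snd d ` fst d))) (\<lambda>(x,y). (snd c x, snd d y))"
    using homeomorphic_map_maps by blast
  then have "homeomorphic_map (subtopology (prod_topology T T') (fst c \<times> fst d))
     (top_of_set ((snd c ` fst c) \<times> (snd d ` fst d))) (map_prod (snd c) (snd d))"
    by (simp add: subtopology_Times map_prod_def)
  then show ?thesis
    using c d unfolding topological_chart_def fst_conv snd_conv im
    by (simp add: open_Times openin_prod_Times_iff)
qed

lemma smooth_map_continuous:
  assumes "smooth_map_on M (topspace (mtop M)) N f"
  shows "continuous_map (mtop M) (mtop N) f"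
  unfolding continuous_map
proof (intro conjI allI impI)
  show "f ` topspace (mtop M) \<subseteq> topspace (mtop N)" using assms unfolding smooth_map_on_def by blast
  fix V assume V: "openin (mtop N) V"
  show "openin (mtop M) {x \<in> topspace (mtop M). f x \<in> V}"
  proof (subst openin_subopen, intro ballI)
    fix p assume p: "p \<in> {x \<in> topspace (mtop M). f x \<in> V}"
    then obtain W F where WF: "openin (mtop M) W" "p \<in> W" "\<forall>q\<in>W \<inter> topspace (mtop M). F q = f q"
        "continuous_map (subtopology (mtop M) W) (mtop N) F"
      using assms unfolding smooth_map_on_def by blast
    let ?T = "{x \<in> topspace (subtopology (mtop M) W). F x \<in> V}"
    have "openin (subtopology (mtop M) W) ?T" using WF(4) V openin_continuous_map_preimage by blast
    then have "openin (mtop M) ?T" using WF(1) openin_open_subtopology by blast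
    moreover have "p \<in> ?T" "?T \<subseteq> {x \<in> topspace (mtop M). f x \<in> V}" using p WF(2,3) by auto
    ultimately show "\<exists>T. openin (mtop M) T \<and> p \<in> T \<and> T \<subseteq> {x \<in> topspace (mtop M). f x \<in> V}" by blast
  qed
qed

lemma chart_preimage_open:
  assumes "continuous_map T T' f" "topological_chart T c" "topological_chart T' d"
  shows "open (snd c ` {q \<in> fst c. f q \<in> fst d})"
proof (rule topological_chart_open_image[OF assms(2)])
  have "openin T {q \<in> topspace T. f q \<in> fst d}"
    using assms openin_continuous_map_preimage unfolding topological_chart_def by blast
  moreover have "openin T (fst c)" using assms(2) unfolding topological_chart_def by blast
  ultimately have "openin T (fst c \<inter> {q \<in> topspace T. f q \<in> fst d})" by blast
  moreover have "fst c \<inter> {q \<in> topspace T. f q \<in> fst d} = {q \<in> fst c. f q \<in> fst d}"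
    using openin_subset[OF \<open>openin T (fst c)\<close>] by auto
  ultimately show "openin T {q \<in> fst c. f q \<in> fst d}" by simp
qed auto

text \<open>The definition of \<open>smooth_map_on\<close> speaks of local extensions. On the whole
  space an extension agrees with \<open>f\<close> near the point, so the coordinate expression of
  \<open>f\<close> inherits its regularity.\<close>

lemma smooth_map_local_rep:
  assumes f: "smooth_map_on M (topspace (mtop M)) N f"
    and c: "c \<in> atlas M" "topological_chart (mtop M) c" and d: "d \<in> atlas N" "topological_chart (mtop N) d"
  shows "Ck_on k (snd c ` {q \<in> fst c. f q \<in> fst d}) (local_rep c d f)"
proof (rule Ck_on_local)
  fix x assume "x \<in> snd c ` {q \<in> fst c. f q \<in> fst d}"
  then obtain p where p: "p \<in> fst c" "f p \<in> fst d" "x = snd c p" by auto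
  have sub: "fst c \<subseteq> topspace (mtop M)" and oc: "openin (mtop M) (fst c)"
    using c(2) openin_subset unfolding topological_chart_def by auto
  then obtain W F where WF: "openin (mtop M) W" "p \<in> W" "\<forall>q\<in>W \<inter> topspace (mtop M). F q = f q"
      "continuous_map (subtopology (mtop M) W) (mtop N) F"
      "smooth_on (snd c ` {q \<in> fst c \<inter> W. F q \<in> fst d}) (local_rep c d F)"
    using f p c d unfolding smooth_map_on_def by blast
  let ?Q = "{q \<in> fst c \<inter> W. F q \<in> fst d}"
  let ?T = "snd c ` ?Q"
  have "openin (subtopology (mtop M) W) {q \<in> topspace (subtopology (mtop M) W). F q \<in> fst d}"
    using WF(4) d(2) openin_continuous_map_preimage unfolding topological_chart_def by blast
  then have "openin (mtop M) {q \<in> topspace (subtopology (mtop M) W). F q \<in> fst d}"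
    using WF(1) openin_open_subtopology by blast
  then have "openin (mtop M) (fst c \<inter> {q \<in> topspace (subtopology (mtop M) W). F q \<in> fst d})" using oc by blast
  moreover have "fst c \<inter> {q \<in> topspace (subtopology (mtop M) W). F q \<in> fst d} = ?Q" using sub by auto
  ultimately have oT: "open ?T" using topological_chart_open_image[OF c(2), of ?Q] by auto
  have "Ck_on k ?T (local_rep c d f)"
  proof (rule Ck_on_cong[OF oT])
    show "Ck_on k ?T (local_rep c d F)" using WF(5) unfolding smooth_on_def by blast
    fix y assume "y \<in> ?T"
    then show "local_rep c d F y = local_rep c d f y"
      using WF(3) sub topological_chart_inv[OF c(2)] unfolding local_rep_def by auto
  qed
  moreover have "x \<in> ?T" using p WF(2,3) sub by auto
  ultimately show "\<exists>T. open T \<and> x \<in> T \<and> Ck_on k T (local_rep c d f)" using oT by blast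
qed

lemma complex_manifold_chart:
  assumes "complex_manifold M" "c \<in> atlas M"
  shows "topological_chart (mtop M) c"
  using assms unfolding complex_manifold_def smooth_chart_def topological_chart_def by blast

text \<open>Pointwise form of holomorphy. Translations and orbit maps arise by fixing one argument
  of a holomorphic map on a product; for them the derivative at one point and its complex linearity
  are enough.\<close>

definition complex_diff_at ::
  "('a, 'e::real_normed_vector) cmanifold => ('b, 'f::real_normed_vector) cmanifold => ('a => 'b) => 'a => bool" where
  "complex_diff_at M N F p \<longleftrightarrow> (\<forall>c\<in>atlas M. \<forall>d\<in>atlas N. p \<in> fst c --> F p \<in> fst d -->
     (\<exists>D. (local_rep c d F has_derivative D) (at (snd c p)) \<and> (\<forall>v. D (i_mult M v) = i_mult N (D v))))"

lemma holomorphic_map_complex_diff_at: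
  assumes f: "holomorphic_map M N f"
    and c: "\<And>c. c \<in> atlas M ==> topological_chart (mtop M) c" and d: "\<And>d. d \<in> atlas N ==> topological_chart (mtop N) d"
  shows "complex_diff_at M N f p"
  unfolding complex_diff_at_def
proof (intro ballI impI)
  fix x y assume h: "x \<in> atlas M" "y \<in> atlas N" "p \<in> fst x" "f p \<in> fst y"
  have s: "smooth_map_on M (topspace (mtop M)) N f" using f unfolding holomorphic_map_def by blast
  have "Ck_on (Suc 0) (snd x ` {q \<in> fst x. f q \<in> fst y}) (local_rep x y f)"
    by (rule smooth_map_local_rep[OF s h(1) c[OF h(1)] h(2) d[OF h(2)]])
  then have "local_rep x y f differentiable (at (snd x p))" using h by auto
  then have "(local_rep x y f has_derivative frechet_derivative (local_rep x y f) (at (snd x p))) (at (snd x p))"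
    by (simp add: frechet_derivative_works)
  then show "\<exists>D. (local_rep x y f has_derivative D) (at (snd x p)) \<and> (\<forall>v. D (i_mult M v) = i_mult N (D v))"
    using f h unfolding holomorphic_map_def by blast
qed

lemma complex_diff_at_compose:
  assumes F: "complex_diff_at M N F p" and G: "complex_diff_at N Q G (F p)"
    and cont: "continuous_map (mtop M) (mtop N) F"
    and c: "\<And>c. c \<in> atlas M ==> topological_chart (mtop M) c"
    and e: "e \<in> atlas N" "topological_chart (mtop N) e" "F p \<in> fst e"
  shows "complex_diff_at M Q (\<lambda>x. G (F x)) p"
  unfolding complex_diff_at_def
proof (intro ballI impI)
  fix x y assume h: "x \<in> atlas M" "y \<in> atlas Q" "p \<in> fst x" "G (F p) \<in> fst y"
  obtain D where D: "(local_rep x e F has_derivative D) (at (snd x p))" "\<forall>v. D (i_mult M v) = i_mult N (D v)"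
    using F h e unfolding complex_diff_at_def by blast
  obtain E where E: "(local_rep e y G has_derivative E) (at (snd e (F p)))" "\<forall>v. E (i_mult N v) = i_mult Q (E v)"
    using G h e unfolding complex_diff_at_def by blast
  have lp: "local_rep x e F (snd x p) = snd e (F p)"
    using topological_chart_inv[OF c[OF h(1)] h(3)] by (simp add: local_rep_def)
  have "(local_rep e y G \<circ> local_rep x e F has_derivative E \<circ> D) (at (snd x p))"
    using diff_chain_at[OF D(1)] E(1) lp by simp
  moreover have "open (snd x ` {q \<in> fst x. F q \<in> fst e})" by (rule chart_preimage_open[OF cont c[OF h(1)] e(2)])
  moreover have "snd x p \<in> snd x ` {q \<in> fst x. F q \<in> fst e}" using h e by auto
  moreover have "(local_rep e y G \<circ> local_rep x e F) z = local_rep x y (\<lambda>x. G (F x)) z"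
    if "z \<in> snd x ` {q \<in> fst x. F q \<in> fst e}" for z
    using that topological_chart_inv[OF c[OF h(1)]] topological_chart_inv[OF e(2)] by (auto simp: local_rep_def)
  ultimately have "(local_rep x y (\<lambda>x. G (F x)) has_derivative E \<circ> D) (at (snd x p))"
    by (rule has_derivative_transform_within_open)
  moreover have "(E \<circ> D) (i_mult M v) = i_mult Q ((E \<circ> D) v)" for v using D(2) E(2) by simp
  ultimately show "\<exists>D. (local_rep x y (\<lambda>x. G (F x)) has_derivative D) (at (snd x p)) \<and> (\<forall>v. D (i_mult M v) = i_mult Q (D v))"
    by blast
qed

text \<open>The chain rule for a curve. Near \<open>t0\<close> the curve has to stay in the domain
  of \<open>c\<close>, where the coordinate expression of \<open>F\<close> is meaningful.\<close>

lemma complex_diff_at_curve: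
  assumes D: "(local_rep c d F has_derivative D) (at (snd c p))"
    and g: "\<gamma> t0 = p" "((\<lambda>t. snd c (\<gamma> t)) has_vector_derivative v) (at t0)" "\<forall>\<^sub>F t in at t0. \<gamma> t \<in> fst c"
    and c: "topological_chart T c" "p \<in> fst c"
  shows "((\<lambda>t. snd d (F (\<gamma> t))) has_vector_derivative D v) (at t0)"
proof -
  have "(local_rep c d F has_derivative D) (at (snd c (\<gamma> t0)))" using D g(1) by simp
  then have "(local_rep c d F \<circ> (\<lambda>t. snd c (\<gamma> t)) has_derivative D \<circ> (\<lambda>h. h *\<^sub>R v)) (at t0)"
    using diff_chain_at[OF g(2)[unfolded has_vector_derivative_def]] by blast
  moreover have "\<forall>\<^sub>F t in at t0. (local_rep c d F \<circ> (\<lambda>t. snd c (\<gamma> t))) t = snd d (F (\<gamma> t))"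
    using g(3) by eventually_elim (simp add: local_rep_def topological_chart_inv[OF c(1)])
  moreover have "(local_rep c d F \<circ> (\<lambda>t. snd c (\<gamma> t))) t0 = snd d (F (\<gamma> t0))"
    using c g(1) by (simp add: local_rep_def topological_chart_inv[OF c(1)])
  ultimately have "((\<lambda>t. snd d (F (\<gamma> t))) has_derivative D \<circ> (\<lambda>h. h *\<^sub>R v)) (at t0)"
    by (rule has_derivative_transform_eventually) auto
  moreover have "D \<circ> (\<lambda>h. h *\<^sub>R v) = (\<lambda>h. h *\<^sub>R D v)"
    using linear_scale[OF has_derivative_linear[OF D]] by auto
  ultimately show ?thesis by (simp add: has_vector_derivative_def)
qed

lemma i_mult_facts:
  assumes "complex_manifold M"
  shows "linear (i_mult M)" "i_mult M (i_mult M v) = - v" "i_mult M 0 = 0"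
    "i_mult M (- v) = - i_mult M v" "i_mult M (v + w) = i_mult M v + i_mult M w" "i_mult M (r *\<^sub>R v) = r *\<^sub>R i_mult M v"
proof -
  show l: "linear (i_mult M)" and "i_mult M (i_mult M v) = - v" using assms unfolding complex_manifold_def by auto
  show "i_mult M 0 = 0" "i_mult M (- v) = - i_mult M v" "i_mult M (v + w) = i_mult M v + i_mult M w"
    "i_mult M (r *\<^sub>R v) = r *\<^sub>R i_mult M v"
    using linear_0[OF l] linear_neg[OF l] linear_add[OF l] linear_scale[OF l] by auto
qed

lemma prod_manifold_chart:
  assumes "complex_manifold M" "complex_manifold N" "c \<in> atlas (prod_manifold M N)"
  shows "topological_chart (mtop (prod_manifold M N)) c"
proof -
  obtain a b where ab: "a \<in> atlas M" "b \<in> atlas N" "c = (fst a \<times> fst b, map_prod (snd a) (snd b))"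
    using assms(3) unfolding prod_manifold_def by auto
  show ?thesis
    using topological_chart_prod[OF complex_manifold_chart[OF assms(1) ab(1)] complex_manifold_chart[OF assms(2) ab(2)]]
    by (simp add: ab(3) prod_manifold_def)
qed

lemma complex_manifold_chart_at:
  assumes "complex_manifold M" "p \<in> topspace (mtop M)"
  obtains c where "c \<in> atlas M" "p \<in> fst c"
  using assms unfolding complex_manifold_def by blast

text \<open>In a product chart, freezing one coordinate restricts the derivative to vectors
  \<open>(v, 0)\<close> or \<open>(0, v)\<close>, and these subspaces are stable under the product
  complex structure.\<close>

lemma holomorphic_map_slice:
  assumes M: "complex_manifold M" and N: "complex_manifold N" and Q: "complex_manifold Q"
    and G: "holomorphic_map (prod_manifold M N) Q G" and p: "p \<in> topspace (mtop M)" and q: "q \<in> topspace (mtop N)"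
  shows "complex_diff_at M Q (\<lambda>h. G (h, q)) p" "complex_diff_at N Q (\<lambda>h. G (p, h)) q"
proof -
  let ?e = "\<lambda>c d. (fst c \<times> fst d, map_prod (snd c) (snd d))"
  have e: "?e c d \<in> atlas (prod_manifold M N)" if "c \<in> atlas M" "d \<in> atlas N" for c d
    using that unfolding prod_manifold_def cmanifold.simps by blast
  have D: "\<exists>D. (local_rep (?e c d) y G has_derivative D) (at (snd c p, snd d q)) \<and>
      (\<forall>v w. D (i_mult M v, i_mult N w) = i_mult Q (D (v, w)))"
    if "c \<in> atlas M" "d \<in> atlas N" "p \<in> fst c" "q \<in> fst d" "y \<in> atlas Q" "G (p, q) \<in> fst y" for c d y
  proof -
    have "complex_diff_at (prod_manifold M N) Q G (p, q)"
      by (rule holomorphic_map_complex_diff_at[OF G prod_manifold_chart[OF M N] complex_manifold_chart[OF Q]])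
    from this[unfolded complex_diff_at_def, rule_format, OF e[OF that(1,2)] that(5)] that show ?thesis
      by (auto simp: prod_manifold_def)
  qed
  have inv: "inv_into (fst c \<times> fst d) (map_prod (snd c) (snd d)) (snd c a, snd d b) = (a, b)"
    if "c \<in> atlas M" "d \<in> atlas N" "a \<in> fst c" "b \<in> fst d" for c d a b
    using topological_chart_inv[OF prod_manifold_chart[OF M N e[OF that(1,2)]], of "(a, b)"] that by simp
  show "complex_diff_at M Q (\<lambda>h. G (h, q)) p"
    unfolding complex_diff_at_def
  proof (intro ballI impI)
    fix c y assume h: "c \<in> atlas M" "y \<in> atlas Q" "p \<in> fst c" "G (p, q) \<in> fst y"
    note c = complex_manifold_chart[OF M h(1)]
    obtain d where d: "d \<in> atlas N" "q \<in> fst d" by (rule complex_manifold_chart_at[OF N q])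
    obtain D where D: "(local_rep (?e c d) y G has_derivative D) (at (snd c p, snd d q))"
      "\<And>v w. D (i_mult M v, i_mult N w) = i_mult Q (D (v, w))" using D[OF h(1) d(1) h(3) d(2) h(2,4)] by blast
    have "((\<lambda>z. local_rep (?e c d) y G (z, snd d q)) has_derivative (\<lambda>v. D (v, 0))) (at (snd c p))"
      by (rule has_derivative_compose[OF has_derivative_Pair[OF has_derivative_ident has_derivative_const] D(1)])
    then have "(local_rep c y (\<lambda>h. G (h, q)) has_derivative (\<lambda>v. D (v, 0))) (at (snd c p))"
      by (rule has_derivative_transform_within_open[where s = "snd c ` fst c"])
        (use c h d topological_chart_inv[OF c] inv in \<open>auto simp: topological_chart_def local_rep_def\<close>)
    then show "\<exists>D. (local_rep c y (\<lambda>h. G (h, q)) has_derivative D) (at (snd c p)) \<and> (\<forall>v. D (i_mult M v) = i_mult Q (D v))"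
      using D(2)[of _ 0] i_mult_facts(3)[OF N] by auto
  qed
  show "complex_diff_at N Q (\<lambda>h. G (p, h)) q"
    unfolding complex_diff_at_def
  proof (intro ballI impI)
    fix d y assume h: "d \<in> atlas N" "y \<in> atlas Q" "q \<in> fst d" "G (p, q) \<in> fst y"
    note d = complex_manifold_chart[OF N h(1)]
    obtain c where c: "c \<in> atlas M" "p \<in> fst c" by (rule complex_manifold_chart_at[OF M p])
    obtain D where D: "(local_rep (?e c d) y G has_derivative D) (at (snd c p, snd d q))"
      "\<And>v w. D (i_mult M v, i_mult N w) = i_mult Q (D (v, w))" using D[OF c(1) h(1) c(2) h(3) h(2,4)] by blast
    have "((\<lambda>z. local_rep (?e c d) y G (snd c p, z)) has_derivative (\<lambda>v. D (0, v))) (at (snd d q))"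
      by (rule has_derivative_compose[OF has_derivative_Pair[OF has_derivative_const has_derivative_ident] D(1)])
    then have "(local_rep d y (\<lambda>h. G (p, h)) has_derivative (\<lambda>v. D (0, v))) (at (snd d q))"
      by (rule has_derivative_transform_within_open[where s = "snd d ` fst d"])
        (use d h c topological_chart_inv[OF d] inv in \<open>auto simp: topological_chart_def local_rep_def\<close>)
    then show "\<exists>D. (local_rep d y (\<lambda>h. G (p, h)) has_derivative D) (at (snd d q)) \<and> (\<forall>v. D (i_mult N v) = i_mult Q (D v))"
      using D(2)[of 0] i_mult_facts(3)[OF M] by auto
  qed
qed

section \<open>Local structure of a Lie group near the identity\<close>

locale complex_lie_gp =
  fixes L :: "('g, 'e::real_normed_vector) lie_group" (structure)
  assumes complex_lie_group: "complex_lie_group L"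
begin

sublocale group L using complex_lie_group unfolding complex_lie_group_def by blast

abbreviation \<phi> :: "'g => 'e" where "\<phi> \<equiv> snd (id_chart L)"
abbreviation D0 :: "'g set" where "D0 \<equiv> fst (id_chart L)"

text \<open>The chart is translated so that the identity has coordinate 0. On \<open>E0\<close> the
  map \<open>\<sigma>\<close> is the inverse of \<open>\<psi>\<close>; elsewhere its values are
  arbitrary.\<close>

definition \<psi> :: "'g => 'e" where "\<psi> g = \<phi> g - \<phi> \<one>"
definition \<sigma> :: "'e => 'g" where "\<sigma> x = inv_into D0 (\<phi>) (x + \<phi> \<one>)"
definition E0 :: "'e set" where "E0 = \<psi> ` D0"

abbreviation limL :: "('n => 'g) => 'g => 'n filter => bool" where "limL \<equiv> limitin (ltop L)"

lemma mfd: "complex_manifold (mfd L)"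
  and carrier: "carrier L = topspace (ltop L)"
  and id_chart_atlas: "id_chart L \<in> atlas (mfd L)"
  and one_D0: "\<one> \<in> D0"
  and holo_mult: "holomorphic_map (prod_manifold (mfd L) (mfd L)) (mfd L) (\<lambda>(g, h). g \<otimes> h)"
  and holo_inv: "holomorphic_map (mfd L) (mfd L) (\<lambda>g. inv g)"
  using complex_lie_group unfolding complex_lie_group_def by blast+

lemma fd: "finite_dimensional TYPE('e)"
  and Hausdorff: "Hausdorff_space (ltop L)"
  and second_countable_L: "second_countable (ltop L)"
  using mfd unfolding complex_manifold_def by blast+

lemma id_chart: "topological_chart (ltop L) (id_chart L)"
  using complex_manifold_chart[OF mfd id_chart_atlas] .

lemma D0_open: "openin (ltop L) D0"
  using id_chart unfolding topological_chart_def by blast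

lemma D0_carrier: "g \<in> D0 ==> g \<in> carrier L"
  using openin_subset[OF D0_open] carrier by auto

lemma psi_one [simp]: "\<psi> \<one> = 0" by (simp add: \<psi>_def)

lemma sigma_psi [simp]: "g \<in> D0 ==> \<sigma> (\<psi> g) = g"
  unfolding \<sigma>_def \<psi>_def using topological_chart_inv[OF id_chart] by simp

lemma sigma_D0: "x \<in> E0 ==> \<sigma> x \<in> D0"
  unfolding E0_def by auto

lemma psi_sigma [simp]: "x \<in> E0 ==> \<psi> (\<sigma> x) = x"
  unfolding E0_def by auto

lemma psi_E0: "g \<in> D0 ==> \<psi> g \<in> E0"
  unfolding E0_def by auto

lemma zero_E0: "0 \<in> E0"
  unfolding E0_def using one_D0 by force

lemma sigma_zero [simp]: "\<sigma> 0 = \<one>"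
  using sigma_psi[OF one_D0] by simp

lemma E0_translate: "E0 = (\<lambda>x. x - \<phi> \<one>) ` (\<phi> ` D0)"
  unfolding E0_def \<psi>_def by auto

lemma E0_open: "open E0"
  unfolding E0_translate using id_chart unfolding topological_chart_def
  by (metis open_translation_subtract)

lemma sigma_carrier: "x \<in> E0 ==> \<sigma> x \<in> carrier L"
  using sigma_D0 D0_carrier by blast

lemma limitin_D0:
  assumes "p \<in> D0"
  shows "limL f p F \<longleftrightarrow> (\<forall>\<^sub>F n in F. f n \<in> D0) \<and> ((\<lambda>n. \<psi> (f n)) \<longlongrightarrow> \<psi> p) F"
proof -
  have "((\<lambda>n. \<phi> (f n)) \<longlongrightarrow> \<phi> p) F \<longleftrightarrow> ((\<lambda>n. \<psi> (f n)) \<longlongrightarrow> \<psi> p) F"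
  proof
    assume "((\<lambda>n. \<phi> (f n)) \<longlongrightarrow> \<phi> p) F"
    then show "((\<lambda>n. \<psi> (f n)) \<longlongrightarrow> \<psi> p) F" unfolding \<psi>_def by (intro tendsto_diff tendsto_const)
  next
    assume "((\<lambda>n. \<psi> (f n)) \<longlongrightarrow> \<psi> p) F"
    from tendsto_add[OF this tendsto_const[of "\<phi> \<one>"]]
    show "((\<lambda>n. \<phi> (f n)) \<longlongrightarrow> \<phi> p) F" unfolding \<psi>_def by simp
  qed
  then show ?thesis using topological_chart_limitin[OF id_chart assms, of f F] by blast
qed

lemma limitin_one: "limL f \<one> F \<longleftrightarrow> (\<forall>\<^sub>F n in F. f n \<in> D0) \<and> ((\<lambda>n. \<psi> (f n)) \<longlongrightarrow> 0) F"
  using limitin_D0[OF one_D0] by simp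

lemma limitin_sigma:
  assumes "(f \<longlongrightarrow> x) F" "x \<in> E0"
  shows "limL (\<lambda>n. \<sigma> (f n)) (\<sigma> x) F"
proof -
  have ev: "\<forall>\<^sub>F n in F. f n \<in> E0" using assms E0_open topological_tendstoD by blast
  have "((\<lambda>n. \<psi> (\<sigma> (f n))) \<longlongrightarrow> x) F"
    using assms(1) by (rule Lim_transform_eventually) (use ev in \<open>auto elim: eventually_mono\<close>)
  then show ?thesis
    unfolding limitin_D0[OF sigma_D0[OF assms(2)]] using assms(2) ev by (auto elim: eventually_mono intro: sigma_D0)
qed

lemma cont_mult: "continuous_map (prod_topology (ltop L) (ltop L)) (ltop L) (\<lambda>(g, h). g \<otimes> h)"
  using smooth_map_continuous[OF conjunct1[OF holo_mult[unfolded holomorphic_map_def]]] by (simp add: prod_manifold_def)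

lemma cont_inv: "continuous_map (ltop L) (ltop L) (\<lambda>g. inv g)"
  using smooth_map_continuous[OF conjunct1[OF holo_inv[unfolded holomorphic_map_def]]] .

lemma limitin_mult:
  assumes "limL f a F" "limL g b F"
  shows "limL (\<lambda>n. f n \<otimes> g n) (a \<otimes> b) F"
proof -
  have "limitin (prod_topology (ltop L) (ltop L)) (\<lambda>n. (f n, g n)) (a, b) F"
    using assms by (simp add: limitin_pairwise o_def)
  from continuous_map_limit[OF cont_mult this] show ?thesis by (simp add: o_def)
qed

lemma limitin_inv:
  assumes "limL f a F"
  shows "limL (\<lambda>n. inv (f n)) (inv a) F"
  using continuous_map_limit[OF cont_inv assms] by (simp add: o_def)

lemma limitin_constL: "a \<in> carrier L ==> limL (\<lambda>_. a) a F"
  using carrier by simp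

lemma limitin_carrier: "limL f a F ==> a \<in> carrier L"
  using limitin_topspace[of "ltop L" f a F] by (simp add: carrier)

lemma limitin_unique_L:
  assumes "limL f a F" "limL f b F" "F \<noteq> bot"
  shows "a = b"
  using limitin_Hausdorff_unique[OF assms(1,2) assms(3) Hausdorff] .

text \<open>The atlas of the product contains the uncentred chart, hence the shifts by
  \<open>c1\<close> whenever \<open>mult_rep\<close> is compared with \<open>\<psi>\<close> and
  \<open>\<sigma>\<close>.\<close>

definition mult_rep :: "'e \<times> 'e => 'e" where
  "mult_rep = local_rep (D0 \<times> D0, map_prod (\<phi>) (\<phi>)) (id_chart L) (\<lambda>(g, h). g \<otimes> h)"

definition mult_dom :: "('e \<times> 'e) set" where
  "mult_dom = map_prod (\<phi>) (\<phi>) ` {q \<in> D0 \<times> D0. (\<lambda>(g, h). g \<otimes> h) q \<in> D0}"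

abbreviation c1 :: 'e where "c1 \<equiv> \<phi> \<one>"

lemma prod_chart:
  "(D0 \<times> D0, map_prod (\<phi>) (\<phi>)) \<in> atlas (prod_manifold (mfd L) (mfd L))"
  "topological_chart (prod_topology (ltop L) (ltop L)) (D0 \<times> D0, map_prod (\<phi>) (\<phi>))"
proof -
  show "(D0 \<times> D0, map_prod (\<phi>) (\<phi>)) \<in> atlas (prod_manifold (mfd L) (mfd L))"
    using id_chart_atlas unfolding prod_manifold_def cmanifold.simps by blast
  show "topological_chart (prod_topology (ltop L) (ltop L)) (D0 \<times> D0, map_prod (\<phi>) (\<phi>))"
    by (rule topological_chart_prod[OF id_chart id_chart])
qed

lemma mult_dom_open: "open mult_dom"
  using chart_preimage_open[OF cont_mult prod_chart(2) id_chart] unfolding mult_dom_def by simp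

lemma one_mult_dom: "(c1, c1) \<in> mult_dom"
  unfolding mult_dom_def using one_D0 by (auto intro!: image_eqI[of _ _ "(\<one>, \<one>)"])

lemma Ck_mult_rep: "Ck_on k mult_dom mult_rep"
proof -
  have "topological_chart (mtop (prod_manifold (mfd L) (mfd L))) (D0 \<times> D0, map_prod (\<phi>) (\<phi>))"
    using prod_chart(2) by (simp add: prod_manifold_def)
  from smooth_map_local_rep[OF conjunct1[OF holo_mult[unfolded holomorphic_map_def]] prod_chart(1) this id_chart_atlas id_chart]
  show ?thesis unfolding mult_dom_def mult_rep_def fst_conv snd_conv .
qed

lemma mult_rep_psi:
  assumes "g \<in> D0" "h \<in> D0"
  shows "mult_rep (\<psi> g + c1, \<psi> h + c1) = \<psi> (g \<otimes> h) + c1"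
proof -
  have "inv_into (D0 \<times> D0) (map_prod (\<phi>) (\<phi>)) (\<phi> g, \<phi> h) = (g, h)"
    using topological_chart_inv[OF prod_chart(2), of "(g, h)"] assms by simp
  then show ?thesis unfolding mult_rep_def local_rep_def \<psi>_def by simp
qed

lemma mult_dom_psi: "(x + c1, y + c1) \<in> mult_dom ==> x \<in> E0 \<and> y \<in> E0 \<and> \<sigma> x \<otimes> \<sigma> y \<in> D0"
proof -
  assume "(x + c1, y + c1) \<in> mult_dom"
  then obtain g h where gh: "g \<in> D0" "h \<in> D0" "g \<otimes> h \<in> D0" "x + c1 = \<phi> g" "y + c1 = \<phi> h"
    unfolding mult_dom_def by auto
  then have "x = \<psi> g" "y = \<psi> h" unfolding \<psi>_def by (metis add_diff_cancel)+
  then show ?thesis using gh psi_E0 by simp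
qed

text \<open>Multiplication by the identity on either side is the identity map, so both partial
  derivatives are identities.\<close>

lemma frechet_mult_rep:
  "frechet_derivative mult_rep (at (c1, c1)) (v, w) = v + w"
proof -
  let ?D = "frechet_derivative mult_rep (at (c1, c1))"
  have diff: "mult_rep differentiable (at (c1, c1))"
    using Ck_mult_rep[of "Suc 0"] one_mult_dom by auto
  then have D: "(mult_rep has_derivative ?D) (at (c1, c1))" by (simp add: frechet_derivative_works)
  have lin: "linear ?D" by (rule frechet_linear[OF diff])
  have op: "open ((\<lambda>x. x + c1) ` E0)" using open_translation[OF E0_open, of c1] by (simp add: add.commute)
  have c1i: "c1 \<in> (\<lambda>x. x + c1) ` E0" using zero_E0 by force
  have "((\<lambda>x. (x, c1)) has_derivative (\<lambda>v. (v, 0))) (at c1)" by (intro derivative_eq_intros) auto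
  from diff_chain_at[OF this D] have "(mult_rep \<circ> (\<lambda>x. (x, c1)) has_derivative ?D \<circ> (\<lambda>v. (v, 0))) (at c1)" .
  moreover have "(mult_rep \<circ> (\<lambda>x. (x, c1))) z = z" if "z \<in> (\<lambda>x. x + c1) ` E0" for z
    using that mult_rep_psi[OF _ one_D0] D0_carrier unfolding E0_def by force
  ultimately have "((\<lambda>z. z) has_derivative ?D \<circ> (\<lambda>v. (v, 0))) (at c1)"
    by (rule has_derivative_transform_within_open[OF _ op c1i])
  from has_derivative_unique[OF this has_derivative_ident] have 1: "?D \<circ> (\<lambda>v. (v, 0)) = (\<lambda>v. v)" .
  have "((\<lambda>x. (c1, x)) has_derivative (\<lambda>v. (0, v))) (at c1)" by (intro derivative_eq_intros) auto
  from diff_chain_at[OF this D] have "(mult_rep \<circ> (\<lambda>x. (c1, x)) has_derivative ?D \<circ> (\<lambda>v. (0, v))) (at c1)" .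
  moreover have "(mult_rep \<circ> (\<lambda>x. (c1, x))) z = z" if "z \<in> (\<lambda>x. x + c1) ` E0" for z
    using that mult_rep_psi[OF one_D0] D0_carrier unfolding E0_def by force
  ultimately have "((\<lambda>z. z) has_derivative ?D \<circ> (\<lambda>v. (0, v))) (at c1)"
    by (rule has_derivative_transform_within_open[OF _ op c1i])
  from has_derivative_unique[OF this has_derivative_ident] have 2: "?D \<circ> (\<lambda>v. (0, v)) = (\<lambda>v. v)" .
  have "?D (v, w) = ?D (v, 0) + ?D (0, w)" using linear_add[OF lin, of "(v, 0)" "(0, w)"] by simp
  also have "\<dots> = v + w" using fun_cong[OF 1, of v] fun_cong[OF 2, of w] by simp
  finally show ?thesis .
qed

text \<open>Strict differentiability of the product at the identity: on the ball of radius
  \<open>\<delta>\<close>, product minus sum is Lipschitz with constant \<open>\<epsilon>\<close>.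
  The Lipschitz form is what allows errors to be added up over many factors.\<close>

definition mul_close :: "real => real => bool" where
  "mul_close \<epsilon> \<delta> \<longleftrightarrow> \<delta> > 0 \<and> ball 0 \<delta> \<subseteq> E0 \<and>
     (\<forall>x y. norm x < \<delta> --> norm y < \<delta> --> \<sigma> x \<otimes> \<sigma> y \<in> D0) \<and>
     (\<forall>x y x' y'. norm x < \<delta> --> norm y < \<delta> --> norm x' < \<delta> --> norm y' < \<delta> -->
        norm (\<psi> (\<sigma> x \<otimes> \<sigma> y) - \<psi> (\<sigma> x' \<otimes> \<sigma> y') - (x - x') - (y - y')) \<le> \<epsilon> * (norm (x - x') + norm (y - y')))"

lemma mul_close_exists:
  assumes "\<epsilon> > 0"
  obtains \<delta> where "mul_close \<epsilon> \<delta>"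
proof -
  have fd2: "finite_dimensional TYPE('e \<times> 'e)" using finite_dimensional_prod[OF fd fd] .
  obtain d where d: "d > 0" "ball (c1, c1) d \<subseteq> mult_dom"
    "\<And>X Y. X \<in> ball (c1, c1) d ==> Y \<in> ball (c1, c1) d ==>
       norm (mult_rep X - mult_rep Y - frechet_derivative mult_rep (at (c1, c1)) (X - Y)) \<le> \<epsilon> * norm (X - Y)"
    by (rule Ck1_strict[OF fd2 mult_dom_open one_mult_dom Ck_mult_rep assms]) (rule that, assumption+)
  have inb: "(x + c1, y + c1) \<in> ball (c1, c1) d" if "norm x < d/2" "norm y < d/2" for x y
  proof -
    have "dist (c1, c1) (x + c1, y + c1) = norm (x, y)"
      by (simp add: dist_Pair_Pair norm_Pair dist_norm)
    also have "\<dots> \<le> norm x + norm y" by (rule norm_Pair_le)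
    finally show ?thesis using that by simp
  qed
  have dom: "x \<in> E0 \<and> y \<in> E0 \<and> \<sigma> x \<otimes> \<sigma> y \<in> D0" if "norm x < d/2" "norm y < d/2" for x y
    using mult_dom_psi inb[OF that] d(2) by blast
  show ?thesis
  proof (rule that[of "d/2"], unfold mul_close_def, intro conjI allI impI)
    show "d/2 > 0" using d by simp
    show "ball 0 (d/2) \<subseteq> E0" using dom[of _ 0] d(1) by auto
    show "\<sigma> x \<otimes> \<sigma> y \<in> D0" if "norm x < d/2" "norm y < d/2" for x y using dom that by blast
    fix x y x' y' :: 'e
    assume h: "norm x < d/2" "norm y < d/2" "norm x' < d/2" "norm y' < d/2"
    have e: "mult_rep (x + c1, y + c1) = \<psi> (\<sigma> x \<otimes> \<sigma> y) + c1" if "norm x < d/2" "norm y < d/2" for x y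
      using mult_rep_psi[of "\<sigma> x" "\<sigma> y"] dom[OF that] sigma_D0 by simp
    have "norm (\<psi> (\<sigma> x \<otimes> \<sigma> y) - \<psi> (\<sigma> x' \<otimes> \<sigma> y') - (x - x') - (y - y')) =
        norm (mult_rep (x + c1, y + c1) - mult_rep (x' + c1, y' + c1)
          - frechet_derivative mult_rep (at (c1, c1)) ((x + c1, y + c1) - (x' + c1, y' + c1)))"
      using e[OF h(1,2)] e[OF h(3,4)] by (simp add: frechet_mult_rep algebra_simps)
    also have "\<dots> \<le> \<epsilon> * norm ((x + c1, y + c1) - (x' + c1, y' + c1))"
      by (rule d(3)[OF inb[OF h(1,2)] inb[OF h(3,4)]])
    also have "\<dots> = \<epsilon> * norm (x - x', y - y')" by simp
    also have "\<dots> \<le> \<epsilon> * (norm (x - x') + norm (y - y'))"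
      using assms by (intro mult_left_mono norm_Pair_le) auto
    finally show "norm (\<psi> (\<sigma> x \<otimes> \<sigma> y) - \<psi> (\<sigma> x' \<otimes> \<sigma> y') - (x - x') - (y - y')) \<le> \<epsilon> * (norm (x - x') + norm (y - y'))" .
  qed
qed

lemma mul_closeD:
  assumes "mul_close \<epsilon> \<delta>"
  shows "\<delta> > 0" "norm x < \<delta> ==> x \<in> E0" "norm x < \<delta> ==> norm y < \<delta> ==> \<sigma> x \<otimes> \<sigma> y \<in> D0"
    "norm x < \<delta> ==> norm y < \<delta> ==> norm x' < \<delta> ==> norm y' < \<delta> ==>
       norm (\<psi> (\<sigma> x \<otimes> \<sigma> y) - \<psi> (\<sigma> x' \<otimes> \<sigma> y') - (x - x') - (y - y')) \<le> \<epsilon> * (norm (x - x') + norm (y - y'))"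
proof -
  show "\<delta> > 0" using assms unfolding mul_close_def by blast
  show "norm x < \<delta> ==> x \<in> E0" using assms mem_ball_0 unfolding mul_close_def by blast
  show "norm x < \<delta> ==> norm y < \<delta> ==> \<sigma> x \<otimes> \<sigma> y \<in> D0" using assms unfolding mul_close_def by blast
  show "norm x < \<delta> ==> norm y < \<delta> ==> norm x' < \<delta> ==> norm y' < \<delta> ==>
       norm (\<psi> (\<sigma> x \<otimes> \<sigma> y) - \<psi> (\<sigma> x' \<otimes> \<sigma> y') - (x - x') - (y - y')) \<le> \<epsilon> * (norm (x - x') + norm (y - y'))"
    using assms unfolding mul_close_def by blast
qed

text \<open>Comparison with the pairs \<open>(x, 0)\<close> and \<open>(0, y)\<close>, where product
  and sum agree exactly. The error is thus bounded by either factor alone, which is what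
  \<open>telescope\<close> accumulates.\<close>

lemma mul_close_right:
  assumes "mul_close \<epsilon> \<delta>" "norm x < \<delta>" "norm y < \<delta>"
  shows "norm (\<psi> (\<sigma> x \<otimes> \<sigma> y) - x - y) \<le> \<epsilon> * norm y"
    "norm (\<psi> (\<sigma> x \<otimes> \<sigma> y) - x - y) \<le> \<epsilon> * norm x"
proof -
  have d: "norm (0::'e) < \<delta>" using mul_closeD(1)[OF assms(1)] by simp
  have c: "\<sigma> x \<in> carrier L" "\<sigma> y \<in> carrier L" "x \<in> E0" "y \<in> E0"
    using mul_closeD(2)[OF assms(1)] assms(2,3) sigma_carrier by auto
  show "norm (\<psi> (\<sigma> x \<otimes> \<sigma> y) - x - y) \<le> \<epsilon> * norm y"
    using mul_closeD(4)[OF assms(1-3) assms(2) d] c by simp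
  show "norm (\<psi> (\<sigma> x \<otimes> \<sigma> y) - x - y) \<le> \<epsilon> * norm x"
    using mul_closeD(4)[OF assms(1-3) d assms(3)] c by (simp add: diff_diff_eq add.commute)
qed

text \<open>Continuity puts the inverse into the small ball; then the estimate for the product of
  \<open>\<sigma> x\<close> with its inverse, which has coordinate 0, gives the claim.\<close>

lemma inv_close:
  assumes e: "\<epsilon> > 0"
  obtains \<delta> where "\<delta> > 0" "\<And>x. norm x < \<delta> ==> x \<in> E0 \<and> inv (\<sigma> x) \<in> D0 \<and> norm (\<psi> (inv (\<sigma> x)) + x) \<le> \<epsilon> * norm x"
proof -
  define \<epsilon>' where "\<epsilon>' = min (\<epsilon>/3) (1/3)"
  have e': "\<epsilon>' > 0" "\<epsilon>' \<le> 1/3" "3 * \<epsilon>' \<le> \<epsilon>" using e unfolding \<epsilon>'_def by auto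
  obtain d where d: "mul_close \<epsilon>' d" using mul_close_exists[OF e'(1)] .
  have "limL (\<lambda>x. inv (\<sigma> x)) (inv (\<sigma> 0)) (nhds 0)"
    by (rule limitin_inv, rule limitin_sigma[OF _ zero_E0]) (simp add: filterlim_def)
  then have "(\<forall>\<^sub>F x in nhds 0. inv (\<sigma> x) \<in> D0) \<and> ((\<lambda>x. \<psi> (inv (\<sigma> x))) \<longlongrightarrow> 0) (nhds 0)"
    by (simp add: limitin_one)
  then have "\<forall>\<^sub>F x in nhds 0. inv (\<sigma> x) \<in> D0 \<and> norm (\<psi> (inv (\<sigma> x))) < d"
    using mul_closeD(1)[OF d] tendstoD[of "\<lambda>x. \<psi> (inv (\<sigma> x))" 0 "nhds 0" d] by (auto intro: eventually_conj)
  then obtain d1 where d1: "d1 > 0" "\<And>x. norm x < d1 ==> inv (\<sigma> x) \<in> D0 \<and> norm (\<psi> (inv (\<sigma> x))) < d"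
    unfolding eventually_nhds_metric by auto
  show ?thesis
  proof (rule that[of "min d d1"], use mul_closeD(1)[OF d] d1(1) in simp, intro conjI)
    fix x :: 'e assume x: "norm x < min d d1"
    show xE: "x \<in> E0" using mul_closeD(2)[OF d] x by simp
    show iD: "inv (\<sigma> x) \<in> D0" using d1(2) x by simp
    let ?i = "\<psi> (inv (\<sigma> x))"
    have ni: "norm ?i < d" using d1(2) x by simp
    have "norm (\<psi> (\<sigma> x \<otimes> \<sigma> ?i) - x - ?i) \<le> \<epsilon>' * norm x"
      using mul_close_right(2)[OF d _ ni] x by simp
    then have "norm (x + ?i) \<le> \<epsilon>' * norm x"
      using iD sigma_carrier[OF xE] by (simp add: norm_minus_commute algebra_simps) (metis add.commute norm_minus_cancel minus_add_distrib uminus_add_conv_diff)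
    also have "\<dots> \<le> \<epsilon> * norm x" using e' by (intro mult_right_mono) auto
    finally show "norm (?i + x) \<le> \<epsilon> * norm x" by (simp add: add.commute)
  qed
qed

text \<open>The error is proportional to \<open>x\<close> alone, uniformly for \<open>a\<close> in
  the ball. This gives both the control of conjugated errors in long products and the continuity of
  \<open>Ad\<close>.\<close>

lemma conj_close:
  assumes e: "\<epsilon> > 0"
  obtains \<delta> where "\<delta> > 0" "\<And>a x. norm a < \<delta> ==> norm x < \<delta> ==> a \<in> E0 \<and> x \<in> E0 \<and>
     \<sigma> a \<otimes> \<sigma> x \<otimes> inv (\<sigma> a) \<in> D0 \<and> norm (\<psi> (\<sigma> a \<otimes> \<sigma> x \<otimes> inv (\<sigma> a)) - x) \<le> \<epsilon> * norm x"
proof -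
  define \<epsilon>' where "\<epsilon>' = min (\<epsilon>/3) (1/3)"
  have e': "\<epsilon>' > 0" "\<epsilon>' \<le> 1/3" "3 * \<epsilon>' \<le> \<epsilon>" using e unfolding \<epsilon>'_def by auto
  obtain d where d: "mul_close \<epsilon>' d" using mul_close_exists[OF e'(1)] .
  obtain d1 where d1: "d1 > 0" "\<And>x. norm x < d1 ==> x \<in> E0 \<and> inv (\<sigma> x) \<in> D0 \<and> norm (\<psi> (inv (\<sigma> x)) + x) \<le> 1 * norm x"
    using inv_close[of 1] by auto
  have d0: "d > 0" using mul_closeD(1)[OF d] .
  show ?thesis
  proof (rule that[of "min (d/4) d1"], use d0 d1(1) in simp)
    fix a x :: 'e assume ax: "norm a < min (d/4) d1" "norm x < min (d/4) d1"
    have na: "norm a < d" "norm x < d" using ax d0 by auto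
    have E: "a \<in> E0" "x \<in> E0" using mul_closeD(2)[OF d] na by auto
    let ?i = "\<psi> (inv (\<sigma> a))"
    have iD: "inv (\<sigma> a) \<in> D0" using d1(2) ax by simp
    have "norm (?i + a) \<le> norm a" using d1(2)[of a] ax by simp
    then have "norm ?i \<le> 2 * norm a" using norm_triangle_ineq4[of "?i + a" a] by simp
    then have ni: "norm ?i < d" using ax norm_ge_zero[of a] by linarith
    let ?m = "\<psi> (\<sigma> a \<otimes> \<sigma> x)"
    have mD: "\<sigma> a \<otimes> \<sigma> x \<in> D0" using mul_closeD(3)[OF d] na by simp
    have m1: "norm (?m - a - x) \<le> \<epsilon>' * norm x" using mul_close_right(1)[OF d na] .
    have "\<epsilon>' * norm x \<le> norm x" using e'(2) by (simp add: mult_left_le_one_le e'(1) less_imp_le)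
    then have "norm ?m \<le> norm a + 2 * norm x"
      using m1 norm_triangle_ineq[of "?m - a - x" "a + x"] norm_triangle_ineq[of a x] by simp
    then have nm: "norm ?m < d" using ax norm_ge_zero[of a] norm_ge_zero[of x] by linarith
    have c: "\<sigma> a \<in> carrier L" "\<sigma> x \<in> carrier L" using E sigma_carrier by auto
    have zD: "\<sigma> a \<otimes> \<sigma> x \<otimes> inv (\<sigma> a) \<in> D0"
      using mul_closeD(3)[OF d nm ni] mD iD by simp
    \<comment> \<open>Compare with the pair \<open>a\<close>, \<open>?i\<close>, whose product is
      the identity: the common second factor cancels and only \<open>?m - a\<close>, of the order of
      \<open>x\<close>, remains.\<close>
    have "norm (\<psi> (\<sigma> ?m \<otimes> \<sigma> ?i) - \<psi> (\<sigma> a \<otimes> \<sigma> ?i) - (?m - a) - (?i - ?i)) \<le> \<epsilon>' * (norm (?m - a) + norm (?i - ?i))"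
      by (rule mul_closeD(4)[OF d nm ni na(1) ni])
    then have z: "norm (\<psi> (\<sigma> a \<otimes> \<sigma> x \<otimes> inv (\<sigma> a)) - (?m - a)) \<le> \<epsilon>' * norm (?m - a)"
      using mD iD c by simp
    have "norm (?m - a) \<le> norm (?m - a - x) + norm x" using norm_triangle_ineq[of "?m - a - x" x] by simp
    also have "\<dots> \<le> 2 * norm x" using m1 \<open>\<epsilon>' * norm x \<le> norm x\<close> by simp
    finally have "\<epsilon>' * norm (?m - a) \<le> \<epsilon>' * (2 * norm x)" using e' by (intro mult_left_mono) auto
    then have "norm (\<psi> (\<sigma> a \<otimes> \<sigma> x \<otimes> inv (\<sigma> a)) - x) \<le> 3 * \<epsilon>' * norm x"
      using z m1 norm_triangle_ineq[of "\<psi> (\<sigma> a \<otimes> \<sigma> x \<otimes> inv (\<sigma> a)) - (?m - a)" "?m - a - x"] by simp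
    also have "\<dots> \<le> \<epsilon> * norm x" using e' by (intro mult_right_mono) auto
    finally show "a \<in> E0 \<and> x \<in> E0 \<and> \<sigma> a \<otimes> \<sigma> x \<otimes> inv (\<sigma> a) \<in> D0 \<and>
      norm (\<psi> (\<sigma> a \<otimes> \<sigma> x \<otimes> inv (\<sigma> a)) - x) \<le> \<epsilon> * norm x" using E zD by blast
  qed
qed

primrec gprod :: "(nat => 'g) => nat => 'g" where
  "gprod f 0 = \<one>"
| "gprod f (Suc n) = gprod f n \<otimes> f n"

lemma gprod_closed: "(\<And>i. i < n ==> f i \<in> carrier L) ==> gprod f n \<in> carrier L"
  by (induction n) auto

lemma gprod_cong: "(\<And>i. i < n ==> f i = g i) ==> gprod f n = gprod g n"
  by (induction n) auto

lemma gprod_const: "a \<in> carrier L ==> gprod (\<lambda>_. a) n = a [^] n"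
  by (induction n) auto

text \<open>Induction on the number of factors: appending a factor costs \<open>\<epsilon>\<close>
  times its own norm. Only the total length matters, so the number of factors may tend to
  infinity.\<close>

lemma telescope:
  assumes e: "0 < \<epsilon>" "\<epsilon> \<le> 1"
  obtains \<delta> where "\<delta> > 0" "\<And>w n. (\<Sum>i<n. norm (w i)) < \<delta> ==>
     (\<forall>i<n. w i \<in> E0) \<and> gprod (\<lambda>i. \<sigma> (w i)) n \<in> D0 \<and>
     norm (\<psi> (gprod (\<lambda>i. \<sigma> (w i)) n) - (\<Sum>i<n. w i)) \<le> \<epsilon> * (\<Sum>i<n. norm (w i))"
proof -
  obtain d where d: "mul_close \<epsilon> d" using mul_close_exists[OF e(1)] .
  have d0: "d > 0" using mul_closeD(1)[OF d] .
  show ?thesis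
  \<comment> \<open>Half the radius, since the coordinate of a partial product may reach twice the
    total length of its factors.\<close>
  proof (rule that[of "d/2"], use d0 in simp)
    fix w :: "nat => 'e" and n
    assume "(\<Sum>i<n. norm (w i)) < d/2"
    then show "(\<forall>i<n. w i \<in> E0) \<and> gprod (\<lambda>i. \<sigma> (w i)) n \<in> D0 \<and>
       norm (\<psi> (gprod (\<lambda>i. \<sigma> (w i)) n) - (\<Sum>i<n. w i)) \<le> \<epsilon> * (\<Sum>i<n. norm (w i))"
    proof (induction n)
      case 0
      then show ?case using one_D0 by simp
    next
      case (Suc n)
      have s0: "0 \<le> (\<Sum>i<n. norm (w i))" by (intro sum_nonneg) auto
      have nw: "norm (w n) < d/2" "(\<Sum>i<n. norm (w i)) < d/2"
        using Suc.prems s0 norm_ge_zero[of "w n"] unfolding sum.lessThan_Suc by linarith+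
      let ?g = "gprod (\<lambda>i. \<sigma> (w i)) n" and ?S = "\<Sum>i<n. w i" and ?N = "\<Sum>i<n. norm (w i)"
      have IH: "\<forall>i<n. w i \<in> E0" "?g \<in> D0" "norm (\<psi> ?g - ?S) \<le> \<epsilon> * ?N" using Suc.IH nw by auto
      have wE: "w n \<in> E0" using mul_closeD(2)[OF d] nw d0 by simp
      have "\<epsilon> * ?N \<le> ?N" using e s0 by (simp add: mult_left_le_one_le less_imp_le)
      then have "norm (\<psi> ?g) \<le> 2 * ?N"
        using IH(3) norm_triangle_ineq[of "\<psi> ?g - ?S" ?S] norm_sum[of w "{..<n}"] by simp
      then have ng: "norm (\<psi> ?g) < d" using nw by simp
      have nwd: "norm (w n) < d" using nw d0 by simp
      have "?g \<otimes> \<sigma> (w n) \<in> D0" using mul_closeD(3)[OF d ng nwd] IH(2) by simp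
      moreover have "norm (\<psi> (?g \<otimes> \<sigma> (w n)) - \<psi> ?g - w n) \<le> \<epsilon> * norm (w n)"
        using mul_close_right(1)[OF d ng nwd] IH(2) by simp
      then have "norm (\<psi> (?g \<otimes> \<sigma> (w n)) - (?S + w n)) \<le> \<epsilon> * ?N + \<epsilon> * norm (w n)"
        using IH(3) norm_triangle_ineq[of "\<psi> (?g \<otimes> \<sigma> (w n)) - \<psi> ?g - w n" "\<psi> ?g - ?S"] by (simp add: algebra_simps)
      ultimately show ?case using IH(1) wE by (auto simp: less_Suc_eq algebra_simps)
    qed
  qed
qed

end

section \<open>One-parameter subgroups\<close>

text \<open>A subsequence need not make uncountably many indices converge at once; by Tychonoff's
  theorem a filter finer than \<open>sequentially\<close> does.\<close>

lemma compact_cluster_filter: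
  fixes Y :: "nat => 'i => 'a::topological_space"
  assumes K: "compact K" and Y: "\<And>n t. Y n t \<in> K"
  obtains H c where "H \<noteq> bot" "H \<le> sequentially" "\<And>t. c t \<in> K" "\<And>t. ((\<lambda>n. Y n t) \<longlongrightarrow> c t) H"
proof -
  have "compactin (product_topology (\<lambda>i::'i. euclidean :: 'a topology) UNIV) (PiE UNIV (\<lambda>i. K))"
    by (subst compactin_PiE) (use K in auto)
  then have comp: "compact (PiE UNIV (\<lambda>i::'i. K))" by (simp add: euclidean_product_topology)
  have "eventually (\<lambda>f. f \<in> PiE UNIV (\<lambda>i::'i. K)) (filtermap Y sequentially)"
    using Y by (simp add: eventually_filtermap PiE_def Pi_def)
  moreover have "filtermap Y sequentially \<noteq> bot" by (simp add: filtermap_bot_iff)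
  ultimately obtain c where c: "c \<in> PiE UNIV (\<lambda>i::'i. K)" "inf (nhds c) (filtermap Y sequentially) \<noteq> bot"
    using comp unfolding compact_filter by blast
  \<comment> \<open>The pullback makes the whole family converge; the meet with
    \<open>sequentially\<close> preserves limits that exist along the sequence.\<close>
  define H where "H = inf (filtercomap Y (nhds c)) sequentially"
  have lim: "filterlim Y (nhds c) H"
    unfolding H_def by (rule filterlim_mono[OF filterlim_filtercomap]) auto
  show ?thesis
  proof (rule that[of H c])
    show "H \<noteq> bot"
    proof
      assume "H = bot"
      then have "eventually (\<lambda>_. False) H" by simp
      then obtain Q R where QR: "eventually Q (filtercomap Y (nhds c))" "eventually R sequentially" "\<And>n. \<not> (Q n \<and> R n)"
        unfolding H_def eventually_inf by auto
      then obtain S where S: "eventually S (nhds c)" "\<And>n. S (Y n) ==> Q n"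
        unfolding eventually_filtercomap by blast
      have "eventually (\<lambda>f. \<not> S f) (filtermap Y sequentially)"
        unfolding eventually_filtermap using QR(2) by eventually_elim (use QR(3) S(2) in blast)
      then have "eventually (\<lambda>_. False) (inf (nhds c) (filtermap Y sequentially))"
        unfolding eventually_inf using S(1) by blast
      then show False using c(2) by (simp add: trivial_limit_def)
    qed
    show "H \<le> sequentially" unfolding H_def by simp
    show "c t \<in> K" for t using c(1) by (auto simp: PiE_def Pi_def)
    show "((\<lambda>n. Y n t) \<longlongrightarrow> c t) H" for t
    proof (rule topological_tendstoI)
      fix S assume S: "open S" "c t \<in> S"
      have "open ((\<lambda>f :: 'i => 'a. f t) -` S)" by (intro open_vimage S continuous_on_product_coordinates)
      then have "eventually (\<lambda>f. f \<in> (\<lambda>f. f t) -` S) (nhds c)" using S by (intro eventually_nhds_in_open) auto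
      then show "\<forall>\<^sub>F n in H. Y n t \<in> S" using lim unfolding filterlim_iff by auto
    qed
  qed
qed

section \<open>The product formula and uniqueness of one-parameter subgroups\<close>

context complex_lie_gp
begin

abbreviation ops :: "'e => (real => 'g) => bool" where "ops \<equiv> one_parameter_subgroup L"

lemma opsD:
  assumes "ops \<xi> \<gamma>"
  shows "\<gamma> (s + t) = \<gamma> s \<otimes> \<gamma> t" "\<gamma> 0 = \<one>" "\<gamma> t \<in> carrier L" "\<gamma> (- t) = inv (\<gamma> t)"
    "(f \<longlongrightarrow> t) F ==> limL (\<lambda>n. \<gamma> (f n)) (\<gamma> t) F"
proof -
  have cont: "continuous_map euclideanreal (ltop L) \<gamma>" and add: "\<And>s t. \<gamma> (s + t) = \<gamma> s \<otimes> \<gamma> t" and z: "\<gamma> 0 = \<one>"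
    using assms unfolding one_parameter_subgroup_def by auto
  show "\<gamma> (s + t) = \<gamma> s \<otimes> \<gamma> t" "\<gamma> 0 = \<one>" by (fact add, fact z)
  have car: "\<gamma> t \<in> carrier L" for t using cont continuous_map_image_subset_topspace carrier by fastforce
  then show "\<gamma> t \<in> carrier L" .
  have "\<gamma> (-t) \<otimes> \<gamma> t = \<one>" using add[of "-t" t] z by simp
  then show "\<gamma> (- t) = inv (\<gamma> t)" using car inv_equality by metis
  show "limL (\<lambda>n. \<gamma> (f n)) (\<gamma> t) F" if "(f \<longlongrightarrow> t) F"
    using continuous_map_limit[OF cont, of f t F] that by (simp add: o_def)
qed

lemma ops_mult:
  assumes "ops \<xi> \<gamma>"
  shows "\<gamma> (real n * t) = \<gamma> t [^] n"
proof (induction n)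
  case (Suc n)
  have "real (Suc n) * t = real n * t + t" by (simp add: algebra_simps)
  then show ?case using Suc opsD(1)[OF assms] by simp
qed (simp add: opsD(2)[OF assms])

lemma ops_gprod: "ops \<xi> \<gamma> ==> gprod (\<lambda>_. \<gamma> h) i = \<gamma> (real i * h)"
  using gprod_const[of "\<gamma> h"] opsD(3)[of \<xi> \<gamma>] ops_mult by simp

lemma ops_near:
  assumes "ops \<xi> \<gamma>" "\<delta> > 0"
  obtains \<tau> where "\<tau> > 0" "\<And>t. \<bar>t\<bar> < \<tau> ==> \<gamma> t \<in> D0 \<and> norm (\<psi> (\<gamma> t)) < \<delta>"
proof -
  have "limL \<gamma> \<one> (nhds 0)"
    using opsD(5)[OF assms(1), of "\<lambda>t. t" 0 "nhds 0"] opsD(2)[OF assms(1)] by (simp add: filterlim_def)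
  then have "\<forall>\<^sub>F t in nhds 0. \<gamma> t \<in> D0 \<and> norm (\<psi> (\<gamma> t)) < \<delta>"
    unfolding limitin_one using tendstoD[of "\<lambda>t. \<psi> (\<gamma> t)" 0 "nhds 0" \<delta>] assms(2) by (auto intro: eventually_conj)
  then show ?thesis using that unfolding eventually_nhds_metric by (auto simp: dist_real_def)
qed

lemma ops_deriv:
  assumes "ops \<xi> \<gamma>" "\<epsilon> > 0"
  obtains \<tau> where "\<tau> > 0" "\<And>t. \<bar>t\<bar> < \<tau> ==> norm (\<psi> (\<gamma> t) - t *\<^sub>R \<xi>) \<le> \<epsilon> * \<bar>t\<bar>"
proof -
  have "((\<lambda>t. \<phi> (\<gamma> t)) has_derivative (\<lambda>t. t *\<^sub>R \<xi>)) (at 0)"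
    using assms unfolding one_parameter_subgroup_def has_vector_derivative_def by simp
  then obtain d where "d > 0" "\<And>y. norm (y - 0) < d ==>
      norm (\<phi> (\<gamma> y) - \<phi> (\<gamma> 0) - (y - 0) *\<^sub>R \<xi>) \<le> \<epsilon> * norm (y - 0)"
    unfolding has_derivative_at_alt using assms(2) by blast
  then show ?thesis using that[of d] opsD(2)[OF assms(1)] by (simp add: \<psi>_def)
qed

text \<open>The elements \<open>f n i\<close>, \<open>i \<in> A n\<close>, agree with \<open>exp (h n x n i)\<close> to first order, uniformly in \<open>i\<close>.\<close>

definition tang :: "'n filter => ('n => 'i set) => ('n => real) => ('n => 'i => 'g) => ('n => 'i => 'e) => bool" where
  "tang F A h f x \<longleftrightarrow>
     (\<forall>\<epsilon>>0. \<forall>\<^sub>F n in F. \<forall>i\<in>A n. f n i \<in> D0 \<and> norm (\<psi> (f n i) - h n *\<^sub>R x n i) \<le> \<epsilon> * h n)"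

lemma tangD: "tang F A h f x ==> \<epsilon> > 0 ==>
    \<forall>\<^sub>F n in F. \<forall>i\<in>A n. f n i \<in> D0 \<and> norm (\<psi> (f n i) - h n *\<^sub>R x n i) \<le> \<epsilon> * h n"
  unfolding tang_def by blast

lemma tangI_lim:
  assumes "\<forall>\<^sub>F n in F. h n > 0" "\<forall>\<^sub>F n in F. g n \<in> D0" "((\<lambda>n. \<psi> (g n) /\<^sub>R h n) \<longlongrightarrow> x) F"
  shows "tang F A h (\<lambda>n _. g n) (\<lambda>_ _. x)"
  unfolding tang_def
proof (intro allI impI)
  fix \<epsilon> :: real assume "\<epsilon> > 0"
  from assms(1,2) tendstoD[OF assms(3) this]
  show "\<forall>\<^sub>F n in F. \<forall>i\<in>A n. g n \<in> D0 \<and> norm (\<psi> (g n) - h n *\<^sub>R x) \<le> \<epsilon> * h n"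
  proof eventually_elim
    case (elim n)
    have "\<psi> (g n) - h n *\<^sub>R x = h n *\<^sub>R (\<psi> (g n) /\<^sub>R h n - x)" using elim(1) by (simp add: scaleR_diff_right)
    then show ?case using elim by (simp add: dist_norm)
  qed
qed

text \<open>The one-element index type \<open>unit\<close> specialises \<open>tang\<close> to a
  single family. Together with \<open>tangI_lim\<close> this identifies it with convergence of
  difference quotients.\<close>

lemma tang_lim:
  assumes h: "\<forall>\<^sub>F n in F. h n > 0" and g: "tang F (\<lambda>_. UNIV :: unit set) h (\<lambda>n _. g n) (\<lambda>n _. y n)" and y: "(y \<longlongrightarrow> x) F"
  shows "\<forall>\<^sub>F n in F. g n \<in> D0" "((\<lambda>n. \<psi> (g n) /\<^sub>R h n) \<longlongrightarrow> x) F"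
proof -
  show "\<forall>\<^sub>F n in F. g n \<in> D0" using tangD[OF g zero_less_one] by (auto elim: eventually_mono)
  have "((\<lambda>n. \<psi> (g n) /\<^sub>R h n - y n) \<longlongrightarrow> 0) F"
  proof (rule tendstoI)
    fix r :: real assume "r > 0"
    then have "r / 2 > 0" by simp
    from tangD[OF g this] h show "\<forall>\<^sub>F n in F. dist (\<psi> (g n) /\<^sub>R h n - y n) 0 < r"
    proof eventually_elim
      case (elim n)
      have "\<psi> (g n) - h n *\<^sub>R y n = h n *\<^sub>R (\<psi> (g n) /\<^sub>R h n - y n)" using elim(2) by (simp add: scaleR_diff_right)
      then have "norm (\<psi> (g n) /\<^sub>R h n - y n) \<le> r / 2" using elim by simp
      then show ?case using \<open>r > 0\<close> by simp
    qed
  qed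
  from tendsto_add[OF this y] show "((\<lambda>n. \<psi> (g n) /\<^sub>R h n) \<longlongrightarrow> x) F" by simp
qed

lemma tang_small:
  assumes f: "tang F A h f x" and h: "(h \<longlongrightarrow> 0) F" "\<forall>\<^sub>F n in F. h n > 0" and x: "\<And>n i. norm (x n i) \<le> C" and d: "\<delta> > 0"
  shows "\<forall>\<^sub>F n in F. \<forall>i\<in>A n. f n i \<in> D0 \<and> norm (\<psi> (f n i)) < \<delta>"
proof -
  have "((\<lambda>n. h n * (C + 1)) \<longlongrightarrow> 0 * (C + 1)) F" by (intro tendsto_intros h)
  then have "\<forall>\<^sub>F n in F. h n * (C + 1) < \<delta>" using order_tendstoD(2) d by fastforce
  with tangD[OF f zero_less_one] h(2) show ?thesis
  proof eventually_elim
    case (elim n)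
    have "f n i \<in> D0 \<and> norm (\<psi> (f n i)) < \<delta>" if "i \<in> A n" for i
    proof -
      have fi: "f n i \<in> D0" "norm (\<psi> (f n i) - h n *\<^sub>R x n i) \<le> h n" using elim(1) that by auto
      have "norm (h n *\<^sub>R x n i) \<le> h n * C" using elim(2) x by (simp add: mult_left_mono)
      then show ?thesis using fi elim(3) norm_triangle_sub[of "\<psi> (f n i)" "h n *\<^sub>R x n i"] by (simp add: distrib_left)
    qed
    then show ?case by blast
  qed
qed

text \<open>To first order the product is addition. The common bound \<open>C\<close> on the
  velocities makes the estimate uniform in \<open>i\<close>.\<close>

lemma tang_mult:
  assumes f: "tang F A h f x" and g: "tang F A h g y" and h: "(h \<longlongrightarrow> 0) F" "\<forall>\<^sub>F n in F. h n > 0"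
    and x: "\<And>n i. norm (x n i) \<le> C" and y: "\<And>n i. norm (y n i) \<le> C"
  shows "tang F A h (\<lambda>n i. f n i \<otimes> g n i) (\<lambda>n i. x n i + y n i)"
  unfolding tang_def
proof (intro allI impI)
  fix \<epsilon> :: real assume e: "\<epsilon> > 0"
  have C: "C \<ge> 0" using x order_trans[OF norm_ge_zero] by blast
  \<comment> \<open>Two tangency errors \<open>r * h n\<close> and one multiplication error
    \<open>r * (C + 1) * h n\<close> add up to \<open>r * (C + 3) * h n\<close>.\<close>
  define r where "r = min 1 (\<epsilon> / (C + 3))"
  have r: "r > 0" "r \<le> 1" unfolding r_def using e C by auto
  have "r * (C + 3) \<le> \<epsilon> / (C + 3) * (C + 3)" unfolding r_def using C by (intro mult_right_mono) auto
  then have r3: "r * (C + 3) \<le> \<epsilon>" using C by simp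
  obtain d where d: "mul_close r d" by (rule mul_close_exists[OF r(1)])
  have d0: "d > 0" by (rule mul_closeD(1)[OF d])
  show "\<forall>\<^sub>F n in F. \<forall>i\<in>A n. f n i \<otimes> g n i \<in> D0 \<and> norm (\<psi> (f n i \<otimes> g n i) - h n *\<^sub>R (x n i + y n i)) \<le> \<epsilon> * h n"
    using tang_small[OF f h x d0] tang_small[OF g h y d0] tangD[OF f r(1)] tangD[OF g r(1)] h(2)
  proof eventually_elim
    case (elim n)
    have "f n i \<otimes> g n i \<in> D0 \<and> norm (\<psi> (f n i \<otimes> g n i) - h n *\<^sub>R (x n i + y n i)) \<le> \<epsilon> * h n" if i: "i \<in> A n" for i
    proof -
      let ?a = "\<psi> (f n i \<otimes> g n i) - \<psi> (f n i) - \<psi> (g n i)" and ?b = "\<psi> (f n i) - h n *\<^sub>R x n i" and ?c = "\<psi> (g n i) - h n *\<^sub>R y n i"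
      have fg: "f n i \<in> D0" "norm (\<psi> (f n i)) < d" "g n i \<in> D0" "norm (\<psi> (g n i)) < d"
        and bc: "norm ?b \<le> r * h n" "norm ?c \<le> r * h n" using elim i by auto
      have "norm (h n *\<^sub>R y n i) \<le> h n * C" using elim(5) y by (simp add: mult_left_mono)
      moreover have "r * h n \<le> 1 * h n" using r elim(5) by (intro mult_right_mono) auto
      ultimately have "norm (\<psi> (g n i)) \<le> h n * (C + 1)"
        using bc(2) norm_triangle_sub[of "\<psi> (g n i)" "h n *\<^sub>R y n i"] by (simp add: distrib_left)
      then have "r * norm (\<psi> (g n i)) \<le> r * (h n * (C + 1))" using r(1) by (intro mult_left_mono) auto
      then have a: "norm ?a \<le> r * (h n * (C + 1))" using mul_close_right(1)[OF d fg(2,4)] fg by simp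
      have "norm (?a + (?b + ?c)) \<le> norm ?a + (norm ?b + norm ?c)"
        using norm_triangle_ineq[of ?a "?b + ?c"] norm_triangle_ineq[of ?b ?c] by linarith
      also have "\<dots> \<le> r * (C + 3) * h n" using a bc by (simp add: algebra_simps)
      also have "\<dots> \<le> \<epsilon> * h n" using r3 elim(5) by (intro mult_right_mono) auto
      also have "?a + (?b + ?c) = \<psi> (f n i \<otimes> g n i) - h n *\<^sub>R (x n i + y n i)" by (simp add: scaleR_add_right)
      finally show ?thesis using mul_closeD(3)[OF d fg(2,4)] fg by simp
    qed
    then show ?case by blast
  qed
qed

lemma ops_tang:
  assumes ops: "ops \<xi> \<gamma>" and h: "(h \<longlongrightarrow> 0) F" "\<forall>\<^sub>F n in F. h n > 0" and r: "\<bar>r\<bar> \<le> 1"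
  shows "tang F A h (\<lambda>n _. \<gamma> (r * h n)) (\<lambda>_ _. r *\<^sub>R \<xi>)"
  unfolding tang_def
proof (intro allI impI)
  fix \<epsilon> :: real assume e: "\<epsilon> > 0"
  obtain t1 where t1: "t1 > 0" "\<And>t. \<bar>t\<bar> < t1 ==> norm (\<psi> (\<gamma> t) - t *\<^sub>R \<xi>) \<le> \<epsilon> * \<bar>t\<bar>" by (rule ops_deriv[OF ops e]) (rule that; blast)
  obtain t2 where t2: "t2 > 0" "\<And>t. \<bar>t\<bar> < t2 ==> \<gamma> t \<in> D0 \<and> norm (\<psi> (\<gamma> t)) < 1" by (rule ops_near[OF ops zero_less_one]) (rule that; blast)
  have "\<forall>\<^sub>F n in F. h n < min t1 t2" using t1(1) t2(1) by (intro order_tendstoD(2)[OF h(1)]) simp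
  with h(2) show "\<forall>\<^sub>F n in F. \<forall>i\<in>A n. \<gamma> (r * h n) \<in> D0 \<and> norm (\<psi> (\<gamma> (r * h n)) - h n *\<^sub>R r *\<^sub>R \<xi>) \<le> \<epsilon> * h n"
  proof eventually_elim
    case (elim n)
    have rh: "\<bar>r * h n\<bar> \<le> h n" using r elim(1) by (simp add: abs_mult mult_left_le_one_le)
    then have "\<epsilon> * \<bar>r * h n\<bar> \<le> \<epsilon> * h n" using e by (intro mult_left_mono) auto
    moreover have "\<bar>r * h n\<bar> < t1" "\<bar>r * h n\<bar> < t2" using rh elim(2) by auto
    ultimately show ?case using t1(2)[of "r * h n"] t2(2)[of "r * h n"] by (auto simp: mult.commute)
  qed
qed

text \<open>Each perturbation \<open>e i\<close> is pulled to the left through the partial product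
  ending with \<open>a i\<close>, which replaces it by a conjugate; all perturbations end up in
  front of the unperturbed product.\<close>

lemma gprod_compare:
  assumes "\<And>i. i < n ==> a i \<in> carrier L" "\<And>i. i < n ==> e i \<in> carrier L"
  shows "gprod (\<lambda>i. a i \<otimes> e i) n = gprod (\<lambda>i. gprod a (Suc i) \<otimes> e i \<otimes> inv (gprod a (Suc i))) n \<otimes> gprod a n"
  using assms
proof (induction n)
  case 0
  then show ?case by simp
next
  case (Suc n)
  let ?X = "gprod (\<lambda>i. gprod a (Suc i) \<otimes> e i \<otimes> inv (gprod a (Suc i))) n"
  have cA: "gprod a n \<in> carrier L" "a n \<in> carrier L" "e n \<in> carrier L" using Suc.prems by (auto intro!: gprod_closed)
  have cX: "?X \<in> carrier L"
  proof (rule gprod_closed)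
    fix i assume "i < n"
    then have "gprod a (Suc i) \<in> carrier L" "e i \<in> carrier L" using Suc.prems by (auto intro!: gprod_closed)
    then show "gprod a (Suc i) \<otimes> e i \<otimes> inv (gprod a (Suc i)) \<in> carrier L" by simp
  qed
  define B where "B = gprod a (Suc n)"
  have B: "B \<in> carrier L" "gprod a n \<otimes> a n = B" using cA unfolding B_def by auto
  have "gprod (\<lambda>i. a i \<otimes> e i) (Suc n) = ?X \<otimes> gprod a n \<otimes> (a n \<otimes> e n)"
    using Suc by simp
  also have "\<dots> = ?X \<otimes> ((gprod a n \<otimes> a n) \<otimes> e n)"
    using cA cX by (simp add: m_assoc)
  also have "\<dots> = ?X \<otimes> (B \<otimes> e n \<otimes> inv B) \<otimes> B"
    unfolding B(2) using cA cX B(1) by (simp add: m_assoc)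
  also have "\<dots> = ?X \<otimes> (gprod a (Suc n) \<otimes> e n \<otimes> inv (gprod a (Suc n))) \<otimes> gprod a (Suc n)"
    unfolding B_def ..
  finally show ?case by simp
qed

text \<open>Conjugation by a partial product near the identity at most doubles \<open>e i\<close>,
  and the coordinate of the product of the conjugates is at most twice the sum of their norms,
  whence the factor 4.\<close>

lemma gprod_near:
  obtains \<delta> where "\<delta> > 0" "\<forall>n a e. (\<forall>i<n. a i \<in> carrier L \<and> e i \<in> D0 \<and> gprod a (Suc i) \<in> D0 \<and> norm (\<psi> (gprod a (Suc i))) < \<delta>)
     --> (\<Sum>i<n. norm (\<psi> (e i))) < \<delta>
     --> gprod (\<lambda>i. a i \<otimes> e i) n \<otimes> inv (gprod a n) \<in> D0 \<and>
        norm (\<psi> (gprod (\<lambda>i. a i \<otimes> e i) n \<otimes> inv (gprod a n))) \<le> 4 * (\<Sum>i<n. norm (\<psi> (e i)))"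
proof -
  obtain d1 where d1: "d1 > 0" "\<And>a x. norm a < d1 ==> norm x < d1 ==> a \<in> E0 \<and> x \<in> E0 \<and>
     \<sigma> a \<otimes> \<sigma> x \<otimes> inv (\<sigma> a) \<in> D0 \<and> norm (\<psi> (\<sigma> a \<otimes> \<sigma> x \<otimes> inv (\<sigma> a)) - x) \<le> 1 * norm x"
    using conj_close[of 1] by auto
  obtain d2 where d2: "d2 > 0" "\<And>w n. (\<Sum>i<n. norm (w i)) < d2 ==>
     (\<forall>i<n. w i \<in> E0) \<and> gprod (\<lambda>i. \<sigma> (w i)) n \<in> D0 \<and>
     norm (\<psi> (gprod (\<lambda>i. \<sigma> (w i)) n) - (\<Sum>i<n. w i)) \<le> 1 * (\<Sum>i<n. norm (w i))"
    using telescope[of 1] by auto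
  show ?thesis
  \<comment> \<open>The conjugates may have twice the total length of the \<open>e i\<close>, so
    \<open>d2\<close> is halved.\<close>
  proof (rule that[of "min d1 (d2/2)"], use d1(1) d2(1) in simp, intro allI impI)
    fix n a e
    assume h': "\<forall>i<n. a i \<in> carrier L \<and> e i \<in> D0 \<and> gprod a (Suc i) \<in> D0 \<and> norm (\<psi> (gprod a (Suc i))) < min d1 (d2/2)"
      and s: "(\<Sum>i<n. norm (\<psi> (e i))) < min d1 (d2/2)"
    have h: "\<And>i. i < n ==> a i \<in> carrier L \<and> e i \<in> D0 \<and> gprod a (Suc i) \<in> D0 \<and> norm (\<psi> (gprod a (Suc i))) < min d1 (d2/2)"
      using h' by blast
    define c where "c i = gprod a (Suc i) \<otimes> e i \<otimes> inv (gprod a (Suc i))" for i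
    define w where "w i = \<psi> (c i)" for i
    have cw: "c i \<in> D0 \<and> norm (w i) \<le> 2 * norm (\<psi> (e i))" if i: "i < n" for i
    proof -
      have "norm (\<psi> (e i)) \<le> (\<Sum>i<n. norm (\<psi> (e i)))" using i by (intro member_le_sum) auto
      then have ne: "norm (\<psi> (e i)) < d1" using s by simp
      have "norm (\<psi> (gprod a (Suc i))) < d1" using h[OF i] by simp
      from d1(2)[OF this ne] h[OF i] have "c i \<in> D0" "norm (w i - \<psi> (e i)) \<le> norm (\<psi> (e i))"
        unfolding w_def c_def by (simp_all del: gprod.simps)
      then show ?thesis using norm_triangle_ineq[of "w i - \<psi> (e i)" "\<psi> (e i)"] by simp
    qed
    have "(\<Sum>i<n. norm (w i)) \<le> (\<Sum>i<n. 2 * norm (\<psi> (e i)))" using cw by (intro sum_mono) auto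
    then have sw: "(\<Sum>i<n. norm (w i)) \<le> 2 * (\<Sum>i<n. norm (\<psi> (e i)))" by (simp add: sum_distrib_left)
    then have "(\<Sum>i<n. norm (w i)) < d2" using s by simp
    note t = d2(2)[OF this]
    have gc: "gprod (\<lambda>i. \<sigma> (w i)) n = gprod c n" using cw unfolding w_def by (intro gprod_cong) simp
    have "gprod (\<lambda>i. a i \<otimes> e i) n = gprod c n \<otimes> gprod a n"
      unfolding c_def using h D0_carrier by (intro gprod_compare) auto
    moreover have "gprod a n \<in> carrier L" "gprod c n \<in> carrier L" using h cw D0_carrier by (auto intro!: gprod_closed)
    ultimately have eq: "gprod (\<lambda>i. a i \<otimes> e i) n \<otimes> inv (gprod a n) = gprod c n" by (simp add: m_assoc)
    have "norm (\<psi> (gprod c n)) \<le> norm (\<Sum>i<n. w i) + (\<Sum>i<n. norm (w i))"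
      using t gc norm_triangle_ineq[of "\<psi> (gprod c n) - (\<Sum>i<n. w i)" "\<Sum>i<n. w i"] by simp
    also have "\<dots> \<le> 4 * (\<Sum>i<n. norm (\<psi> (e i)))" using norm_sum[of w "{..<n}"] sw by simp
    finally show "gprod (\<lambda>i. a i \<otimes> e i) n \<otimes> inv (gprod a n) \<in> D0 \<and>
        norm (\<psi> (gprod (\<lambda>i. a i \<otimes> e i) n \<otimes> inv (gprod a n))) \<le> 4 * (\<Sum>i<n. norm (\<psi> (e i)))"
      using t gc eq by simp
  qed
qed

text \<open>Each factor is \<open>\<gamma> (h n)\<close> times an error of velocity 0; about
  \<open>t / h n\<close> errors, each small compared with \<open>h n\<close>, disappear in the
  limit. Smallness of \<open>t\<close> keeps the powers of \<open>\<gamma> (h n)\<close> near the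
  identity, as \<open>gprod_near\<close> requires.\<close>

lemma product_limit_small:
  assumes ops: "ops \<xi> \<gamma>"
  obtains \<tau> where "\<tau> > 0"
    "\<forall>t h N f. 0 \<le> t --> t \<le> \<tau> --> (\<forall>n. h n > 0) --> h \<longlonglongrightarrow> 0 --> (\<lambda>n. real (N n) * h n) \<longlonglongrightarrow> t -->
      tang sequentially (\<lambda>n. {..<N n}) h f (\<lambda>_ _. \<xi>) --> limL (\<lambda>n. gprod (f n) (N n)) (\<gamma> t) sequentially"
proof -
  obtain d where d: "d > 0" "\<forall>n a e. (\<forall>i<n. a i \<in> carrier L \<and> e i \<in> D0 \<and> gprod a (Suc i) \<in> D0 \<and> norm (\<psi> (gprod a (Suc i))) < d)
     --> (\<Sum>i<n. norm (\<psi> (e i))) < d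
     --> gprod (\<lambda>i. a i \<otimes> e i) n \<otimes> inv (gprod a n) \<in> D0 \<and>
        norm (\<psi> (gprod (\<lambda>i. a i \<otimes> e i) n \<otimes> inv (gprod a n))) \<le> 4 * (\<Sum>i<n. norm (\<psi> (e i)))"
    by (rule gprod_near)
  obtain \<tau>' where \<tau>': "\<tau>' > 0" "\<And>t. \<bar>t\<bar> < \<tau>' ==> \<gamma> t \<in> D0 \<and> norm (\<psi> (\<gamma> t)) < d" by (rule ops_near[OF ops d(1)]) (rule that; blast)
  define \<tau> where "\<tau> = \<tau>'/2"
  show ?thesis
  proof (rule that[of \<tau>], use \<tau>' \<tau>_def in simp, intro allI impI)
    fix t h N f
    assume t: "0 \<le> t" "t \<le> \<tau>" and h': "\<forall>n::nat. h n > (0::real)" "h \<longlonglongrightarrow> 0" and Nh: "(\<lambda>n. real (N n) * h n) \<longlonglongrightarrow> t"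
      and f: "tang sequentially (\<lambda>n. {..<N n}) h f (\<lambda>_ _. \<xi>)"
    have h: "\<And>n::nat. h n > (0::real)" "h \<longlonglongrightarrow> 0" using h' by auto
    \<comment> \<open>The discrepancy between the given factor and \<open>\<gamma> (h n)\<close>;
      the velocities \<open>- \<xi>\<close> and \<open>\<xi>\<close> cancel.\<close>
    define e where "e n i = \<gamma> (- 1 * h n) \<otimes> f n i" for n i
    have "tang sequentially (\<lambda>n. {..<N n}) h (\<lambda>n i. \<gamma> (- 1 * h n) \<otimes> f n i) (\<lambda>n i. - 1 *\<^sub>R \<xi> + \<xi>)"
      by (rule tang_mult[OF ops_tang[OF ops h(2)] f h(2), of _ "norm \<xi>"]) (use h(1) in simp_all)
    then have et: "tang sequentially (\<lambda>n. {..<N n}) h e (\<lambda>_ _. 0)" unfolding e_def by simp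
    have e_small: "\<forall>\<^sub>F n in sequentially. \<forall>i<N n. e n i \<in> D0 \<and> norm (\<psi> (e n i)) \<le> \<eta> * h n" if "\<eta> > 0" for \<eta>
      using tangD[OF et that] by (simp add: Ball_def)
    define X where "X n = gprod (f n) (N n) \<otimes> inv (\<gamma> (real (N n) * h n))" for n
    have X_small: "\<forall>\<^sub>F n in sequentially. (\<forall>i<N n. f n i \<in> carrier L) \<and> X n \<in> D0 \<and> norm (\<psi> (X n)) \<le> \<eta>" if \<eta>: "\<eta> > 0" for \<eta>
    proof -
      \<comment> \<open>The errors have total length at most \<open>\<eta>'\<close> times
        \<open>real (N n) * h n\<close>, which is eventually below \<open>\<tau>'\<close>. The part
        \<open>\<eta>/4\<close> pays for the factor 4 of \<open>gprod_near\<close>, the part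
        \<open>d/2\<close> for its hypothesis.\<close>
      define \<eta>' where "\<eta>' = min (\<eta>/4) (d/2) / (\<tau>' + 1)"
      have \<eta>': "\<eta>' > 0" using \<eta> d(1) \<tau>'(1) unfolding \<eta>'_def by simp
      have "\<forall>\<^sub>F n in sequentially. real (N n) * h n < \<tau>'"
        using Nh t \<tau>'(1) unfolding \<tau>_def by (intro order_tendstoD(2)[OF Nh]) simp
      with e_small[OF \<eta>'] tangD[OF f zero_less_one] show ?thesis
      proof eventually_elim
        case (elim n)
        have hn: "h n > 0" by (rule h)
        have S: "(\<Sum>i<N n. norm (\<psi> (e n i))) \<le> real (N n) * (\<eta>' * h n)"
          using sum_bounded_above[of "{..<N n}" "\<lambda>i. norm (\<psi> (e n i))" "\<eta>' * h n"] elim(1) by simp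
        also have "\<dots> = \<eta>' * (real (N n) * h n)" by simp
        also have "\<dots> \<le> \<eta>' * (\<tau>' + 1)" using elim(3) \<eta>' by (intro mult_left_mono) auto
        also have "\<dots> = min (\<eta>/4) (d/2)" using \<tau>'(1) unfolding \<eta>'_def by simp
        finally have S: "(\<Sum>i<N n. norm (\<psi> (e n i))) \<le> min (\<eta>/4) (d/2)" .
        have car: "f n i \<in> carrier L" if "i < N n" for i using elim(2) that D0_carrier by blast
        have fe: "gprod (f n) (N n) = gprod (\<lambda>i. \<gamma> (h n) \<otimes> e n i) (N n)"
          by (rule gprod_cong) (use car opsD(3,4)[OF ops] in \<open>simp add: e_def m_assoc[symmetric]\<close>)
        have "gprod (\<lambda>i. \<gamma> (h n) \<otimes> e n i) (N n) \<otimes> inv (gprod (\<lambda>_. \<gamma> (h n)) (N n)) \<in> D0 \<and>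
          norm (\<psi> (gprod (\<lambda>i. \<gamma> (h n) \<otimes> e n i) (N n) \<otimes> inv (gprod (\<lambda>_. \<gamma> (h n)) (N n)))) \<le> 4 * (\<Sum>i<N n. norm (\<psi> (e n i)))"
        proof (rule d(2)[rule_format])
          fix i assume i: "i < N n"
          have "real (Suc i) * h n \<le> real (N n) * h n" using i hn by (intro mult_right_mono) auto
          then have "real (Suc i) * h n < \<tau>'" "0 \<le> real (Suc i) * h n" using elim(3) hn by (linarith, simp)
          then have "\<bar>real (Suc i) * h n\<bar> < \<tau>'" by linarith
          then show "\<gamma> (h n) \<in> carrier L \<and> e n i \<in> D0 \<and> gprod (\<lambda>_. \<gamma> (h n)) (Suc i) \<in> D0 \<and> norm (\<psi> (gprod (\<lambda>_. \<gamma> (h n)) (Suc i))) < d"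
            using elim(1) i opsD(3)[OF ops] \<tau>'(2) unfolding ops_gprod[OF ops] by blast
        next
          show "(\<Sum>i<N n. norm (\<psi> (e n i))) < d" using S d(1) by simp
        qed
        then show ?case using S car unfolding X_def fe ops_gprod[OF ops] by auto
      qed
    qed
    have "limL X \<one> sequentially"
      unfolding limitin_one
    proof
      show "\<forall>\<^sub>F n in sequentially. X n \<in> D0" using X_small[OF zero_less_one] by (auto elim: eventually_mono)
      show "(\<lambda>n. \<psi> (X n)) \<longlonglongrightarrow> 0"
      proof (rule tendstoI)
        fix r :: real assume "r > 0"
        then have "r/2 > 0" by simp
        from X_small[OF this] show "\<forall>\<^sub>F n in sequentially. dist (\<psi> (X n)) 0 < r"
          by eventually_elim (use \<open>r > 0\<close> in auto)
      qed
    qed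
    from limitin_mult[OF this opsD(5)[OF ops Nh]]
    have "limL (\<lambda>n. X n \<otimes> \<gamma> (real (N n) * h n)) (\<gamma> t) sequentially" using opsD(3)[OF ops] by simp
    then show "limL (\<lambda>n. gprod (f n) (N n)) (\<gamma> t) sequentially"
    proof (rule limitin_transform_eventually[rotated])
      show "\<forall>\<^sub>F n in sequentially. X n \<otimes> \<gamma> (real (N n) * h n) = gprod (f n) (N n)"
        using X_small[OF zero_less_one]
      proof eventually_elim
        case (elim n)
        have "gprod (f n) (N n) \<in> carrier L" using elim by (intro gprod_closed) auto
        then show ?case unfolding X_def using opsD(3)[OF ops] by (simp add: m_assoc)
      qed
    qed
  qed
qed

lemma floor_multiple_limit:
  assumes h: "\<And>n. h n > (0::real)" "h \<longlonglongrightarrow> 0" and t: "t \<ge> 0"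
  shows "(\<lambda>n. real (nat \<lfloor>t / h n\<rfloor>) * h n) \<longlonglongrightarrow> t"
proof (rule tendsto_sandwich[of "\<lambda>n. t - h n" _ _ "\<lambda>_. t"])
  have b: "(t / h n - 1) * h n \<le> real (nat \<lfloor>t / h n\<rfloor>) * h n \<and> real (nat \<lfloor>t / h n\<rfloor>) * h n \<le> t / h n * h n" for n
    using h(1)[of n] divide_nonneg_pos[OF t h(1)[of n]] by (intro conjI mult_right_mono) linarith+
  have "t - h n \<le> real (nat \<lfloor>t / h n\<rfloor>) * h n \<and> real (nat \<lfloor>t / h n\<rfloor>) * h n \<le> t" for n
    using b[of n] h(1)[of n] by (simp add: left_diff_distrib)
  then show "\<forall>\<^sub>F n in sequentially. t - h n \<le> real (nat \<lfloor>t / h n\<rfloor>) * h n"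
    "\<forall>\<^sub>F n in sequentially. real (nat \<lfloor>t / h n\<rfloor>) * h n \<le> t" by simp_all
  show "(\<lambda>n. t - h n) \<longlonglongrightarrow> t" using tendsto_diff[OF tendsto_const h(2)] by simp
qed simp

lemma gprod_add:
  "(\<And>i. i < m + n ==> f i \<in> carrier L) ==> gprod f (m + n) = gprod f m \<otimes> gprod (\<lambda>i. f (m + i)) n"
proof (induction n)
  case (Suc n)
  have "gprod f m \<in> carrier L" "gprod (\<lambda>i. f (m + i)) n \<in> carrier L" using Suc.prems by (auto intro!: gprod_closed)
  then show ?case using Suc by (simp add: m_assoc)
next
  case 0
  have "gprod f m \<in> carrier L" using 0 by (auto intro!: gprod_closed)
  then show ?case by simp
qed

text \<open>Induction on the number of pieces of length \<open>\<tau>\<close>. Shifting the index of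
  the factors preserves tangency because it is uniform in \<open>i\<close>.\<close>

lemma product_limit:
  assumes ops: "ops \<xi> \<gamma>" and h: "\<And>n. h n > 0" "h \<longlonglongrightarrow> 0" and t: "t \<ge> 0"
    and N: "(\<lambda>n. real (N n) * h n) \<longlonglongrightarrow> t" and f: "tang sequentially (\<lambda>n. {..<N n}) h f (\<lambda>_ _. \<xi>)"
  shows "limL (\<lambda>n. gprod (f n) (N n)) (\<gamma> t) sequentially"
proof -
  obtain \<tau> where \<tau>: "\<tau> > 0"
    "\<forall>t h N f. 0 \<le> t --> t \<le> \<tau> --> (\<forall>n. h n > 0) --> h \<longlonglongrightarrow> 0 --> (\<lambda>n. real (N n) * h n) \<longlonglongrightarrow> t -->
      tang sequentially (\<lambda>n. {..<N n}) h f (\<lambda>_ _. \<xi>) --> limL (\<lambda>n. gprod (f n) (N n)) (\<gamma> t) sequentially"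
    by (rule product_limit_small[OF ops])
  obtain M :: nat where "t / \<tau> < real M" using reals_Archimedean2 by blast
  then have "t \<le> real M * \<tau>" using \<tau>(1) by (simp add: field_simps)
  then show ?thesis using t N f
  proof (induction M arbitrary: t N f)
    case 0
    then have "t \<le> \<tau>" using \<tau>(1) by simp
    then show ?case using 0 \<tau>(2) h by blast
  next
    case (Suc M)
    show ?case
    proof (cases "t \<le> \<tau>")
      case True
      then show ?thesis using Suc.prems \<tau> h by blast
    next
      case False
      \<comment> \<open>The number of factors that cover the first piece.\<close>
      define N1 where "N1 n = nat \<lfloor>\<tau> / h n\<rfloor>" for n
      have l1: "(\<lambda>n. real (N1 n) * h n) \<longlonglongrightarrow> \<tau>" unfolding N1_def by (rule floor_multiple_limit[OF h less_imp_le[OF \<tau>(1)]])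
      have l2: "(\<lambda>n. real (N n) * h n - real (N1 n) * h n) \<longlonglongrightarrow> t - \<tau>" by (intro tendsto_diff Suc.prems(3) l1)
      have "\<forall>\<^sub>F n in sequentially. 0 < real (N n) * h n - real (N1 n) * h n" using False by (intro order_tendstoD(1)[OF l2]) simp
      then have ev: "\<forall>\<^sub>F n in sequentially. N1 n \<le> N n"
        by eventually_elim (use h(1) in \<open>simp add: mult_less_cancel_right_pos\<close>)
      have t1: "tang sequentially (\<lambda>n. {..<N1 n}) h f (\<lambda>_ _. \<xi>)"
        unfolding tang_def
      proof (intro allI impI)
        fix \<epsilon> :: real assume "\<epsilon> > 0"
        from tangD[OF Suc.prems(4) this] ev
        show "\<forall>\<^sub>F n in sequentially. \<forall>i\<in>{..<N1 n}. f n i \<in> D0 \<and> norm (\<psi> (f n i) - h n *\<^sub>R \<xi>) \<le> \<epsilon> * h n"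
          by eventually_elim auto
      qed
      have t2: "tang sequentially (\<lambda>n. {..<N n - N1 n}) h (\<lambda>n i. f n (N1 n + i)) (\<lambda>_ _. \<xi>)"
        using Suc.prems(4) unfolding tang_def by (fastforce elim: eventually_mono)
      have "(\<lambda>n. real (N n - N1 n) * h n) \<longlonglongrightarrow> t - \<tau>"
        using l2 by (rule Lim_transform_eventually) (use ev in eventually_elim, simp add: of_nat_diff left_diff_distrib)
      from limitin_mult[OF \<tau>(2)[rule_format, OF _ _ h l1 t1] Suc.IH[OF _ _ this t2]] False Suc.prems(1) \<tau>(1)
      have "limL (\<lambda>n. gprod (f n) (N1 n) \<otimes> gprod (\<lambda>i. f n (N1 n + i)) (N n - N1 n)) (\<gamma> t) sequentially"
        using opsD(1)[OF ops, of \<tau> "t - \<tau>"] by (simp add: algebra_simps)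
      then show ?thesis
      proof (rule limitin_transform_eventually[rotated])
        show "\<forall>\<^sub>F n in sequentially. gprod (f n) (N1 n) \<otimes> gprod (\<lambda>i. f n (N1 n + i)) (N n - N1 n) = gprod (f n) (N n)"
          using ev tangD[OF Suc.prems(4) zero_less_one]
        proof eventually_elim
          case (elim n)
          show ?case using gprod_add[of "N1 n" "N n - N1 n" "f n"] elim D0_carrier by auto
        qed
      qed
    qed
  qed
qed

text \<open>The product formula with the factors \<open>\<gamma>2 (h n)\<close>: their product is
  \<open>\<gamma>2 t\<close> exactly, while the limit is \<open>\<gamma>1 t\<close>.\<close>

lemma ops_unique:
  assumes 1: "ops \<xi> \<gamma>1" and 2: "ops \<xi> \<gamma>2"
  shows "\<gamma>1 = \<gamma>2"
proof -
  have pos: "\<gamma>1 t = \<gamma>2 t" if t: "t > 0" for t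
  proof -
    define h where "h n = t / real (Suc n)" for n
    have h: "\<And>n. h n > 0" "h \<longlonglongrightarrow> 0" using t LIMSEQ_Suc[OF lim_const_over_n[of t]] unfolding h_def by simp_all
    have "limL (\<lambda>n. gprod (\<lambda>_. \<gamma>2 (h n)) (Suc n)) (\<gamma>1 t) sequentially"
    proof (rule product_limit[OF 1 h less_imp_le[OF t]])
      show "(\<lambda>n. real (Suc n) * h n) \<longlonglongrightarrow> t" unfolding h_def by simp
      show "tang sequentially (\<lambda>n. {..<Suc n}) h (\<lambda>n _. \<gamma>2 (h n)) (\<lambda>_ _. \<xi>)"
        using ops_tang[OF 2 h(2), of 1] h(1) by simp
    qed
    moreover have "gprod (\<lambda>_. \<gamma>2 (h n)) (Suc n) = \<gamma>2 t" for n
      unfolding ops_gprod[OF 2] h_def by simp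
    ultimately have "limL (\<lambda>n. \<gamma>2 t) (\<gamma>1 t) sequentially" by simp
    from limitin_unique_L[OF this limitin_constL[OF opsD(3)[OF 2]]] show ?thesis by simp
  qed
  show ?thesis
  proof
    fix t :: real
    consider "t > 0" | "t = 0" | "- t > 0" by linarith
    then show "\<gamma>1 t = \<gamma>2 t"
      using pos opsD(2)[OF 1] opsD(2)[OF 2] opsD(4)[OF 1, of "-t"] opsD(4)[OF 2, of "-t"] by cases auto
  qed
qed

end

lemma continuous_map_top_of_setI:
  assumes "\<And>x. x \<in> S ==> limitin T f (f x) (at x within S)"
  shows "continuous_map (top_of_set S) T f"
  unfolding continuous_map_atin
proof
  fix x assume "x \<in> topspace (top_of_set S)"
  then have x: "x \<in> S" by simp
  show "limitin T f (f x) (atin (top_of_set S) x)"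
    unfolding limitin_def
  proof (intro conjI allI impI)
    show "f x \<in> topspace T" using assms[OF x] by (rule limitin_topspace)
    fix U assume U: "openin T U \<and> f x \<in> U"
    then have "\<forall>\<^sub>F y in at x within S. f y \<in> U" using assms[OF x] unfolding limitin_def by blast
    then obtain A where A: "open A" "x \<in> A" "\<forall>y\<in>A. y \<noteq> x --> y \<in> S --> f y \<in> U"
      unfolding eventually_at_topological by blast
    show "\<forall>\<^sub>F y in atin (top_of_set S) x. f y \<in> U"
      unfolding eventually_atin using A x by (intro disjI2 exI[of _ "S \<inter> A"]) (auto simp: openin_open)
  qed
qed

lemma has_vector_derivative_quotient:
  fixes f :: "real => 'a::real_normed_vector"
  shows "(f has_vector_derivative f') (at 0) \<longleftrightarrow> ((\<lambda>h. (f h - f 0) /\<^sub>R h) \<longlongrightarrow> f') (at 0)"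
proof -
  have "((\<lambda>h. (f h - f 0) /\<^sub>R h) \<longlongrightarrow> f') (at 0) \<longleftrightarrow> ((\<lambda>h. norm ((f h - f 0) /\<^sub>R h - f')) \<longlongrightarrow> 0) (at 0)"
    using tendsto_norm_zero_iff[of "\<lambda>h. (f h - f 0) /\<^sub>R h - f'" "at 0"] Lim_null[of "\<lambda>h. (f h - f 0) /\<^sub>R h" f' "at 0"] by simp
  also have "\<dots> \<longleftrightarrow> ((\<lambda>h. norm (f (0 + h) - f 0 - h *\<^sub>R f') / norm h) \<longlongrightarrow> 0) (at 0)"
  proof (rule filterlim_cong[OF refl refl])
    show "\<forall>\<^sub>F h in at 0. norm ((f h - f 0) /\<^sub>R h - f') = norm (f (0 + h) - f 0 - h *\<^sub>R f') / norm h"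
      unfolding eventually_at_filter
    proof (intro always_eventually allI impI)
      fix h :: real assume "h \<noteq> 0"
      then have "(f h - f 0) /\<^sub>R h - f' = (f h - f 0 - h *\<^sub>R f') /\<^sub>R h" by (simp add: scaleR_diff_right)
      then show "norm ((f h - f 0) /\<^sub>R h - f') = norm (f (0 + h) - f 0 - h *\<^sub>R f') / norm h"
        by (simp add: divide_inverse mult.commute)
    qed
  qed
  also have "\<dots> \<longleftrightarrow> (f has_vector_derivative f') (at 0)"
    unfolding has_vector_derivative_def has_derivative_at using bounded_linear_scaleR_left[of f'] by simp
  finally show ?thesis by simp
qed

section \<open>Existence of one-parameter subgroups\<close>

context complex_lie_gp
begin

lemma E0_cball:
  obtains R where "R > 0" "cball 0 R \<subseteq> E0"
proof -
  obtain R0 where R0: "R0 > 0" "ball 0 R0 \<subseteq> E0" using E0_open zero_E0 open_contains_ball by blast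
  then show ?thesis using that[of "R0 / 2"] by (auto simp: subset_iff)
qed

text \<open>Rounding errors. The floor of a sum differs from the sum of the floors by at most one,
  and the corresponding power of a sequence tending to the identity disappears.\<close>

lemma limitin_bounded_int_pow:
  assumes a: "limL a \<one> H" "\<And>n. a n \<in> carrier L" and r: "\<And>n. r n \<in> {-1, 0, 1::int}"
  shows "limL (\<lambda>n. a n [^] r n) \<one> H"
  unfolding limitin_def
proof (intro conjI allI impI)
  show "\<one> \<in> topspace (ltop L)" using carrier one_closed by simp
  fix U assume U: "openin (ltop L) U \<and> \<one> \<in> U"
  have "limL (\<lambda>n. inv (a n)) \<one> H" using limitin_inv[OF a(1)] by simp
  then have "\<forall>\<^sub>F n in H. inv (a n) \<in> U" using U limitinD by metis
  moreover have "\<forall>\<^sub>F n in H. a n \<in> U" using a(1) U limitinD by metis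
  ultimately show "\<forall>\<^sub>F n in H. a n [^] r n \<in> U"
  proof eventually_elim
    case (elim n)
    have "a n [^] (-1::int) = inv (a n)" using int_pow_neg[OF a(2), of n 1] int_pow_1[OF a(2)] by simp
    then show ?case using r[of n] elim U int_pow_1[OF a(2)] by auto
  qed
qed

lemma tang_inv:
  assumes f: "tang F A h f x" and h: "(h \<longlongrightarrow> 0) F" "\<forall>\<^sub>F n in F. h n > 0" and x: "\<And>n i. norm (x n i) \<le> C"
  shows "tang F A h (\<lambda>n i. inv (f n i)) (\<lambda>n i. - x n i)"
  unfolding tang_def
proof (intro allI impI)
  fix \<epsilon> :: real assume e: "\<epsilon> > 0"
  have C: "C \<ge> 0" using x order_trans[OF norm_ge_zero] by blast
  define r where "r = min 1 (\<epsilon> / (C + 2))"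
  have r: "r > 0" "r \<le> 1" unfolding r_def using e C by auto
  have "r * (C + 2) \<le> \<epsilon> / (C + 2) * (C + 2)" unfolding r_def using C by (intro mult_right_mono) auto
  then have r3: "r * (C + 2) \<le> \<epsilon>" using C by simp
  obtain d where d: "d > 0" "\<And>x. norm x < d ==> x \<in> E0 \<and> inv (\<sigma> x) \<in> D0 \<and> norm (\<psi> (inv (\<sigma> x)) + x) \<le> r * norm x"
    using inv_close[OF r(1)] by blast
  show "\<forall>\<^sub>F n in F. \<forall>i\<in>A n. inv (f n i) \<in> D0 \<and> norm (\<psi> (inv (f n i)) - h n *\<^sub>R - x n i) \<le> \<epsilon> * h n"
    using tang_small[OF f h x d(1)] tangD[OF f r(1)] h(2)
  proof eventually_elim
    case (elim n)
    have "inv (f n i) \<in> D0 \<and> norm (\<psi> (inv (f n i)) - h n *\<^sub>R - x n i) \<le> \<epsilon> * h n" if i: "i \<in> A n" for i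
    proof -
      have fi: "f n i \<in> D0" "norm (\<psi> (f n i)) < d" and b: "norm (\<psi> (f n i) - h n *\<^sub>R x n i) \<le> r * h n" using elim i by auto
      have a: "inv (f n i) \<in> D0" "norm (\<psi> (inv (f n i)) + \<psi> (f n i)) \<le> r * norm (\<psi> (f n i))" using d(2)[OF fi(2)] fi(1) by auto
      have "norm (h n *\<^sub>R x n i) \<le> h n * C" "r * h n \<le> 1 * h n" using elim(3) x r by (simp_all add: mult_left_mono)
      then have "norm (\<psi> (f n i)) \<le> h n * (C + 1)"
        using b norm_triangle_sub[of "\<psi> (f n i)" "h n *\<^sub>R x n i"] by (simp add: distrib_left)
      then have "r * norm (\<psi> (f n i)) \<le> r * (h n * (C + 1))" using r(1) by (intro mult_left_mono) auto
      then have "norm (\<psi> (inv (f n i)) - h n *\<^sub>R - x n i) \<le> r * (h n * (C + 1)) + r * h n"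
        using a(2) b norm_triangle_ineq4[of "\<psi> (inv (f n i)) + \<psi> (f n i)" "\<psi> (f n i) - h n *\<^sub>R x n i"] by simp
      also have "\<dots> = r * (C + 2) * h n" by (simp add: algebra_simps)
      also have "\<dots> \<le> \<epsilon> * h n" using r3 elim(3) by (intro mult_right_mono) auto
      finally show ?thesis using a(1) by blast
    qed
    then show ?case by blast
  qed
qed

text \<open>The polygons give a velocity for positive times only. Inverses supply the derivative
  from the left, and the homomorphism property carries continuity at 0 to every point.\<close>

lemma ops_of_right_tangent:
  fixes \<Gamma> :: "real => 'g"
  assumes add: "\<And>s t. \<Gamma> (s + t) = \<Gamma> s \<otimes> \<Gamma> t" and car: "\<And>t. \<Gamma> t \<in> carrier L"
    and t: "tang (at_right 0) (\<lambda>_. UNIV :: unit set) (\<lambda>s. s) (\<lambda>s _. \<Gamma> s) (\<lambda>_ _. v)"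
  shows "ops v \<Gamma>"
proof -
  have h: "((\<lambda>s::real. s) \<longlongrightarrow> 0) (at_right 0)" "\<forall>\<^sub>F s in at_right (0::real). s > 0"
    by (rule tendsto_ident_at, simp add: eventually_at_right_less)
  have 0: "\<Gamma> 0 = \<one>" using add[of 0 0] car[of 0] by simp
  have neg: "\<Gamma> (- s) = inv (\<Gamma> s)" for s using add[of "- s" s] 0 car inv_equality by (metis add.left_inverse)
  have i: "tang (at_right 0) (\<lambda>_. UNIV :: unit set) (\<lambda>s. s) (\<lambda>s _. \<Gamma> (- s)) (\<lambda>_ _. - v)"
    unfolding neg by (rule tang_inv[OF t h order_refl])
  note r = tang_lim[OF h(2) t tendsto_const] and l = tang_lim[OF h(2) i tendsto_const]
  have "((\<lambda>s. \<psi> (\<Gamma> s) /\<^sub>R s) \<longlongrightarrow> v) (at_left 0)"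
    unfolding filterlim_at_left_to_right using tendsto_minus[OF l(2)] by simp
  then have "((\<lambda>s. \<psi> (\<Gamma> s) /\<^sub>R s) \<longlongrightarrow> v) (at 0)" using r(2) by (rule filterlim_split_at)
  then have D: "((\<lambda>s. \<psi> (\<Gamma> s)) has_vector_derivative v) (at 0)" unfolding has_vector_derivative_quotient using 0 by simp
  have one: "limL \<Gamma> \<one> (at 0)"
    unfolding limitin_one eventually_at_split eventually_at_left_to_right
    using r(1) l(1) has_vector_derivative_continuous[OF D] 0 by (simp add: continuous_within)
  have "limL \<Gamma> (\<Gamma> x) (at x)" for x
  proof -
    have "limL (\<lambda>s. \<Gamma> s \<otimes> \<Gamma> x) (\<one> \<otimes> \<Gamma> x) (at 0)" by (intro limitin_mult one limitin_constL car)
    then have "limL (\<lambda>s. \<Gamma> (s + x)) (\<Gamma> x) (at 0)" using car by (simp add: add)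
    then show ?thesis unfolding limitin_def at_to_0[of x] eventually_filtermap .
  qed
  then have "continuous_map (top_of_set UNIV) (ltop L) \<Gamma>" by (intro continuous_map_top_of_setI) simp
  then show ?thesis
    using add 0 D unfolding one_parameter_subgroup_def \<psi>_def by (simp add: has_vector_derivative_diff_const)
qed

text \<open>The one-parameter subgroup with velocity \<open>v\<close> is a cluster point of the polygons
  \<open>t \<mapsto> \<sigma>(v / n) ^ \<lfloor>t n\<rfloor>\<close>.\<close>

lemma ops_exists: "\<exists>\<gamma>. ops v \<gamma>"
proof -
  \<comment> \<open>The default identity covers the finitely many \<open>n\<close> for which the
    scaled vector lies outside the chart.\<close>
  define a where "a n = (if v /\<^sub>R real (Suc n) \<in> E0 then \<sigma> (v /\<^sub>R real (Suc n)) else \<one>)" for n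
  have ac: "a n \<in> carrier L" for n unfolding a_def using sigma_carrier by auto
  \<comment> \<open>Powers of \<open>a n\<close> follow the segment in direction \<open>v\<close> as
    long as the distance travelled stays below \<open>\<delta>\<close>;
    \<open>real j / real (Suc n)\<close> is the time.\<close>
  have est: "\<exists>\<delta>>0. \<forall>n j. real j / real (Suc n) * norm v < \<delta> --> a n [^] j \<in> D0 \<and>
      norm (\<psi> (a n [^] j) - (real j / real (Suc n)) *\<^sub>R v) \<le> \<epsilon> * (real j / real (Suc n) * norm v)"
    if e: "0 < \<epsilon>" "\<epsilon> \<le> 1" for \<epsilon>
  proof -
    obtain d where d: "d > 0" "\<And>w n. (\<Sum>i<n. norm (w i)) < d ==>
     (\<forall>i<n. w i \<in> E0) \<and> gprod (\<lambda>i. \<sigma> (w i)) n \<in> D0 \<and>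
     norm (\<psi> (gprod (\<lambda>i. \<sigma> (w i)) n) - (\<Sum>i<n. w i)) \<le> \<epsilon> * (\<Sum>i<n. norm (w i))"
      using telescope[OF e] by blast
    show ?thesis
    proof (intro exI[of _ d] conjI allI impI)
      show "d > 0" by fact
      fix n j assume h: "real j / real (Suc n) * norm v < d"
      let ?w = "\<lambda>i::nat. v /\<^sub>R real (Suc n)"
      have S: "(\<Sum>i<j. norm (?w i)) = real j / real (Suc n) * norm v" by (simp add: divide_simps)
      have S': "(\<Sum>i<j. ?w i) = (real j / real (Suc n)) *\<^sub>R v" by (simp add: sum_constant_scaleR divide_inverse)
      have g: "gprod (\<lambda>i. \<sigma> (?w i)) j = a n [^] j"
      proof (cases "j = 0")
        case False
        then have "?w 0 \<in> E0" using d(2)[of ?w j] h S by auto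
        then have "a n = \<sigma> (v /\<^sub>R real (Suc n))" unfolding a_def by simp
        then show ?thesis using gprod_const[OF ac[of n]] by simp
      qed simp
      show "a n [^] j \<in> D0" "norm (\<psi> (a n [^] j) - (real j / real (Suc n)) *\<^sub>R v) \<le> \<epsilon> * (real j / real (Suc n) * norm v)"
        using d(2)[of ?w j] h unfolding S S' g by auto
    qed
  qed
  obtain \<delta> where \<delta>: "\<delta> > 0" "\<And>n j. real j / real (Suc n) * norm v < \<delta> ==> a n [^] j \<in> D0 \<and>
      norm (\<psi> (a n [^] j) - (real j / real (Suc n)) *\<^sub>R v) \<le> 1 * (real j / real (Suc n) * norm v)"
    using est[of 1] by auto
  obtain R where R: "R > 0" "cball 0 R \<subseteq> E0" by (rule E0_cball)
  \<comment> \<open>Up to this time the powers stay within reach of the estimate and in the compact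
    ball; adding 1 avoids division by 0.\<close>
  define \<tau> where "\<tau> = min \<delta> (R / 2) / (norm v + 1)"
  have nv1: "norm v + 1 > 0" using norm_ge_zero[of v] by linarith
  have \<tau>: "\<tau> > 0" unfolding \<tau>_def using \<delta>(1) R(1) nv1 by simp
  have "\<tau> * (norm v + 1) = min \<delta> (R / 2)" unfolding \<tau>_def using nv1 by simp
  then have \<tau>v: "\<tau> * norm v < \<delta>" "\<tau> * norm v < R / 2" using \<tau> by (auto simp: distrib_left)
  have jb: "real (nat \<lfloor>t * real (Suc n)\<rfloor>) / real (Suc n) * norm v \<le> t * norm v" if "0 \<le> t" for t n
    using that by (intro mult_right_mono) (simp_all add: pos_divide_le_eq)
  have jD: "a n [^] nat \<lfloor>t * real (Suc n)\<rfloor> \<in> D0 \<and> norm (\<psi> (a n [^] nat \<lfloor>t * real (Suc n)\<rfloor>)) \<le> R" if t: "0 \<le> t" "t \<le> \<tau>" for t n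
  proof -
    let ?j = "nat \<lfloor>t * real (Suc n)\<rfloor>"
    let ?q = "real ?j / real (Suc n)"
    have b: "?q * norm v \<le> \<tau> * norm v" using jb[OF t(1), of n] mult_right_mono[OF t(2) norm_ge_zero[of v]] by linarith
    then have "?q * norm v < \<delta>" using \<tau>v by linarith
    from \<delta>(2)[OF this] have 1: "a n [^] ?j \<in> D0" "norm (\<psi> (a n [^] ?j) - ?q *\<^sub>R v) \<le> ?q * norm v" by auto
    have "norm (?q *\<^sub>R v) = ?q * norm v" by simp
    then have "norm (\<psi> (a n [^] ?j)) \<le> R"
      using 1(2) b \<tau>v norm_triangle_sub[of "\<psi> (a n [^] ?j)" "?q *\<^sub>R v"] by linarith
    then show ?thesis using 1(1) by blast
  qed
  \<comment> \<open>For other \<open>t\<close> the value 0 merely stays in the compact ball, so that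
    one filter serves all \<open>t\<close>.\<close>
  define Y where "Y n t = (if 0 \<le> t \<and> t \<le> \<tau> then \<psi> (a n [^] nat \<lfloor>t * real (Suc n)\<rfloor>) else 0)" for n t
  have Yb: "Y n t \<in> cball 0 R" for n t using jD R(1) unfolding Y_def by auto
  obtain H c where H: "H \<noteq> bot" "H \<le> sequentially" "\<And>t. c t \<in> cball 0 R" "\<And>t. ((\<lambda>n. Y n t) \<longlongrightarrow> c t) H"
    using compact_cluster_filter[of "cball 0 R" Y, OF finite_dimensional_compact_cball[OF fd] Yb] by blast
  \<comment> \<open>Integer powers give meaning to negative times. Limits for large times are
    obtained as products of limits for small ones.\<close>
  define lim where "lim t g = limL (\<lambda>n. a n [^] \<lfloor>t * real (Suc n)\<rfloor>) g H" for t g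
  have lim_car: "g \<in> carrier L" if "lim t g" for t g using that limitin_carrier unfolding lim_def by blast
  have lim_uniq: "g = g'" if "lim t g" "lim t g'" for t g g'
    using limitin_unique_L that H(1) unfolding lim_def by blast
  have a1: "limL a \<one> H"
  proof -
    have z: "(\<lambda>n. v /\<^sub>R real (Suc n)) \<longlonglongrightarrow> 0"
      using tendsto_scaleR[OF LIMSEQ_inverse_real_of_nat tendsto_const[of v]] by simp
    have "limL (\<lambda>n. \<sigma> (v /\<^sub>R real (Suc n))) \<one> sequentially" using limitin_sigma[OF z zero_E0] by simp
    moreover have "\<forall>\<^sub>F n in sequentially. \<sigma> (v /\<^sub>R real (Suc n)) = a n"
      using topological_tendstoD[OF z E0_open zero_E0] by eventually_elim (simp add: a_def)
    ultimately have "limL a \<one> sequentially" by (rule limitin_transform_eventually[rotated])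
    then show ?thesis using H(2) unfolding limitin_def by (meson filter_leD)
  qed
  have lim_small: "lim t (\<sigma> (c t))" if t: "0 \<le> t" "t \<le> \<tau>" for t
  proof -
    have "limL (\<lambda>n. \<sigma> (Y n t)) (\<sigma> (c t)) H" using limitin_sigma[OF H(4)] H(3) R(2) by blast
    moreover have "\<sigma> (Y n t) = a n [^] \<lfloor>t * real (Suc n)\<rfloor>" for n
    proof -
      have "\<lfloor>t * real (Suc n)\<rfloor> = int (nat \<lfloor>t * real (Suc n)\<rfloor>)" using t by simp
      then have "a n [^] \<lfloor>t * real (Suc n)\<rfloor> = a n [^] nat \<lfloor>t * real (Suc n)\<rfloor>" by (metis int_pow_int)
      then show ?thesis using jD[OF t] t unfolding Y_def by simp
    qed
    ultimately show ?thesis unfolding lim_def by simp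
  qed
  have lim_add: "lim (s + t) (g \<otimes> h)" if "lim s g" "lim t h" for s t g h
  proof -
    define r where "r n = \<lfloor>(s + t) * real (Suc n)\<rfloor> - \<lfloor>s * real (Suc n)\<rfloor> - \<lfloor>t * real (Suc n)\<rfloor>" for n
    have r: "r n \<in> {-1, 0, 1}" for n
    proof -
      have "(s + t) * real (Suc n) = s * real (Suc n) + t * real (Suc n)" by (rule distrib_right)
      then have "r n = \<lfloor>s * real (Suc n) + t * real (Suc n)\<rfloor> - \<lfloor>s * real (Suc n)\<rfloor> - \<lfloor>t * real (Suc n)\<rfloor>" unfolding r_def by simp
      then have "0 \<le> r n \<and> r n \<le> 1" by linarith
      then show ?thesis by auto
    qed
    have "limL (\<lambda>n. a n [^] \<lfloor>s * real (Suc n)\<rfloor> \<otimes> a n [^] \<lfloor>t * real (Suc n)\<rfloor> \<otimes> a n [^] r n) (g \<otimes> h \<otimes> \<one>) H"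
      using that limitin_bounded_int_pow[OF a1 ac r] unfolding lim_def by (intro limitin_mult)
    moreover have "a n [^] \<lfloor>s * real (Suc n)\<rfloor> \<otimes> a n [^] \<lfloor>t * real (Suc n)\<rfloor> \<otimes> a n [^] r n = a n [^] \<lfloor>(s + t) * real (Suc n)\<rfloor>" for n
      unfolding r_def by (simp only: int_pow_mult[OF ac, symmetric]) simp
    ultimately show ?thesis using lim_car[OF that(1)] lim_car[OF that(2)] unfolding lim_def by simp
  qed
  have lim_neg: "lim (- t) (inv g)" if "lim t g" for t g
  proof -
    define r where "r n = \<lfloor>(- t) * real (Suc n)\<rfloor> + \<lfloor>t * real (Suc n)\<rfloor>" for n
    have r: "r n \<in> {-1, 0, 1}" for n
    proof -
      have "(- t) * real (Suc n) = - (t * real (Suc n))" by simp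
      then have "r n = \<lfloor>- (t * real (Suc n))\<rfloor> + \<lfloor>t * real (Suc n)\<rfloor>" unfolding r_def by simp
      then have "-1 \<le> r n \<and> r n \<le> 0" by linarith
      then show ?thesis by auto
    qed
    have "limL (\<lambda>n. inv (a n [^] \<lfloor>t * real (Suc n)\<rfloor>) \<otimes> a n [^] r n) (inv g \<otimes> \<one>) H"
      using that limitin_bounded_int_pow[OF a1 ac r] unfolding lim_def by (intro limitin_mult limitin_inv)
    moreover have "inv (a n [^] \<lfloor>t * real (Suc n)\<rfloor>) \<otimes> a n [^] r n = a n [^] \<lfloor>(- t) * real (Suc n)\<rfloor>" for n
      unfolding r_def by (simp only: int_pow_mult[OF ac, symmetric] int_pow_neg[OF ac, symmetric]) simp
    ultimately show ?thesis using lim_car[OF that] unfolding lim_def by simp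
  qed
  have lim_mult: "\<exists>g. lim (real k * t) g" if "0 \<le> t" "t \<le> \<tau>" for t k
  proof (induction k)
    case 0
    then show ?case using lim_small[of 0] \<tau> by auto
  next
    case (Suc k)
    then obtain g where "lim (real k * t) g" ..
    from lim_add[OF this lim_small[OF that]] show ?case by (auto simp: algebra_simps)
  qed
  have lim_nonneg: "\<exists>g. lim t g" if "0 \<le> t" for t
  proof -
    obtain k :: nat where k: "t / \<tau> < real k" using reals_Archimedean2 by blast
    have k0: "real k > 0" using k that \<tau> by (meson divide_nonneg_pos le_less_trans)
    have "t / real k \<le> \<tau>" using k k0 \<tau> by (simp add: field_simps)
    then show ?thesis using lim_mult[of "t / real k" k] that k0 by simp
  qed
  have lim_ex: "\<exists>g. lim t g" for t
    using lim_nonneg[of t] lim_nonneg[of "-t"] lim_neg[of "-t"] by (cases "0 \<le> t") force+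
  define \<Gamma> where "\<Gamma> t = (SOME g. lim t g)" for t
  have \<Gamma>: "lim t (\<Gamma> t)" for t unfolding \<Gamma>_def using lim_ex someI_ex by metis
  have \<Gamma>c: "\<Gamma> t \<in> carrier L" for t using lim_car[OF \<Gamma>] .
  have \<Gamma>add: "\<Gamma> (s + t) = \<Gamma> s \<otimes> \<Gamma> t" for s t by (rule lim_uniq[OF \<Gamma> lim_add[OF \<Gamma> \<Gamma>]])
  \<comment> \<open>The estimate for the powers passes to the limit for every
    \<open>\<epsilon>\<close> and yields the velocity \<open>v\<close> from the right.\<close>
  have pos: "\<exists>d>0. \<forall>t. 0 \<le> t \<and> t < d --> \<Gamma> t \<in> D0 \<and> norm (\<psi> (\<Gamma> t) - t *\<^sub>R v) \<le> \<epsilon> * (t * norm v)"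
    if e: "0 < \<epsilon>" "\<epsilon> \<le> 1" for \<epsilon>
  proof -
    obtain d where d: "d > 0" "\<And>n j. real j / real (Suc n) * norm v < d ==> a n [^] j \<in> D0 \<and>
      norm (\<psi> (a n [^] j) - (real j / real (Suc n)) *\<^sub>R v) \<le> \<epsilon> * (real j / real (Suc n) * norm v)"
      using est[OF e] by auto
    show ?thesis
    proof (intro exI[of _ "min \<tau> (d / (norm v + 1))"] conjI allI impI)
      show "min \<tau> (d / (norm v + 1)) > 0" using \<tau> d(1) norm_ge_zero[of v] by (simp add: add_nonneg_pos)
      fix t assume t: "0 \<le> t \<and> t < min \<tau> (d / (norm v + 1))"
      have "t * (norm v + 1) < d" using t nv1 by (simp add: pos_less_divide_eq)
      then have tv: "t * norm v < d" using t by (simp add: distrib_left)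
      have ct: "\<Gamma> t = \<sigma> (c t)" using lim_uniq[OF \<Gamma> lim_small] t by simp
      have cE: "c t \<in> E0" using H(3) R(2) by blast
      show "\<Gamma> t \<in> D0" unfolding ct by (rule sigma_D0[OF cE])
      let ?q = "\<lambda>n. real (nat \<lfloor>t * real (Suc n)\<rfloor>) / real (Suc n)"
      have "?q \<longlonglongrightarrow> t"
        using floor_multiple_limit[of "\<lambda>n. 1 / real (Suc n)" t] LIMSEQ_Suc[OF lim_const_over_n[of 1]] t by simp
      then have q: "(?q \<longlongrightarrow> t) H" by (rule filterlim_mono[OF _ order_refl H(2)])
      have "norm (c t - t *\<^sub>R v) \<le> \<epsilon> * (t * norm v)"
      proof (rule tendsto_le[OF H(1)])
        show "((\<lambda>n. \<epsilon> * (?q n * norm v)) \<longlongrightarrow> \<epsilon> * (t * norm v)) H" by (intro tendsto_intros q)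
        show "((\<lambda>n. norm (Y n t - ?q n *\<^sub>R v)) \<longlongrightarrow> norm (c t - t *\<^sub>R v)) H" by (intro tendsto_intros q H(4))
        show "\<forall>\<^sub>F n in H. norm (Y n t - ?q n *\<^sub>R v) \<le> \<epsilon> * (?q n * norm v)"
        proof (intro always_eventually allI)
          fix n
          have "?q n * norm v < d" using jb[of t n] t tv by linarith
          from d(2)[OF this] show "norm (Y n t - ?q n *\<^sub>R v) \<le> \<epsilon> * (?q n * norm v)" using t unfolding Y_def by simp
        qed
      qed
      then show "norm (\<psi> (\<Gamma> t) - t *\<^sub>R v) \<le> \<epsilon> * (t * norm v)" unfolding ct using cE by simp
    qed
  qed
  have "tang (at_right 0) (\<lambda>_. UNIV :: unit set) (\<lambda>s. s) (\<lambda>s _. \<Gamma> s) (\<lambda>_ _. v)"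
    unfolding tang_def
  proof (intro allI impI)
    fix \<epsilon> :: real assume e: "\<epsilon> > 0"
    define \<epsilon>' where "\<epsilon>' = min 1 (\<epsilon> / (norm v + 1))"
    have e': "0 < \<epsilon>'" "\<epsilon>' \<le> 1" unfolding \<epsilon>'_def using e nv1 by auto
    have "\<epsilon>' * norm v \<le> \<epsilon> / (norm v + 1) * (norm v + 1)" unfolding \<epsilon>'_def using e nv1 by (intro mult_mono) auto
    then have ev: "\<epsilon>' * norm v \<le> \<epsilon>" using nv1 by simp
    obtain d where d: "d > 0" "\<forall>t. 0 \<le> t \<and> t < d --> \<Gamma> t \<in> D0 \<and> norm (\<psi> (\<Gamma> t) - t *\<^sub>R v) \<le> \<epsilon>' * (t * norm v)" using pos[OF e'] by blast
    show "\<forall>\<^sub>F t in at_right 0. \<forall>i\<in>UNIV. \<Gamma> t \<in> D0 \<and> norm (\<psi> (\<Gamma> t) - t *\<^sub>R v) \<le> \<epsilon> * t"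
      unfolding eventually_at_right_field
    proof (intro exI[of _ d] conjI d(1) allI impI ballI)
      fix t assume t: "0 < t" "t < d"
      then show "\<Gamma> t \<in> D0" using d(2) by simp
      have "\<epsilon>' * (t * norm v) \<le> \<epsilon> * t" using mult_right_mono[OF ev, of t] t by (simp add: mult_ac)
      then show "norm (\<psi> (\<Gamma> t) - t *\<^sub>R v) \<le> \<epsilon> * t" using d(2)[rule_format, of t] t by linarith
    qed
  qed
  then show ?thesis using ops_of_right_tangent[OF \<Gamma>add \<Gamma>c] by blast
qed

end

section \<open>The exponential map and closed subgroups\<close>

context complex_lie_gp
begin

abbreviation Exp :: "'e => 'g" where "Exp \<equiv> lie_exp L"
abbreviation ex :: "real => 'e => 'g" where "ex t \<xi> \<equiv> Exp (t *\<^sub>R \<xi>)"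

lemma ops_scale:
  assumes "ops \<xi> \<gamma>"
  shows "ops (t *\<^sub>R \<xi>) (\<lambda>s. \<gamma> (t * s))"
  unfolding one_parameter_subgroup_def
proof (intro conjI allI)
  have "continuous_map euclideanreal euclideanreal (\<lambda>s. t * s)" by (simp add: continuous_intros)
  then show "continuous_map euclideanreal (ltop L) (\<lambda>s. \<gamma> (t * s))"
    using continuous_map_compose[of euclideanreal euclideanreal "\<lambda>s. t * s" "ltop L" \<gamma>] assms
    unfolding one_parameter_subgroup_def o_def by blast
  show "\<gamma> (t * (r + s)) = \<gamma> (t * r) \<otimes> \<gamma> (t * s)" for r s
    using opsD(1)[OF assms] by (simp add: distrib_left)
  show "\<gamma> (t * 0) = \<one>" using opsD(2)[OF assms] by simp
  have 1: "((\<lambda>s. t * s) has_vector_derivative t) (at 0)"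
    unfolding has_vector_derivative_def by (auto intro!: derivative_eq_intros)
  have 2: "((\<lambda>t. \<phi> (\<gamma> t)) has_vector_derivative \<xi>) (at (t * 0))"
    using assms unfolding one_parameter_subgroup_def by simp
  from vector_diff_chain_at[OF 1 2]
  show "((\<lambda>s. \<phi> (\<gamma> (t * s))) has_vector_derivative t *\<^sub>R \<xi>) (at 0)" by (simp add: o_def)
qed

lemma ops_eq_Exp:
  assumes "ops \<xi> \<gamma>"
  shows "\<gamma> t = ex t \<xi>"
proof -
  have "(THE \<gamma>'. ops (t *\<^sub>R \<xi>) \<gamma>') = (\<lambda>s. \<gamma> (t * s))"
    using ops_scale[OF assms, of t] by (intro the_equality) (auto intro: ops_unique)
  then show ?thesis unfolding lie_exp_def by simp
qed

lemma ops_Exp: "ops \<xi> (\<lambda>t. ex t \<xi>)"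
proof -
  obtain \<gamma> where g: "ops \<xi> \<gamma>" using ops_exists by blast
  have "\<gamma> = (\<lambda>t. ex t \<xi>)" using ops_eq_Exp[OF g] by auto
  then show ?thesis using g by simp
qed

lemma Exp_carrier [simp]: "Exp \<xi> \<in> carrier L"
  using opsD(3)[OF ops_Exp[of \<xi>], of 1] by simp

lemma Exp_zero [simp]: "Exp 0 = \<one>"
  using opsD(2)[OF ops_Exp[of 0]] by simp

lemma Exp_add: "ex (s + t) \<xi> = ex s \<xi> \<otimes> ex t \<xi>"
  using opsD(1)[OF ops_Exp] by simp

lemma Exp_neg: "Exp (- \<xi>) = inv (Exp \<xi>)"
  using opsD(4)[OF ops_Exp[of \<xi>], of 1] by simp

text \<open>\<open>Exp \<xi>\<close> is a product of \<open>Suc n\<close> equal factors whose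
  coordinates, multiplied by \<open>Suc n\<close>, tend to \<open>\<xi>\<close>;
  \<open>telescope\<close> applies for large \<open>n\<close> and its bound survives the limit.
  Hence the estimate is uniform in the direction of \<open>\<xi>\<close>.\<close>

lemma Exp_close:
  assumes e: "\<epsilon> > 0"
  obtains \<delta> where "\<delta> > 0" "\<forall>\<xi>. norm \<xi> < \<delta> --> Exp \<xi> \<in> D0 \<and> norm (\<psi> (Exp \<xi>) - \<xi>) \<le> \<epsilon> * norm \<xi>"
proof -
  define \<epsilon>' where "\<epsilon>' = min 1 \<epsilon>"
  have e': "0 < \<epsilon>'" "\<epsilon>' \<le> 1" "\<epsilon>' \<le> \<epsilon>" using e unfolding \<epsilon>'_def by auto
  obtain d where d: "d > 0" "\<And>w n. (\<Sum>i<n. norm (w i)) < d ==>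
     (\<forall>i<n. w i \<in> E0) \<and> gprod (\<lambda>i. \<sigma> (w i)) n \<in> D0 \<and>
     norm (\<psi> (gprod (\<lambda>i. \<sigma> (w i)) n) - (\<Sum>i<n. w i)) \<le> \<epsilon>' * (\<Sum>i<n. norm (w i))"
    using telescope[OF e'(1,2)] by blast
  show ?thesis
  proof (rule that[OF d(1)], intro allI impI)
    fix \<xi> :: 'e assume x: "norm \<xi> < d"
    define w where "w n = \<psi> (ex (1 / real (Suc n)) \<xi>)" for n
    have h: "(\<lambda>n. 1 / real (Suc n)) \<longlonglongrightarrow> 0" "\<forall>\<^sub>F n in sequentially. 1 / real (Suc n) > 0"
      using LIMSEQ_Suc[OF lim_const_over_n[of 1]] by simp_all
    have "tang sequentially (\<lambda>_. UNIV :: unit set) (\<lambda>n. 1 / real (Suc n)) (\<lambda>n _. ex (1 / real (Suc n)) \<xi>) (\<lambda>_ _. \<xi>)"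
      using ops_tang[OF ops_Exp[of \<xi>] h, of 1] by simp
    note v = tang_lim[OF h(2) this tendsto_const]
    have w: "(\<lambda>n. real (Suc n) *\<^sub>R w n) \<longlonglongrightarrow> \<xi>" unfolding w_def using v(2) by simp
    then have nw: "(\<lambda>n. norm (real (Suc n) *\<^sub>R w n)) \<longlonglongrightarrow> norm \<xi>" by (rule tendsto_norm)
    have ev: "\<forall>\<^sub>F n in sequentially. Exp \<xi> \<in> D0 \<and> norm (\<psi> (Exp \<xi>) - real (Suc n) *\<^sub>R w n) \<le> \<epsilon>' * norm (real (Suc n) *\<^sub>R w n)"
      using v(1) order_tendstoD(2)[OF nw x]
    proof eventually_elim
      case (elim n)
      have S: "(\<Sum>i<Suc n. norm (w n)) = norm (real (Suc n) *\<^sub>R w n)" by simp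
      have S2: "(\<Sum>i<Suc n. w n) = real (Suc n) *\<^sub>R w n" by (simp add: sum_constant_scaleR del: sum.lessThan_Suc)
      have g: "gprod (\<lambda>i. \<sigma> (w n)) (Suc n) = Exp \<xi>"
        using ops_gprod[OF ops_Exp[of \<xi>], of "1 / real (Suc n)" "Suc n"] elim(1) unfolding w_def by simp
      show ?case using d(2)[of "\<lambda>_. w n" "Suc n"] elim(2) unfolding S S2 g by blast
    qed
    have "Exp \<xi> \<in> D0" using eventually_happens[OF ev] by auto
    moreover have "norm (\<psi> (Exp \<xi>) - \<xi>) \<le> \<epsilon>' * norm \<xi>"
    proof (rule tendsto_le[OF sequentially_bot])
      show "(\<lambda>n. \<epsilon>' * norm (real (Suc n) *\<^sub>R w n)) \<longlonglongrightarrow> \<epsilon>' * norm \<xi>" by (intro tendsto_intros nw)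
      show "(\<lambda>n. norm (\<psi> (Exp \<xi>) - real (Suc n) *\<^sub>R w n)) \<longlonglongrightarrow> norm (\<psi> (Exp \<xi>) - \<xi>)" by (intro tendsto_intros w)
      show "\<forall>\<^sub>F n in sequentially. norm (\<psi> (Exp \<xi>) - real (Suc n) *\<^sub>R w n) \<le> \<epsilon>' * norm (real (Suc n) *\<^sub>R w n)"
        using ev by (auto elim: eventually_mono)
    qed
    moreover have "\<epsilon>' * norm \<xi> \<le> \<epsilon> * norm \<xi>" using e' by (intro mult_right_mono) auto
    ultimately show "Exp \<xi> \<in> D0 \<and> norm (\<psi> (Exp \<xi>) - \<xi>) \<le> \<epsilon> * norm \<xi>" by linarith
  qed
qed

lemma Exp_tang:
  assumes h: "(h \<longlongrightarrow> 0) F" "\<forall>\<^sub>F n in F. h n > 0" and x: "\<And>n i. norm (x n i) \<le> C"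
  shows "tang F A h (\<lambda>n i. ex (h n) (x n i)) x"
  unfolding tang_def
proof (intro allI impI)
  fix \<epsilon> :: real assume e: "\<epsilon> > 0"
  have C: "C \<ge> 0" using x order_trans[OF norm_ge_zero] by blast
  obtain d where d: "d > 0" "\<forall>\<xi>. norm \<xi> < d --> Exp \<xi> \<in> D0 \<and> norm (\<psi> (Exp \<xi>) - \<xi>) \<le> \<epsilon> / (C + 1) * norm \<xi>"
    by (rule Exp_close[of "\<epsilon> / (C + 1)"]) (use e C in simp)
  have "((\<lambda>n. h n * (C + 1)) \<longlongrightarrow> 0 * (C + 1)) F" by (intro tendsto_intros h)
  then have "\<forall>\<^sub>F n in F. h n * (C + 1) < d" using order_tendstoD(2) d(1) by fastforce
  with h(2) show "\<forall>\<^sub>F n in F. \<forall>i\<in>A n. ex (h n) (x n i) \<in> D0 \<and> norm (\<psi> (ex (h n) (x n i)) - h n *\<^sub>R x n i) \<le> \<epsilon> * h n"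
  proof eventually_elim
    case (elim n)
    have "norm (h n *\<^sub>R x n i) \<le> h n * (C + 1)" for i using elim(1) x[of n i] by (simp add: mult_left_mono)
    moreover from this have "\<epsilon> / (C + 1) * norm (h n *\<^sub>R x n i) \<le> \<epsilon> / (C + 1) * (h n * (C + 1))" for i
      using e C by (intro mult_left_mono) auto
    moreover have "\<epsilon> / (C + 1) * (h n * (C + 1)) = \<epsilon> * h n" using C by simp
    ultimately show ?case using elim(2) d(2) by (metis le_less_trans order_trans)
  qed
qed

text \<open>For a sequence \<open>y\<close> tending to \<open>\<xi>\<close>,
  \<open>Exp (y n)\<close> is a power of \<open>ex (1 / real (Suc n)) (y n)\<close>. These factors
  are tangent to \<open>\<xi>\<close>, so the product formula gives the limit.\<close>

lemma limitin_Exp: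
  assumes f: "(f \<longlongrightarrow> \<xi>) F"
  shows "limL (\<lambda>n. Exp (f n)) (Exp \<xi>) F"
proof -
  let ?h = "\<lambda>n. 1 / real (Suc n)"
  have h: "\<And>n. ?h n > 0" "?h \<longlonglongrightarrow> 0" using LIMSEQ_Suc[OF lim_const_over_n[of 1]] by simp_all
  then have ev: "\<forall>\<^sub>F n in sequentially. ?h n > 0" by simp
  have seq: "limL (\<lambda>n. Exp (y n)) (Exp \<xi>) sequentially" if y: "y \<longlonglongrightarrow> \<xi>" for y
  proof -
    obtain C where C: "\<And>n. norm (y n) \<le> C" using convergent_imp_Bseq[of y] y unfolding Bseq_def convergent_def by blast
    note l = tang_lim[OF ev Exp_tang[OF h(2) ev, of "\<lambda>n _. y n", OF C] y]
    have "(\<lambda>n. real (Suc n) * ?h n) \<longlonglongrightarrow> 1" by simp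
    from product_limit[OF ops_Exp h _ this tangI_lim[OF ev l]]
    have "limL (\<lambda>n. gprod (\<lambda>_. ex (?h n) (y n)) (Suc n)) (ex 1 \<xi>) sequentially" by simp
    moreover have "gprod (\<lambda>_. ex (?h n) (y n)) (Suc n) = Exp (y n)" for n
      using ops_gprod[OF ops_Exp[of "y n"], of "?h n" "Suc n"] by simp
    ultimately show ?thesis by simp
  qed
  show ?thesis
    unfolding limitin_def
  proof (intro conjI allI impI)
    show "Exp \<xi> \<in> topspace (ltop L)" using Exp_carrier carrier by simp
    fix S assume "openin (ltop L) S \<and> Exp \<xi> \<in> S"
    then have "\<forall>\<^sub>F x in nhds \<xi>. Exp x \<in> S"
      unfolding eventually_nhds_iff_sequentially by (auto intro: limitinD[OF seq])
    then show "\<forall>\<^sub>F n in F. Exp (f n) \<in> S" using f unfolding filterlim_iff by blast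
  qed
qed

lemma lie_algebra_scale: "\<xi> \<in> lie_algebra L H ==> r *\<^sub>R \<xi> \<in> lie_algebra L H"
  unfolding lie_algebra_def by simp

lemma lie_algebra_Exp: "\<xi> \<in> lie_algebra L H ==> Exp \<xi> \<in> H"
  unfolding lie_algebra_def by (metis (mono_tags) mem_Collect_eq scaleR_one)

lemma limitin_closed:
  assumes "closedin (ltop L) G" "limL f a F" "F \<noteq> bot" "\<forall>\<^sub>F n in F. f n \<in> G"
  shows "a \<in> G"
proof (rule ccontr)
  assume "a \<notin> G"
  then have "a \<in> topspace (ltop L) - G" using limitin_topspace[OF assms(2)] by blast
  moreover have "openin (ltop L) (topspace (ltop L) - G)" using assms(1) by (simp add: closedin_def)
  ultimately have "\<forall>\<^sub>F n in F. f n \<in> topspace (ltop L) - G" using assms(2) limitinD by metis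
  with assms(4) have "\<forall>\<^sub>F n in F. False" by eventually_elim auto
  then show False using assms(3) by simp
qed

text \<open>Suitable powers of \<open>g n\<close> stay in \<open>G\<close> and tend to points of the
  one-parameter subgroup of \<open>w\<close>; closedness of \<open>G\<close> keeps the limits
  inside.\<close>

lemma lie_algebra_limit:
  assumes G: "closedin (ltop L) G" "subgroup G L"
    and g: "\<And>n. g n \<in> G" "\<forall>\<^sub>F n in sequentially. g n \<in> D0" and h: "\<And>n. h n > 0" "h \<longlonglongrightarrow> 0"
    and lim: "(\<lambda>n. \<psi> (g n) /\<^sub>R h n) \<longlonglongrightarrow> w"
  shows "w \<in> lie_algebra L G"
proof -
  have pos: "ex t w \<in> G" if t: "t \<ge> 0" for t
  proof (rule limitin_closed[OF G(1) _ sequentially_bot])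
    show "limL (\<lambda>n. gprod (\<lambda>_. g n) (nat \<lfloor>t / h n\<rfloor>)) (ex t w) sequentially"
      by (rule product_limit[OF ops_Exp h t floor_multiple_limit[OF h t] tangI_lim[OF _ g(2) lim]]) (simp add: h(1))
    have "gprod (\<lambda>_. g n) k \<in> G" for n k
      by (induction k) (simp_all add: g(1) subgroup.m_closed[OF G(2)] subgroup.one_closed[OF G(2)])
    then show "\<forall>\<^sub>F n in sequentially. gprod (\<lambda>_. g n) (nat \<lfloor>t / h n\<rfloor>) \<in> G" by simp
  qed
  have "ex t w \<in> G" for t
  proof (cases "t \<ge> 0")
    case False
    then have "inv (ex (- t) w) \<in> G" using pos[of "-t"] subgroup.m_inv_closed[OF G(2)] by simp
    then show ?thesis using Exp_neg[of "(-t) *\<^sub>R w"] by simp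
  qed (use pos in simp)
  then show ?thesis unfolding lie_algebra_def by blast
qed

text \<open>For closure under addition: the product of short pieces of the two one-parameter
  subgroups lies in \<open>G\<close> and has velocity \<open>x + y\<close>.\<close>

lemma lie_algebra_subspace:
  assumes G: "closedin (ltop L) G" "subgroup G L"
  shows "subspace (lie_algebra L G)"
  unfolding subspace_def
proof (intro conjI ballI allI)
  show "0 \<in> lie_algebra L G" unfolding lie_algebra_def using subgroup.one_closed[OF G(2)] by simp
  show "c *\<^sub>R x \<in> lie_algebra L G" if "x \<in> lie_algebra L G" for c x using lie_algebra_scale[OF that] .
  fix x y assume xy: "x \<in> lie_algebra L G" "y \<in> lie_algebra L G"
  let ?h = "\<lambda>n. 1 / real (Suc n)"
  have h: "?h \<longlonglongrightarrow> 0" "\<forall>\<^sub>F n in sequentially. ?h n > 0" using LIMSEQ_Suc[OF lim_const_over_n[of 1]] by simp_all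
  have "tang sequentially (\<lambda>_. UNIV :: unit set) ?h (\<lambda>n _. ex (?h n) x \<otimes> ex (?h n) y) (\<lambda>_ _. x + y)"
    by (rule tang_mult[where C = "norm x + norm y", OF Exp_tang[OF h order_refl] Exp_tang[OF h order_refl] h]) auto
  from tang_lim[OF h(2) this tendsto_const]
  show "x + y \<in> lie_algebra L G"
    by (intro lie_algebra_limit[OF G _ _ _ h(1)]) (use xy subgroup.m_closed[OF G(2)] in \<open>auto simp: lie_algebra_def\<close>)
qed

end

section \<open>Reaching the identity by minimisation\<close>

context complex_lie_gp
begin

text \<open>Minimising the distance to the identity over \<open>S\<close>: if the minimiser is not the identity, the
  normalised coordinates accumulate at a direction \<open>w\<close> in the Lie algebra, and moving by \<open>- s w\<close> decreases the
  distance.\<close>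

lemma minimize_to_one:
  assumes G: "closedin (ltop L) G" "subgroup G L"
    and p: "\<And>w. w \<in> lie_algebra L G ==> p1 w + p2 w = - w"
  obtains \<delta>0 where "\<delta>0 > 0" "\<forall>\<delta> S. 0 < \<delta> --> \<delta> \<le> \<delta>0 --> closedin (ltop L) S --> S \<subseteq> G --> (\<exists>g\<in>S. g \<in> D0 \<and> norm (\<psi> g) < \<delta>) -->
     (\<forall>g\<in>S. g \<in> D0 --> norm (\<psi> g) < \<delta> --> (\<forall>w\<in>lie_algebra L G.
         \<forall>\<^sub>F s in at_right 0. ex s (p1 w) \<otimes> g \<otimes> ex s (p2 w) \<in> S)) --> \<one> \<in> S"
proof (rule ccontr)
  note goal = that
  assume neg: "\<not> thesis"
  define P where "P \<delta> S \<longleftrightarrow> closedin (ltop L) S \<and> S \<subseteq> G \<and> (\<exists>g\<in>S. g \<in> D0 \<and> norm (\<psi> g) < \<delta>) \<and>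
     (\<forall>g\<in>S. g \<in> D0 --> norm (\<psi> g) < \<delta> --> (\<forall>w\<in>lie_algebra L G.
         \<forall>\<^sub>F s in at_right 0. ex s (p1 w) \<otimes> g \<otimes> ex s (p2 w) \<in> S)) \<and> \<one> \<notin> S" for \<delta> S
  \<comment> \<open>Failure for every bound yields counterexamples at arbitrarily small scales. They
    are taken at radii tending to 0 so that a tangent direction can be extracted.\<close>
  have ex: "\<exists>\<delta>'. 0 < \<delta>' \<and> \<delta>' \<le> \<delta> \<and> (\<exists>S. P \<delta>' S)" if "\<delta> > 0" for \<delta>
  proof (rule ccontr)
    assume "\<not> (\<exists>\<delta>'. 0 < \<delta>' \<and> \<delta>' \<le> \<delta> \<and> (\<exists>S. P \<delta>' S))"
    then have "\<forall>\<delta>' S. 0 < \<delta>' --> \<delta>' \<le> \<delta> --> \<not> P \<delta>' S" by blast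
    then have "thesis" unfolding P_def by (intro goal[OF that]) blast
    then show False using neg by blast
  qed
  obtain R where R: "R > 0" "cball 0 R \<subseteq> E0" by (rule E0_cball)
  have "\<forall>n. \<exists>\<delta>'. 0 < \<delta>' \<and> \<delta>' \<le> R / real (Suc n) \<and> (\<exists>S. P \<delta>' S)" using ex R(1) by simp
  then obtain \<delta> where \<delta>S: "\<forall>n. 0 < \<delta> n \<and> \<delta> n \<le> R / real (Suc n) \<and> (\<exists>S. P (\<delta> n) S)" by (rule choice[THEN exE])
  have "R / real (Suc n) \<le> R" for n using R(1) by (simp add: divide_simps)
  then have \<delta>: "\<delta> n > 0" "\<delta> n \<le> R" for n using \<delta>S order_trans by blast+
  have \<delta>0: "\<delta> \<longlonglongrightarrow> 0"
    by (rule tendsto_sandwich[OF _ _ tendsto_const LIMSEQ_Suc[OF lim_const_over_n[of R]]]) (use \<delta>S in \<open>auto intro!: always_eventually less_imp_le\<close>)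
  obtain S where S: "\<And>n. P (\<delta> n) (S n)" using \<delta>S by metis
  \<comment> \<open>The part of \<open>S n\<close> in a small closed ball is compact in coordinates,
    so a point closest to the identity exists.\<close>
  have min: "\<exists>x. norm x < \<delta> n \<and> \<sigma> x \<in> S n \<and> (\<forall>y. norm y \<le> norm x --> \<sigma> y \<in> S n --> norm x \<le> norm y)" for n
  proof -
    obtain g where g: "g \<in> S n" "g \<in> D0" "norm (\<psi> g) < \<delta> n" using S[of n] unfolding P_def by blast
    define r where "r = norm (\<psi> g)"
    define X where "X = cball 0 r \<inter> {x. x \<in> cball 0 r \<and> \<sigma> x \<in> S n}"
    have rR: "cball 0 r \<subseteq> E0" using R(2) \<delta>(2)[of n] g(3) unfolding r_def by (auto simp: subset_iff)
    have clS: "closedin (ltop L) (S n)" using S[of n] unfolding P_def by blast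
    have "closed {x. x \<in> cball 0 r \<and> \<sigma> x \<in> S n}"
      unfolding closed_sequential_limits
    proof (intro allI impI)
      fix f l assume h: "(\<forall>k. f k \<in> {x. x \<in> cball 0 r \<and> \<sigma> x \<in> S n}) \<and> f \<longlonglongrightarrow> l"
      have l: "l \<in> cball 0 r" using closed_cball h unfolding closed_sequential_limits by blast
      then have "limL (\<lambda>k. \<sigma> (f k)) (\<sigma> l) sequentially" using limitin_sigma h rR by blast
      then have "\<sigma> l \<in> S n" by (rule limitin_closed[OF clS _ sequentially_bot]) (use h in auto)
      then show "l \<in> {x. x \<in> cball 0 r \<and> \<sigma> x \<in> S n}" using l by blast
    qed
    then have "compact X" unfolding X_def by (rule compact_Int_closed[OF finite_dimensional_compact_cball[OF fd]])
    moreover have "\<psi> g \<in> X" unfolding X_def r_def using g by simp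
    ultimately obtain x where x: "x \<in> X" "\<And>y. y \<in> X ==> norm x \<le> norm y"
      using continuous_attains_inf[of X norm] continuous_on_norm_id by blast
    have "norm x < \<delta> n" "\<sigma> x \<in> S n" using x(1) g(3) unfolding X_def r_def by auto
    moreover have "norm x \<le> norm y" if "norm y \<le> norm x" "\<sigma> y \<in> S n" for y
      using x that unfolding X_def by auto
    ultimately show ?thesis by blast
  qed
  define xp where "xp n x \<longleftrightarrow> norm x < \<delta> n \<and> \<sigma> x \<in> S n \<and> (\<forall>y. norm y \<le> norm x --> \<sigma> y \<in> S n --> norm x \<le> norm y)" for n x
  have "\<forall>n. \<exists>x. xp n x" using min unfolding xp_def by blast
  then obtain x where xx: "\<And>n. xp n (x n)" by metis
  have x: "norm (x n) < \<delta> n" "\<sigma> (x n) \<in> S n" "\<And>y. norm y \<le> norm (x n) ==> \<sigma> y \<in> S n ==> norm (x n) \<le> norm y" for n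
    using xx[of n] unfolding xp_def by blast+
  have x0: "x n \<noteq> 0" for n using x(2)[of n] S[of n] unfolding P_def by (metis sigma_zero)
  have xE: "x n \<in> E0" for n using x(1)[of n] \<delta>(2)[of n] R(2) by (auto simp: subset_iff)
  have xlim: "(\<lambda>n. norm (x n)) \<longlonglongrightarrow> 0"
    by (rule tendsto_sandwich[OF _ _ tendsto_const \<delta>0]) (use x(1) in \<open>auto intro!: always_eventually less_imp_le\<close>)
  define u where "u n = x n /\<^sub>R norm (x n)" for n
  have "u n \<in> cball 0 1" for n unfolding u_def using x0[of n] by simp
  then obtain w r where wr: "w \<in> cball 0 1" "strict_mono (r :: nat => nat)" "(u \<circ> r) \<longlonglongrightarrow> w"
    using finite_dimensional_compact_cball[OF fd, of 0 1] unfolding compact_eq_seq_compact_metric seq_compact_def by metis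
  have wG: "w \<in> lie_algebra L G"
  proof (rule lie_algebra_limit[OF G, of "\<lambda>n. \<sigma> (x (r n))" "\<lambda>n. norm (x (r n))"])
    show "\<sigma> (x (r n)) \<in> G" "0 < norm (x (r n))" "\<forall>\<^sub>F n in sequentially. \<sigma> (x (r n)) \<in> D0" for n
      using x(2)[of "r n"] S[of "r n"] x0[of "r n"] sigma_D0[OF xE] unfolding P_def by auto
    show "(\<lambda>n. norm (x (r n))) \<longlonglongrightarrow> 0" using LIMSEQ_subseq_LIMSEQ[OF xlim wr(2)] by (simp add: o_def)
    show "(\<lambda>n. \<psi> (\<sigma> (x (r n))) /\<^sub>R norm (x (r n))) \<longlonglongrightarrow> w" using wr(3) xE unfolding u_def o_def by simp
  qed
  define C where "C = norm (p1 w) + norm (p2 w)"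
  have C: "0 \<le> C" "norm (p1 w) \<le> C" "norm (p2 w) \<le> C" unfolding C_def by auto
  \<comment> \<open>Makes each of the two multiplication errors below at most
    \<open>s/16\<close>.\<close>
  define \<eta> where "\<eta> = 1 / (16 * (C + 1))"
  have \<eta>: "\<eta> > 0" "\<eta> * (C + 1) = 1/16" using C unfolding \<eta>_def by (auto simp: divide_simps)
  obtain d where d: "mul_close \<eta> d" using mul_close_exists[OF \<eta>(1)] .
  have d0: "d > 0" using mul_closeD(1)[OF d] .
  have ev_n: "\<forall>\<^sub>F n in sequentially. norm (u (r n) - w) < 1/4 \<and> norm (x (r n)) < d/2"
    using tendstoD[OF wr(3), of "1/4"] order_tendstoD(2)[OF LIMSEQ_subseq_LIMSEQ[OF xlim wr(2)], of "d/2"] d0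
    by (auto simp: dist_norm o_def intro: eventually_conj)
  obtain n where n: "norm (u (r n) - w) < 1/4" "norm (x (r n)) < d/2"
    using eventually_happens[OF ev_n] sequentially_bot by blast
  define m where "m = r n"
  let ?x = "x m"
  have nx: "norm ?x > 0" using x0 by simp
  have xd: "norm ?x < d" using n(2) d0 m_def by simp
  have d4: "d/4 > 0" "(1/16::real) > 0" using d0 by auto
  have evS: "\<forall>\<^sub>F s in at_right 0. ex s (p1 w) \<otimes> \<sigma> ?x \<otimes> ex s (p2 w) \<in> S m"
    using S[of m] x(1,2)[of m] sigma_D0[OF xE[of m]] xE[of m] wG unfolding P_def by auto
  have evp: "\<forall>\<^sub>F s in at_right (0::real). s > 0" by (simp add: eventually_at_right_less)
  have evx: "\<forall>\<^sub>F s in at_right 0. s < norm ?x" using nx unfolding eventually_at_right_field by blast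
  have t: "tang (at_right 0) (\<lambda>_. UNIV :: unit set) (\<lambda>s. s) (\<lambda>s _. ex s v) (\<lambda>_ _. v)" for v
    by (rule Exp_tang[OF tendsto_ident_at evp order_refl])
  have "\<forall>\<^sub>F s in at_right (0::real). False"
    using evS evp evx tang_small[OF t[of "p1 w"] tendsto_ident_at evp order_refl d4(1)]
      tang_small[OF t[of "p2 w"] tendsto_ident_at evp order_refl d4(1)] tangD[OF t[of "p1 w"] d4(2)] tangD[OF t[of "p2 w"] d4(2)]
  proof eventually_elim
    case (elim s)
    note elim = elim(1-3) elim(4-7)[THEN bspec, OF UNIV_I]
    let ?a = "ex s (p1 w)" and ?b = "ex s (p2 w)"
    define y where "y = \<psi> (?a \<otimes> \<sigma> ?x \<otimes> ?b)"
    define z where "z = \<psi> (?a \<otimes> \<sigma> ?x)"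
    have ad: "norm (\<psi> ?a) < d" "norm (\<psi> ?b) < d" using elim d0 by linarith+
    have aD: "?a \<in> D0" "?b \<in> D0" using elim by auto
    have na: "norm (\<psi> ?a) \<le> (C + 1) * s" "norm (\<psi> ?b) \<le> (C + 1) * s"
    proof -
      have "norm (s *\<^sub>R p1 w) \<le> C * s" "norm (s *\<^sub>R p2 w) \<le> C * s"
        using C(2,3) elim(2) mult_right_mono[OF C(2), of s] mult_right_mono[OF C(3), of s] by (auto simp: mult.commute)
      then show "norm (\<psi> ?a) \<le> (C + 1) * s" "norm (\<psi> ?b) \<le> (C + 1) * s"
        using elim norm_triangle_sub[of "\<psi> ?a" "s *\<^sub>R p1 w"] norm_triangle_sub[of "\<psi> ?b" "s *\<^sub>R p2 w"]
        unfolding distrib_right by linarith+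
    qed
    have \<eta>s: "\<eta> * norm (\<psi> ?a) \<le> s/16" "\<eta> * norm (\<psi> ?b) \<le> s/16"
    proof -
      have "\<eta> * ((C + 1) * s) = s/16" using \<eta>(2) by (metis mult.assoc mult.commute mult_1 times_divide_eq_right)
      then show "\<eta> * norm (\<psi> ?a) \<le> s/16" "\<eta> * norm (\<psi> ?b) \<le> s/16"
        using mult_left_mono[OF na(1), of \<eta>] mult_left_mono[OF na(2), of \<eta>] less_imp_le[OF \<eta>(1)] by linarith+
    qed
    have z1: "norm (z - \<psi> ?a - ?x) \<le> \<eta> * norm (\<psi> ?a)"
      using mul_close_right(2)[OF d ad(1) xd] aD unfolding z_def by simp
    have zD: "?a \<otimes> \<sigma> ?x \<in> D0" using mul_closeD(3)[OF d ad(1) xd] aD by simp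
    have "\<eta> * 1 \<le> \<eta> * (C + 1)" using \<eta>(1) C(1) by (intro mult_left_mono) auto
    then have "\<eta> \<le> 1/16" using \<eta>(2) by linarith
    then have "\<eta> * norm (\<psi> ?a) \<le> 1 * norm (\<psi> ?a)" by (intro mult_right_mono) auto
    then have "norm z \<le> norm ?x + 2 * norm (\<psi> ?a)"
      using z1 norm_triangle_sub[of "z - \<psi> ?a" ?x] norm_triangle_sub[of z "\<psi> ?a"] by linarith
    then have zd: "norm z < d" using elim n(2) unfolding m_def by linarith
    have y1: "norm (y - z - \<psi> ?b) \<le> \<eta> * norm (\<psi> ?b)"
      using mul_close_right(1)[OF d zd ad(2)] aD zD unfolding y_def z_def by simp
    have yD: "?a \<otimes> \<sigma> ?x \<otimes> ?b \<in> D0" using mul_closeD(3)[OF d zd ad(2)] aD zD unfolding z_def by simp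
    have pw: "s *\<^sub>R p1 w + s *\<^sub>R p2 w = - (s *\<^sub>R w)" using p[OF wG] by (metis scaleR_add_right scaleR_minus_right)
    have "y - (?x - s *\<^sub>R w) = (y - z - \<psi> ?b) + ((z - \<psi> ?a - ?x) + ((\<psi> ?a - s *\<^sub>R p1 w) + (\<psi> ?b - s *\<^sub>R p2 w)))
        + (s *\<^sub>R p1 w + s *\<^sub>R p2 w) + s *\<^sub>R w" by (simp add: algebra_simps)
    also have "\<dots> = (y - z - \<psi> ?b) + ((z - \<psi> ?a - ?x) + ((\<psi> ?a - s *\<^sub>R p1 w) + (\<psi> ?b - s *\<^sub>R p2 w)))"
      unfolding pw by simp
    also have "norm \<dots> \<le> norm (y - z - \<psi> ?b) + (norm (z - \<psi> ?a - ?x) + (norm (\<psi> ?a - s *\<^sub>R p1 w) + norm (\<psi> ?b - s *\<^sub>R p2 w)))"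
      by (intro norm_triangle_le add_left_mono) simp_all
    also have "\<dots> \<le> s/16 + (s/16 + (1/16 * s + 1/16 * s))" using y1 z1 \<eta>s elim by linarith
    finally have y2: "norm (y - (?x - s *\<^sub>R w)) \<le> s/4" by simp
    \<comment> \<open>\<open>u m\<close> is a unit vector, so the first summand has length
      \<open>norm ?x - s\<close>, and the second has length at most \<open>s/4\<close>. With the
      error \<open>s/4\<close> above, the distance drops by at least \<open>s/2\<close>.\<close>
    have "?x - s *\<^sub>R w = (norm ?x - s) *\<^sub>R u m + s *\<^sub>R (u m - w)"
      unfolding u_def using nx by (simp add: algebra_simps)
    then have "norm (?x - s *\<^sub>R w) \<le> norm ((norm ?x - s) *\<^sub>R u m) + norm (s *\<^sub>R (u m - w))"
      by (metis norm_triangle_ineq)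
    also have "\<dots> \<le> (norm ?x - s) + s * (1/4)"
      using elim n(1) nx unfolding m_def[symmetric] u_def by (intro add_mono) auto
    finally have "norm y \<le> norm ?x - s/2" using y2 norm_triangle_sub[of y "?x - s *\<^sub>R w"] by simp
    then have "norm y < norm ?x" using elim by simp
    moreover have "\<sigma> y \<in> S m" using elim(1) yD unfolding y_def by simp
    ultimately show False using x(3)[of y m] by simp
  qed
  then show False by simp
qed

end

section \<open>The adjoint representation\<close>

context complex_lie_gp
begin

lemma atlas_chart: "c \<in> atlas (mfd L) ==> topological_chart (ltop L) c"
  using complex_manifold_chart[OF mfd] .

lemma continuous_left_mult: "g \<in> carrier L ==> continuous_map (ltop L) (ltop L) (\<lambda>h. g \<otimes> h)"
  using continuous_map_compose[OF _ cont_mult, of "ltop L" "\<lambda>h. (g, h)"] carrier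
  by (simp add: continuous_map_pairwise o_def)

lemma continuous_right_mult: "g \<in> carrier L ==> continuous_map (ltop L) (ltop L) (\<lambda>h. h \<otimes> g)"
  using continuous_map_compose[OF _ cont_mult, of "ltop L" "\<lambda>h. (h, g)"] carrier
  by (simp add: continuous_map_pairwise o_def)

text \<open>Conjugation is a left translation followed by a right translation, both slices of the
  holomorphic product.\<close>

lemma Ad_has_derivative:
  assumes g: "g \<in> carrier L"
  shows "(local_rep (id_chart L) (id_chart L) (\<lambda>h. g \<otimes> h \<otimes> inv g) has_derivative Ad L g) (at c1)"
    and "Ad L g (i_lie L v) = i_lie L (Ad L g v)"
proof -
  obtain d where d: "d \<in> atlas (mfd L)" "g \<in> fst d"
    using complex_manifold_chart_at[OF mfd] g carrier by metis
  have "complex_diff_at (mfd L) (mfd L) (\<lambda>h. (\<lambda>h. h \<otimes> inv g) (g \<otimes> h)) \<one>"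
  proof (rule complex_diff_at_compose[where F = "\<lambda>h. g \<otimes> h" and G = "\<lambda>h. h \<otimes> inv g"])
    show "complex_diff_at (mfd L) (mfd L) (\<lambda>h. g \<otimes> h) \<one>" using holomorphic_map_slice(2)[OF mfd mfd mfd holo_mult, of g \<one>] g unfolding carrier[symmetric] by simp
    show "complex_diff_at (mfd L) (mfd L) (\<lambda>h. h \<otimes> inv g) (g \<otimes> \<one>)" using holomorphic_map_slice(1)[OF mfd mfd mfd holo_mult, of g "inv g"] g unfolding carrier[symmetric] by simp
    show "continuous_map (ltop L) (ltop L) (\<lambda>h. g \<otimes> h)" using continuous_left_mult[OF g] .
    show "topological_chart (ltop L) c" if "c \<in> atlas (mfd L)" for c using atlas_chart[OF that] .
    show "d \<in> atlas (mfd L)" "topological_chart (ltop L) d" using d atlas_chart by auto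
    show "g \<otimes> \<one> \<in> fst d" using d g by simp
  qed
  then obtain D where D: "(local_rep (id_chart L) (id_chart L) (\<lambda>h. g \<otimes> h \<otimes> inv g) has_derivative D) (at c1)"
    "\<forall>v. D (i_lie L v) = i_lie L (D v)"
    using id_chart_atlas one_D0 g unfolding complex_diff_at_def by fastforce
  have "Ad L g = D" unfolding Ad_def using frechet_derivative_at[OF D(1)] by simp
  then show "(local_rep (id_chart L) (id_chart L) (\<lambda>h. g \<otimes> h \<otimes> inv g) has_derivative Ad L g) (at c1)"
    "Ad L g (i_lie L v) = i_lie L (Ad L g v)" using D by auto
qed

lemma Ad_linear: "g \<in> carrier L ==> linear (Ad L g)"
  using has_derivative_linear[OF Ad_has_derivative(1)] .

lemma Ad_bounded_linear: "g \<in> carrier L ==> bounded_linear (Ad L g)"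
  using has_derivative_bounded_linear[OF Ad_has_derivative(1)] .

lemma Exp_has_vector_derivative: "((\<lambda>t. \<phi> (ex t \<xi>)) has_vector_derivative \<xi>) (at 0)"
  using ops_Exp[of \<xi>] unfolding one_parameter_subgroup_def by blast

lemma ops_conj:
  assumes g: "g \<in> carrier L"
  shows "ops (Ad L g \<xi>) (\<lambda>t. g \<otimes> ex t \<xi> \<otimes> inv g)"
  unfolding one_parameter_subgroup_def
proof (intro conjI allI)
  have "continuous_map euclideanreal (ltop L) (\<lambda>t. ex t \<xi>)"
    using ops_Exp[of \<xi>] unfolding one_parameter_subgroup_def by blast
  then show "continuous_map euclideanreal (ltop L) (\<lambda>t. g \<otimes> ex t \<xi> \<otimes> inv g)"
    using continuous_map_compose[OF continuous_map_compose[OF _ continuous_left_mult[OF g]] continuous_right_mult[of "inv g"]] g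
    by (auto simp: o_def)
  show "g \<otimes> ex (s + t) \<xi> \<otimes> inv g = g \<otimes> ex s \<xi> \<otimes> inv g \<otimes> (g \<otimes> ex t \<xi> \<otimes> inv g)" for s t
  proof -
    have "g \<otimes> ex s \<xi> \<otimes> inv g \<otimes> (g \<otimes> ex t \<xi> \<otimes> inv g) = g \<otimes> ex s \<xi> \<otimes> (inv g \<otimes> g) \<otimes> ex t \<xi> \<otimes> inv g"
      using g by (simp only: m_assoc m_closed inv_closed Exp_carrier)
    then show ?thesis using g unfolding Exp_add by (simp add: m_assoc)
  qed
  show "g \<otimes> ex 0 \<xi> \<otimes> inv g = \<one>" using g by simp
  have ev: "\<forall>\<^sub>F t in at 0. ex t \<xi> \<in> D0"
  proof -
    have "limL (\<lambda>t. ex t \<xi>) (ex 0 \<xi>) (at 0)" by (intro limitin_Exp tendsto_intros)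
    then show ?thesis unfolding scaleR_zero_left Exp_zero limitin_one by blast
  qed
  show "((\<lambda>t. \<phi> (g \<otimes> ex t \<xi> \<otimes> inv g)) has_vector_derivative Ad L g \<xi>) (at 0)"
    by (rule complex_diff_at_curve[OF Ad_has_derivative(1)[OF g] _ Exp_has_vector_derivative ev id_chart one_D0]) simp
qed

lemma Ad_Exp: "g \<in> carrier L ==> Exp (Ad L g \<xi>) = g \<otimes> Exp \<xi> \<otimes> inv g"
  using ops_eq_Exp[OF ops_conj[of g \<xi>], of 1] by simp

lemma Ad_Exp_scale: "g \<in> carrier L ==> ex t (Ad L g \<xi>) = g \<otimes> ex t \<xi> \<otimes> inv g"
  using Ad_Exp[of g "t *\<^sub>R \<xi>"] linear_scale[OF Ad_linear, of g t \<xi>] by simp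

text \<open>A one-parameter subgroup determines its velocity. Identities for \<open>Ad\<close> are
  proved below by comparing the one-parameter subgroups generated by the two sides.\<close>

lemma Exp_inject:
  assumes "\<And>t. ex t \<xi> = ex t \<eta>"
  shows "\<xi> = \<eta>"
  using vector_derivative_unique_at[OF Exp_has_vector_derivative[of \<xi>]] Exp_has_vector_derivative[of \<eta>] assms by simp

lemma Ad_mult:
  assumes "g \<in> carrier L" "h \<in> carrier L"
  shows "Ad L (g \<otimes> h) \<xi> = Ad L g (Ad L h \<xi>)"
  by (rule Exp_inject) (use assms in \<open>simp add: Ad_Exp_scale m_assoc inv_mult_group\<close>)

lemma Ad_one [simp]: "Ad L \<one> \<xi> = \<xi>"
  by (rule Exp_inject) (simp add: Ad_Exp_scale)

lemma Ad_inv: "g \<in> carrier L ==> Ad L (inv g) (Ad L g \<xi>) = \<xi>" "g \<in> carrier L ==> Ad L g (Ad L (inv g) \<xi>) = \<xi>"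
  using Ad_mult[of "inv g" g \<xi>] Ad_mult[of g "inv g" \<xi>] by auto

text \<open>The conjugation estimate at the points \<open>ex (1 / real (Suc n)) \<xi>\<close>,
  multiplied by \<open>real (Suc n)\<close>, becomes in the limit an estimate for the linear
  map.\<close>

lemma Ad_close:
  assumes e: "\<epsilon> > 0"
  obtains \<delta> where "\<delta> > 0" "\<forall>a \<xi>. norm a < \<delta> --> a \<in> E0 \<and> norm (Ad L (\<sigma> a) \<xi> - \<xi>) \<le> \<epsilon> * norm \<xi>"
proof -
  obtain \<delta> where d: "\<delta> > 0" "\<And>a x. norm a < \<delta> ==> norm x < \<delta> ==> a \<in> E0 \<and> x \<in> E0 \<and>
     \<sigma> a \<otimes> \<sigma> x \<otimes> inv (\<sigma> a) \<in> D0 \<and> norm (\<psi> (\<sigma> a \<otimes> \<sigma> x \<otimes> inv (\<sigma> a)) - x) \<le> \<epsilon> * norm x"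
    using conj_close[OF e] by blast
  show ?thesis
  proof (rule that[OF d(1)], intro allI impI conjI)
    fix a \<xi> :: 'e assume a: "norm a < \<delta>"
    show aE: "a \<in> E0" using d(2)[OF a, of 0] d(1) by simp
    have g: "\<sigma> a \<in> carrier L" by (rule sigma_carrier[OF aE])
    let ?r = "\<lambda>n. 1 / real (Suc n)"
    have r: "?r \<longlonglongrightarrow> 0" "\<forall>\<^sub>F n in sequentially. ?r n > 0" using LIMSEQ_Suc[OF lim_const_over_n[of 1]] by simp_all
    have v: "\<forall>\<^sub>F n in sequentially. ex (?r n) \<zeta> \<in> D0" "(\<lambda>n. real (Suc n) *\<^sub>R \<psi> (ex (?r n) \<zeta>)) \<longlonglongrightarrow> \<zeta>" for \<zeta>
      using tang_lim[OF r(2) Exp_tang[OF r order_refl] tendsto_const, of \<zeta>] by simp_all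
    have "(\<lambda>n. ?r n *\<^sub>R (real (Suc n) *\<^sub>R \<psi> (ex (?r n) \<xi>))) \<longlonglongrightarrow> 0 *\<^sub>R \<xi>" by (intro tendsto_scaleR r v)
    then have "(\<lambda>n. norm (\<psi> (ex (?r n) \<xi>))) \<longlonglongrightarrow> 0" by (simp add: tendsto_norm_zero)
    from order_tendstoD(2)[OF this d(1)] v(1)[of \<xi>]
    have ev: "\<forall>\<^sub>F n in sequentially. norm (real (Suc n) *\<^sub>R \<psi> (ex (?r n) (Ad L (\<sigma> a) \<xi>)) - real (Suc n) *\<^sub>R \<psi> (ex (?r n) \<xi>))
        \<le> \<epsilon> * norm (real (Suc n) *\<^sub>R \<psi> (ex (?r n) \<xi>))"
    proof eventually_elim
      case (elim n)
      let ?x = "\<psi> (ex (?r n) \<xi>)"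
      have "norm (\<psi> (ex (?r n) (Ad L (\<sigma> a) \<xi>)) - ?x) \<le> \<epsilon> * norm ?x"
        using d(2)[OF a elim(1)] elim(2) unfolding Ad_Exp_scale[OF g] by simp
      then have "real (Suc n) * norm (\<psi> (ex (?r n) (Ad L (\<sigma> a) \<xi>)) - ?x) \<le> real (Suc n) * (\<epsilon> * norm ?x)"
        by (intro mult_left_mono) auto
      then show ?case unfolding scaleR_diff_right[symmetric] norm_scaleR by (simp add: mult_ac)
    qed
    show "norm (Ad L (\<sigma> a) \<xi> - \<xi>) \<le> \<epsilon> * norm \<xi>"
      by (rule tendsto_le[OF sequentially_bot _ _ ev]) (intro tendsto_intros v)+
  qed
qed

lemma Ad_tendsto_one:
  assumes "limL f \<one> F" "(v \<longlongrightarrow> w) F"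
  shows "((\<lambda>n. Ad L (f n) (v n)) \<longlongrightarrow> w) F"
proof -
  have "((\<lambda>n. Ad L (f n) (v n) - v n) \<longlongrightarrow> 0) F"
  proof (rule tendstoI)
    fix e :: real assume e: "e > 0"
    have p: "norm w + 1 > 0" using norm_ge_zero[of w] by linarith
    then have "e / (norm w + 1) > 0" using e by simp
    then obtain d where d: "d > 0" "\<forall>a \<xi>. norm a < d --> a \<in> E0 \<and> norm (Ad L (\<sigma> a) \<xi> - \<xi>) \<le> e / (norm w + 1) * norm \<xi>"
      by (rule Ad_close)
    have 1: "\<forall>\<^sub>F n in F. f n \<in> D0" and 2: "((\<lambda>n. \<psi> (f n)) \<longlongrightarrow> 0) F" using assms(1) unfolding limitin_one by auto
    have 3: "\<forall>\<^sub>F n in F. norm (v n) < norm w + 1" using order_tendstoD(2)[OF tendsto_norm[OF assms(2)], of "norm w + 1"] by simp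
    from 1 tendstoD[OF 2 d(1)] 3 show "\<forall>\<^sub>F n in F. dist (Ad L (f n) (v n) - v n) 0 < e"
    proof eventually_elim
      case (elim n)
      then have "norm (Ad L (f n) (v n) - v n) \<le> e / (norm w + 1) * norm (v n)" using d(2)[rule_format, of "\<psi> (f n)" "v n"] by simp
      also have "\<dots> < e / (norm w + 1) * (norm w + 1)" using elim(3) e p by (intro mult_strict_left_mono) auto
      also have "\<dots> = e" using p by simp
      finally show ?case by simp
    qed
  qed
  from tendsto_add[OF this assms(2)] show ?thesis by simp
qed

text \<open>The homomorphism property carries continuity at the identity to
  \<open>a\<close>.\<close>

lemma Ad_tendsto:
  assumes "limL f a F" "(v \<longlongrightarrow> w) F"
  shows "((\<lambda>n. Ad L (f n) (v n)) \<longlongrightarrow> Ad L a w) F"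
proof -
  have a: "a \<in> carrier L" using limitin_carrier[OF assms(1)] .
  have l1: "limL (\<lambda>n. inv a \<otimes> f n) \<one> F"
    using limitin_mult[OF limitin_constL[of "inv a"] assms(1)] a by simp
  have "openin (ltop L) (carrier L)" unfolding carrier by simp
  then have ev: "\<forall>\<^sub>F n in F. f n \<in> carrier L" using assms(1) a limitinD by metis
  have "((\<lambda>n. Ad L a (Ad L (inv a \<otimes> f n) (v n))) \<longlongrightarrow> Ad L a w) F"
    by (rule bounded_linear.tendsto[OF Ad_bounded_linear[OF a] Ad_tendsto_one[OF l1 assms(2)]])
  moreover have "\<forall>\<^sub>F n in F. Ad L a (Ad L (inv a \<otimes> f n) (v n)) = Ad L (f n) (v n)"
    using ev by eventually_elim (use a in \<open>simp add: Ad_mult Ad_inv\<close>)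
  ultimately show ?thesis by (rule Lim_transform_eventually)
qed

end

lemma has_vector_derivative_seq:
  fixes f :: "real => 'a::real_normed_vector"
  assumes "(f has_vector_derivative f') (at 0)"
  shows "(\<lambda>n. real (Suc n) *\<^sub>R (f (1 / real (Suc n)) - f 0)) \<longlonglongrightarrow> f'"
proof -
  have "filterlim (\<lambda>n. 1 / real (Suc n)) (at 0) sequentially"
    unfolding filterlim_at using LIMSEQ_Suc[OF lim_const_over_n[of 1]] by simp
  from filterlim_compose[OF assms[unfolded has_vector_derivative_quotient] this] show ?thesis
    by (simp add: divide_inverse)
qed

section \<open>The Lie bracket as derivative of the adjoint representation\<close>

context complex_lie_gp
begin

definition d2_12 :: "'e => 'e \<times> 'e => 'e" where
  "d2_12 v = frechet_derivative (\<lambda>P. frechet_derivative mult_rep (at P) (0, v)) (at (c1, c1))"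

definition d2_21 :: "'e => 'e \<times> 'e => 'e" where
  "d2_21 v = frechet_derivative (\<lambda>P. frechet_derivative mult_rep (at P) (v, 0)) (at (c1, c1))"

text \<open>The Lie bracket in coordinates, the antisymmetrised mixed second derivative of the
  product at the identity. In this form it is visibly linear in \<open>\<xi>\<close>; linearity in
  \<open>v\<close> follows once it is recognised as the derivative of \<open>Ad\<close>.\<close>

definition bracket :: "'e => 'e => 'e" where
  "bracket \<xi> v = d2_12 v (\<xi>, 0) - d2_21 v (0, \<xi>)"

lemma d2_has_derivative:
  "((\<lambda>P. frechet_derivative mult_rep (at P) (0, v)) has_derivative d2_12 v) (at (c1, c1))"
  "((\<lambda>P. frechet_derivative mult_rep (at P) (v, 0)) has_derivative d2_21 v) (at (c1, c1))"
  using Ck_mult_rep[of "Suc (Suc 0)"] one_mult_dom unfolding d2_12_def d2_21_def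
  by (auto simp: frechet_derivative_works[symmetric])

lemma mult_rep_differentiable: "P \<in> mult_dom ==> mult_rep differentiable (at P)"
  using Ck_mult_rep[of "Suc 0"] by auto

lemma mult_domI:
  assumes "x \<in> E0" shows "(x + c1, c1) \<in> mult_dom" "(c1, x + c1) \<in> mult_dom"
proof -
  have 1: "\<phi> (\<sigma> x) = x + c1" using psi_sigma[OF assms] unfolding \<psi>_def by (simp add: diff_eq_eq)
  have 2: "\<sigma> x \<in> D0" "\<sigma> x \<in> carrier L" using sigma_D0[OF assms] D0_carrier by auto
  show "(x + c1, c1) \<in> mult_dom" unfolding mult_dom_def using 1 2 one_D0 by (intro image_eqI[of _ _ "(\<sigma> x, \<one>)"]) auto
  show "(c1, x + c1) \<in> mult_dom" unfolding mult_dom_def using 1 2 one_D0 by (intro image_eqI[of _ _ "(\<one>, \<sigma> x)"]) auto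
qed

text \<open>The velocities at \<open>\<sigma> x\<close> of
  \<open>\<sigma> x \<otimes> ex t v\<close> and of \<open>ex t v \<otimes> \<sigma> x\<close>: the
  left-invariant and the right-invariant vector field of \<open>v\<close>.\<close>

abbreviation dR :: "'e => 'e => 'e" where "dR x v \<equiv> frechet_derivative mult_rep (at (x + c1, c1)) (0, v)"
abbreviation dL :: "'e => 'e => 'e" where "dL x v \<equiv> frechet_derivative mult_rep (at (c1, x + c1)) (v, 0)"

lemma Exp_D0_eventually: "\<forall>\<^sub>F t in at 0. ex t \<xi> \<in> D0"
proof -
  have "limL (\<lambda>t. ex t \<xi>) (ex 0 \<xi>) (at 0)" by (intro limitin_Exp tendsto_intros)
  then show ?thesis unfolding scaleR_zero_left Exp_zero limitin_one by blast
qed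

lemma mult_curve:
  assumes p: "(p has_vector_derivative u) (at 0)" "p 0 \<in> E0" and q: "(q has_vector_derivative w) (at 0)" "q 0 \<in> E0"
    and dom: "(p 0 + c1, q 0 + c1) \<in> mult_dom"
  shows "((\<lambda>t::real. \<psi> (\<sigma> (p t) \<otimes> \<sigma> (q t))) has_vector_derivative
    frechet_derivative mult_rep (at (p 0 + c1, q 0 + c1)) (u, w)) (at 0)"
proof -
  have c: "((\<lambda>t. (p t + c1, q t + c1)) has_vector_derivative (u, w)) (at 0)"
    using p(1) q(1) by (intro has_vector_derivative_Pair) (simp_all add: has_vector_derivative_add_const)
  have D: "(mult_rep has_derivative frechet_derivative mult_rep (at (p 0 + c1, q 0 + c1))) (at (p 0 + c1, q 0 + c1))"
    using mult_rep_differentiable[OF dom] unfolding frechet_derivative_works .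
  have "((mult_rep \<circ> (\<lambda>t. (p t + c1, q t + c1))) has_vector_derivative
      frechet_derivative mult_rep (at (p 0 + c1, q 0 + c1)) (u, w)) (at 0)"
    by (rule vector_derivative_diff_chain_within[OF c has_derivative_at_withinI[OF D]])
  then have d: "((\<lambda>t. mult_rep (p t + c1, q t + c1) - c1) has_vector_derivative
      frechet_derivative mult_rep (at (p 0 + c1, q 0 + c1)) (u, w)) (at 0)"
    by (simp add: o_def has_vector_derivative_diff_const)
  have near: "\<forall>\<^sub>F t in at 0. f t \<in> E0" if "(f has_vector_derivative v) (at 0)" "f 0 \<in> E0" for f v
    using has_vector_derivative_continuous[OF that(1)] topological_tendstoD[OF _ E0_open that(2)]
    by (simp add: continuous_within)
  have eq: "mult_rep (x + c1, y + c1) - c1 = \<psi> (\<sigma> x \<otimes> \<sigma> y)" if "x \<in> E0" "y \<in> E0" for x y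
    using mult_rep_psi[OF sigma_D0[OF that(1)] sigma_D0[OF that(2)]] that by simp
  show ?thesis
    using d unfolding has_vector_derivative_def
    by (rule has_derivative_transform_eventually[OF _ eventually_mono[OF eventually_conj[OF near[OF p] near[OF q]]]])
      (use p q eq in auto)
qed

lemma psi_Exp_has_vector_derivative: "((\<lambda>t. \<psi> (ex t v)) has_vector_derivative v) (at 0)"
  using Exp_has_vector_derivative[of v] unfolding \<psi>_def by (simp add: has_vector_derivative_diff_const)

lemma mult_Exp:
  assumes x: "x \<in> E0"
  shows "((\<lambda>t. \<psi> (\<sigma> x \<otimes> ex t v)) has_vector_derivative dR x v) (at 0)"
    and "((\<lambda>t. \<psi> (ex t v \<otimes> \<sigma> x)) has_vector_derivative dL x v) (at 0)"
proof -
  have ev: "\<forall>\<^sub>F t in at 0. \<sigma> (\<psi> (ex t v)) = ex t v"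
    using Exp_D0_eventually[of v] by (rule eventually_mono) simp
  note m = mult_curve[OF has_vector_derivative_const x psi_Exp_has_vector_derivative[of v]]
    mult_curve[OF psi_Exp_has_vector_derivative[of v] _ has_vector_derivative_const x]
  have s: "((\<lambda>t. \<psi> (\<sigma> x \<otimes> \<sigma> (\<psi> (ex t v)))) has_vector_derivative dR x v) (at 0)"
    "((\<lambda>t. \<psi> (\<sigma> (\<psi> (ex t v)) \<otimes> \<sigma> x)) has_vector_derivative dL x v) (at 0)"
    using m mult_domI[OF x] by (simp_all add: zero_E0)
  show "((\<lambda>t. \<psi> (\<sigma> x \<otimes> ex t v)) has_vector_derivative dR x v) (at 0)"
    using s(1) unfolding has_vector_derivative_def
    by (rule has_derivative_transform_eventually[OF _ eventually_mono[OF ev]]) simp_all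
  show "((\<lambda>t. \<psi> (ex t v \<otimes> \<sigma> x)) has_vector_derivative dL x v) (at 0)"
    using s(2) unfolding has_vector_derivative_def
    by (rule has_derivative_transform_eventually[OF _ eventually_mono[OF ev]]) simp_all
qed

text \<open>Moving \<open>\<sigma> x\<close> past \<open>ex t v\<close> conjugates the latter;
  compare velocities. This expresses \<open>Ad\<close> through first derivatives of the product,
  which can be differentiated once more.\<close>

lemma dR_eq_dL: "x \<in> E0 ==> dR x v = dL x (Ad L (\<sigma> x) v)"
proof -
  assume x: "x \<in> E0"
  have g: "\<sigma> x \<in> carrier L" by (rule sigma_carrier[OF x])
  have "ex t (Ad L (\<sigma> x) v) \<otimes> \<sigma> x = \<sigma> x \<otimes> ex t v" for t
    unfolding Ad_Exp_scale[OF g] using g by (simp add: m_assoc)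
  then have "((\<lambda>t. \<psi> (\<sigma> x \<otimes> ex t v)) has_vector_derivative dL x (Ad L (\<sigma> x) v)) (at 0)"
    using mult_Exp(2)[OF x, of "Ad L (\<sigma> x) v"] by simp
  from vector_derivative_unique_at[OF mult_Exp(1)[OF x] this] show ?thesis .
qed

lemma dL_linear: "x \<in> E0 ==> linear (dL x)"
proof -
  assume "x \<in> E0"
  then have "linear (frechet_derivative mult_rep (at (c1, x + c1)))"
    using frechet_linear[OF mult_rep_differentiable] mult_domI(2) by blast
  then show ?thesis
    using linear_compose[of "\<lambda>v. (v, 0)" "frechet_derivative mult_rep (at (c1, x + c1))"] by (simp add: o_def linear_iff)
qed

text \<open>Near the identity \<open>dL x\<close> is almost the identity operator, so
  \<open>Ad\<close> can be isolated from \<open>dR_eq_dL\<close> up to a small error.\<close>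

lemma dL_close:
  assumes d: "mul_close \<epsilon> \<delta>" and nx: "norm x < \<delta>"
  shows "norm (dL x v - v) \<le> \<epsilon> * norm v"
proof -
  note x = mul_closeD(2)[OF d nx]
  have l: "((\<lambda>t. t *\<^sub>R v) has_vector_derivative v) (at 0)" by (auto intro!: derivative_eq_intros)
  have "((\<lambda>t. \<psi> (\<sigma> (t *\<^sub>R v) \<otimes> \<sigma> x)) has_vector_derivative dL x v) (at 0)"
    using mult_curve[OF l _ has_vector_derivative_const x] mult_domI(2)[OF x] by (simp add: zero_E0)
  then have lim: "((\<lambda>t. (\<psi> (\<sigma> (t *\<^sub>R v) \<otimes> \<sigma> x) - x) /\<^sub>R t - v) \<longlongrightarrow> dL x v - v) (at 0)"
    unfolding has_vector_derivative_quotient using sigma_carrier[OF x] x by (intro tendsto_diff) simp_all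
  have "((\<lambda>t. norm (t *\<^sub>R v)) \<longlongrightarrow> norm (0 *\<^sub>R v)) (at 0)" by (intro tendsto_intros)
  then have "\<forall>\<^sub>F t in at 0. norm (t *\<^sub>R v) < \<delta>" using order_tendstoD(2) mul_closeD(1)[OF d] by fastforce
  then have "\<forall>\<^sub>F t in at 0. norm ((\<psi> (\<sigma> (t *\<^sub>R v) \<otimes> \<sigma> x) - x) /\<^sub>R t - v) \<le> \<epsilon> * norm v"
    using eventually_neq_at_within[of 0]
  proof eventually_elim
    case (elim t)
    have "(\<psi> (\<sigma> (t *\<^sub>R v) \<otimes> \<sigma> x) - x) /\<^sub>R t - v = (\<psi> (\<sigma> (t *\<^sub>R v) \<otimes> \<sigma> x) - t *\<^sub>R v - x) /\<^sub>R t"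
      using elim(2) by (simp add: algebra_simps)
    then show ?case using mul_close_right(2)[OF d elim(1) nx] elim(2) by (simp add: divide_simps mult_ac)
  qed
  then show ?thesis by (rule tendsto_upperbound[OF tendsto_norm[OF lim]]) simp
qed

text \<open>Differentiating \<open>dL x (Ad (\<sigma> x) v) = dR x v\<close> along \<open>x = \<psi> (exp (t \<xi>))\<close>.\<close>

lemma Ad_Exp_has_vector_derivative_0:
  "((\<lambda>t. Ad L (ex t \<xi>) v) has_vector_derivative bracket \<xi> v) (at 0)"
proof -
  define x where "x t = \<psi> (ex t \<xi>)" for t
  define g where "g t = dR (x t) v - dL (x t) v" for t
  define D where "D t = Ad L (ex t \<xi>) v - v" for t
  have x0: "x 0 = 0" unfolding x_def by simp
  have xd: "((\<lambda>t. x t + c1) has_vector_derivative \<xi>) (at 0)"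
    using psi_Exp_has_vector_derivative[of \<xi>] unfolding x_def by (simp add: has_vector_derivative_add_const)
  have "((\<lambda>t. (x t + c1, c1)) has_vector_derivative (\<xi>, 0)) (at 0)" "((\<lambda>t. (c1, x t + c1)) has_vector_derivative (0, \<xi>)) (at 0)"
    by (intro has_vector_derivative_Pair xd has_vector_derivative_const)+
  from vector_derivative_diff_chain_within[OF this(1) has_derivative_at_withinI, of _ "d2_12 v"]
    vector_derivative_diff_chain_within[OF this(2) has_derivative_at_withinI, of _ "d2_21 v"]
  have "(g has_vector_derivative bracket \<xi> v) (at 0)"
    unfolding g_def bracket_def using d2_has_derivative[of v] x0
    by (intro has_vector_derivative_diff) (simp_all add: o_def)
  moreover have "g 0 = 0" unfolding g_def x0 by (simp add: frechet_mult_rep)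
  ultimately have q: "((\<lambda>t. g t /\<^sub>R t) \<longlongrightarrow> bracket \<xi> v) (at 0)" unfolding has_vector_derivative_quotient by simp
  define K where "K = norm (bracket \<xi> v) + 1"
  have K: "K > 0" unfolding K_def by (simp add: add_nonneg_pos)
  have qK: "\<forall>\<^sub>F t in at 0. norm (g t /\<^sub>R t) < K" using order_tendstoD(2)[OF tendsto_norm[OF q]] unfolding K_def by simp
  have "((\<lambda>t. D t /\<^sub>R t - g t /\<^sub>R t) \<longlongrightarrow> 0) (at 0)"
  proof (rule tendstoI)
    fix e :: real assume e: "e > 0"
    \<comment> \<open>The bound \<open>1/2\<close> makes the norm of \<open>D t /\<^sub>R t\<close>
      at most twice that of \<open>g t /\<^sub>R t\<close>; the bound \<open>e / (4 * K)\<close>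
      then makes the error smaller than \<open>e\<close>.\<close>
    define \<epsilon> where "\<epsilon> = min (1/2) (e / (4 * K))"
    have eps: "\<epsilon> > 0" "\<epsilon> \<le> 1/2" unfolding \<epsilon>_def using e K by auto
    have "\<epsilon> * (4 * K) \<le> e / (4 * K) * (4 * K)" unfolding \<epsilon>_def using K by (intro mult_right_mono) auto
    then have epsK: "\<epsilon> * (4 * K) \<le> e" using K by simp
    obtain \<delta> where d: "mul_close \<epsilon> \<delta>" by (rule mul_close_exists[OF eps(1)])
    have "((\<lambda>t. norm (x t)) \<longlongrightarrow> norm (x 0)) (at 0)"
      using has_vector_derivative_continuous[OF psi_Exp_has_vector_derivative[of \<xi>]] unfolding x_def continuous_within by (intro tendsto_norm)
    then have "\<forall>\<^sub>F t in at 0. norm (x t) < \<delta>" using order_tendstoD(2) mul_closeD(1)[OF d] x0 by fastforce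
    then show "\<forall>\<^sub>F t in at 0. dist (D t /\<^sub>R t - g t /\<^sub>R t) 0 < e"
      using qK Exp_D0_eventually[of \<xi>]
    proof eventually_elim
      case (elim t)
      have xE: "x t \<in> E0" "\<sigma> (x t) = ex t \<xi>" using elim(3) psi_E0 unfolding x_def by auto
      \<comment> \<open>\<open>dR_eq_dL\<close> after subtracting \<open>dL (x t) v\<close>.\<close>
      have "dL (x t) (D t /\<^sub>R t) = g t /\<^sub>R t"
        by (simp only: g_def D_def dR_eq_dL[OF xE(1)] xE(2) linear_scale[OF dL_linear[OF xE(1)]] linear_diff[OF dL_linear[OF xE(1)]])
      then have n: "norm (g t /\<^sub>R t - D t /\<^sub>R t) \<le> \<epsilon> * norm (D t /\<^sub>R t)" using dL_close[OF d elim(1), of "D t /\<^sub>R t"] by simp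
      have "\<epsilon> * norm (D t /\<^sub>R t) \<le> 1/2 * norm (D t /\<^sub>R t)" using eps by (intro mult_right_mono) auto
      then have "norm (D t /\<^sub>R t) \<le> 2 * norm (g t /\<^sub>R t)"
        using n norm_triangle_sub[of "D t /\<^sub>R t" "g t /\<^sub>R t"] by (simp add: norm_minus_commute)
      then have "\<epsilon> * norm (D t /\<^sub>R t) \<le> \<epsilon> * (2 * K)" using eps(1) elim(2) by (intro mult_left_mono) auto
      then show ?case using n epsK e by (simp add: dist_norm norm_minus_commute)
    qed
  qed
  from tendsto_add[OF this q] show ?thesis unfolding has_vector_derivative_quotient D_def by simp
qed

lemma bracket_linear_right: "linear (bracket \<xi>)"
proof (rule linearI)
  show "bracket \<xi> (v + w) = bracket \<xi> v + bracket \<xi> w" for v w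
    by (rule vector_derivative_unique_at[OF Ad_Exp_has_vector_derivative_0])
      (use has_vector_derivative_add[OF Ad_Exp_has_vector_derivative_0[of \<xi> v] Ad_Exp_has_vector_derivative_0[of \<xi> w]]
       in \<open>simp add: linear_add[OF Ad_linear]\<close>)
  show "bracket \<xi> (r *\<^sub>R v) = r *\<^sub>R bracket \<xi> v" for r v
    by (rule vector_derivative_unique_at[OF Ad_Exp_has_vector_derivative_0])
      (use bounded_linear.has_vector_derivative[OF bounded_linear_scaleR_right[of r] Ad_Exp_has_vector_derivative_0[of \<xi> v]]
       in \<open>simp add: linear_scale[OF Ad_linear]\<close>)
qed

lemma bracket_linear_left: "linear (\<lambda>\<xi>. bracket \<xi> v)"
proof -
  note l = has_derivative_linear[OF d2_has_derivative(1)[of v]] has_derivative_linear[OF d2_has_derivative(2)[of v]]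
  have p: "linear (\<lambda>\<xi>::'e. (\<xi>, 0::'e))" "linear (\<lambda>\<xi>::'e. (0::'e, \<xi>))" by (auto intro!: linearI)
  show ?thesis
    unfolding bracket_def using linear_compose_sub[OF linear_compose[OF p(1) l(1)] linear_compose[OF p(2) l(2)]] by (simp add: o_def)
qed

lemma bracket_self: "bracket \<xi> \<xi> = 0"
proof -
  have "Ad L (ex t \<xi>) \<xi> = \<xi>" for t
  proof (rule Exp_inject)
    fix s
    have "ex t \<xi> \<otimes> ex s \<xi> = ex s \<xi> \<otimes> ex t \<xi>"
      by (simp add: Exp_add[symmetric] add.commute)
    then show "ex s (Ad L (ex t \<xi>) \<xi>) = ex s \<xi>" by (simp add: Ad_Exp_scale m_assoc)
  qed
  then show ?thesis
    using vector_derivative_unique_at[OF Ad_Exp_has_vector_derivative_0[of \<xi> \<xi>]] has_vector_derivative_const by simp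
qed

lemma bracket_antisym: "bracket \<xi> v = - bracket v \<xi>"
proof -
  have "bracket (\<xi> + v) (\<xi> + v) = bracket \<xi> v + bracket v \<xi>"
    unfolding linear_add[OF bracket_linear_left] linear_add[OF bracket_linear_right] by (simp add: bracket_self)
  then show ?thesis using bracket_self eq_neg_iff_add_eq_0 by metis
qed

lemma i_lie_bounded_linear: "bounded_linear (i_lie L)"
  by (rule finite_dimensional_bounded_linear[OF fd i_mult_facts(1)[OF mfd]])

lemma bracket_i_right: "bracket \<xi> (i_lie L v) = i_lie L (bracket \<xi> v)"
  by (rule vector_derivative_unique_at[OF Ad_Exp_has_vector_derivative_0])
    (use bounded_linear.has_vector_derivative[OF i_lie_bounded_linear Ad_Exp_has_vector_derivative_0[of \<xi> v]]
     in \<open>simp add: Ad_has_derivative(2)\<close>)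

lemma bracket_i_left: "bracket (i_lie L \<xi>) v = i_lie L (bracket \<xi> v)"
  using bracket_antisym[of "i_lie L \<xi>" v] bracket_antisym[of \<xi> v] bracket_i_right[of v \<xi>] i_mult_facts(4)[OF mfd] by simp

lemma has_vector_derivative_shift:
  fixes f :: "real => 'a::real_normed_vector"
  assumes "((\<lambda>h. f (t + h)) has_vector_derivative f') (at 0)"
  shows "(f has_vector_derivative f') (at t)"
proof -
  have "((\<lambda>s. s - t) has_vector_derivative 1) (at t)"
    unfolding has_vector_derivative_def by (auto intro!: derivative_eq_intros)
  from vector_diff_chain_at[OF this, of "\<lambda>h. f (t + h)" f'] assms show ?thesis by (simp add: o_def)
qed

lemma Ad_Exp_has_vector_derivative:
  "((\<lambda>t. Ad L (ex t \<xi>) v) has_vector_derivative Ad L (ex t \<xi>) (bracket \<xi> v)) (at t)"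
  "((\<lambda>t. Ad L (ex t \<xi>) v) has_vector_derivative bracket \<xi> (Ad L (ex t \<xi>) v)) (at t)"
proof -
  have 1: "Ad L (ex (t + h) \<xi>) v = Ad L (ex t \<xi>) (Ad L (ex h \<xi>) v)" for h
    unfolding Exp_add by (simp add: Ad_mult)
  have 2: "Ad L (ex (t + h) \<xi>) v = Ad L (ex h \<xi>) (Ad L (ex t \<xi>) v)" for h
    unfolding add.commute[of t h] Exp_add by (simp add: Ad_mult)
  show "((\<lambda>t. Ad L (ex t \<xi>) v) has_vector_derivative Ad L (ex t \<xi>) (bracket \<xi> v)) (at t)"
    by (rule has_vector_derivative_shift, unfold 1)
      (intro bounded_linear.has_vector_derivative[OF Ad_bounded_linear] Ad_Exp_has_vector_derivative_0 Exp_carrier)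
  show "((\<lambda>t. Ad L (ex t \<xi>) v) has_vector_derivative bracket \<xi> (Ad L (ex t \<xi>) v)) (at t)"
    by (rule has_vector_derivative_shift, unfold 2) (rule Ad_Exp_has_vector_derivative_0)
qed

lemma Ad_lie_algebra:
  assumes "subgroup H L" "g \<in> H" "\<xi> \<in> lie_algebra L H"
  shows "Ad L g \<xi> \<in> lie_algebra L H"
proof -
  have g: "g \<in> carrier L" using subgroup.mem_carrier[OF assms(1,2)] .
  have "g \<otimes> ex t \<xi> \<otimes> inv g \<in> H" for t
    using assms(2,3) unfolding lie_algebra_def
    by (intro subgroup.m_closed[OF assms(1)] subgroup.m_inv_closed[OF assms(1)]) auto
  then show ?thesis unfolding lie_algebra_def by (simp add: Ad_Exp_scale[OF g])
qed

text \<open>The difference quotients of \<open>Ad L (ex t \<xi>) v\<close> lie in the Lie algebra, a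
  closed subspace.\<close>

lemma bracket_lie_algebra:
  assumes H: "closedin (ltop L) H" "subgroup H L" and "\<xi> \<in> lie_algebra L H" "v \<in> lie_algebra L H"
  shows "bracket \<xi> v \<in> lie_algebra L H"
proof -
  have sub: "subspace (lie_algebra L H)" by (rule lie_algebra_subspace[OF H])
  have cl: "closed (lie_algebra L H)" by (rule finite_dimensional_closed_subspace[OF fd sub])
  let ?f = "\<lambda>n. real (Suc n) *\<^sub>R (Ad L (ex (1 / real (Suc n)) \<xi>) v - Ad L (ex 0 \<xi>) v)"
  have lim: "?f \<longlonglongrightarrow> bracket \<xi> v"
    by (rule has_vector_derivative_seq[OF Ad_Exp_has_vector_derivative_0])
  have "Ad L (ex t \<xi>) v \<in> lie_algebra L H" for t
    using Ad_lie_algebra[OF H(2) _ assms(4)] assms(3) unfolding lie_algebra_def by blast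
  then have mem: "\<forall>n. ?f n \<in> lie_algebra L H" by (intro allI subspace_scale[OF sub] subspace_diff[OF sub])
  show ?thesis
    by (rule cl[unfolded closed_sequential_limits, THEN spec, of ?f, THEN spec, THEN mp, OF conjI[OF mem lim]])
qed

end

section \<open>Self-adjoint operators on finite-dimensional spaces\<close>

text \<open>The inner product is a function beside the norm of the model space;
  \<open>bounded_bilinear_IP\<close> and \<open>IP_lower_bound\<close> show the two to be
  equivalent.\<close>

locale fd_inner =
  fixes IP :: "'e::real_normed_vector => 'e => real"
  assumes fd_space: "finite_dimensional TYPE('e)"
    and IP_sym: "IP x y = IP y x"
    and IP_add_left: "IP (x + y) z = IP x z + IP y z"
    and IP_scale_left: "IP (r *\<^sub>R x) z = r * IP x z"
    and IP_pos: "x \<noteq> 0 ==> IP x x > 0"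
begin

lemma IP_add_right: "IP x (y + z) = IP x y + IP x z"
  using IP_add_left[of y z x] by (simp add: IP_sym[of x])

lemma IP_scale_right: "IP x (r *\<^sub>R y) = r * IP x y"
  using IP_scale_left[of r y x] by (simp add: IP_sym[of x])

lemma IP_zero [simp]: "IP 0 x = 0" "IP x 0 = 0"
  using IP_scale_left[of 0 0 x] IP_scale_right[of x 0 0] by auto

lemma IP_minus: "IP (- x) y = - IP x y" "IP x (- y) = - IP x y"
  using IP_scale_left[of "-1" x y] IP_scale_right[of x "-1" y] by auto

lemma IP_diff: "IP (x - y) z = IP x z - IP y z" "IP z (x - y) = IP z x - IP z y"
  using IP_add_left[of x "- y" z] IP_add_right[of z x "- y"] IP_minus by auto

lemma IP_sum: "IP (\<Sum>i\<in>I. f i) z = (\<Sum>i\<in>I. IP (f i) z)"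
  by (induction I rule: infinite_finite_induct) (simp_all add: IP_add_left)

lemma IP_nonneg: "IP x x \<ge> 0"
  using IP_pos[of x] by (cases "x = 0") auto

lemma IP_eq_0: "IP x x = 0 ==> x = 0"
  using IP_pos[of x] by force

lemma bounded_bilinear_IP: "bounded_bilinear IP"
proof -
  have bl: "bounded_linear (\<lambda>x. IP x y)" for y
    by (rule finite_dimensional_bounded_linear[OF fd_space]) (simp add: linear_iff IP_add_left IP_scale_left)
  obtain B :: "'e set" where B: "finite B" "independent B" "span B = UNIV"
    using finite_dimensional_basis[OF fd_space] .
  obtain C where C: "C > 0" "\<And>c. (\<Sum>b\<in>B. \<bar>c b\<bar>) \<le> C * norm (\<Sum>b\<in>B. c b *\<^sub>R b)"
    using coordinates_bounded[OF B(1,2)] by blast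
  have "\<exists>K. \<forall>x. norm (IP x b) \<le> norm x * K" for b using bounded_linear.bounded[OF bl] .
  then obtain K where K: "\<And>b x. norm (IP x b) \<le> norm x * K b" by metis
  define M where "M = (\<Sum>b\<in>B. \<bar>K b\<bar>)"
  show ?thesis
  proof
    show "IP (a + a') b = IP a b + IP a' b" "IP a (b + b') = IP a b + IP a b'" "IP (r *\<^sub>R a) b = r *\<^sub>R IP a b"
      "IP a (r *\<^sub>R b) = r *\<^sub>R IP a b" for a a' b b' r
      by (simp_all add: IP_add_left IP_add_right IP_scale_left IP_scale_right)
    show "\<exists>K. \<forall>a b. norm (IP a b) \<le> norm a * norm b * K"
    proof (intro exI allI)
      fix a v
      define c where "c = representation B v"
      have v: "v = (\<Sum>b\<in>B. c b *\<^sub>R b)" unfolding c_def by (rule finite_dimensional_coordinates[OF B])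
      have "IP a v = (\<Sum>b\<in>B. c b * IP a b)"
        by (subst v) (simp add: IP_sym[of a] IP_sum IP_scale_left)
      then have "norm (IP a v) \<le> (\<Sum>b\<in>B. \<bar>c b\<bar> * \<bar>IP a b\<bar>)" by (simp add: abs_mult[symmetric])
      also have "\<dots> \<le> (\<Sum>b\<in>B. \<bar>c b\<bar> * (norm a * M))"
      proof (intro sum_mono mult_left_mono)
        fix b assume b: "b \<in> B"
        have "\<bar>IP a b\<bar> \<le> norm a * K b" using K[of a b] by simp
        also have "\<dots> \<le> norm a * \<bar>K b\<bar>" by (intro mult_left_mono) auto
        also have "\<dots> \<le> norm a * M" unfolding M_def using b B(1) by (intro mult_left_mono member_le_sum) auto
        finally show "\<bar>IP a b\<bar> \<le> norm a * M" .
      qed auto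
      also have "\<dots> = (\<Sum>b\<in>B. \<bar>c b\<bar>) * (norm a * M)" by (simp add: sum_distrib_right)
      also have "\<dots> \<le> (C * norm v) * (norm a * M)"
        using C(2)[of c] v unfolding M_def by (intro mult_right_mono mult_nonneg_nonneg sum_nonneg) auto
      finally show "norm (IP a v) \<le> norm a * norm v * (C * M)" by (simp add: mult_ac)
    qed
  qed
qed

lemma continuous_IP: "continuous_on S (\<lambda>x. IP x x)"
  using bounded_bilinear.continuous_on[OF bounded_bilinear_IP continuous_on_id continuous_on_id] .

lemma IP_lower_bound:
  obtains m where "m > 0" "\<forall>x. IP x x \<ge> m * (norm x)\<^sup>2"
proof (cases "\<exists>x::'e. x \<noteq> 0")
  case False
  then have z: "x = 0" for x :: 'e by blast
  have "1 * (norm x)\<^sup>2 \<le> IP x x" for x unfolding z[of x] by simp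
  then show ?thesis by (intro that[of 1]) auto
next
  case True
  then obtain x0 :: 'e where x0: "x0 \<noteq> 0" by blast
  have "closed {x :: 'e. norm x = 1}" by (intro closed_Collect_eq continuous_intros)
  from compact_Int_closed[OF finite_dimensional_compact_cball[OF fd_space, of 0 1] this]
  have "compact (sphere (0::'e) 1)" by (rule back_subst[of compact]) auto
  moreover have "x0 /\<^sub>R norm x0 \<in> sphere 0 1" using x0 by simp
  ultimately obtain y where y: "y \<in> sphere 0 1" "\<And>x. x \<in> sphere 0 1 ==> IP y y \<le> IP x x"
    using continuous_attains_inf[of "sphere (0::'e) 1" "\<lambda>x. IP x x"] continuous_IP by blast
  have p: "IP y y > 0" using y(1) by (intro IP_pos) auto
  have "IP x x \<ge> IP y y * (norm x)\<^sup>2" for x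
  proof (cases "x = 0")
    case False
    then have "IP y y \<le> IP (x /\<^sub>R norm x) (x /\<^sub>R norm x)" by (intro y(2)) simp
    also have "\<dots> = IP x x / (norm x)\<^sup>2" by (simp add: IP_scale_left IP_scale_right power2_eq_square divide_inverse)
    finally show ?thesis using False by (simp add: pos_le_divide_eq)
  qed simp
  then show ?thesis using that p by blast
qed

text \<open>A maximum of the quadratic form of \<open>A\<close> on the compact unit sphere of
  \<open>X\<close> is an eigenvector.\<close>

lemma eigenvector_exists:
  assumes X: "subspace X" "x0 \<in> X" "x0 \<noteq> 0" and A: "linear A" "\<And>x. x \<in> X ==> A x \<in> X"
    and sa: "\<And>x y. x \<in> X ==> y \<in> X ==> IP (A x) y = IP x (A y)"
  obtains v \<kappa> where "v \<in> X" "IP v v = 1" "A v = \<kappa> *\<^sub>R v"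
proof -
  have blA: "bounded_linear A" by (rule finite_dimensional_bounded_linear[OF fd_space A(1)])
  define S where "S = {x. IP x x = 1} \<inter> X"
  obtain m where m: "m > 0" "\<forall>x. IP x x \<ge> m * (norm x)\<^sup>2" by (rule IP_lower_bound)
  have "closed {x. IP x x = 1}" by (intro closed_Collect_eq continuous_IP continuous_on_const)
  then have "closed S" unfolding S_def using finite_dimensional_closed_subspace[OF fd_space X(1)] by blast
  moreover have "S \<subseteq> cball 0 (sqrt (1/m))"
  proof
    fix x assume "x \<in> S"
    then have "m * (norm x)\<^sup>2 \<le> 1" using m(2)[rule_format, of x] unfolding S_def by simp
    then have "(norm x)\<^sup>2 \<le> 1/m" using m(1) by (simp add: field_simps)
    then show "x \<in> cball 0 (sqrt (1/m))" by (simp add: real_le_rsqrt)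
  qed
  ultimately have "compact S"
    using finite_dimensional_compact_cball[OF fd_space, of 0 "sqrt (1/m)"] by (metis compact_Int_closed inf.absorb_iff2 inf_commute)
  moreover have "x0 /\<^sub>R sqrt (IP x0 x0) \<in> S"
    using X IP_pos[OF X(3)] unfolding S_def
    by (auto simp: IP_scale_left IP_scale_right subspace_scale divide_inverse[symmetric] field_simps)
  moreover have "continuous_on S (\<lambda>x. IP (A x) x)"
    using bounded_bilinear.continuous_on[OF bounded_bilinear_IP linear_continuous_on[OF blA] continuous_on_id] .
  ultimately obtain v where v: "v \<in> S" "\<And>x. x \<in> S ==> IP (A x) x \<le> IP (A v) v"
    using continuous_attains_sup[of S "\<lambda>x. IP (A x) x"] by blast
  define \<kappa> where "\<kappa> = IP (A v) v"
  have vX: "v \<in> X" "IP v v = 1" using v(1) unfolding S_def by auto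
  have le: "IP (A x) x \<le> \<kappa> * IP x x" if x: "x \<in> X" for x
  proof (cases "x = 0")
    case False
    have p: "IP x x > 0" by (rule IP_pos[OF False])
    define r where "r = inverse (sqrt (IP x x))"
    have r2: "r * r * IP x x = 1" using p unfolding r_def by (simp add: field_simps)
    have "r *\<^sub>R x \<in> S" unfolding S_def using r2 x X(1) by (simp add: IP_scale_left IP_scale_right subspace_scale mult.assoc)
    then have "IP (A (r *\<^sub>R x)) (r *\<^sub>R x) \<le> \<kappa>" unfolding \<kappa>_def by (rule v(2))
    then have "r * r * IP (A x) x \<le> \<kappa>" by (simp add: linear_scale[OF A(1)] IP_scale_left IP_scale_right mult.assoc)
    then have "r * r * IP (A x) x * IP x x \<le> \<kappa> * IP x x" using p by (intro mult_right_mono) auto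
    then show ?thesis using r2 by (metis (no_types, lifting) mult.assoc mult.commute mult_1)
  qed (simp add: linear_0[OF A(1)])
  \<comment> \<open>The residual of the eigenvalue equation, used as test direction: maximality at
    \<open>v\<close> gives \<open>quad\<close> for all \<open>t\<close>, which forces
    \<open>y\<close> to vanish.\<close>
  define y where "y = \<kappa> *\<^sub>R v - A v"
  have yX: "y \<in> X" unfolding y_def using vX(1) A(2) X(1) by (intro subspace_diff subspace_scale) auto
  define q where "q = \<kappa> * IP y y - IP (A y) y"
  have q: "q \<ge> 0" using le[OF yX] unfolding q_def by simp
  have e1: "IP (A y) v = IP (A v) y" using sa[OF yX vX(1)] IP_sym by simp
  have e2: "IP y v = IP v y" by (rule IP_sym)
  have quad: "0 \<le> 2 * t * IP y y + t\<^sup>2 * q" for t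
  proof -
    have "v + t *\<^sub>R y \<in> X" using vX(1) yX X(1) by (intro subspace_add subspace_scale) auto
    from le[OF this] have "0 \<le> \<kappa> * IP (v + t *\<^sub>R y) (v + t *\<^sub>R y) - IP (A (v + t *\<^sub>R y)) (v + t *\<^sub>R y)" by simp
    also have "\<dots> = (\<kappa> * IP v v - IP (A v) v) + 2 * t * (\<kappa> * IP v y - IP (A v) y) + t\<^sup>2 * q"
      unfolding q_def linear_add[OF A(1)] linear_scale[OF A(1)] IP_add_left IP_add_right IP_scale_left IP_scale_right
        e1 e2 by (simp add: algebra_simps power2_eq_square)
    also have "\<kappa> * IP v y - IP (A v) y = IP y y" unfolding y_def by (simp add: IP_diff IP_scale_left IP_scale_right algebra_simps)
    finally show ?thesis using vX(2) unfolding \<kappa>_def by simp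
  qed
  \<comment> \<open>Chosen so that \<open>quad\<close> at \<open>- s\<close> reads
    \<open>s\<^sup>2 * (q + 2) \<le> 0\<close>.\<close>
  define s where "s = IP y y / (q + 1)"
  have s: "IP y y = s * (q + 1)" unfolding s_def using q by simp
  have "s\<^sup>2 * (q + 2) \<le> 0" using quad[of "- s"] unfolding s by (simp add: power2_eq_square algebra_simps)
  then have "s = 0" using q by (simp add: mult_le_0_iff)
  then have "IP y y = 0" using s by simp
  then have "y = 0" by (rule IP_eq_0)
  then have "A v = \<kappa> *\<^sub>R v" unfolding y_def by simp
  then show ?thesis by (rule that[OF vX])
qed

definition orthonormal :: "'e set => bool" where
  "orthonormal B \<longleftrightarrow> (\<forall>b\<in>B. \<forall>c\<in>B. IP b c = (if b = c then 1 else 0))"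

lemma orthonormal_independent:
  assumes "orthonormal B" shows "independent B"
  unfolding independent_explicit_module
proof (intro allI impI)
  fix S u v assume S: "finite S" "S \<subseteq> B" "(\<Sum>v\<in>S. u v *\<^sub>R v) = 0" "v \<in> S"
  have "0 = IP (\<Sum>w\<in>S. u w *\<^sub>R w) v" using S(3) by simp
  also have "\<dots> = (\<Sum>w\<in>S. u w * IP w v)" by (simp add: IP_sum IP_scale_left)
  also have "\<dots> = (\<Sum>w\<in>S. if w = v then u w else 0)"
    using assms S(2,4) unfolding orthonormal_def by (intro sum.cong) (auto simp: subset_iff)
  also have "\<dots> = u v" using S(1,4) by simp
  finally show "u v = 0" by simp
qed

text \<open>By a maximal orthonormal system of eigenvectors.\<close>

lemma spectral:
  assumes V: "subspace V" and A: "linear A" "\<And>x. x \<in> V ==> A x \<in> V"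
    and sa: "\<And>x y. x \<in> V ==> y \<in> V ==> IP (A x) y = IP x (A y)"
  obtains B ev where "finite B" "B \<subseteq> V" "orthonormal B" "\<And>b. b \<in> B ==> A b = ev b *\<^sub>R b"
    "\<And>x. x \<in> V ==> x = (\<Sum>b\<in>B. IP x b *\<^sub>R b)"
proof -
  define P where "P B \<longleftrightarrow> finite B \<and> B \<subseteq> V \<and> orthonormal B \<and> (\<forall>b\<in>B. \<exists>c. A b = c *\<^sub>R b)" for B
  obtain D :: "'e set" where D: "finite D" "span D = UNIV" using fd_space unfolding finite_dimensional_def by blast
  have bound: "card B \<le> card D" if "P B" for B
    using independent_span_bound[OF D(1) orthonormal_independent, of B] D(2) that unfolding P_def by simp
  have "P {}" unfolding P_def orthonormal_def by simp
  moreover have "\<forall>y. P y --> card y < Suc (card D)" using bound by (simp add: less_Suc_eq_le)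
  ultimately obtain B where B: "P B" "\<forall>B'. P B' --> card B' \<le> card B"
    using ex_has_greatest_nat[of P "{}" card "Suc (card D)"] by blast
  have fin: "finite B" and BV: "B \<subseteq> V" and on: "orthonormal B" and eig: "\<forall>b\<in>B. \<exists>c. A b = c *\<^sub>R b"
    using B(1) unfolding P_def by auto
  obtain ev where ev: "\<And>b. b \<in> B ==> A b = ev b *\<^sub>R b" using eig by metis
  \<comment> \<open>The orthogonal complement of the maximal system. It is stable under
    \<open>A\<close>, and an eigenvector in it would enlarge the system.\<close>
  define X where "X = {x\<in>V. \<forall>b\<in>B. IP x b = 0}"
  have subX: "subspace X" unfolding subspace_def X_def
    using V by (auto simp: subspace_def IP_add_left IP_scale_left)
  have AX: "A x \<in> X" if "x \<in> X" for x
    unfolding X_def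
  proof (intro CollectI conjI ballI)
    show "A x \<in> V" using that A(2) unfolding X_def by blast
    show "IP (A x) b = 0" if b: "b \<in> B" for b
      using sa[of x b] that \<open>x \<in> X\<close> BV b ev[OF b] unfolding X_def by (auto simp: IP_scale_right)
  qed
  have all: "x = (\<Sum>b\<in>B. IP x b *\<^sub>R b)" if x: "x \<in> V" for x
  proof (rule ccontr)
    assume ne: "x \<noteq> (\<Sum>b\<in>B. IP x b *\<^sub>R b)"
    define z where "z = x - (\<Sum>b\<in>B. IP x b *\<^sub>R b)"
    have z0: "z \<noteq> 0" using ne unfolding z_def by simp
    have zX: "z \<in> X" unfolding X_def
    proof (intro CollectI conjI ballI)
      show "z \<in> V" unfolding z_def using x BV V by (intro subspace_diff subspace_sum subspace_scale) auto
      fix b assume b: "b \<in> B"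
      have "IP (\<Sum>c\<in>B. IP x c *\<^sub>R c) b = (\<Sum>c\<in>B. IP x c * IP c b)" by (simp add: IP_sum IP_scale_left)
      also have "\<dots> = (\<Sum>c\<in>B. if c = b then IP x c else 0)"
        using on b unfolding orthonormal_def by (intro sum.cong) auto
      also have "\<dots> = IP x b" using fin b by simp
      finally show "IP z b = 0" unfolding z_def by (simp add: IP_diff)
    qed
    obtain v \<kappa> where v: "v \<in> X" "IP v v = 1" "A v = \<kappa> *\<^sub>R v"
      by (rule eigenvector_exists[OF subX zX z0 A(1) AX]) (use sa in \<open>auto simp: X_def\<close>)
    have vB: "v \<notin> B" using v(1,2) unfolding X_def by force
    have vb: "IP v b = 0" "IP b v = 0" if "b \<in> B" for b using v(1) that IP_sym[of b v] unfolding X_def by auto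
    have "orthonormal (insert v B)"
      unfolding orthonormal_def
    proof (intro ballI)
      fix b c assume "b \<in> insert v B" "c \<in> insert v B"
      then consider "b = v" "c = v" | "b = v" "c \<in> B" | "b \<in> B" "c = v" | "b \<in> B" "c \<in> B" by blast
      then show "IP b c = (if b = c then 1 else 0)"
        using vb v(2) vB on unfolding orthonormal_def by cases auto
    qed
    then have "P (insert v B)"
      unfolding P_def using fin BV eig v(1,3) unfolding X_def by blast
    from B(2)[rule_format, OF this] show False using fin vB by simp
  qed
  show ?thesis by (rule that[OF fin BV on ev all])
qed

end

section \<open>Compatible subgroups: the inner product and the grading by \<open>\<beta>\<close>\<close>

lemma has_vector_derivative_zero_const:
  fixes f :: "real => 'a::real_normed_vector"
  assumes "\<And>t. (f has_vector_derivative 0) (at t)"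
  shows "f t = f 0"
proof -
  have "\<exists>c. \<forall>x\<in>UNIV. f x = c"
    using assms unfolding has_vector_derivative_def by (intro has_derivative_zero_constant) auto
  then show ?thesis by auto
qed

context complex_lie_gp
begin

text \<open>Along a solution the vector \<open>Ad L (ex (- t) \<xi>) (w t)\<close> is constant. The
  product rule is carried out on difference quotients, from joint continuity of \<open>Ad\<close>
  and its derivative on a fixed vector.\<close>

lemma flow_unique:
  assumes w: "\<And>t. (w has_vector_derivative bracket \<xi> (w t)) (at t)"
  shows "w t = Ad L (ex t \<xi>) (w 0)"
proof -
  define v where "v t = Ad L (ex (- t) \<xi>) (w t)" for t
  have "(v has_vector_derivative 0) (at t)" for t
  proof (rule has_vector_derivative_shift)
    define u where "u h = w (t + h)" for h
    have "((\<lambda>h. t + h) has_vector_derivative 1) (at 0)"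
      unfolding has_vector_derivative_def by (auto intro!: derivative_eq_intros)
    from vector_diff_chain_at[OF this, of w] w[of t]
    have u: "(u has_vector_derivative bracket \<xi> (u 0)) (at 0)" unfolding u_def by (simp add: o_def)
    have veq: "v (t + h) = Ad L (ex (- t) \<xi>) (Ad L (ex (- h) \<xi>) (u h))" for h
    proof -
      have "- (t + h) = - t + - h" by simp
      then show ?thesis unfolding v_def u_def by (simp only: Exp_add Ad_mult[OF Exp_carrier Exp_carrier])
    qed
    have 1: "((\<lambda>h. (u h - u 0) /\<^sub>R h) \<longlongrightarrow> bracket \<xi> (u 0)) (at 0)" using u has_vector_derivative_quotient by blast
    have 2: "((\<lambda>h. (Ad L (ex h (- \<xi>)) (u 0) - Ad L (ex 0 (- \<xi>)) (u 0)) /\<^sub>R h) \<longlongrightarrow> bracket (- \<xi>) (u 0)) (at 0)"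
      using iffD1[OF has_vector_derivative_quotient Ad_Exp_has_vector_derivative_0[of "- \<xi>" "u 0"]] .
    have "limL (\<lambda>h. ex (- h) \<xi>) (ex (- 0) \<xi>) (at 0)" by (intro limitin_Exp tendsto_intros)
    then have l: "limL (\<lambda>h. ex (- h) \<xi>) \<one> (at 0)" by simp
    from tendsto_add[OF Ad_tendsto_one[OF l 1] 2]
    have "((\<lambda>h. Ad L (ex (- h) \<xi>) ((u h - u 0) /\<^sub>R h) + (Ad L (ex h (- \<xi>)) (u 0) - Ad L (ex 0 (- \<xi>)) (u 0)) /\<^sub>R h) \<longlongrightarrow> 0) (at 0)"
      using linear_neg[OF bracket_linear_left[of "u 0"], of \<xi>] by simp
    \<comment> \<open>The quotient splits into one with moving vector and one with moving group
      element.\<close>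
    moreover have "Ad L (ex (- h) \<xi>) ((u h - u 0) /\<^sub>R h) + (Ad L (ex h (- \<xi>)) (u 0) - Ad L (ex 0 (- \<xi>)) (u 0)) /\<^sub>R h
        = (Ad L (ex (- h) \<xi>) (u h) - Ad L (ex (- 0) \<xi>) (u 0)) /\<^sub>R h" for h
      by (simp add: linear_scale[OF Ad_linear] linear_diff[OF Ad_linear] scaleR_diff_right)
    ultimately have "((\<lambda>h. (Ad L (ex (- h) \<xi>) (u h) - Ad L (ex (- 0) \<xi>) (u 0)) /\<^sub>R h) \<longlongrightarrow> 0) (at 0)" by simp
    then have "((\<lambda>h. Ad L (ex (- h) \<xi>) (u h)) has_vector_derivative 0) (at 0)"
      using has_vector_derivative_quotient by blast
    from bounded_linear.has_vector_derivative[OF Ad_bounded_linear[of "ex (- t) \<xi>"] this]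
    show "((\<lambda>h. v (t + h)) has_vector_derivative 0) (at 0)"
      unfolding veq using linear_0[OF Ad_linear[of "ex (- t) \<xi>"]] by simp
  qed
  from has_vector_derivative_zero_const[OF this, of t] have "Ad L (ex (- t) \<xi>) (w t) = w 0" unfolding v_def by simp
  then have "Ad L (ex t \<xi>) (Ad L (inv (ex t \<xi>)) (w t)) = Ad L (ex t \<xi>) (w 0)"
    using Exp_neg[of "t *\<^sub>R \<xi>"] by simp
  then show ?thesis by (simp add: Ad_inv)
qed

end

section \<open>The real form \<uu>, the invariant inner product and the Cartan involution\<close>

locale compatible_pair = complex_lie_gp L
  for L :: "('g, 'e::real_normed_vector) lie_group" (structure) +
  fixes U G :: "'g set" and ip :: "'e => 'e => real"
  assumes complexification: "complexification L U"
    and compatible: "compatible_subgroup L U G"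
    and connected_G: "connectedin (ltop L) G"
    and invariant_ip: "invariant_inner_product L U ip"
begin

abbreviation lu :: "'e set" where "lu \<equiv> lie_algebra L U"
abbreviation lg :: "'e set" where "lg \<equiv> lie_algebra L G"
abbreviation lp :: "'e set" where "lp \<equiv> p_part L U G"
abbreviation J :: "'e => 'e" where "J \<equiv> i_lie L"

lemmas J = i_mult_facts[OF mfd]

lemma U_subgroup: "subgroup U L" and U_compact: "compactin (ltop L) U"
  and lu_direct: "lu \<inter> J ` lu = {0}" and lu_span: "\<exists>\<xi>\<in>lu. \<exists>\<eta>\<in>lu. \<zeta> = \<xi> + J \<eta>"
  using complexification unfolding complexification_def by blast+

lemma U_closed: "closedin (ltop L) U"
  using compactin_imp_closedin[OF Hausdorff U_compact] .

lemma G_subgroup: "subgroup G L" and G_closed: "closedin (ltop L) G"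
  using compatible unfolding compatible_subgroup_def by blast+

lemma G_carrier: "g \<in> G ==> g \<in> carrier L" and U_carrier: "g \<in> U ==> g \<in> carrier L"
  by (fact subgroup.mem_carrier[OF G_subgroup], fact subgroup.mem_carrier[OF U_subgroup])

lemma polar:
  assumes "g \<in> G" obtains k \<alpha> where "k \<in> G \<inter> U" "\<alpha> \<in> lp" "g = k \<otimes> Exp \<alpha>"
proof -
  have "bij_betw (\<lambda>(k, \<beta>). k \<otimes> Exp \<beta>) ((G \<inter> U) \<times> lp) G"
    using compatible unfolding compatible_subgroup_def polar_decomposition_def diffeomorphism_on_def by blast
  then have "g \<in> (\<lambda>(k, \<beta>). k \<otimes> Exp \<beta>) ` ((G \<inter> U) \<times> lp)" using assms unfolding bij_betw_def by blast
  then obtain x where x: "x \<in> (G \<inter> U) \<times> lp" "g = (\<lambda>(k, \<beta>). k \<otimes> Exp \<beta>) x" by blast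
  show ?thesis by (rule that[of "fst x" "snd x"]) (use x in \<open>auto simp: mem_Times_iff case_prod_beta\<close>)
qed

lemma lu_subspace: "subspace lu" by (rule lie_algebra_subspace[OF U_closed U_subgroup])
lemma lg_subspace: "subspace lg" by (rule lie_algebra_subspace[OF G_closed G_subgroup])
lemma lp_lg: "\<alpha> \<in> lp ==> \<alpha> \<in> lg" and lp_Jlu: "\<alpha> \<in> lp ==> \<alpha> \<in> J ` lu" unfolding p_part_def by auto

lemma lu_unique:
  assumes "\<xi> \<in> lu" "\<eta> \<in> lu" "\<xi>' \<in> lu" "\<eta>' \<in> lu" "\<xi> + J \<eta> = \<xi>' + J \<eta>'"
  shows "\<xi> = \<xi>' \<and> \<eta> = \<eta>'"
proof -
  have "\<xi> - \<xi>' = J \<eta>' - J \<eta>" using assms(5) by (simp add: algebra_simps)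
  also have "\<dots> = J (\<eta>' - \<eta>)" by (rule linear_diff[OF J(1), symmetric])
  finally have e: "\<xi> - \<xi>' = J (\<eta>' - \<eta>)" .
  have "\<xi> - \<xi>' \<in> lu" "\<eta>' - \<eta> \<in> lu" using assms lu_subspace by (auto intro: subspace_diff)
  then have "\<xi> - \<xi>' \<in> lu \<inter> J ` lu" using e by blast
  then have 0: "\<xi> - \<xi>' = 0" using lu_direct by simp
  then have "J (J (\<eta>' - \<eta>)) = 0" using e J(3) by simp
  then show ?thesis using 0 J(2) by simp
qed

text \<open>\<open>re\<close> and \<open>im\<close> are the components with respect to the real form
  \<uu>.\<close>

definition re :: "'e => 'e" where "re \<zeta> = (THE \<xi>. \<xi> \<in> lu \<and> (\<exists>\<eta>\<in>lu. \<zeta> = \<xi> + J \<eta>))"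
definition im :: "'e => 'e" where "im \<zeta> = re (- J \<zeta>)"

lemma reI: "\<xi> \<in> lu ==> \<eta> \<in> lu ==> re (\<xi> + J \<eta>) = \<xi>"
  unfolding re_def by (rule the_equality) (use lu_unique in blast)+

lemma imI: "\<xi> \<in> lu ==> \<eta> \<in> lu ==> im (\<xi> + J \<eta>) = \<eta>"
  unfolding im_def using reI[of \<eta> "- \<xi>"] subspace_neg[OF lu_subspace, of \<xi>] by (simp add: J)

lemma reim: "re \<zeta> \<in> lu" "im \<zeta> \<in> lu" "\<zeta> = re \<zeta> + J (im \<zeta>)"
proof -
  obtain \<xi> \<eta> where "\<xi> \<in> lu" "\<eta> \<in> lu" "\<zeta> = \<xi> + J \<eta>" using lu_span by blast
  then show "re \<zeta> \<in> lu" "im \<zeta> \<in> lu" "\<zeta> = re \<zeta> + J (im \<zeta>)" using reI imI by auto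
qed

lemma reim_eqI: "\<xi> \<in> lu ==> \<eta> \<in> lu ==> \<zeta> = \<xi> + J \<eta> ==> re \<zeta> = \<xi> \<and> im \<zeta> = \<eta>"
  using reI imI by blast

lemma reim_add: "re (a + b) = re a + re b" "im (a + b) = im a + im b"
proof -
  have "a + b = (re a + J (im a)) + (re b + J (im b))" using reim(3) by metis
  then have "a + b = (re a + re b) + J (im a + im b)" by (simp add: J(5) algebra_simps)
  then show "re (a + b) = re a + re b" "im (a + b) = im a + im b"
    using reim_eqI[of "re a + re b" "im a + im b" "a + b"] reim(1,2) subspace_add[OF lu_subspace] by auto
qed

lemma reim_scale: "re (r *\<^sub>R a) = r *\<^sub>R re a" "im (r *\<^sub>R a) = r *\<^sub>R im a"
proof -
  have "r *\<^sub>R a = r *\<^sub>R (re a + J (im a))" using reim(3) by metis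
  then have "r *\<^sub>R a = r *\<^sub>R re a + J (r *\<^sub>R im a)" by (simp add: J(6) algebra_simps)
  then show "re (r *\<^sub>R a) = r *\<^sub>R re a" "im (r *\<^sub>R a) = r *\<^sub>R im a"
    using reim_eqI[of "r *\<^sub>R re a" "r *\<^sub>R im a" "r *\<^sub>R a"] reim(1,2) subspace_scale[OF lu_subspace] by auto
qed

lemma reim_J: "re (J a) = - im a" "im (J a) = re a"
proof -
  have "J a = J (re a + J (im a))" using reim(3) by metis
  then have "J a = - im a + J (re a)" by (simp add: J algebra_simps)
  then show "re (J a) = - im a" "im (J a) = re a"
    using reim_eqI[of "- im a" "re a" "J a"] reim(1,2) subspace_neg[OF lu_subspace] by auto
qed

text \<open>The extension of \<open>ip\<close> for which \<uu> and i \<uu> are orthogonal and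
  \<open>J\<close> is an isometry; on i \<uu> it is the transported inner product. Brackets with
  \<uu> are skew for it, brackets with i \<uu> symmetric.\<close>

definition IP :: "'e => 'e => real" where "IP a b = ip (re a) (re b) + ip (im a) (im b)"

lemma ip_facts:
  assumes "\<xi> \<in> lu" "\<eta> \<in> lu" "\<zeta> \<in> lu"
  shows "ip \<xi> \<eta> = ip \<eta> \<xi>" "ip (\<xi> + \<eta>) \<zeta> = ip \<xi> \<zeta> + ip \<eta> \<zeta>" "ip (r *\<^sub>R \<xi>) \<zeta> = r * ip \<xi> \<zeta>" "\<xi> \<noteq> 0 ==> ip \<xi> \<xi> > 0"
    "u \<in> U ==> ip (Ad L u \<xi>) (Ad L u \<eta>) = ip \<xi> \<eta>" "ip 0 \<zeta> = 0"
proof -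
  have lin: "ip (a *\<^sub>R \<xi> + b *\<^sub>R \<eta>) \<zeta> = a * ip \<xi> \<zeta> + b * ip \<eta> \<zeta>" for a b
    using invariant_ip assms unfolding invariant_inner_product_def by blast
  show "ip (\<xi> + \<eta>) \<zeta> = ip \<xi> \<zeta> + ip \<eta> \<zeta>" "ip (r *\<^sub>R \<xi>) \<zeta> = r * ip \<xi> \<zeta>" "ip 0 \<zeta> = 0"
    using lin[of 1 1] lin[of r 0] lin[of 0 0] by auto
  show "ip \<xi> \<eta> = ip \<eta> \<xi>" "\<xi> \<noteq> 0 ==> ip \<xi> \<xi> > 0" "u \<in> U ==> ip (Ad L u \<xi>) (Ad L u \<eta>) = ip \<xi> \<eta>"
    using invariant_ip assms unfolding invariant_inner_product_def by blast+
qed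

sublocale IP: fd_inner IP
proof
  show "finite_dimensional TYPE('e)" by (rule fd)
  show "IP x y = IP y x" for x y unfolding IP_def using ip_facts(1)[OF reim(1) reim(1) reim(1)] ip_facts(1)[OF reim(2) reim(2) reim(2)] by metis
  show "IP (x + y) z = IP x z + IP y z" for x y z
    unfolding IP_def reim_add using ip_facts(2)[OF reim(1) reim(1) reim(1)] ip_facts(2)[OF reim(2) reim(2) reim(2)] by simp
  show "IP (r *\<^sub>R x) z = r * IP x z" for r x z
    unfolding IP_def reim_scale using ip_facts(3)[OF reim(1) reim(1) reim(1)] ip_facts(3)[OF reim(2) reim(2) reim(2)]
    by (simp add: distrib_left)
  show "IP x x > 0" if "x \<noteq> 0" for x
  proof -
    have nn: "ip \<xi> \<xi> \<ge> 0" if "\<xi> \<in> lu" for \<xi>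
      using ip_facts(4)[OF that that that] ip_facts(6)[OF that that that] by (cases "\<xi> = 0") auto
    have "re x \<noteq> 0 \<or> im x \<noteq> 0" using reim(3)[of x] that J(3) by auto
    then show ?thesis
      unfolding IP_def using ip_facts(4)[OF reim(1) reim(1) reim(1), of x] ip_facts(4)[OF reim(2) reim(2) reim(2), of x]
        nn[OF reim(1), of x] nn[OF reim(2), of x] by auto
  qed
qed

text \<open>The conjugation with respect to \<uu>, that is, the Cartan involution.\<close>

definition \<tau> :: "'e => 'e" where "\<tau> a = re a - J (im a)"

lemma tau_add: "\<tau> (a + b) = \<tau> a + \<tau> b" and tau_scale: "\<tau> (r *\<^sub>R a) = r *\<^sub>R \<tau> a"
  unfolding \<tau>_def reim_add reim_scale J(5,6) by (simp_all add: algebra_simps)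

lemma tau_linear: "linear \<tau>" by (rule linearI) (simp_all add: tau_add tau_scale)

lemma tau_J: "\<tau> (J a) = - J (\<tau> a)"
  unfolding \<tau>_def reim_J using linear_diff[OF J(1)] by (simp add: J)

lemma Jlu_reim: "\<alpha> \<in> J ` lu ==> re \<alpha> = 0 \<and> im \<alpha> \<in> lu \<and> \<alpha> = J (im \<alpha>)"
  using reim_eqI[of 0] subspace_0[OF lu_subspace] by fastforce

lemma tau_Jlu: "\<alpha> \<in> J ` lu ==> \<tau> \<alpha> = - \<alpha>"
  using Jlu_reim[of \<alpha>] unfolding \<tau>_def by force

lemma Ad_lu: "u \<in> U ==> \<xi> \<in> lu ==> Ad L u \<xi> \<in> lu"
  using Ad_lie_algebra[OF U_subgroup] .

lemma Ad_Jlu: "u \<in> U ==> \<alpha> \<in> J ` lu ==> Ad L u \<alpha> \<in> J ` lu"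
  using Ad_lu U_carrier by (auto simp: Ad_has_derivative(2))

lemma Ad_reim:
  assumes u: "u \<in> U" shows "re (Ad L u a) = Ad L u (re a)" "im (Ad L u a) = Ad L u (im a)"
proof -
  have c: "u \<in> carrier L" using U_carrier[OF u] .
  have "Ad L u a = Ad L u (re a + J (im a))" using reim(3) by metis
  also have "\<dots> = Ad L u (re a) + J (Ad L u (im a))" by (simp add: linear_add[OF Ad_linear[OF c]] Ad_has_derivative(2)[OF c])
  finally show "re (Ad L u a) = Ad L u (re a)" "im (Ad L u a) = Ad L u (im a)"
    using reim_eqI[OF Ad_lu[OF u reim(1)] Ad_lu[OF u reim(2)]] by blast+
qed

lemma IP_Ad: "u \<in> U ==> IP (Ad L u a) (Ad L u b) = IP a b"
  unfolding IP_def Ad_reim using ip_facts(5)[OF reim(1) reim(1) reim(1)] ip_facts(5)[OF reim(2) reim(2) reim(2)] by simp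

text \<open>Derivative at time 0 of the invariance of \<open>IP\<close> under
  \<open>Ad L (ex t \<xi>)\<close>.\<close>

lemma IP_bracket_lu:
  assumes "\<xi> \<in> lu" shows "IP (bracket \<xi> a) b = - IP a (bracket \<xi> b)"
proof -
  have "IP (Ad L (ex t \<xi>) a) (Ad L (ex t \<xi>) b) = IP a b" for t
    using IP_Ad assms unfolding lie_algebra_def by blast
  moreover have "((\<lambda>t. IP (Ad L (ex t \<xi>) a) (Ad L (ex t \<xi>) b)) has_vector_derivative
      (IP (Ad L (ex 0 \<xi>) a) (bracket \<xi> b) + IP (bracket \<xi> a) (Ad L (ex 0 \<xi>) b))) (at 0)"
    by (intro bounded_bilinear.has_vector_derivative[OF IP.bounded_bilinear_IP] Ad_Exp_has_vector_derivative_0)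
  ultimately have "((\<lambda>t::real. IP a b) has_vector_derivative (IP a (bracket \<xi> b) + IP (bracket \<xi> a) b)) (at 0)" by simp
  from vector_derivative_unique_at[OF this has_vector_derivative_const] show ?thesis by simp
qed

lemma bracket_lu: "\<xi> \<in> lu ==> \<eta> \<in> lu ==> bracket \<xi> \<eta> \<in> lu"
  using bracket_lie_algebra[OF U_closed U_subgroup] .

lemma bracket_reim:
  assumes "\<xi> \<in> lu" shows "re (bracket \<xi> a) = bracket \<xi> (re a)" "im (bracket \<xi> a) = bracket \<xi> (im a)"
proof -
  have "bracket \<xi> a = bracket \<xi> (re a + J (im a))" using reim(3) by metis
  also have "\<dots> = bracket \<xi> (re a) + J (bracket \<xi> (im a))" by (simp add: linear_add[OF bracket_linear_right] bracket_i_right)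
  finally show "re (bracket \<xi> a) = bracket \<xi> (re a)" "im (bracket \<xi> a) = bracket \<xi> (im a)"
    using reim_eqI[OF bracket_lu[OF assms reim(1)] bracket_lu[OF assms reim(2)]] by blast+
qed

lemma IP_J: "IP (J a) b = - IP a (J b)"
proof -
  have "ip (- x) y = - ip x y" if "x \<in> lu" "y \<in> lu" for x y
    using ip_facts(3)[OF that(1,1) that(2), of "-1"] by simp
  moreover have "ip x (- y) = - ip x y" if "x \<in> lu" "y \<in> lu" for x y
    using calculation[OF that(2,1)] ip_facts(1)[OF that that(1)] ip_facts(1)[OF that(1) subspace_neg[OF lu_subspace that(2)] that(1)] by simp
  ultimately show ?thesis unfolding IP_def reim_J using reim by simp
qed

text \<open>For \<open>\<alpha> = J \<eta>\<close> the signs from the skew operators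
  \<open>J\<close> and \<open>bracket \<eta>\<close> cancel. This is why
  \<open>bracket \<beta>\<close> is diagonalisable with real eigenvalues.\<close>

lemma IP_bracket_Jlu:
  assumes "\<alpha> \<in> J ` lu" shows "IP (bracket \<alpha> a) b = IP a (bracket \<alpha> b)"
proof -
  obtain \<eta> where \<eta>: "\<eta> \<in> lu" "\<alpha> = J \<eta>" using assms by blast
  have "IP (bracket \<alpha> a) b = - IP (bracket \<eta> a) (J b)" unfolding \<eta>(2) bracket_i_left IP_J ..
  also have "\<dots> = IP a (J (bracket \<eta> b))" unfolding IP_bracket_lu[OF \<eta>(1)] bracket_i_right by simp
  finally show ?thesis unfolding \<eta>(2) bracket_i_left .
qed

lemma tau_bracket_Jlu:
  assumes "\<alpha> \<in> J ` lu" shows "\<tau> (bracket \<alpha> a) = - bracket \<alpha> (\<tau> a)"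
proof -
  obtain \<eta> where \<eta>: "\<eta> \<in> lu" "\<alpha> = J \<eta>" using assms by blast
  have "\<tau> (bracket \<eta> a) = bracket \<eta> (\<tau> a)"
    unfolding \<tau>_def bracket_reim[OF \<eta>(1)] by (simp add: linear_diff[OF bracket_linear_right] bracket_i_right)
  then show ?thesis unfolding \<eta>(2) bracket_i_left tau_J by simp
qed

text \<open>\<open>\<tau>\<close> anticommutes with \<open>bracket \<alpha>\<close>, so it carries
  the flow of \<open>\<alpha>\<close> to the flow of \<open>- \<alpha>\<close>.\<close>

lemma tau_Ad_Exp:
  assumes "\<alpha> \<in> J ` lu" shows "\<tau> (Ad L (ex t \<alpha>) a) = Ad L (ex (- t) \<alpha>) (\<tau> a)"
proof -
  have bl: "bounded_linear \<tau>" by (rule finite_dimensional_bounded_linear[OF fd tau_linear])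
  define w where "w t = \<tau> (Ad L (ex t \<alpha>) a)" for t
  have "(w has_vector_derivative bracket (- \<alpha>) (w t)) (at t)" for t
    using bounded_linear.has_vector_derivative[OF bl Ad_Exp_has_vector_derivative(2)[of \<alpha> a t]]
    unfolding w_def tau_bracket_Jlu[OF assms] linear_neg[OF bracket_linear_left] .
  from flow_unique[OF this, of t] show ?thesis unfolding w_def by simp
qed

text \<open>If the second argument is moved backwards in time, the two symmetric brackets cancel and
  the pairing stays constant.\<close>

lemma IP_Ad_Exp:
  assumes "\<alpha> \<in> J ` lu" shows "IP (Ad L (ex t \<alpha>) a) b = IP a (Ad L (ex t \<alpha>) b)"
proof -
  define b' where "b' = Ad L (ex t \<alpha>) b"
  define h where "h s = IP (Ad L (ex s \<alpha>) a) (Ad L (ex s (- \<alpha>)) b')" for s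
  have "(h has_vector_derivative 0) (at s)" for s
  proof -
    have "(h has_vector_derivative (IP (Ad L (ex s \<alpha>) a) (bracket (- \<alpha>) (Ad L (ex s (- \<alpha>)) b'))
       + IP (bracket \<alpha> (Ad L (ex s \<alpha>) a)) (Ad L (ex s (- \<alpha>)) b'))) (at s)"
      unfolding h_def
      by (intro bounded_bilinear.has_vector_derivative[OF IP.bounded_bilinear_IP] Ad_Exp_has_vector_derivative(2))
    then show ?thesis unfolding linear_neg[OF bracket_linear_left] IP_bracket_Jlu[OF assms] IP.IP_minus by simp
  qed
  from has_vector_derivative_zero_const[OF this, of t]
  have "IP (Ad L (ex t \<alpha>) a) (Ad L (inv (ex t \<alpha>)) b') = IP a b'"
    unfolding h_def using Exp_neg[of "t *\<^sub>R \<alpha>"] by simp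
  then show ?thesis unfolding b'_def by (simp add: Ad_inv)
qed

text \<open>\<open>F s\<close> is positive, being the square of the self-adjoint
  \<open>F (s/2)\<close>, and a positive operator whose square fixes \<open>\<beta>\<close> fixes
  \<open>\<beta>\<close>. The proof expands two squares and uses no eigenvectors.\<close>

lemma Ad_Exp_half:
  assumes \<alpha>: "\<alpha> \<in> J ` lu" and fix2: "Ad L (ex (2 * s) \<alpha>) \<beta> = \<beta>"
  shows "Ad L (ex s \<alpha>) \<beta> = \<beta>"
proof -
  define F where "F r = Ad L (ex r \<alpha>)" for r
  have F_add: "F (r + r') x = F r (F r' x)" for r r' x unfolding F_def Exp_add by (simp add: Ad_mult)
  have F_sa: "IP (F r x) y = IP x (F r y)" for r x y unfolding F_def by (rule IP_Ad_Exp[OF \<alpha>])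
  have F0: "F 0 x = x" for x unfolding F_def by simp
  have F2: "F (2 * s) \<beta> = \<beta>" using fix2 unfolding F_def .
  have Fm: "F (- s) \<beta> = F s \<beta>" using F_add[of "-s" "2 * s" \<beta>] F2 by simp
  define N where "N = IP \<beta> \<beta>" define c where "c = IP (F s \<beta>) \<beta>"
  have sq: "IP (F r \<beta>) (F r \<beta>) = IP (F (r + r) \<beta>) \<beta>" for r
    unfolding F_add F_sa[of r "F r \<beta>" \<beta>] ..
  have 1: "IP (F s \<beta>) (F s \<beta>) = N" unfolding sq N_def using F2 by simp
  have 2: "IP (F (s/2) \<beta>) (F (s/2) \<beta>) = c" unfolding sq c_def by simp
  have 3: "IP (F (-(s/2)) \<beta>) (F (-(s/2)) \<beta>) = c" unfolding sq c_def using Fm by simp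
  have 4: "IP (F (s/2) \<beta>) (F (-(s/2)) \<beta>) = N" using F_sa[of "s/2" \<beta> "F (-(s/2)) \<beta>"] F_add[of "s/2" "-(s/2)" \<beta>] F0 unfolding N_def by simp
  \<comment> \<open>This square gives \<open>N \<le> c\<close>, while the square of
    \<open>F s \<beta> - \<beta>\<close> equals \<open>2 * N - 2 * c\<close>; so the latter is
    0.\<close>
  have "0 \<le> IP (F (s/2) \<beta> - F (-(s/2)) \<beta>) (F (s/2) \<beta> - F (-(s/2)) \<beta>)" by (rule IP.IP_nonneg)
  also have "\<dots> = 2 * c - 2 * N" using 2 3 4 IP.IP_sym[of "F (-(s/2)) \<beta>" "F (s/2) \<beta>"] by (simp add: IP.IP_diff)
  finally have cN: "N \<le> c" by simp
  have "IP (F s \<beta> - \<beta>) (F s \<beta> - \<beta>) = 2 * N - 2 * c"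
    using 1 IP.IP_sym[of \<beta> "F s \<beta>"] unfolding c_def N_def by (simp add: IP.IP_diff)
  then have "IP (F s \<beta> - \<beta>) (F s \<beta> - \<beta>) = 0" using cN IP.IP_nonneg[of "F s \<beta> - \<beta>"] by simp
  then show ?thesis using IP.IP_eq_0 unfolding F_def by fastforce
qed

lemma bracket_zero_imp_fixed: "bracket \<alpha> \<beta> = 0 ==> Ad L (ex s \<alpha>) \<beta> = \<beta>"
  using flow_unique[of "\<lambda>_. \<beta>" \<alpha> s] by simp

text \<open>The positive operators \<open>Ad (exp (s \<alpha>))\<close> fix \<open>\<beta>\<close> for \<open>s = 2\<close>, hence for all \<open>s = 2 / 2 ^ k\<close>.\<close>

lemma Ad_Exp_Jlu_fixed:
  assumes \<alpha>: "\<alpha> \<in> J ` lu" and \<beta>: "\<beta> \<in> J ` lu" and im: "Ad L (Exp \<alpha>) \<beta> \<in> J ` lu"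
  shows "bracket \<alpha> \<beta> = 0"
proof -
  \<comment> \<open>\<open>\<beta>\<close> and its image lie in i \<uu>, where \<open>\<tau>\<close>
    is - 1, and \<open>\<tau>\<close> reverses the flow. So the operator and its inverse agree on
    \<open>\<beta>\<close>.\<close>
  have "- Ad L (Exp \<alpha>) \<beta> = Ad L (Exp (- \<alpha>)) (- \<beta>)"
    using tau_Ad_Exp[OF \<alpha>, of 1 \<beta>] tau_Jlu[OF im] tau_Jlu[OF \<beta>] by simp
  then have "Ad L (Exp \<alpha>) \<beta> = Ad L (inv (Exp \<alpha>)) \<beta>" unfolding Exp_neg using linear_neg[OF Ad_linear[of "inv (Exp \<alpha>)"]] by simp
  then have "Ad L (Exp \<alpha>) (Ad L (Exp \<alpha>) \<beta>) = \<beta>" by (simp add: Ad_inv)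
  then have 2: "Ad L (ex 2 \<alpha>) \<beta> = \<beta>" using Exp_add[of 1 1 \<alpha>] by (simp add: Ad_mult)
  have dy: "Ad L (ex (1 / 2 ^ k) \<alpha>) \<beta> = \<beta>" for k :: nat
  proof (induction k)
    case 0
    then show ?case using Ad_Exp_half[OF \<alpha>, of 1 \<beta>] 2 by simp
  next
    case (Suc k)
    then show ?case using Ad_Exp_half[OF \<alpha>, of "1 / 2 ^ Suc k" \<beta>] by simp
  qed
  have lim: "(\<lambda>n. real (Suc n) *\<^sub>R (Ad L (ex (1 / real (Suc n)) \<alpha>) \<beta> - Ad L (ex 0 \<alpha>) \<beta>)) \<longlonglongrightarrow> bracket \<alpha> \<beta>"
    by (rule has_vector_derivative_seq[OF Ad_Exp_has_vector_derivative_0])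
  \<comment> \<open>The index \<open>2 ^ k - 1\<close> makes \<open>Suc n\<close> a power of
    2.\<close>
  have sm: "strict_mono (\<lambda>k. 2 ^ k - 1 :: nat)"
    by (rule strict_monoI_Suc) (simp add: diff_less_mono)
  have "real (Suc (2 ^ k - 1)) = 2 ^ k" for k by simp
  then have "(\<lambda>k::nat. 0) \<longlonglongrightarrow> bracket \<alpha> \<beta>"
    using LIMSEQ_subseq_LIMSEQ[OF lim sm] dy by (simp add: o_def)
  from LIMSEQ_unique[OF this tendsto_const] show ?thesis .
qed

end

section \<open>The conjugation flow\<close>

context complex_lie_gp
begin

lemma eigen_flow:
  assumes "bracket \<beta> b = c *\<^sub>R b"
  shows "Ad L (ex t \<beta>) b = exp (t * c) *\<^sub>R b"
proof -
  define w where "w t = exp (t * c) *\<^sub>R b" for t :: real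
  have "(w has_vector_derivative bracket \<beta> (w t)) (at t)" for t
    unfolding w_def linear_scale[OF bracket_linear_right] assms
    by (auto intro!: derivative_eq_intros simp: has_vector_derivative_def algebra_simps)
  from flow_unique[OF this, of t] show ?thesis unfolding w_def by simp
qed

text \<open>The flow whose limit at minus infinity occurs in \<open>parabolic_plus\<close>.\<close>

definition cj :: "'e => real => 'g => 'g" where
  "cj \<beta> t g = ex t \<beta> \<otimes> g \<otimes> ex (- t) \<beta>"

lemma Exp_neg_scale: "ex (- t) \<beta> = inv (ex t \<beta>)"
  using Exp_neg[of "t *\<^sub>R \<beta>"] by simp

lemma cj_carrier [simp]: "g \<in> carrier L ==> cj \<beta> t g \<in> carrier L"
  by (simp add: cj_def)

lemma cj_minus: "cj (- \<beta>) t g = cj \<beta> (- t) g"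
  by (simp add: cj_def)

lemma cj_one [simp]: "cj \<beta> t \<one> = \<one>"
  unfolding cj_def Exp_neg_scale by simp

lemma cj_mult: "g \<in> carrier L ==> h \<in> carrier L ==> cj \<beta> t (g \<otimes> h) = cj \<beta> t g \<otimes> cj \<beta> t h"
  unfolding cj_def Exp_neg_scale by (simp add: m_assoc inv_solve_left)

lemma cj_inv: "g \<in> carrier L ==> cj \<beta> t (inv g) = inv (cj \<beta> t g)"
  unfolding cj_def Exp_neg_scale by (simp add: m_assoc inv_mult_group)

lemma cj_cj: "g \<in> carrier L ==> cj \<beta> s (cj \<beta> t g) = cj \<beta> (s + t) g"
proof -
  assume g: "g \<in> carrier L"
  have "- (s + t) = - t + - s" by simp
  then have "ex (- (s + t)) \<beta> = ex (- t) \<beta> \<otimes> ex (- s) \<beta>" by (simp only: Exp_add)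
  then show ?thesis unfolding cj_def using g by (simp add: Exp_add m_assoc)
qed

lemma cj_zero [simp]: "g \<in> carrier L ==> cj \<beta> 0 g = g"
  by (simp add: cj_def)

lemma cj_Exp: "cj \<beta> t (Exp \<nu>) = Exp (Ad L (ex t \<beta>) \<nu>)"
  unfolding cj_def Exp_neg_scale by (simp add: Ad_Exp)

lemma cj_limitin: "limL f a F ==> limL (\<lambda>n. cj \<beta> t (f n)) (cj \<beta> t a) F"
  unfolding cj_def by (intro limitin_mult limitin_constL) auto

text \<open>Both sides say that \<open>h\<close> commutes with the one-parameter subgroup of
  \<open>\<beta>\<close>.\<close>

lemma cj_fixed: "h \<in> carrier L ==> (\<forall>t. cj \<beta> t h = h) \<longleftrightarrow> Ad L h \<beta> = \<beta>"
proof
  assume h: "h \<in> carrier L" and "\<forall>t. cj \<beta> t h = h"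
  then have e: "ex t \<beta> \<otimes> h \<otimes> inv (ex t \<beta>) = h" for t unfolding cj_def Exp_neg_scale by blast
  show "Ad L h \<beta> = \<beta>"
  proof (rule Exp_inject)
    fix t
    have "ex t \<beta> \<otimes> h = h \<otimes> ex t \<beta>" using e[of t] h by (metis Exp_carrier inv_solve_right m_closed)
    then show "ex t (Ad L h \<beta>) = ex t \<beta>" using h by (simp add: Ad_Exp_scale inv_solve_right')
  qed
next
  assume h: "h \<in> carrier L" and e: "Ad L h \<beta> = \<beta>"
  show "\<forall>t. cj \<beta> t h = h"
  proof
    fix t
    have "ex t \<beta> = h \<otimes> ex t \<beta> \<otimes> inv h" using Ad_Exp_scale[OF h, of t \<beta>] e by simp
    then have "ex t \<beta> \<otimes> h = h \<otimes> ex t \<beta>" using h by (metis Exp_carrier inv_solve_right m_closed)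
    then show "cj \<beta> t h = h" unfolding cj_def Exp_neg_scale using h by (simp add: inv_solve_right')
  qed
qed

lemma Ad_cj: "g \<in> carrier L ==> Ad L (cj \<beta> t g) (Ad L (ex t \<beta>) v) = Ad L (ex t \<beta>) (Ad L g v)"
  unfolding cj_def Exp_neg_scale by (simp add: Ad_mult Ad_inv)

end

context compatible_pair
begin

text \<open>For an orthonormal eigenbasis \<open>B\<close>, the sum of the eigenspaces in
  \<open>lg\<close> whose eigenvalue satisfies \<open>P\<close>, described by vanishing
  coordinates.\<close>

definition part :: "'e set => ('e => real) => (real => bool) => 'e set" where
  "part B ev P = {v \<in> lg. \<forall>b\<in>B. \<not> P (ev b) --> IP v b = 0}"

text \<open>The group R^- of elements contracted to the identity as time grows;
  \<open>Rm (- \<beta>)\<close> is R^+.\<close>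

definition Rm :: "'e => 'g set" where
  "Rm \<beta> = {u \<in> G. limL (\<lambda>t. cj \<beta> t u) \<one> at_top}"

definition Cent :: "'e => 'g set" where "Cent \<beta> = {h \<in> G. Ad L h \<beta> = \<beta>}"

lemma Exp_lg: "v \<in> lg ==> Exp v \<in> G"
  by (rule lie_algebra_Exp)

lemma lg_scale: "v \<in> lg ==> r *\<^sub>R v \<in> lg"
  by (rule lie_algebra_scale)

lemma Ad_lg: "g \<in> G ==> v \<in> lg ==> Ad L g v \<in> lg"
  by (rule Ad_lie_algebra[OF G_subgroup])

lemmas G_mult = subgroup.m_closed[OF G_subgroup]
lemmas G_inv = subgroup.m_inv_closed[OF G_subgroup]
lemmas G_one = subgroup.one_closed[OF G_subgroup]

lemma RmD: "u \<in> Rm \<beta> ==> u \<in> G" "u \<in> Rm \<beta> ==> limL (\<lambda>t. cj \<beta> t u) \<one> at_top"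
  and CentD: "h \<in> Cent \<beta> ==> h \<in> G" "h \<in> Cent \<beta> ==> Ad L h \<beta> = \<beta>"
  unfolding Rm_def Cent_def by auto

lemma Rm_mult: "u \<in> Rm \<beta> ==> v \<in> Rm \<beta> ==> u \<otimes> v \<in> Rm \<beta>"
proof -
  assume u: "u \<in> Rm \<beta>" and v: "v \<in> Rm \<beta>"
  have "limL (\<lambda>t. cj \<beta> t u \<otimes> cj \<beta> t v) (\<one> \<otimes> \<one>) at_top"
    by (rule limitin_mult[OF RmD(2)[OF u] RmD(2)[OF v]])
  then show ?thesis unfolding Rm_def using RmD(1)[OF u] RmD(1)[OF v] G_mult G_carrier by (simp add: cj_mult)
qed

lemma Rm_inv: "u \<in> Rm \<beta> ==> inv u \<in> Rm \<beta>"
proof -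
  assume u: "u \<in> Rm \<beta>"
  have "limL (\<lambda>t. inv (cj \<beta> t u)) (inv \<one>) at_top"
    by (rule limitin_inv[OF RmD(2)[OF u]])
  then show ?thesis unfolding Rm_def using RmD(1)[OF u] G_inv G_carrier by (simp add: cj_inv)
qed

lemma Rm_one: "\<one> \<in> Rm \<beta>"
  unfolding Rm_def using G_one limitin_constL[OF one_closed] by simp

lemma Cent_subgroup: "subgroup (Cent \<beta>) L"
proof (rule subgroupI)
  show "Cent \<beta> \<subseteq> carrier L" unfolding Cent_def using G_carrier by auto
  show "Cent \<beta> \<noteq> {}" unfolding Cent_def using G_one by auto
  show "inv a \<in> Cent \<beta>" if "a \<in> Cent \<beta>" for a
    using that Ad_inv(1)[of a \<beta>] G_carrier[of a] G_inv unfolding Cent_def by auto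
  show "a \<otimes> b \<in> Cent \<beta>" if "a \<in> Cent \<beta>" "b \<in> Cent \<beta>" for a b
    using that G_mult G_carrier[of a] G_carrier[of b] unfolding Cent_def by (auto simp: Ad_mult)
qed

lemma Cent_Rm: "h \<in> Cent \<beta> ==> u \<in> Rm \<beta> ==> h \<otimes> u \<otimes> inv h \<in> Rm \<beta>"
proof -
  assume h: "h \<in> Cent \<beta>" and u: "u \<in> Rm \<beta>"
  have hc: "h \<in> carrier L" "h \<in> G" and uc: "u \<in> carrier L" "u \<in> G" using CentD(1)[OF h] RmD(1)[OF u] G_carrier by auto
  have fx: "cj \<beta> t h = h" for t using cj_fixed[OF hc(1)] CentD(2)[OF h] by blast
  have "limL (\<lambda>t. h \<otimes> cj \<beta> t u \<otimes> inv h) (h \<otimes> \<one> \<otimes> inv h) at_top"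
    by (intro limitin_mult limitin_constL RmD(2)[OF u]) (use hc in auto)
  moreover have "cj \<beta> t (h \<otimes> u \<otimes> inv h) = h \<otimes> cj \<beta> t u \<otimes> inv h" for t
    using hc uc by (simp add: cj_mult cj_inv fx)
  moreover have "h \<otimes> \<one> \<otimes> inv h = \<one>" using hc by simp
  ultimately show ?thesis unfolding Rm_def using G_mult G_inv hc uc by simp
qed

lemma Rm_Cent_trivial: "u \<in> Rm \<beta> ==> u \<in> Cent \<beta> ==> u = \<one>"
proof -
  assume u: "u \<in> Rm \<beta>" and h: "u \<in> Cent \<beta>"
  have uc: "u \<in> carrier L" using RmD(1)[OF u] G_carrier by auto
  have "cj \<beta> t u = u" for t using cj_fixed[OF uc] CentD(2)[OF h] by blast
  then have "limL (\<lambda>t::real. u) \<one> at_top" using RmD(2)[OF u] by simp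
  from limitin_unique_L[OF limitin_constL[OF uc] this] show ?thesis by simp
qed

text \<open>For \<open>\<alpha> \<in> \<pp>\<close> the components of positive and negative weight are exchanged by \<open>- \<tau>\<close>.\<close>

lemma tau_split:
  assumes \<beta>: "\<beta> \<in> J ` lu" and \<alpha>: "\<tau> (a + z + c) = - (a + z + c)"
    and a: "((\<lambda>t. Ad L (ex t \<beta>) a) \<longlongrightarrow> 0) at_top"
    and c: "((\<lambda>t. Ad L (ex t \<beta>) c) \<longlongrightarrow> 0) at_bot"
    and z: "\<And>t. Ad L (ex t \<beta>) z = z"
  shows "\<tau> a = - c"
proof -
  have tb: "bounded_linear \<tau>" by (rule finite_dimensional_bounded_linear[OF fd tau_linear])
  have mir: "((\<lambda>t. Ad L (ex (- t) \<beta>) v) \<longlongrightarrow> 0) F ==> ((\<lambda>t. Ad L (ex t \<beta>) (\<tau> v)) \<longlongrightarrow> 0) F" for v F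
    using bounded_linear.tendsto[OF tb, of "\<lambda>t. Ad L (ex (- t) \<beta>) v" 0 F] linear_0[OF tau_linear] by (simp add: tau_Ad_Exp[OF \<beta>, of "- _", simplified])
  have ta: "((\<lambda>t. Ad L (ex t \<beta>) (\<tau> a)) \<longlongrightarrow> 0) at_bot"
    by (rule mir, rule filterlim_compose[OF a]) (rule filterlim_uminus_at_top_at_bot)
  have tc: "((\<lambda>t. Ad L (ex t \<beta>) (\<tau> c)) \<longlongrightarrow> 0) at_top"
    by (rule mir, rule filterlim_compose[OF c]) (rule filterlim_uminus_at_bot_at_top)
  have tz: "Ad L (ex t \<beta>) (\<tau> z) = \<tau> z" for t
    using tau_Ad_Exp[OF \<beta>, of "- t" z] z[of "- t"] by simp
  have lin: "Ad L (Exp w) (x + y) = Ad L (Exp w) x + Ad L (Exp w) y" for w x y by (simp add: linear_add[OF Ad_linear])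
  \<comment> \<open>The positive, zero and negative parts of the vanishing sum of the vector and its
    image under \<open>\<tau>\<close>. \<open>X\<close> is orthogonal to the others: moving the
    self-adjoint flow between the two arguments leaves the pairing constant, while its limit is
    0.\<close>
  define X Y W where "X = \<tau> a + c" and "Y = \<tau> z + z" and "W = \<tau> c + a"
  have X: "((\<lambda>t. Ad L (ex t \<beta>) X) \<longlongrightarrow> 0) at_bot" unfolding X_def lin using tendsto_add[OF ta c] by simp
  have W: "((\<lambda>t. Ad L (ex t \<beta>) W) \<longlongrightarrow> 0) at_top" unfolding W_def lin using tendsto_add[OF tc a] by simp
  have W': "((\<lambda>t. Ad L (ex (- t) \<beta>) W) \<longlongrightarrow> 0) at_bot"
    by (rule filterlim_compose[OF W]) (rule filterlim_uminus_at_top_at_bot)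
  have Y: "Ad L (ex t \<beta>) Y = Y" for t unfolding Y_def lin tz z ..
  have XYW: "X + Y + W = 0" using \<alpha> unfolding X_def Y_def W_def tau_add by (simp add: algebra_simps eq_neg_iff_add_eq_0)
  have "((\<lambda>t. IP (Ad L (ex t \<beta>) X) Y) \<longlongrightarrow> IP 0 Y) at_bot"
    by (rule bounded_bilinear.tendsto[OF IP.bounded_bilinear_IP X tendsto_const])
  then have "((\<lambda>t::real. IP X Y) \<longlongrightarrow> 0) at_bot" unfolding IP_Ad_Exp[OF \<beta>] Y by simp
  then have XY: "IP X Y = 0" by (simp add: tendsto_const_iff)
  have "((\<lambda>t. IP (Ad L (ex t \<beta>) X) (Ad L (ex (- t) \<beta>) W)) \<longlongrightarrow> IP 0 0) at_bot"
    by (rule bounded_bilinear.tendsto[OF IP.bounded_bilinear_IP X W'])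
  moreover have "IP (Ad L (ex t \<beta>) X) (Ad L (ex (- t) \<beta>) W) = IP X W" for t
    unfolding IP_Ad_Exp[OF \<beta>] Exp_neg_scale by (simp add: Ad_inv)
  ultimately have XW: "IP X W = 0" by (simp add: tendsto_const_iff)
  have "IP X (X + Y + W) = 0" using XYW by simp
  then have "IP X X = 0" using XY XW by (simp add: IP.IP_add_right)
  then have "X = 0" by (rule IP.IP_eq_0)
  then show ?thesis unfolding X_def by (simp add: eq_neg_iff_add_eq_0)
qed

lemma tau_fixed_lu: "\<tau> v = v ==> v \<in> lu"
proof -
  assume "\<tau> v = v"
  then have "re v - J (im v) = re v + J (im v)" unfolding \<tau>_def using reim(3)[of v] by simp
  then have "- J (im v) = J (im v)" by simp
  then have "2 *\<^sub>R J (im v) = 0" using eq_neg_iff_add_eq_0[of "J (im v)" "J (im v)"] by (simp add: scaleR_2)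
  then have "J (im v) = 0" by simp
  then have "v = re v" using reim(3)[of v] by simp
  then show ?thesis using reim(1)[of v] by simp
qed

end

section \<open>The weight decomposition of \<gg> under \<beta>\<close>

locale graded = compatible_pair L U G ip
  for L :: "('g, 'e::real_normed_vector) lie_group" (structure) and U G ip +
  fixes \<beta> :: 'e and B :: "'e set" and ev :: "'e => real"
  assumes beta: "\<beta> \<in> lp" and B_fin: "finite B" and B_lg: "B \<subseteq> lg" and B_on: "IP.orthonormal B"
    and B_ev: "b \<in> B ==> bracket \<beta> b = ev b *\<^sub>R b" and B_span: "x \<in> lg ==> x = (\<Sum>b\<in>B. IP x b *\<^sub>R b)"

text \<open>\<open>bracket \<beta>\<close> preserves \<gg> and is self-adjoint for
  \<open>IP\<close>, so the spectral theorem applies on \<gg>.\<close>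

lemma (in compatible_pair) graded_exists:
  assumes \<beta>: "\<beta> \<in> lp" obtains B ev where "graded L U G ip \<beta> B ev"
proof -
  have lin: "linear (bracket \<beta>)" by (rule bracket_linear_right)
  have inv: "bracket \<beta> x \<in> lg" if "x \<in> lg" for x using bracket_lie_algebra[OF G_closed G_subgroup lp_lg[OF \<beta>] that] .
  obtain B ev where B: "finite B" "B \<subseteq> lg" "IP.orthonormal B" "\<And>b. b \<in> B ==> bracket \<beta> b = ev b *\<^sub>R b"
    "\<And>x. x \<in> lg ==> x = (\<Sum>b\<in>B. IP x b *\<^sub>R b)"
    by (rule IP.spectral[OF lg_subspace lin inv IP_bracket_Jlu[OF lp_Jlu[OF \<beta>]]]) auto
  have "graded L U G ip \<beta> B ev" by unfold_locales (use \<beta> B in auto)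
  then show ?thesis by (rule that)
qed

context graded
begin

abbreviation pt :: "(real => bool) => 'e set" where "pt \<equiv> part B ev"
abbreviation Phi :: "real => 'e => 'e" where "Phi t \<equiv> Ad L (ex t \<beta>)"

text \<open>Changing the sign of \<open>\<beta>\<close> exchanges positive and negative weights, so
  statements about R^- carry over to R^+ with time reversed.\<close>

lemma opposite: "graded L U G ip (- \<beta>) B (\<lambda>b. - ev b)"
proof unfold_locales
  have "- \<beta> = (-1) *\<^sub>R \<beta>" by simp
  moreover have "subspace lp" unfolding p_part_def
    by (rule subspace_inter[OF lg_subspace linear_subspace_image[OF J(1) lu_subspace]])
  ultimately show "- \<beta> \<in> lp" using beta subspace_scale by metis
  show "bracket (- \<beta>) b = - ev b *\<^sub>R b" if "b \<in> B" for b
    using B_ev[OF that] linear_neg[OF bracket_linear_left] by simp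
qed (fact B_fin B_lg B_on B_span)+

lemma part_opposite: "part B (\<lambda>b. - ev b) P = pt (\<lambda>c. P (- c))"
  unfolding part_def ..

lemma beta_lg: "\<beta> \<in> lg" and beta_Jlu: "\<beta> \<in> J ` lu"
  using beta lp_lg lp_Jlu by auto

lemma Exp_beta_G: "ex t \<beta> \<in> G"
  by (intro Exp_lg lg_scale beta_lg)

lemma Phi_lg: "v \<in> lg ==> Phi t v \<in> lg"
  by (rule Ad_lg[OF Exp_beta_G])

lemma flow_coord: "b \<in> B ==> IP (Phi t v) b = exp (t * ev b) * IP v b"
  unfolding IP_Ad_Exp[OF beta_Jlu] eigen_flow[OF B_ev] by (simp add: IP.IP_scale_right)

lemma coord_eqI: "v \<in> lg ==> w \<in> lg ==> (\<And>b. b \<in> B ==> IP v b = IP w b) ==> v = w"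
proof -
  assume v: "v \<in> lg" and w: "w \<in> lg" and e: "\<And>b. b \<in> B ==> IP v b = IP w b"
  have "(\<Sum>b\<in>B. IP v b *\<^sub>R b) = (\<Sum>b\<in>B. IP w b *\<^sub>R b)" by (rule sum.cong) (auto simp: e)
  then show ?thesis unfolding B_span[OF v, symmetric] B_span[OF w, symmetric] .
qed

lemma coord_tendsto:
  assumes f: "\<forall>\<^sub>F n in F. f n \<in> lg" and l: "l \<in> lg" and c: "\<And>b. b \<in> B ==> ((\<lambda>n. IP (f n) b) \<longlongrightarrow> IP l b) F"
  shows "(f \<longlongrightarrow> l) F"
proof -
  have "((\<lambda>n. \<Sum>b\<in>B. IP (f n) b *\<^sub>R b) \<longlongrightarrow> (\<Sum>b\<in>B. IP l b *\<^sub>R b)) F"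
    by (intro tendsto_sum tendsto_scaleR c tendsto_const)
  moreover have "\<forall>\<^sub>F n in F. (\<Sum>b\<in>B. IP (f n) b *\<^sub>R b) = f n"
    using f by eventually_elim (rule B_span[symmetric])
  ultimately have "(f \<longlongrightarrow> (\<Sum>b\<in>B. IP l b *\<^sub>R b)) F" by (rule Lim_transform_eventually)
  then show ?thesis unfolding B_span[OF l, symmetric] .
qed

lemma coord_tendsto_at: "(f \<longlongrightarrow> l) F ==> ((\<lambda>n. IP (f n) b) \<longlongrightarrow> IP l b) F"
  by (intro bounded_bilinear.tendsto[OF IP.bounded_bilinear_IP] tendsto_const)

definition proj :: "(real => bool) => 'e => 'e" where
  "proj P v = (\<Sum>b\<in>{b \<in> B. P (ev b)}. IP v b *\<^sub>R b)"

lemma proj_coord: assumes c: "c \<in> B" shows "IP (proj P v) c = (if P (ev c) then IP v c else 0)"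
proof -
  have o: "IP b c = (if b = c then 1 else 0)" if "b \<in> B" for b using B_on c that unfolding IP.orthonormal_def by blast
  have "IP (proj P v) c = (\<Sum>b\<in>{b \<in> B. P (ev b)}. if b = c then IP v b else 0)"
    unfolding proj_def IP.IP_sum by (rule sum.cong) (auto simp: IP.IP_scale_left o)
  then show ?thesis using B_fin c by simp
qed

lemma proj_lg: "proj P v \<in> lg"
  unfolding proj_def by (intro subspace_sum[OF lg_subspace] subspace_scale[OF lg_subspace]) (use B_lg in auto)

lemma proj_part: "proj P v \<in> pt P"
  unfolding part_def using proj_lg proj_coord by auto

lemma part_lg: "v \<in> part B ev P ==> v \<in> lg"
  unfolding part_def by simp

lemma part_coord: "v \<in> part B ev P ==> b \<in> B ==> \<not> P (ev b) ==> IP v b = 0"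
  unfolding part_def by simp

lemma partI: "v \<in> lg ==> (\<And>b. b \<in> B ==> \<not> P (ev b) ==> IP v b = 0) ==> v \<in> pt P"
  unfolding part_def by simp

lemma part_subspace: "subspace (pt P)"
  unfolding subspace_def
  by (auto intro!: partI subspace_0[OF lg_subspace] subspace_add[OF lg_subspace] subspace_scale[OF lg_subspace]
      simp: IP.IP_add_left IP.IP_scale_left part_coord part_lg)

lemma part_mono: "v \<in> pt P ==> (\<And>c. P c ==> Q c) ==> v \<in> pt Q"
  unfolding part_def by blast

lemma proj_split: "v \<in> lg ==> v = proj (\<lambda>c. c < 0) v + proj (\<lambda>c. c = 0) v + proj (\<lambda>c. c > 0) v"
  by (rule coord_eqI) (auto intro!: subspace_add[OF lg_subspace] proj_lg simp: IP.IP_add_left proj_coord)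

lemma neg_flow:
  assumes v: "v \<in> pt (\<lambda>c. c < 0)"
  shows "((\<lambda>t. Phi t v) \<longlongrightarrow> 0) at_top"
proof (rule coord_tendsto)
  show "\<forall>\<^sub>F t in at_top. Phi t v \<in> lg" using Phi_lg[OF part_lg[OF v]] by simp
  show "0 \<in> lg" by (rule subspace_0[OF lg_subspace])
  fix b assume b: "b \<in> B"
  show "((\<lambda>t. IP (Phi t v) b) \<longlongrightarrow> IP 0 b) at_top"
  proof (cases "ev b < 0")
    case True
    have "filterlim (\<lambda>t. t * ev b) at_bot at_top"
      using filterlim_tendsto_neg_mult_at_bot[OF tendsto_const True filterlim_ident] by (simp add: mult.commute)
    then have "((\<lambda>t. exp (t * ev b)) \<longlongrightarrow> 0) at_top" by (rule filterlim_compose[OF exp_at_bot])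
    then show ?thesis unfolding flow_coord[OF b] using tendsto_mult_left_zero by fastforce
  next
    case False
    then show ?thesis unfolding flow_coord[OF b] using part_coord[OF v b] by simp
  qed
qed

text \<open>Coordinates of nonnegative weight do not shrink along the flow, so they vanish if the
  flow tends to 0.\<close>

lemma neg_flowD:
  assumes v: "v \<in> lg" and lim: "((\<lambda>t. Phi t v) \<longlongrightarrow> 0) at_top"
  shows "v \<in> pt (\<lambda>c. c < 0)"
proof (rule partI[OF v])
  fix b assume b: "b \<in> B" "\<not> ev b < 0"
  have "((\<lambda>t. \<bar>IP (Phi t v) b\<bar>) \<longlongrightarrow> 0) at_top"
    using tendsto_rabs[OF coord_tendsto_at[OF lim, of b]] by simp
  moreover have "\<forall>\<^sub>F t in at_top. \<bar>IP v b\<bar> \<le> \<bar>IP (Phi t v) b\<bar>"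
    using eventually_ge_at_top[of 0]
  proof eventually_elim
    case (elim t)
    then have "exp (t * ev b) \<ge> 1" using b(2) by simp
    then show ?case unfolding flow_coord[OF b(1)] abs_mult using mult_right_mono[of 1 "exp (t * ev b)" "\<bar>IP v b\<bar>"] by simp
  qed
  ultimately have "\<bar>IP v b\<bar> \<le> 0" by (rule tendsto_lowerbound) simp
  then show "IP v b = 0" by simp
qed

lemma zero_flow: "v \<in> pt (\<lambda>c. c = 0) ==> Phi t v = v"
  by (rule coord_eqI[OF Phi_lg[OF part_lg] part_lg]) (auto simp: flow_coord dest: part_coord)

lemma zero_flowD:
  assumes v: "v \<in> lg" and e: "Phi 1 v = v"
  shows "v \<in> pt (\<lambda>c. c = 0)"
proof (rule partI[OF v])
  fix b assume b: "b \<in> B" "ev b \<noteq> 0"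
  have "exp (ev b) * IP v b = IP v b" using flow_coord[OF b(1), of 1 v] e by simp
  then show "IP v b = 0" using b(2) by simp
qed

lemma beta_fixed: "Phi t \<beta> = \<beta>"
  by (rule bracket_zero_imp_fixed[OF bracket_self])

lemma pos_flow:
  assumes v: "v \<in> pt (\<lambda>c. c > 0)" shows "((\<lambda>t. Phi t v) \<longlongrightarrow> 0) at_bot"
proof -
  have "((\<lambda>t. Ad L (ex t (- \<beta>)) v) \<longlongrightarrow> 0) at_top"
    by (rule graded.neg_flow[OF opposite]) (use v in \<open>simp add: part_opposite\<close>)
  from filterlim_compose[OF this filterlim_uminus_at_top_at_bot] show ?thesis by simp
qed

text \<open>The \<kk>-component in the decomposition of \<pp> inside \<kk> + Lie P: the negative
  part is completed to a vector fixed by the Cartan involution.\<close>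

definition kap :: "'e => 'e" where "kap \<alpha> = proj (\<lambda>c. c < 0) \<alpha> - proj (\<lambda>c. c > 0) \<alpha>"

text \<open>\<open>\<tau>\<close> exchanges the outer parts \<open>a\<close> and \<open>c\<close> up
  to sign, so \<open>a - c\<close> is fixed by \<open>\<tau>\<close> and lies in \<uu>; the
  remainder \<open>z + 2 *\<^sub>R c\<close> has no negative weights.\<close>

lemma p_decompose:
  assumes \<alpha>: "\<alpha> \<in> lp"
  shows "kap \<alpha> \<in> lg \<inter> lu" and "\<alpha> - kap \<alpha> \<in> pt (\<lambda>c. c \<ge> 0)"
proof -
  define a z c where "a = proj (\<lambda>c. c < 0) \<alpha>" and "z = proj (\<lambda>c. c = 0) \<alpha>" and "c = proj (\<lambda>c. c > 0) \<alpha>"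
  have al: "\<alpha> = a + z + c" unfolding a_def z_def c_def by (rule proj_split[OF lp_lg[OF \<alpha>]])
  have lg: "a \<in> lg" "z \<in> lg" "c \<in> lg" unfolding a_def z_def c_def by (rule proj_lg)+
  have ta: "\<tau> a = - c"
  proof (rule tau_split[OF beta_Jlu])
    show "\<tau> (a + z + c) = - (a + z + c)" using tau_Jlu[OF lp_Jlu[OF \<alpha>]] al by simp
    show "((\<lambda>t. Phi t a) \<longlongrightarrow> 0) at_top" unfolding a_def by (rule neg_flow[OF proj_part])
    show "((\<lambda>t. Phi t c) \<longlongrightarrow> 0) at_bot" unfolding c_def by (rule pos_flow[OF proj_part])
    show "Phi t z = z" for t unfolding z_def by (rule zero_flow[OF proj_part])
  qed
  have "re (\<tau> a) = re a \<and> im (\<tau> a) = - im a"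
    by (rule reim_eqI[OF reim(1) subspace_neg[OF lu_subspace reim(2)]]) (simp add: \<tau>_def J)
  then have "\<tau> (\<tau> a) = re a + J (im a)" unfolding \<tau>_def[of "\<tau> a"] by (simp add: J)
  then have tt: "\<tau> (\<tau> a) = a" using reim(3)[of a] by simp
  have tc: "\<tau> c = - a" using tt linear_neg[OF tau_linear, of c] unfolding ta by (metis minus_minus)
  have kap: "kap \<alpha> = a - c" unfolding kap_def a_def c_def ..
  have "\<tau> (a - c) = a - c" using linear_diff[OF tau_linear, of a c] ta tc by simp
  then show "kap \<alpha> \<in> lg \<inter> lu" unfolding kap using tau_fixed_lu subspace_diff[OF lg_subspace lg(1,3)] by simp
  have "z \<in> pt (\<lambda>c. c \<ge> 0)" "c \<in> pt (\<lambda>c. c \<ge> 0)"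
    unfolding z_def c_def by (auto intro: part_mono[OF proj_part])
  then have "z + 2 *\<^sub>R c \<in> pt (\<lambda>c. c \<ge> 0)" using subspace_add[OF part_subspace] subspace_scale[OF part_subspace] by blast
  moreover have "\<alpha> - kap \<alpha> = z + 2 *\<^sub>R c" unfolding kap using al by (simp add: scaleR_2)
  ultimately show "\<alpha> - kap \<alpha> \<in> pt (\<lambda>c. c \<ge> 0)" by simp
qed

end

lemma continuous_map_top_of_setD:
  assumes "continuous_map (top_of_set S) T f" "(g \<longlongrightarrow> l) F" "l \<in> S" "\<forall>\<^sub>F n in F. g n \<in> S"
  shows "limitin T (\<lambda>n. f (g n)) (f l) F"
  using continuous_map_limit[OF assms(1), of g l F] assms by (simp add: limitin_subtopology o_def)

lemma (in group) cancel_inv: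
  "a \<in> carrier G ==> b \<in> carrier G ==> a \<otimes> (inv a \<otimes> b) = b"
  "a \<in> carrier G ==> b \<in> carrier G ==> inv a \<otimes> (a \<otimes> b) = b"
  by (simp_all add: m_assoc[symmetric])

section \<open>R^-, the centraliser of \<beta>, R^+ and the parabolic subgroup\<close>

context graded
begin

abbreviation "neg \<equiv> pt (\<lambda>c. c < 0)"
abbreviation "pos \<equiv> pt (\<lambda>c. c > 0)"

lemma Rm_carrier: "u \<in> Rm \<gamma> ==> u \<in> carrier L" and Cent_carrier: "h \<in> Cent \<gamma> ==> h \<in> carrier L"
  using RmD(1) CentD(1) G_carrier by auto

text \<open>\<open>Ad L (cj \<beta> t u) \<beta>\<close> tends to \<open>\<beta>\<close> and is the
  flow applied to \<open>Ad L u \<beta>\<close>; the difference from \<open>\<beta>\<close> is thus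
  contracted and has negative weights only.\<close>

lemma Rm_beta:
  assumes u: "u \<in> Rm \<beta>" shows "Ad L u \<beta> - \<beta> \<in> neg"
proof (rule neg_flowD)
  note uc = Rm_carrier[OF u]
  show "Ad L u \<beta> - \<beta> \<in> lg" by (intro subspace_diff[OF lg_subspace] Ad_lg beta_lg RmD(1)[OF u])
  have "((\<lambda>t. Ad L (cj \<beta> t u) \<beta> - \<beta>) \<longlongrightarrow> \<beta> - \<beta>) at_top"
    by (intro tendsto_diff tendsto_const Ad_tendsto_one RmD(2)[OF u])
  moreover have "Ad L (cj \<beta> t u) \<beta> - \<beta> = Phi t (Ad L u \<beta> - \<beta>)" for t
    using Ad_cj[OF uc, of \<beta> t \<beta>] by (simp add: beta_fixed linear_diff[OF Ad_linear])
  ultimately show "((\<lambda>t. Phi t (Ad L u \<beta> - \<beta>)) \<longlongrightarrow> 0) at_top" by simp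
qed

text \<open>The flow conjugates \<open>u\<close> to the identity in the limit. On a coordinate of
  weight at least \<open>a\<close> the rescaled flow reveals the limit exactly, so \<open>u\<close>
  leaves this coordinate of \<open>y\<close> unchanged.\<close>

lemma Rm_unipotent:
  assumes u: "u \<in> Rm \<beta>" and y: "y \<in> pt (\<lambda>c. c \<le> a)" shows "Ad L u y - y \<in> pt (\<lambda>c. c < a)"
proof (rule partI)
  note uc = Rm_carrier[OF u]
  show "Ad L u y - y \<in> lg" by (intro subspace_diff[OF lg_subspace] Ad_lg part_lg[OF y] RmD(1)[OF u])
  fix b' assume b': "b' \<in> B" "\<not> ev b' < a"
  \<comment> \<open>Rescaled so that weight \<open>ev b'\<close> stays put: smaller weights vanish
    in the limit and larger ones do not occur in \<open>y\<close>.\<close>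
  define w where "w t = exp (- (t * ev b')) *\<^sub>R Phi t y" for t
  have "(w \<longlongrightarrow> proj (\<lambda>c. c = ev b') y) at_top"
  proof (rule coord_tendsto)
    show "\<forall>\<^sub>F t in at_top. w t \<in> lg" unfolding w_def by (intro always_eventually allI lg_scale Phi_lg part_lg[OF y])
    show "proj (\<lambda>c. c = ev b') y \<in> lg" by (rule proj_lg)
    fix b assume b: "b \<in> B"
    have wb: "IP (w t) b = exp (t * (ev b - ev b')) * IP y b" for t
      unfolding w_def IP.IP_scale_left flow_coord[OF b] by (simp add: mult_exp_exp[symmetric] algebra_simps flip: exp_add)
    consider "ev b > a" | "ev b = ev b'" | "ev b - ev b' < 0" using b'(2) by linarith
    then show "((\<lambda>t. IP (w t) b) \<longlongrightarrow> IP (proj (\<lambda>c. c = ev b') y) b) at_top"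
      unfolding wb proj_coord[OF b]
    proof cases
      case 1
      then show "((\<lambda>t. exp (t * (ev b - ev b')) * IP y b) \<longlongrightarrow> (if ev b = ev b' then IP y b else 0)) at_top"
        using part_coord[OF y b] by simp
    next
      case 2
      then show "((\<lambda>t. exp (t * (ev b - ev b')) * IP y b) \<longlongrightarrow> (if ev b = ev b' then IP y b else 0)) at_top" by simp
    next
      case 3
      have "filterlim (\<lambda>t. t * (ev b - ev b')) at_bot at_top"
        using filterlim_tendsto_neg_mult_at_bot[OF tendsto_const 3 filterlim_ident] by (simp add: mult.commute)
      then have "((\<lambda>t. exp (t * (ev b - ev b'))) \<longlongrightarrow> 0) at_top" by (rule filterlim_compose[OF exp_at_bot])
      then show "((\<lambda>t. exp (t * (ev b - ev b')) * IP y b) \<longlongrightarrow> (if ev b = ev b' then IP y b else 0)) at_top"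
        using 3 tendsto_mult_left_zero by fastforce
    qed
  qed
  then have "((\<lambda>t. Ad L (cj \<beta> t u) (w t)) \<longlongrightarrow> proj (\<lambda>c. c = ev b') y) at_top"
    by (rule Ad_tendsto_one[OF RmD(2)[OF u]])
  from coord_tendsto_at[OF this, of b']
  have l: "((\<lambda>t. IP (Ad L (cj \<beta> t u) (w t)) b') \<longlongrightarrow> IP y b') at_top" by (simp add: proj_coord[OF b'(1)])
  have "IP (Ad L (cj \<beta> t u) (w t)) b' = IP (Ad L u y) b'" for t
    unfolding w_def linear_scale[OF Ad_linear[OF cj_carrier[OF uc]]] Ad_cj[OF uc] IP.IP_scale_left flow_coord[OF b'(1)]
    by (simp add: exp_minus)
  then have "IP (Ad L u y) b' = IP y b'" using l by (simp add: tendsto_const_iff)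
  then show "IP (Ad L u y - y) b' = 0" by (simp add: IP.IP_diff)
qed

lemma Exp_neg_Rm: "\<nu> \<in> neg ==> Exp \<nu> \<in> Rm \<beta>"
  unfolding Rm_def using limitin_Exp[OF neg_flow] Exp_lg[OF part_lg] by (simp add: cj_Exp)

text \<open>The flow of \<open>\<nu>\<close> on \<open>\<beta>\<close> is affine, because
  \<open>bracket \<nu> \<beta>\<close> is a multiple of \<open>\<nu>\<close> and
  \<open>bracket \<nu> \<nu>\<close> is 0.\<close>

lemma Exp_weight:
  assumes \<nu>: "\<nu> \<in> pt (\<lambda>d. d = c)" shows "Ad L (Exp \<nu>) \<beta> = \<beta> - c *\<^sub>R \<nu>"
proof -
  have br: "bracket \<beta> \<nu> = c *\<^sub>R \<nu>"
  proof (rule coord_eqI)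
    show "bracket \<beta> \<nu> \<in> lg" by (rule bracket_lie_algebra[OF G_closed G_subgroup beta_lg part_lg[OF \<nu>]])
    show "c *\<^sub>R \<nu> \<in> lg" by (rule lg_scale[OF part_lg[OF \<nu>]])
    fix b assume b: "b \<in> B"
    show "IP (bracket \<beta> \<nu>) b = IP (c *\<^sub>R \<nu>) b"
      unfolding IP_bracket_Jlu[OF beta_Jlu] B_ev[OF b] IP.IP_scale_left IP.IP_scale_right
      using part_coord[OF \<nu> b] by auto
  qed
  define w where "w s = \<beta> - s *\<^sub>R c *\<^sub>R \<nu>" for s :: real
  have "bracket \<nu> (w s) = - (c *\<^sub>R \<nu>)" for s
    unfolding w_def linear_diff[OF bracket_linear_right] linear_scale[OF bracket_linear_right] bracket_self
    using bracket_antisym[of \<nu> \<beta>] br by simp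
  moreover have "(w has_vector_derivative - (c *\<^sub>R \<nu>)) (at s)" for s
    unfolding w_def by (auto intro!: derivative_eq_intros simp: has_vector_derivative_def)
  ultimately have "(w has_vector_derivative bracket \<nu> (w s)) (at s)" for s by simp
  from flow_unique[OF this, of 1] show ?thesis unfolding w_def by simp
qed

lemma proj_linear: "linear (proj P)"
  by (rule linearI) (simp_all add: proj_def IP.IP_add_left IP.IP_scale_left scaleR_add_left sum.distrib scaleR_sum_right)

lemma proj_tendsto: "(f \<longlongrightarrow> l) F ==> ((\<lambda>n. proj P (f n)) \<longlongrightarrow> proj P l) F"
  using bounded_linear.tendsto[OF finite_dimensional_bounded_linear[OF fd proj_linear]] .

text \<open>\<open>\<beta> + y\<close> is moved to \<open>\<beta>\<close> by removing the weights of \<open>y\<close> one after the other, the largest first.\<close>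

lemma Rm_transitive_weight:
  assumes "a \<le> 0"
  shows "\<exists>u. continuous_map (top_of_set (pt (\<lambda>c. c < a))) (ltop L) u \<and>
    (\<forall>y\<in>pt (\<lambda>c. c < a). u y \<in> Rm \<beta> \<and> Ad L (u y) \<beta> = \<beta> + y)"
  using assms
proof (induction "card {c \<in> ev ` B. c < a}" arbitrary: a rule: less_induct)
  case less
  have fin: "finite {c \<in> ev ` B. c < a}" using B_fin by simp
  show ?case
  proof (cases "{c \<in> ev ` B. c < a} = {}")
    case True
    have "y = 0" if "y \<in> pt (\<lambda>c. c < a)" for y
      by (rule coord_eqI[OF part_lg[OF that] subspace_0[OF lg_subspace]]) (use that True in \<open>auto simp: part_coord\<close>)
    then show ?thesis using Rm_one carrier one_closed by (intro exI[of _ "\<lambda>_. \<one>"]) auto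
  next
    case False
    \<comment> \<open>The largest weight that can occur in \<open>y\<close>.\<close>
    define c where "c = Max {c \<in> ev ` B. c < a}"
    have c: "c \<in> ev ` B" "c < a" using Max_in[OF fin False] unfolding c_def by auto
    have cmax: "d \<le> c" if "d \<in> ev ` B" "d < a" for d unfolding c_def using Max_ge[OF fin] that by simp
    have "{d \<in> ev ` B. d < c} \<subset> {d \<in> ev ` B. d < a}" using c by auto
    then have "card {d \<in> ev ` B. d < c} < card {d \<in> ev ` B. d < a}" by (rule psubset_card_mono[OF fin])
    from less.hyps[OF this] c(2) less.prems
    obtain u' where u': "continuous_map (top_of_set (pt (\<lambda>d. d < c))) (ltop L) u'"
      "\<And>y. y \<in> pt (\<lambda>d. d < c) ==> u' y \<in> Rm \<beta> \<and> Ad L (u' y) \<beta> = \<beta> + y" by auto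
    have c0: "c < 0" using c(2) less.prems by simp
    \<comment> \<open>By \<open>Exp_weight\<close>, \<open>Exp (- \<nu> y)\<close> subtracts from
      \<open>\<beta>\<close> the weight-\<open>c\<close> part of \<open>y\<close>; by
      \<open>Rm_unipotent\<close> it changes \<open>y\<close> itself only in weights below
      \<open>c\<close>.\<close>
    define \<nu> where "\<nu> y = (- 1 / c) *\<^sub>R proj (\<lambda>d. d = c) y" for y
    define y' where "y' y = Ad L (Exp (- \<nu> y)) (\<beta> + y) - \<beta>" for y
    define u where "u y = Exp (\<nu> y) \<otimes> u' (y' y)" for y
    have nu: "\<nu> y \<in> pt (\<lambda>d. d = c)" for y
      unfolding \<nu>_def by (rule subspace_scale[OF part_subspace proj_part])
    have nuR: "Exp (\<nu> y) \<in> Rm \<beta>" "Exp (- \<nu> y) \<in> Rm \<beta>" for y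
      using Exp_neg_Rm[of "\<nu> y"] part_mono[OF nu] c0 Rm_inv[of "Exp (\<nu> y)" \<beta>] Exp_neg[of "\<nu> y"] by auto
    have y': "y' y \<in> pt (\<lambda>d. d < c)" if y: "y \<in> pt (\<lambda>d. d < a)" for y
    proof -
      have yc: "y \<in> pt (\<lambda>d. d \<le> c)" by (rule partI[OF part_lg[OF y]]) (use cmax part_coord[OF y] in force)
      have "- \<nu> y \<in> pt (\<lambda>d. d = c)" by (rule subspace_neg[OF part_subspace nu])
      from Exp_weight[OF this] have "Ad L (Exp (- \<nu> y)) \<beta> = \<beta> - proj (\<lambda>d. d = c) y" using c0 unfolding \<nu>_def by simp
      then have "y' y = (Ad L (Exp (- \<nu> y)) y - y) + (y - proj (\<lambda>d. d = c) y)"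
        unfolding y'_def by (simp add: linear_add[OF Ad_linear])
      moreover have "y - proj (\<lambda>d. d = c) y \<in> pt (\<lambda>d. d < c)"
        by (rule partI[OF subspace_diff[OF lg_subspace part_lg[OF y] proj_lg]])
          (use part_coord[OF yc] in \<open>auto simp: IP.IP_diff proj_coord\<close>)
      ultimately show ?thesis using subspace_add[OF part_subspace Rm_unipotent[OF nuR(2) yc]] by metis
    qed
    have "u y \<in> Rm \<beta> \<and> Ad L (u y) \<beta> = \<beta> + y" if y: "y \<in> pt (\<lambda>d. d < a)" for y
    proof
      note uy = u'(2)[OF y'[OF y]]
      show "u y \<in> Rm \<beta>" unfolding u_def using Rm_mult nuR uy by blast
      have "Ad L (u y) \<beta> = Ad L (Exp (\<nu> y)) (\<beta> + y' y)"
        unfolding u_def using uy Ad_mult[OF Exp_carrier Rm_carrier[OF conjunct1[OF uy]]] by simp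
      also have "\<dots> = \<beta> + y" unfolding y'_def Exp_neg by (simp add: Ad_inv)
      finally show "Ad L (u y) \<beta> = \<beta> + y" .
    qed
    moreover have "continuous_map (top_of_set (pt (\<lambda>d. d < a))) (ltop L) u"
    proof (rule continuous_map_top_of_setI)
      fix x assume x: "x \<in> pt (\<lambda>d. d < a)"
      let ?F = "at x within pt (\<lambda>d. d < a)"
      have n: "(\<nu> \<longlongrightarrow> \<nu> x) ?F" unfolding \<nu>_def by (intro tendsto_scaleR tendsto_const proj_tendsto tendsto_ident_at)
      have "(y' \<longlongrightarrow> y' x) ?F" unfolding y'_def
        by (intro tendsto_diff tendsto_const Ad_tendsto limitin_Exp tendsto_minus n tendsto_add tendsto_ident_at)
      moreover have "\<forall>\<^sub>F y in ?F. y' y \<in> pt (\<lambda>d. d < c)" using y' unfolding eventually_at_filter by (intro always_eventually) auto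
      ultimately have "limL (\<lambda>y. u' (y' y)) (u' (y' x)) ?F"
        using continuous_map_top_of_setD[OF u'(1) _ y'[OF x]] by blast
      then show "limL u (u x) ?F" unfolding u_def by (intro limitin_mult limitin_Exp n)
    qed
    ultimately show ?thesis by blast
  qed
qed

text \<open>A continuous inverse of the bijection from R^- onto \<open>neg\<close> that sends
  \<open>u\<close> to \<open>Ad L u \<beta> - \<beta>\<close>.\<close>

definition urep :: "'e => 'g" where
  "urep = (SOME u. continuous_map (top_of_set neg) (ltop L) u \<and> (\<forall>y\<in>neg. u y \<in> Rm \<beta> \<and> Ad L (u y) \<beta> = \<beta> + y))"

lemma urep: "continuous_map (top_of_set neg) (ltop L) urep"
  "y \<in> neg ==> urep y \<in> Rm \<beta>" "y \<in> neg ==> Ad L (urep y) \<beta> = \<beta> + y"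
  using someI_ex[OF Rm_transitive_weight[of 0, OF order_refl], folded urep_def] by blast+

text \<open>An element of R^- fixing \<open>\<beta>\<close> is constant under the flow that
  contracts it, hence trivial.\<close>

lemma Rm_eqI:
  assumes u: "u \<in> Rm \<beta>" and v: "v \<in> Rm \<beta>" and e: "Ad L u \<beta> = Ad L v \<beta>"
  shows "u = v"
proof -
  note c = Rm_carrier[OF u] Rm_carrier[OF v]
  have "inv u \<otimes> v \<in> Rm \<beta>" by (intro Rm_mult Rm_inv u v)
  moreover have "inv u \<otimes> v \<in> Cent \<beta>"
    unfolding Cent_def using RmD(1)[OF calculation] c e[symmetric] by (simp add: Ad_mult Ad_inv)
  ultimately have "inv u \<otimes> v = \<one>" by (rule Rm_Cent_trivial)
  then show ?thesis using c by (metis inv_solve_left' r_one one_closed)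
qed

lemma Rm_pos:
  assumes "n \<in> Rm (- \<beta>)" shows "Ad L n \<beta> - \<beta> \<in> pos"
proof -
  have "Ad L n (- \<beta>) - (- \<beta>) \<in> pt (\<lambda>c. - c < 0)"
    using graded.Rm_beta[OF opposite assms] unfolding part_opposite .
  then have "- (Ad L n (- \<beta>) - (- \<beta>)) \<in> pos" using subspace_neg[OF part_subspace] by fastforce
  then show ?thesis by (simp add: linear_neg[OF Ad_linear[OF Rm_carrier[OF assms]]])
qed

lemma Rm_pos_transitive:
  assumes "x \<in> pos" obtains n where "n \<in> Rm (- \<beta>)" "Ad L n \<beta> = \<beta> + x"
proof -
  have "- x \<in> part B (\<lambda>b. - ev b) (\<lambda>c. c < 0)"
    unfolding part_opposite using subspace_neg[OF part_subspace assms] by simp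
  then obtain n where n: "n \<in> Rm (- \<beta>)" "Ad L n (- \<beta>) = - \<beta> + - x"
    using graded.urep(2,3)[OF opposite] by blast
  have "- Ad L n \<beta> = - \<beta> + - x" using n linear_neg[OF Ad_linear[OF Rm_carrier[OF n(1)]]] by simp
  then have "Ad L n \<beta> = \<beta> + x" by (metis add.inverse_distrib_swap add.commute neg_equal_iff_equal)
  then show ?thesis using n that by blast
qed

lemma Cent_minus: "Cent (- \<beta>) = Cent \<beta>"
  unfolding Cent_def using linear_neg[OF Ad_linear[OF G_carrier]] by auto

text \<open>The big cell: the product of R^-, the centraliser of \<beta> and R^+. The encoding is
  linear in the unknowns \<open>x\<close> and \<open>y\<close>, as the density proof
  requires.\<close>

definition \<Omega> :: "'g set" where
  "\<Omega> = {g \<in> G. \<exists>x\<in>pos. \<exists>y\<in>neg. Ad L g (\<beta> + x) = \<beta> + y}"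

text \<open>\<open>\<beta> + x\<close> and \<open>\<beta> + y\<close> run through the orbits of
  \<open>\<beta>\<close> under R^+ and R^-; bringing both back to \<open>\<beta>\<close> leaves an
  element of the centraliser.\<close>

lemma Omega_iff: "g \<in> \<Omega> \<longleftrightarrow> (\<exists>u\<in>Rm \<beta>. \<exists>h\<in>Cent \<beta>. \<exists>n\<in>Rm (- \<beta>). g = u \<otimes> h \<otimes> n)"
proof
  assume "g \<in> \<Omega>"
  then obtain x y where g: "g \<in> G" and x: "x \<in> pos" and y: "y \<in> neg" and e: "Ad L g (\<beta> + x) = \<beta> + y"
    unfolding \<Omega>_def by blast
  obtain n where n: "n \<in> Rm (- \<beta>)" "Ad L n \<beta> = \<beta> + x" by (rule Rm_pos_transitive[OF x])
  define u where "u = urep y"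
  have u: "u \<in> Rm \<beta>" "Ad L u \<beta> = \<beta> + y" unfolding u_def using urep y by auto
  note c = G_carrier[OF g] Rm_carrier[OF n(1)] Rm_carrier[OF u(1)]
  define h where "h = inv u \<otimes> g \<otimes> n"
  have "Ad L h \<beta> = Ad L (inv u) (Ad L u \<beta>)" unfolding h_def using c e n u by (simp add: Ad_mult)
  then have h: "h \<in> Cent \<beta>" unfolding Cent_def h_def
    using G_mult G_inv RmD(1)[OF u(1)] RmD(1)[OF n(1)] g c by (simp add: Ad_inv)
  have "g = u \<otimes> h \<otimes> inv n" unfolding h_def using c by (simp add: m_assoc cancel_inv)
  then show "\<exists>u\<in>Rm \<beta>. \<exists>h\<in>Cent \<beta>. \<exists>n\<in>Rm (- \<beta>). g = u \<otimes> h \<otimes> n" using u h Rm_inv[OF n(1)] by blast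
next
  assume "\<exists>u\<in>Rm \<beta>. \<exists>h\<in>Cent \<beta>. \<exists>n\<in>Rm (- \<beta>). g = u \<otimes> h \<otimes> n"
  then obtain u h n where u: "u \<in> Rm \<beta>" and h: "h \<in> Cent \<beta>" and n: "n \<in> Rm (- \<beta>)" and g: "g = u \<otimes> h \<otimes> n" by blast
  note c = Rm_carrier[OF u] Cent_carrier[OF h] Rm_carrier[OF n]
  have G: "g \<in> G" unfolding g by (intro G_mult RmD(1)[OF u] RmD(1)[OF n] CentD(1)[OF h])
  define x where "x = Ad L (inv n) \<beta> - \<beta>"
  have x: "x \<in> pos" unfolding x_def by (rule Rm_pos[OF Rm_inv[OF n]])
  have "Ad L g (\<beta> + x) = Ad L u \<beta>" unfolding g x_def using c CentD(2)[OF h] by (simp add: Ad_mult Ad_inv)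
  then have "Ad L g (\<beta> + x) = \<beta> + (Ad L u \<beta> - \<beta>)" by simp
  then show "g \<in> \<Omega>" unfolding \<Omega>_def using G x Rm_beta[OF u] by blast
qed

abbreviation PP :: "'g set" where "PP \<equiv> parabolic_plus L G \<beta>"

lemma parabolic_def: "PP = {g \<in> G. \<exists>h\<in>G. limL (\<lambda>t. cj \<beta> t g) h at_bot}"
  unfolding parabolic_plus_def cj_def ..

lemma Rm_minus_limitin: "n \<in> Rm (- \<beta>) \<longleftrightarrow> n \<in> G \<and> limL (\<lambda>t. cj \<beta> t n) \<one> at_bot"
proof -
  have "limL (\<lambda>t. cj (- \<beta>) t n) \<one> at_top \<longleftrightarrow> limL (\<lambda>t. cj \<beta> t n) \<one> at_bot"
    unfolding cj_minus limitin_def at_bot_mirror eventually_filtermap ..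
  then show ?thesis unfolding Rm_def by simp
qed

text \<open>The limit \<open>h\<close> is invariant under time shifts, hence centralises
  \<open>\<beta>\<close>; dividing it off leaves an element contracted to the identity at minus
  infinity.\<close>

lemma parabolic_iff: "p \<in> PP \<longleftrightarrow> (\<exists>h\<in>Cent \<beta>. \<exists>n\<in>Rm (- \<beta>). p = h \<otimes> n)"
proof
  assume "p \<in> PP"
  then obtain h where p: "p \<in> G" and h: "h \<in> G" and lim: "limL (\<lambda>t. cj \<beta> t p) h at_bot"
    unfolding parabolic_def by blast
  note c = G_carrier[OF p] G_carrier[OF h]
  have fx: "cj \<beta> s h = h" for s
  proof -
    have 1: "limL (\<lambda>t. cj \<beta> (s + t) p) (cj \<beta> s h) at_bot"
      using cj_limitin[OF lim, of \<beta> s] by (simp add: cj_cj[OF c(1)])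
    have "filterlim (\<lambda>t::real. s + t) at_bot at_bot"
      unfolding filterlim_at_bot
    proof
      fix Z show "\<forall>\<^sub>F t in at_bot. s + t \<le> Z" using eventually_le_at_bot[of "Z - s"] by eventually_elim simp
    qed
    then have 2: "limL (\<lambda>t. cj \<beta> (s + t) p) h at_bot"
      using lim unfolding limitin_def filterlim_iff by blast
    show ?thesis by (rule limitin_unique_L[OF 1 2]) simp
  qed
  then have hC: "h \<in> Cent \<beta>" unfolding Cent_def using cj_fixed[OF c(2)] h by blast
  have "limL (\<lambda>t. inv h \<otimes> cj \<beta> t p) (inv h \<otimes> h) at_bot"
    by (intro limitin_mult limitin_constL lim) (use c in auto)
  moreover have "cj \<beta> t (inv h \<otimes> p) = inv h \<otimes> cj \<beta> t p" for t using c fx by (simp add: cj_mult cj_inv)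
  ultimately have "inv h \<otimes> p \<in> Rm (- \<beta>)" unfolding Rm_minus_limitin using c p h G_mult G_inv by simp
  moreover have "p = h \<otimes> (inv h \<otimes> p)" using c by (simp add: cancel_inv)
  ultimately show "\<exists>h\<in>Cent \<beta>. \<exists>n\<in>Rm (- \<beta>). p = h \<otimes> n" using hC by blast
next
  assume "\<exists>h\<in>Cent \<beta>. \<exists>n\<in>Rm (- \<beta>). p = h \<otimes> n"
  then obtain h n where h: "h \<in> Cent \<beta>" and n: "n \<in> Rm (- \<beta>)" and p: "p = h \<otimes> n" by blast
  note c = Cent_carrier[OF h] Rm_carrier[OF n]
  have fx: "cj \<beta> t h = h" for t using cj_fixed[OF c(1)] CentD(2)[OF h] by blast
  have "limL (\<lambda>t. h \<otimes> cj \<beta> t n) (h \<otimes> \<one>) at_bot"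
    by (intro limitin_mult limitin_constL) (use c n Rm_minus_limitin in auto)
  then show "p \<in> PP" unfolding parabolic_def p using c h n CentD(1) RmD(1) G_mult by (auto simp: cj_mult fx)
qed

text \<open>Trades the existence of a limit for a closed condition on the vector
  \<open>Ad L p \<beta>\<close>.\<close>

lemma parabolic_Ad: "p \<in> PP \<longleftrightarrow> p \<in> G \<and> Ad L p \<beta> - \<beta> \<in> pos"
proof
  assume "p \<in> PP"
  then obtain h n where h: "h \<in> Cent \<beta>" and n: "n \<in> Rm (- \<beta>)" and p: "p = h \<otimes> n" unfolding parabolic_iff by blast
  note c = Cent_carrier[OF h] Rm_carrier[OF n]
  define n' where "n' = h \<otimes> n \<otimes> inv h"
  have n': "n' \<in> Rm (- \<beta>)" unfolding n'_def using Cent_Rm[of h "- \<beta>" n] h n by (simp add: Cent_minus)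
  have "p = n' \<otimes> h" unfolding n'_def p using c by (simp add: m_assoc)
  then have "Ad L p \<beta> = Ad L n' \<beta>" using c Rm_carrier[OF n'] CentD(2)[OF h] by (simp add: Ad_mult)
  then show "p \<in> G \<and> Ad L p \<beta> - \<beta> \<in> pos" using Rm_pos[OF n'] p G_mult CentD(1)[OF h] RmD(1)[OF n] by simp
next
  assume p: "p \<in> G \<and> Ad L p \<beta> - \<beta> \<in> pos"
  then obtain n where n: "n \<in> Rm (- \<beta>)" "Ad L n \<beta> = \<beta> + (Ad L p \<beta> - \<beta>)" using Rm_pos_transitive by blast
  note c = G_carrier[OF conjunct1[OF p]] Rm_carrier[OF n(1)]
  have "Ad L (inv n \<otimes> p) \<beta> = Ad L (inv n) (Ad L n \<beta>)" using c n(2) by (simp add: Ad_mult)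
  then have h: "inv n \<otimes> p \<in> Cent \<beta>" unfolding Cent_def using c p G_mult G_inv RmD(1)[OF n(1)] by (simp add: Ad_inv)
  define h where "h = inv n \<otimes> p"
  have hC: "h \<in> Cent \<beta>" using h unfolding h_def .
  note hc = Cent_carrier[OF hC]
  have "p = n \<otimes> h" unfolding h_def using c by (simp add: cancel_inv)
  then have "p = h \<otimes> (inv h \<otimes> n \<otimes> inv (inv h))" using c hc by (simp add: m_assoc cancel_inv)
  moreover have "inv h \<otimes> n \<otimes> inv (inv h) \<in> Rm (- \<beta>)"
    using Cent_Rm[of "inv h" "- \<beta>" n] n subgroup.m_inv_closed[OF Cent_subgroup hC] by (simp add: Cent_minus)
  ultimately show "p \<in> PP" unfolding parabolic_iff using hC by blast
qed

lemma parabolic_G: "p \<in> PP ==> p \<in> G"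
  unfolding parabolic_def by simp

lemma parabolic_subgroup: "subgroup PP L"
proof (rule subgroupI)
  show "PP \<subseteq> carrier L" using parabolic_G G_carrier by auto
  have "\<one> \<in> PP" unfolding parabolic_Ad using G_one subspace_0[OF part_subspace] by simp
  then show "PP \<noteq> {}" by auto
  show "inv a \<in> PP" if a: "a \<in> PP" for a
  proof -
    obtain h n where h: "h \<in> Cent \<beta>" and n: "n \<in> Rm (- \<beta>)" and p: "a = h \<otimes> n" using a unfolding parabolic_iff by blast
    note c = Cent_carrier[OF h] Rm_carrier[OF n]
    have "inv a = inv h \<otimes> (h \<otimes> inv n \<otimes> inv h)" unfolding p using c by (simp add: inv_mult_group m_assoc cancel_inv)
    moreover have "h \<otimes> inv n \<otimes> inv h \<in> Rm (- \<beta>)" using Cent_Rm[of h "- \<beta>" "inv n"] h Rm_inv[OF n] by (simp add: Cent_minus)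
    ultimately show ?thesis unfolding parabolic_iff using subgroup.m_inv_closed[OF Cent_subgroup h] by blast
  qed
  show "a \<otimes> b \<in> PP" if a: "a \<in> PP" and b: "b \<in> PP" for a b
  proof -
    obtain h h' where l: "h \<in> G" "h' \<in> G" "limL (\<lambda>t. cj \<beta> t a) h at_bot" "limL (\<lambda>t. cj \<beta> t b) h' at_bot"
      using a b unfolding parabolic_def by blast
    note c = G_carrier[OF parabolic_G[OF a]] G_carrier[OF parabolic_G[OF b]]
    have "limL (\<lambda>t. cj \<beta> t (a \<otimes> b)) (h \<otimes> h') at_bot"
      using limitin_mult[OF l(3,4)] c by (simp add: cj_mult)
    then show ?thesis unfolding parabolic_def using l G_mult parabolic_G[OF a] parabolic_G[OF b] by auto
  qed
qed

end

section \<open>Closed sets invariant under one-parameter subgroups\<close>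

context complex_lie_gp
begin

lemma compact_chart_ball:
  obtains R where "R > 0" "cball 0 R \<subseteq> E0" "\<forall>r\<le>R. compactin (ltop L) (\<sigma> ` cball 0 r)"
proof -
  obtain R where R: "R > 0" "cball 0 R \<subseteq> E0" by (rule E0_cball)
  have "compactin (ltop L) (\<sigma> ` cball 0 r)" if "r \<le> R" for r
  proof (rule image_compactin)
    show "compactin (top_of_set (cball (0::'e) r)) (cball 0 r)"
      using finite_dimensional_compact_cball[OF fd, of 0 r] by (simp add: compactin_subtopology)
    show "continuous_map (top_of_set (cball (0::'e) r)) (ltop L) \<sigma>"
    proof (rule continuous_map_top_of_setI)
      fix x :: 'e assume "x \<in> cball 0 r"
      then have "x \<in> E0" using R(2) that by auto
      then show "limL \<sigma> (\<sigma> x) (at x within cball 0 r)" by (intro limitin_sigma tendsto_ident_at)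
    qed
  qed
  then show ?thesis using that R by blast
qed

lemma near_one_D0: "\<exists>W. openin (ltop L) W \<and> \<one> \<in> W \<and> (\<forall>g\<in>W. g \<in> D0 \<and> norm (\<psi> g) < \<delta>)" if "\<delta> > 0"
proof -
  have "limL (\<lambda>g. g) \<one> (nhdsin (ltop L) \<one>)"
    unfolding limitin_def eventually_nhdsin using carrier one_closed by auto
  then have "\<forall>\<^sub>F g in nhdsin (ltop L) \<one>. g \<in> D0 \<and> norm (\<psi> g) < \<delta>"
    unfolding limitin_one tendsto_iff dist_norm using that eventually_conj by fastforce
  then show ?thesis unfolding eventually_nhdsin using one_closed carrier by auto
qed

text \<open>\<open>minimize_to_one\<close> stands in for the fact that elements of \<open>H\<close>
  near the identity are exponentials.\<close>

lemma invariant_near_one: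
  assumes H: "closedin (ltop L) H" "subgroup H L" and D: "closedin (ltop L) D"
    and inv: "\<And>w d. w \<in> lie_algebra L H ==> d \<in> D ==> Exp w \<otimes> d \<in> D"
  obtains W where "openin (ltop L) W" "\<one> \<in> W" "\<forall>g\<in>W \<inter> H. \<forall>d\<in>D. g \<otimes> d \<in> D"
proof -
  obtain \<delta> where \<delta>: "\<delta> > 0" "\<forall>\<delta>' S. 0 < \<delta>' --> \<delta>' \<le> \<delta> --> closedin (ltop L) S --> S \<subseteq> H --> (\<exists>g\<in>S. g \<in> D0 \<and> norm (\<psi> g) < \<delta>') -->
     (\<forall>g\<in>S. g \<in> D0 --> norm (\<psi> g) < \<delta>' --> (\<forall>w\<in>lie_algebra L H.
         \<forall>\<^sub>F s in at_right 0. ex s 0 \<otimes> g \<otimes> ex s (- w) \<in> S)) --> \<one> \<in> S"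
    by (rule minimize_to_one[OF H, of "\<lambda>_. 0" "\<lambda>w. - w"]) simp_all
  obtain W where W: "openin (ltop L) W" "\<one> \<in> W" "\<forall>g\<in>W. g \<in> D0 \<and> norm (\<psi> g) < \<delta>" using near_one_D0[OF \<delta>(1)] by blast
  have Dc: "d \<in> carrier L" if "d \<in> D" for d using closedin_subset[OF D] that carrier by auto
  show ?thesis
  proof (rule that[OF W(1,2)], intro ballI)
    fix g d assume g: "g \<in> W \<inter> H" and d: "d \<in> D"
    have gc: "g \<in> carrier L" using g subgroup.mem_carrier[OF H(2)] by auto
    note dc = Dc[OF d]
    \<comment> \<open>It contains \<open>g\<close> and is stable under right multiplication by
      exponentials; that it contains the identity means
      \<open>g \<otimes> d \<in> D\<close>.\<close>
    define S where "S = H \<inter> {h \<in> carrier L. inv h \<otimes> (g \<otimes> d) \<in> D}"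
    have cm: "continuous_map (ltop L) (ltop L) (\<lambda>h. inv h \<otimes> (g \<otimes> d))"
      using continuous_map_compose[OF cont_inv continuous_right_mult[of "g \<otimes> d"]] gc dc by (simp add: o_def)
    have "closedin (ltop L) {h \<in> carrier L. inv h \<otimes> (g \<otimes> d) \<in> D}"
      unfolding carrier by (rule closedin_continuous_map_preimage[OF cm D])
    then have "closedin (ltop L) S" unfolding S_def by (rule closedin_Int[OF H(1)])
    moreover have "g \<in> S" unfolding S_def using g gc d dc by (simp add: cancel_inv)
    moreover have "\<forall>\<^sub>F s in at_right 0. ex s 0 \<otimes> h \<otimes> ex s (- w) \<in> S" if h: "h \<in> S" and w: "w \<in> lie_algebra L H" for h w
    proof (intro always_eventually allI)
      fix s :: real
      have hc: "h \<in> carrier L" "h \<in> H" "inv h \<otimes> (g \<otimes> d) \<in> D" using h unfolding S_def by auto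
      have "inv (ex s (- w)) = ex s w" using Exp_neg[of "s *\<^sub>R (- w)"] by simp
      then have "inv (h \<otimes> ex s (- w)) \<otimes> (g \<otimes> d) = ex s w \<otimes> (inv h \<otimes> (g \<otimes> d))"
        using hc gc dc by (simp add: inv_mult_group m_assoc)
      then have "inv (h \<otimes> ex s (- w)) \<otimes> (g \<otimes> d) \<in> D" using inv[OF lie_algebra_scale[OF w] hc(3)] by simp
      moreover have "s *\<^sub>R (- w) \<in> lie_algebra L H" using lie_algebra_scale[OF w, of "- s"] by simp
      then have "h \<otimes> ex s (- w) \<in> H" using subgroup.m_closed[OF H(2) hc(2)] lie_algebra_Exp by blast
      ultimately show "ex s 0 \<otimes> h \<otimes> ex s (- w) \<in> S" unfolding S_def using hc by simp
    qed
    moreover have "g \<in> D0" "norm (\<psi> g) < \<delta>" using g W(3) by auto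
    moreover have "S \<subseteq> H" unfolding S_def by blast
    ultimately have "\<one> \<in> S" using \<delta>(2)[rule_format, OF \<delta>(1) order_refl, of S] by blast
    then show "g \<otimes> d \<in> D" unfolding S_def using gc dc by simp
  qed
qed

end

section \<open>The big cell\<close>

text \<open>Restrictions of entire functions to the real line. They form a ring without zero
  divisors, and vanishing on an interval forces vanishing everywhere.\<close>

definition entire_real :: "(real => real) => bool" where
  "entire_real f \<longleftrightarrow> (\<exists>F. F holomorphic_on UNIV \<and> (\<forall>t. F (of_real t) = complex_of_real (f t)))"

lemma entire_real_const: "entire_real (\<lambda>_. c)"
  unfolding entire_real_def by (intro exI[of _ "\<lambda>_. of_real c"]) auto

lemma entire_real_add: "entire_real f ==> entire_real g ==> entire_real (\<lambda>t. f t + g t)"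
proof -
  assume "entire_real f" "entire_real g"
  then obtain F H where "F holomorphic_on UNIV" "\<forall>t. F (of_real t) = complex_of_real (f t)"
    "H holomorphic_on UNIV" "\<forall>t. H (of_real t) = complex_of_real (g t)" unfolding entire_real_def by blast
  then show ?thesis unfolding entire_real_def by (intro exI[of _ "\<lambda>z. F z + H z"]) (auto intro: holomorphic_on_add)
qed

lemma entire_real_mult: "entire_real f ==> entire_real g ==> entire_real (\<lambda>t. f t * g t)"
proof -
  assume "entire_real f" "entire_real g"
  then obtain F H where "F holomorphic_on UNIV" "\<forall>t. F (of_real t) = complex_of_real (f t)"
    "H holomorphic_on UNIV" "\<forall>t. H (of_real t) = complex_of_real (g t)" unfolding entire_real_def by blast
  then show ?thesis unfolding entire_real_def by (intro exI[of _ "\<lambda>z. F z * H z"]) (auto intro: holomorphic_on_mult)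
qed

lemma entire_real_diff: "entire_real f ==> entire_real g ==> entire_real (\<lambda>t. f t - g t)"
  using entire_real_add[OF _ entire_real_mult[OF entire_real_const[of "-1"]], of f g] by simp

lemma entire_real_zero:
  assumes f: "entire_real f" and ab: "a < b" "\<And>t. a < t ==> t < b ==> f t = 0"
  shows "f t = 0"
proof -
  obtain F where F: "F holomorphic_on UNIV" "\<And>t. F (of_real t) = complex_of_real (f t)"
    using f unfolding entire_real_def by blast
  define m where "m = (a + b) / 2"
  have m: "a < m" "m < b" using ab(1) unfolding m_def by auto
  have "complex_of_real m islimpt of_real ` {a<..<b}"
    unfolding islimpt_approachable
  proof (intro allI impI)
    fix e :: real assume e: "e > 0"
    define x where "x = m + min e (b - m) / 2"
    have "a < x" "x < b" "x \<noteq> m" "\<bar>x - m\<bar> < e" using m e unfolding x_def by (auto simp: min_def field_simps)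
    then show "\<exists>x'\<in>of_real ` {a<..<b}. x' \<noteq> complex_of_real m \<and> dist x' (complex_of_real m) < e"
      by (intro bexI[of _ "of_real x"]) (auto simp: dist_of_real dist_real_def)
  qed
  moreover have "F z = 0" if "z \<in> of_real ` {a<..<b}" for z using that F(2) ab(2) by auto
  ultimately have "F (of_real t) = 0"
    using analytic_continuation[OF F(1) open_UNIV connected_UNIV subset_UNIV UNIV_I, of "of_real m" "of_real ` {a<..<b}" "of_real t"] by auto
  then show ?thesis using F(2) by simp
qed

text \<open>The first factor is nonzero on an interval around \<open>t\<close>; the second vanishes
  there and therefore everywhere.\<close>

lemma entire_real_mult_zero:
  assumes f: "entire_real f" and g: "entire_real g" and fg: "\<And>t. f t * g t = 0" and ft: "f t \<noteq> 0"
  shows "g s = 0"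
proof -
  obtain F where F: "F holomorphic_on UNIV" "\<And>t. F (of_real t) = complex_of_real (f t)"
    using f unfolding entire_real_def by blast
  have "continuous_on UNIV (\<lambda>t. F (complex_of_real t))"
    by (rule continuous_on_compose2[OF holomorphic_on_imp_continuous_on[OF F(1)]]) (auto intro!: continuous_intros)
  then have "open {s. F (complex_of_real s) \<noteq> 0}" by (rule open_Collect_neq) simp
  moreover have "t \<in> {s. F (complex_of_real s) \<noteq> 0}" using F(2)[of t] ft by simp
  ultimately obtain d where d0: "d > 0" "ball t d \<subseteq> {s. F (complex_of_real s) \<noteq> 0}" unfolding open_contains_ball by blast
  have d: "d > 0" "\<And>s. \<bar>s - t\<bar> < d ==> f s \<noteq> 0"
    using d0 F(2) by (auto simp: subset_iff dist_real_def abs_minus_commute)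
  show ?thesis
    by (rule entire_real_zero[OF g, of "t - d" "t + d"]) (use d fg in \<open>force simp: abs_less_iff\<close>)+
qed

text \<open>Fraction-free Gaussian elimination; \<open>\<theta>\<close> is the product of the pivots.\<close>

lemma entire_system:
  fixes A :: "real => 'k => 'i => real" and c :: "real => 'k => real"
  assumes "finite I" "t0 > 0"
    and "\<And>e i. e \<in> E ==> i \<in> I ==> entire_real (\<lambda>t. A t e i)" "\<And>e. e \<in> E ==> entire_real (\<lambda>t. c t e)"
    and "\<And>t. \<bar>t\<bar> < t0 ==> \<exists>x. \<forall>e\<in>E. (\<Sum>i\<in>I. A t e i * x i) = c t e"
  shows "\<exists>\<theta>. entire_real \<theta> \<and> (\<exists>t. \<theta> t \<noteq> 0) \<and> (\<forall>t. \<theta> t \<noteq> 0 --> (\<exists>x. \<forall>e\<in>E. (\<Sum>i\<in>I. A t e i * x i) = c t e))"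
  using assms(1,3-)
proof (induction I arbitrary: A c rule: finite_induct)
  case empty
  \<comment> \<open>Solvability without unknowns means \<open>c t e = 0\<close>; this holds for
    small \<open>t\<close> and so for all \<open>t\<close>.\<close>
  have "c t e = 0" if e: "e \<in> E" for t e
    by (rule entire_real_zero[OF empty(2)[OF e], of "- t0" t0]) (use empty(3) e assms(2) in auto)
  then show ?case by (intro exI[of _ "\<lambda>_. 1"]) (auto intro: entire_real_const)
next
  case (insert i I)
  show ?case
  proof (cases "\<forall>t. \<forall>e\<in>E. A t e i = 0")
    case True
    have "\<exists>\<theta>. entire_real \<theta> \<and> (\<exists>t. \<theta> t \<noteq> 0) \<and> (\<forall>t. \<theta> t \<noteq> 0 --> (\<exists>x. \<forall>e\<in>E. (\<Sum>i\<in>I. A t e i * x i) = c t e))"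
    proof (rule insert.IH)
      show "\<exists>x. \<forall>e\<in>E. (\<Sum>i\<in>I. A t e i * x i) = c t e" if "\<bar>t\<bar> < t0" for t
        using insert.prems(3)[OF that] insert.hyps True by simp
    qed (use insert.prems in auto)
    then show ?thesis using insert.hyps True by simp
  next
    case False
    then obtain t1 e0 where e0: "e0 \<in> E" "A t1 e0 i \<noteq> 0" by blast
    define a where "a t = A t e0 i" for t
    have a: "entire_real a" unfolding a_def using insert.prems(1)[OF e0(1)] by simp
    \<comment> \<open>The row \<open>e0\<close> eliminates the unknown \<open>i\<close>. Multiplying
      by the pivot \<open>a t\<close>, which may have zeros, keeps the coefficients entire.\<close>
    define A' where "A' t e j = a t * A t e j - A t e i * A t e0 j" for t e j
    define c' where "c' t e = a t * c t e - A t e i * c t e0" for t e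
    have sumA': "(\<Sum>j\<in>I. A' t e j * x j) = a t * (\<Sum>j\<in>I. A t e j * x j) - A t e i * (\<Sum>j\<in>I. A t e0 j * x j)" for t e x
      unfolding A'_def by (simp add: sum_distrib_left sum_subtractf algebra_simps)
    have "\<exists>\<theta>. entire_real \<theta> \<and> (\<exists>t. \<theta> t \<noteq> 0) \<and> (\<forall>t. \<theta> t \<noteq> 0 --> (\<exists>x. \<forall>e\<in>E. (\<Sum>i\<in>I. A' t e i * x i) = c' t e))"
    proof (rule insert.IH)
      show "entire_real (\<lambda>t. A' t e j)" if "e \<in> E" "j \<in> I" for e j
        unfolding A'_def by (intro entire_real_diff entire_real_mult a insert.prems(1)) (use that e0 in auto)
      show "entire_real (\<lambda>t. c' t e)" if "e \<in> E" for e
        unfolding c'_def by (intro entire_real_diff entire_real_mult a insert.prems(1,2)) (use that e0 in auto)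
      show "\<exists>x. \<forall>e\<in>E. (\<Sum>i\<in>I. A' t e i * x i) = c' t e" if t: "\<bar>t\<bar> < t0" for t
      proof -
        obtain x where x: "\<And>e. e \<in> E ==> A t e i * x i + (\<Sum>j\<in>I. A t e j * x j) = c t e"
          using insert.prems(3)[OF t] insert.hyps by auto
        have "(\<Sum>j\<in>I. A' t e j * x j) = c' t e" if "e \<in> E" for e
          unfolding sumA' c'_def x[OF that, symmetric] x[OF e0(1), symmetric] a_def by (simp add: algebra_simps)
        then show ?thesis by blast
      qed
    qed
    then obtain \<theta> where \<theta>: "entire_real \<theta>" "\<exists>t. \<theta> t \<noteq> 0"
      "\<And>t. \<theta> t \<noteq> 0 ==> \<exists>x. \<forall>e\<in>E. (\<Sum>i\<in>I. A' t e i * x i) = c' t e" by blast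
    show ?thesis
    proof (intro exI[of _ "\<lambda>t. \<theta> t * a t"] conjI allI impI)
      show "entire_real (\<lambda>t. \<theta> t * a t)" by (rule entire_real_mult[OF \<theta>(1) a])
      show "\<exists>t. \<theta> t * a t \<noteq> 0" using entire_real_mult_zero[OF \<theta>(1) a] \<theta>(2) e0(2) unfolding a_def by blast
      fix t assume t: "\<theta> t * a t \<noteq> 0"
      then obtain x where x: "\<And>e. e \<in> E ==> (\<Sum>i\<in>I. A' t e i * x i) = c' t e" using \<theta>(3)[of t] by auto
      define z where "z = (c t e0 - (\<Sum>j\<in>I. A t e0 j * x j)) / a t"
      have z: "a t * z = c t e0 - (\<Sum>j\<in>I. A t e0 j * x j)" unfolding z_def using t by simp
      have "A t e i * z + (\<Sum>j\<in>I. A t e j * x j) = c t e" if e: "e \<in> E" for e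
      proof -
        have "a t * (A t e i * z + (\<Sum>j\<in>I. A t e j * x j)) = A t e i * (a t * z) + a t * (\<Sum>j\<in>I. A t e j * x j)"
          by (simp add: algebra_simps)
        also have "\<dots> = a t * c t e" using x[OF e] unfolding z sumA' c'_def by (simp add: algebra_simps)
        finally show ?thesis using t by simp
      qed
      moreover have "(\<Sum>j\<in>I. A t e j * (x(i := z)) j) = (\<Sum>j\<in>I. A t e j * x j)" for e
        by (rule sum.cong) (use insert.hyps in auto)
      ultimately have "\<forall>e\<in>E. (\<Sum>j\<in>insert i I. A t e j * (x(i := z)) j) = c t e" using insert.hyps by simp
      then show "\<exists>x. \<forall>e\<in>E. (\<Sum>j\<in>insert i I. A t e j * x j) = c t e" by blast
    qed
  qed
qed

text \<open>The growth bound makes the Maclaurin remainder tend to 0 for every \<open>x\<close>, and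
  it makes the same power series converge on the whole complex plane.\<close>

lemma entire_real_Taylor:
  fixes d :: "nat => real => real"
  assumes deriv: "\<And>m x. DERIV (d m) x :> d (Suc m) x" and M: "M \<ge> 0"
    and bd: "\<And>r. \<exists>C. \<forall>m x. \<bar>x\<bar> \<le> r --> \<bar>d m x\<bar> \<le> C * M ^ m"
  shows "entire_real (d 0)"
proof -
  define a where "a m = d m 0 / fact m" for m
  have ex: "(\<lambda>m. C * (M * r) ^ m / fact m) \<longlonglongrightarrow> 0" "summable (\<lambda>m. C * (M * r) ^ m / fact m)" for C r :: real
  proof -
    have "summable (\<lambda>m. C * (inverse (fact m) * (M * r) ^ m))" by (intro summable_mult summable_exp)
    then show "summable (\<lambda>m. C * (M * r) ^ m / fact m)" by (simp add: divide_inverse mult_ac)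
    then show "(\<lambda>m. C * (M * r) ^ m / fact m) \<longlonglongrightarrow> 0" by (rule summable_LIMSEQ_zero)
  qed
  have sm: "(\<lambda>m. a m * x ^ m) sums d 0 x" for x
  proof -
    obtain C where C: "\<And>m y. \<bar>y\<bar> \<le> \<bar>x\<bar> ==> \<bar>d m y\<bar> \<le> C * M ^ m" using bd[of "\<bar>x\<bar>"] by blast
    have "\<bar>(\<Sum>m<n. a m * x ^ m) - d 0 x\<bar> \<le> C * (M * \<bar>x\<bar>) ^ n / fact n" for n
    proof -
      have dd: "\<forall>m x. DERIV (d m) x :> d (Suc m) x" using deriv by blast
      obtain t where t: "\<bar>t\<bar> \<le> \<bar>x\<bar>" "d 0 x = (\<Sum>m<n. d m 0 / fact m * x ^ m) + d n t / fact n * x ^ n"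
        using Maclaurin_all_le[OF refl dd, of x n] by blast
      have "\<bar>(\<Sum>m<n. a m * x ^ m) - d 0 x\<bar> = \<bar>d n t\<bar> / fact n * \<bar>x\<bar> ^ n"
        unfolding t(2) a_def by (simp add: abs_mult power_abs)
      also have "\<dots> \<le> C * M ^ n / fact n * \<bar>x\<bar> ^ n"
        by (intro mult_right_mono divide_right_mono C t(1)) auto
      finally show ?thesis by (simp add: power_mult_distrib)
    qed
    then have "(\<lambda>n. (\<Sum>m<n. a m * x ^ m) - d 0 x) \<longlonglongrightarrow> 0"
      by (intro tendsto_rabs_zero_cancel[OF tendsto_sandwich[OF _ _ tendsto_const ex(1)[of C "\<bar>x\<bar>"]]]) auto
    then show ?thesis unfolding sums_def by (rule LIM_zero_cancel)
  qed
  define F where "F z = (\<Sum>m. complex_of_real (a m) * z ^ m)" for z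
  have sC: "summable (\<lambda>m. complex_of_real (a m) * z ^ m)" for z
  proof -
    obtain C where C: "\<And>m y. \<bar>y\<bar> \<le> (0::real) ==> \<bar>d m y\<bar> \<le> C * M ^ m" using bd[of 0] by blast
    show ?thesis
    proof (rule summable_comparison_test'[OF ex(2)[of C "norm z"]])
      fix n
      have "norm (complex_of_real (a n) * z ^ n) = \<bar>d n 0\<bar> / fact n * norm z ^ n"
        unfolding a_def by (simp add: norm_mult norm_power norm_divide)
      also have "\<dots> \<le> C * M ^ n / fact n * norm z ^ n"
        by (intro mult_right_mono divide_right_mono C) auto
      finally show "norm (complex_of_real (a n) * z ^ n) \<le> C * (M * norm z) ^ n / fact n" by (simp add: power_mult_distrib)
    qed
  qed
  have "F holomorphic_on UNIV"
    unfolding holomorphic_on_def field_differentiable_def F_def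
    using termdiffs_strong_converges_everywhere[OF sC] by auto
  moreover have "F (of_real t) = of_real (d 0 t)" for t
  proof -
    have "(\<lambda>m. complex_of_real (a m * t ^ m)) sums of_real (d 0 t)" using sums_of_real[OF sm[of t], where 'a = complex] .
    then show ?thesis unfolding F_def by (simp add: sums_iff)
  qed
  ultimately show ?thesis unfolding entire_real_def by blast
qed

context graded
begin

text \<open>The \<open>m\<close>-th derivative replaces \<open>v\<close> by its image under the
  \<open>m\<close>-th power of \<open>bracket \<zeta>\<close>, so it grows at most like a power of a
  bound for that operator.\<close>

lemma entire_real_Ad_Exp:
  assumes z: "\<zeta> \<in> lg" and v: "v \<in> lg"
  shows "entire_real (\<lambda>t. IP (Ad L (ex t \<zeta>) v) b)"
proof -
  define w where "w m = (bracket \<zeta> ^^ m) v" for m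
  define d where "d m t = IP (Ad L (ex t \<zeta>) (w m)) b" for m t
  have w: "w m \<in> lg" for m
    unfolding w_def by (induction m) (auto intro: v bracket_lie_algebra[OF G_closed G_subgroup z])
  have wS: "w (Suc m) = bracket \<zeta> (w m)" for m unfolding w_def by simp
  obtain M where M: "M > 0" "\<And>x. norm (bracket \<zeta> x) \<le> norm x * M"
    using bounded_linear.pos_bounded[OF finite_dimensional_bounded_linear[OF fd bracket_linear_right]] by blast
  have wM: "norm (w m) \<le> norm v * M ^ m" for m
  proof (induction m)
    case (Suc m)
    have "norm (w (Suc m)) \<le> norm (w m) * M" unfolding wS by (rule M(2))
    also have "\<dots> \<le> norm v * M ^ m * M" using Suc M(1) by (intro mult_right_mono) auto
    finally show ?case by (simp add: mult_ac)
  qed (simp add: w_def)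
  obtain K where K: "K > 0" "\<And>x y. \<bar>IP x y\<bar> \<le> norm x * norm y * K"
    using bounded_bilinear.pos_bounded[OF IP.bounded_bilinear_IP] by auto
  have vd: "((\<lambda>t. IP (Ad L (ex t \<zeta>) x) y) has_vector_derivative IP (Ad L (ex t \<zeta>) (bracket \<zeta> x)) y) (at t)" for x y t
    using bounded_bilinear.has_vector_derivative[OF IP.bounded_bilinear_IP Ad_Exp_has_vector_derivative(1)[of \<zeta> x t] has_vector_derivative_const, of y]
    by simp
  have "entire_real (d 0)"
  proof (rule entire_real_Taylor[where M = M])
    show "DERIV (d m) x :> d (Suc m) x" for m x
      unfolding d_def wS has_real_derivative_iff_has_vector_derivative by (rule vd)
    show "M \<ge> 0" using M by simp
    fix r :: real
    have "\<exists>c. \<forall>t. \<bar>t\<bar> \<le> r --> \<bar>IP (Ad L (ex t \<zeta>) b') b\<bar> \<le> c" for b'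
    proof -
      have "continuous_on {-r..r} (\<lambda>t. IP (Ad L (ex t \<zeta>) b') b)"
        using vd[of b' b] by (auto intro!: continuous_at_imp_continuous_on dest: has_vector_derivative_continuous)
      then have "bounded ((\<lambda>t. IP (Ad L (ex t \<zeta>) b') b) ` {-r..r})"
        using compact_continuous_image compact_imp_bounded compact_Icc by blast
      then obtain c where c: "\<forall>t\<in>{-r..r}. \<bar>IP (Ad L (ex t \<zeta>) b') b\<bar> \<le> c" unfolding bounded_iff by auto
      then show ?thesis by (intro exI[of _ c] allI impI) (auto simp: abs_le_iff)
    qed
    then obtain c where c: "\<And>b' t. \<bar>t\<bar> \<le> r ==> \<bar>IP (Ad L (ex t \<zeta>) b') b\<bar> \<le> c b'" by metis
    show "\<exists>C. \<forall>m x. \<bar>x\<bar> \<le> r --> \<bar>d m x\<bar> \<le> C * M ^ m"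
    proof (intro exI allI impI)
      fix m x assume x: "\<bar>x\<bar> \<le> r"
      have "d m x = IP (Ad L (ex x \<zeta>) (\<Sum>b'\<in>B. IP (w m) b' *\<^sub>R b')) b"
        unfolding d_def by (subst B_span[OF w[of m]]) simp
      also have "\<dots> = (\<Sum>b'\<in>B. IP (w m) b' * IP (Ad L (ex x \<zeta>) b') b)"
        by (simp add: linear_sum[OF Ad_linear] linear_scale[OF Ad_linear] IP.IP_sum IP.IP_scale_left)
      finally have "\<bar>d m x\<bar> \<le> (\<Sum>b'\<in>B. \<bar>IP (w m) b' * IP (Ad L (ex x \<zeta>) b') b\<bar>)" by (simp add: sum_abs)
      also have "\<dots> \<le> (\<Sum>b'\<in>B. norm v * M ^ m * norm b' * K * c b')"
      proof (rule sum_mono)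
        fix b' assume "b' \<in> B"
        have "\<bar>IP (w m) b'\<bar> \<le> norm v * M ^ m * norm b' * K"
          by (rule order_trans[OF K(2)]) (use wM[of m] K(1) in \<open>auto intro!: mult_right_mono\<close>)
        then show "\<bar>IP (w m) b' * IP (Ad L (ex x \<zeta>) b') b\<bar> \<le> norm v * M ^ m * norm b' * K * c b'"
          unfolding abs_mult using c[OF x, of b'] by (intro mult_mono) auto
      qed
      also have "\<dots> = (\<Sum>b'\<in>B. norm v * norm b' * K * c b') * M ^ m"
        unfolding sum_distrib_right by (rule sum.cong) (simp_all add: mult_ac)
      finally show "\<bar>d m x\<bar> \<le> (\<Sum>b'\<in>B. norm v * norm b' * K * c b') * M ^ m" .
    qed
  qed
  then show ?thesis unfolding d_def w_def by simp
qed

end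

context complex_lie_gp
begin

lemma limitin_ident: "x \<in> topspace T ==> limitin T (\<lambda>g. g) x (atin T x)"
  unfolding limitin_def by (auto simp: eventually_atin)

lemma continuous_map_Ad: "continuous_map (ltop L) euclidean (\<lambda>g. Ad L g v)"
  unfolding continuous_map_atin limitin_canonical_iff
  by (intro ballI Ad_tendsto limitin_ident tendsto_const)

end

section \<open>The big cell is a neighbourhood of the identity\<close>

context graded
begin

lemma parabolic_closed: "closedin (ltop L) PP"
proof -
  have "continuous_map (ltop L) euclidean (\<lambda>p. Ad L p \<beta> - \<beta>)"
    by (intro continuous_map_diff continuous_map_Ad) simp
  moreover have "closed pos" by (rule finite_dimensional_closed_subspace[OF fd part_subspace])
  ultimately have "closedin (ltop L) {p \<in> topspace (ltop L). Ad L p \<beta> - \<beta> \<in> pos}"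
    by (intro closedin_continuous_map_preimage) auto
  from closedin_Int[OF G_closed this] show ?thesis
    by (rule back_subst[of "closedin (ltop L)"]) (use closedin_subset[OF G_closed] in \<open>auto simp: parabolic_Ad\<close>)
qed

lemma urep_zero: "urep 0 = \<one>"
proof (rule Rm_eqI[OF urep(2) Rm_one])
  show "0 \<in> neg" by (rule subspace_0[OF part_subspace])
  then show "Ad L (urep 0) \<beta> = Ad L \<one> \<beta>" using urep(3) by simp
qed

lemma beta_pt: "\<beta> \<in> pt (\<lambda>c. c = 0)"
  by (rule zero_flowD[OF beta_lg beta_fixed])

lemma proj_neg_beta: "y \<in> neg ==> proj (\<lambda>c. c < 0) (\<beta> + y) = y"
  by (rule coord_eqI[OF proj_lg part_lg]) (auto simp: proj_coord IP.IP_add_left part_coord[OF beta_pt] part_coord)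

lemma proj_neg_pos: "y \<in> pos ==> proj (\<lambda>c. c < 0) (\<beta> + y) = 0"
  by (rule coord_eqI[OF proj_lg subspace_0[OF lg_subspace]]) (auto simp: proj_coord IP.IP_add_left part_coord[OF beta_pt] part_coord)

text \<open>Along a bad sequence \<open>p\<close> subconverges to some \<open>P\<close> in the
  parabolic group. Then \<open>\<beta> + y\<close> tends to \<open>Ad L (inv P) \<beta>\<close>,
  whose negative part is 0, so \<open>y\<close> tends to 0 and \<open>p\<close> to the identity.
  This keeps the parameters in \<open>Omega_near_one\<close> away from the boundary of their compact
  range.\<close>

lemma decomposition_control:
  assumes R: "R > 0" "cball 0 R \<subseteq> E0"
  shows "\<exists>\<delta>>0. \<forall>g g0 y p. g \<in> D0 --> norm (\<psi> g) < \<delta> --> g0 \<in> D0 --> norm (\<psi> g0) < \<delta> --> y \<in> neg -->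
    p \<in> PP --> p \<in> \<sigma> ` cball 0 R --> urep y \<otimes> g \<otimes> p = g0 --> norm y < 1 \<and> p \<in> D0 \<and> norm (\<psi> p) < R"
proof (rule ccontr)
  define bad where "bad \<delta> g g0 y p \<longleftrightarrow> g \<in> D0 \<and> norm (\<psi> g) < \<delta> \<and> g0 \<in> D0 \<and> norm (\<psi> g0) < \<delta> \<and> y \<in> neg \<and>
    p \<in> PP \<and> p \<in> \<sigma> ` cball 0 R \<and> urep y \<otimes> g \<otimes> p = g0 \<and> \<not> (norm y < 1 \<and> p \<in> D0 \<and> norm (\<psi> p) < R)" for \<delta> g g0 y p
  assume "\<not> ?thesis"
  then have "\<exists>q. bad (1 / real (Suc n)) (fst q) (fst (snd q)) (fst (snd (snd q))) (snd (snd (snd q)))" for n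
    unfolding bad_def using of_nat_0_less_iff[of "Suc n"] by fastforce
  then obtain q where "\<And>n. bad (1 / real (Suc n)) (fst (q n)) (fst (snd (q n))) (fst (snd (snd (q n)))) (snd (snd (snd (q n))))" by metis
  moreover define g g0 y p where "g n = fst (q n)" and "g0 n = fst (snd (q n))" and "y n = fst (snd (snd (q n)))"
    and "p n = snd (snd (snd (q n)))" for n
  ultimately have bad: "\<And>n. bad (1 / real (Suc n)) (g n) (g0 n) (y n) (p n)" by simp
  have lim0: "(\<lambda>n. 1 / real (Suc n)) \<longlonglongrightarrow> 0" using LIMSEQ_Suc[OF lim_const_over_n[of 1]] by simp
  have gl: "limL h \<one> sequentially" if "\<And>n. h n \<in> D0 \<and> norm (\<psi> (h n)) < 1 / real (Suc n)" for h
    unfolding limitin_one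
  proof
    show "\<forall>\<^sub>F n in sequentially. h n \<in> D0" using that by simp
    have "\<forall>\<^sub>F n in sequentially. norm (\<psi> (h n)) \<le> 1 / real (Suc n)" using that less_imp_le by (intro always_eventually) blast
    then show "(\<lambda>n. \<psi> (h n)) \<longlonglongrightarrow> 0"
      by (intro tendsto_norm_zero_cancel[OF tendsto_sandwich[OF _ _ tendsto_const lim0]]) simp_all
  qed
  have g: "limL g \<one> sequentially" "limL g0 \<one> sequentially"
    by (rule gl; use bad in \<open>simp add: bad_def\<close>)+
  have "\<forall>n. \<exists>x. x \<in> cball 0 R \<and> p n = \<sigma> x" using bad unfolding bad_def by blast
  then obtain x where x: "\<And>n. x n \<in> cball 0 R" "\<And>n. p n = \<sigma> (x n)" by metis
  obtain l r where lr: "l \<in> cball 0 R" "strict_mono (r :: nat => nat)" "(x \<circ> r) \<longlonglongrightarrow> l"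
    using finite_dimensional_compact_cball[OF fd, of 0 R] x(1) unfolding compact_eq_seq_compact_metric seq_compact_def by metis
  define P where "P = \<sigma> l"
  have P: "limL (\<lambda>n. p (r n)) P sequentially"
    unfolding P_def x(2) using limitin_sigma[OF lr(3)] lr(1) R(2) by (auto simp: o_def)
  have PPP: "P \<in> PP" by (rule limitin_closed[OF parabolic_closed P]) (use bad in \<open>auto simp: bad_def\<close>)
  note Pc = G_carrier[OF parabolic_G[OF PPP]]
  have sub: "limL (\<lambda>n. h (r n)) a sequentially" if "limL h a sequentially" for h a
    using limitin_subsequence[OF lr(2) that] by (simp add: o_def)
  have yn: "y n \<in> neg" for n using bad unfolding bad_def by simp
  have eq: "Ad L (g0 n) (Ad L (inv (p n)) (Ad L (inv (g n)) \<beta>)) = \<beta> + y n" for n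
  proof -
    have c: "urep (y n) \<in> carrier L" "g n \<in> carrier L" "p n \<in> carrier L"
      using Rm_carrier[OF urep(2)[OF yn]] D0_carrier G_carrier[OF parabolic_G] bad[of n] unfolding bad_def by auto
    have "g0 n = urep (y n) \<otimes> g n \<otimes> p n" using bad unfolding bad_def by simp
    then show ?thesis using c urep(3)[OF yn] by (simp add: Ad_mult Ad_inv)
  qed
  have "((\<lambda>n. \<beta> + y (r n)) \<longlonglongrightarrow> Ad L \<one> (Ad L (inv P) (Ad L (inv \<one>) \<beta>)))"
    unfolding eq[symmetric] by (intro Ad_tendsto sub g limitin_inv P tendsto_const)
  then have "(\<lambda>n. \<beta> + y (r n)) \<longlonglongrightarrow> Ad L (inv P) \<beta>" by simp
  from proj_tendsto[OF this, of "\<lambda>c. c < 0"] have "(\<lambda>n. y (r n)) \<longlonglongrightarrow> proj (\<lambda>c. c < 0) (Ad L (inv P) \<beta>)"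
    unfolding proj_neg_beta[OF yn] .
  moreover have "proj (\<lambda>c. c < 0) (Ad L (inv P) \<beta>) = 0"
  proof -
    have "inv P \<in> PP" using subgroup.m_inv_closed[OF parabolic_subgroup PPP] .
    then have "Ad L (inv P) \<beta> - \<beta> \<in> pos" unfolding parabolic_Ad by simp
    from proj_neg_pos[OF this] show ?thesis by simp
  qed
  ultimately have y0: "(\<lambda>n. y (r n)) \<longlonglongrightarrow> 0" by simp
  have u: "limL (\<lambda>n. urep (y (r n))) \<one> sequentially"
    using continuous_map_top_of_setD[OF urep(1) y0 subspace_0[OF part_subspace]] yn by (simp add: urep_zero)
  have "limL (\<lambda>n. inv (g (r n)) \<otimes> inv (urep (y (r n))) \<otimes> g0 (r n)) (inv \<one> \<otimes> inv \<one> \<otimes> \<one>) sequentially"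
    by (intro limitin_mult limitin_inv sub g u)
  moreover have "inv (g n) \<otimes> inv (urep (y n)) \<otimes> g0 n = p n" for n
  proof -
    have c: "urep (y n) \<in> carrier L" "g n \<in> carrier L" "p n \<in> carrier L"
      using Rm_carrier[OF urep(2)[OF yn]] D0_carrier G_carrier[OF parabolic_G] bad[of n] unfolding bad_def by auto
    have "g0 n = urep (y n) \<otimes> g n \<otimes> p n" using bad unfolding bad_def by simp
    then show ?thesis using c by (simp add: m_assoc cancel_inv)
  qed
  ultimately have "limL (\<lambda>n. p (r n)) \<one> sequentially" by simp
  then have e1: "\<forall>\<^sub>F n in sequentially. p (r n) \<in> D0" and lp: "(\<lambda>n. \<psi> (p (r n))) \<longlonglongrightarrow> 0" unfolding limitin_one by auto
  have e2: "\<forall>\<^sub>F n in sequentially. norm (\<psi> (p (r n))) < R"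
    using order_tendstoD(2)[OF tendsto_norm[OF lp], of R] R(1) by simp
  have e3: "\<forall>\<^sub>F n in sequentially. norm (y (r n)) < 1"
    using order_tendstoD(2)[OF tendsto_norm[OF y0], of 1] by simp
  have "\<forall>\<^sub>F n in sequentially. False"
    using e1 e2 e3
  proof eventually_elim
    case (elim n)
    then show ?case using bad[of "r n"] unfolding bad_def by simp
  qed
  then show False by simp
qed

lemma Exp_nonneg_parabolic:
  assumes v: "v \<in> pt (\<lambda>c. c \<ge> 0)" shows "Exp v \<in> PP"
proof -
    define z where "z = proj (\<lambda>c. c = 0) v"
    have z: "z \<in> lg" unfolding z_def by (rule proj_lg)
    have v': "v - z \<in> pos" unfolding z_def
      by (rule partI[OF subspace_diff[OF lg_subspace part_lg[OF v] proj_lg]]) (use part_coord[OF v] in \<open>auto simp: IP.IP_diff proj_coord\<close>)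
    have "((\<lambda>t. Phi t (v - z) + z) \<longlongrightarrow> 0 + z) at_bot"
      by (intro tendsto_add pos_flow[OF v'] tendsto_const)
    moreover have "Phi t (v - z) + z = Phi t v" for t
      using zero_flow[OF proj_part, of t v] unfolding z_def by (simp add: linear_diff[OF Ad_linear])
    ultimately have "limL (\<lambda>t. cj \<beta> t (Exp v)) (Exp z) at_bot"
      unfolding cj_Exp by (intro limitin_Exp) simp
    then show ?thesis unfolding parabolic_def using Exp_lg[OF part_lg[OF v]] Exp_lg[OF z] by blast
  qed

lemma Omega_RmP: "g \<in> \<Omega> \<longleftrightarrow> (\<exists>u\<in>Rm \<beta>. \<exists>p\<in>PP. g = u \<otimes> p)"
proof
  assume "g \<in> \<Omega>"
  then obtain u h n where u: "u \<in> Rm \<beta>" and h: "h \<in> Cent \<beta>" and n: "n \<in> Rm (- \<beta>)" and g: "g = u \<otimes> h \<otimes> n"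
    unfolding Omega_iff by blast
  have "g = u \<otimes> (h \<otimes> n)" unfolding g using Rm_carrier[OF u] Cent_carrier[OF h] Rm_carrier[OF n] by (simp add: m_assoc)
  moreover have "h \<otimes> n \<in> PP" unfolding parabolic_iff using h n by blast
  ultimately show "\<exists>u\<in>Rm \<beta>. \<exists>p\<in>PP. g = u \<otimes> p" using u by blast
next
  assume "\<exists>u\<in>Rm \<beta>. \<exists>p\<in>PP. g = u \<otimes> p"
  then obtain u p where u: "u \<in> Rm \<beta>" and p: "p \<in> PP" and gp: "g = u \<otimes> p" by blast
  from p obtain h n where h: "h \<in> Cent \<beta>" and n: "n \<in> Rm (- \<beta>)" and phn: "p = h \<otimes> n"
    unfolding parabolic_iff by blast
  have g: "g = u \<otimes> (h \<otimes> n)" unfolding gp phn ..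
  have "g = u \<otimes> h \<otimes> n" unfolding g using Rm_carrier[OF u] Cent_carrier[OF h] Rm_carrier[OF n] by (simp add: m_assoc)
  then show "g \<in> \<Omega>" unfolding Omega_iff using u h n by blast
qed

lemma Omega_G: "g \<in> \<Omega> ==> g \<in> G"
  unfolding \<Omega>_def by simp

text \<open>The remainders left after removing from \<open>g0\<close> a factor of R^- on the left
  and a factor of P on the right form a compact set that admits small moves in all directions of
  \<gg>; by \<open>minimize_to_one\<close> it contains the identity.\<close>

lemma Omega_near_one: "\<exists>W. openin (ltop L) W \<and> \<one> \<in> W \<and> W \<inter> G \<subseteq> \<Omega>"
proof -
  \<comment> \<open>A direction is shared between the two sides: negative weights move on the left,
    all others on the right.\<close>
  define p1 where "p1 w = - proj (\<lambda>c. c < 0) w" for w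
  define p2 where "p2 w = - (w - proj (\<lambda>c. c < 0) w)" for w
  obtain \<delta>0 where \<delta>0: "\<delta>0 > 0" "\<forall>\<delta> S. 0 < \<delta> --> \<delta> \<le> \<delta>0 --> closedin (ltop L) S --> S \<subseteq> G --> (\<exists>g\<in>S. g \<in> D0 \<and> norm (\<psi> g) < \<delta>) -->
     (\<forall>g\<in>S. g \<in> D0 --> norm (\<psi> g) < \<delta> --> (\<forall>w\<in>lg.
         \<forall>\<^sub>F s in at_right 0. ex s (p1 w) \<otimes> g \<otimes> ex s (p2 w) \<in> S)) --> \<one> \<in> S"
    by (rule minimize_to_one[OF G_closed G_subgroup, of p1 p2]) (simp_all add: p1_def p2_def)
  obtain R where R: "R > 0" "cball 0 R \<subseteq> E0" "\<forall>r\<le>R. compactin (ltop L) (\<sigma> ` cball 0 r)" by (rule compact_chart_ball)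
  obtain \<delta>1 where \<delta>1: "\<delta>1 > 0" "\<forall>g g0 y p. g \<in> D0 --> norm (\<psi> g) < \<delta>1 --> g0 \<in> D0 --> norm (\<psi> g0) < \<delta>1 --> y \<in> neg -->
    p \<in> PP --> p \<in> \<sigma> ` cball 0 R --> urep y \<otimes> g \<otimes> p = g0 --> norm y < 1 \<and> p \<in> D0 \<and> norm (\<psi> p) < R"
    using decomposition_control[OF R(1,2)] by blast
  define \<delta> where "\<delta> = min \<delta>0 \<delta>1"
  have \<delta>: "0 < \<delta>" "\<delta> \<le> \<delta>0" "\<delta> \<le> \<delta>1" unfolding \<delta>_def using \<delta>0(1) \<delta>1(1) by auto
  obtain W where W: "openin (ltop L) W" "\<one> \<in> W" "\<forall>g\<in>W. g \<in> D0 \<and> norm (\<psi> g) < \<delta>" using near_one_D0[OF \<delta>(1)] by blast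
  define K where "K = PP \<inter> \<sigma> ` cball 0 R"
  have K: "compactin (ltop L) K" unfolding K_def
    by (rule closed_Int_compactin[OF parabolic_closed R(3)[rule_format, OF order_refl]])
  have "g0 \<in> \<Omega>" if g0: "g0 \<in> W \<inter> G" for g0
  proof -
    note g0c = G_carrier[OF IntD2[OF g0]]
    define f where "f q = (case q of (y, p) => inv (urep y) \<otimes> g0 \<otimes> inv p)" for q
    define S where "S = f ` ((neg \<inter> cball 0 1) \<times> K)"
    have cf: "continuous_map (prod_topology (top_of_set neg) (ltop L)) (ltop L) f"
    proof -
      let ?T = "prod_topology (top_of_set neg) (ltop L)"
      have 1: "continuous_map ?T (ltop L) (\<lambda>q. inv (urep (fst q)) \<otimes> g0)"
        using continuous_map_compose[OF continuous_map_compose[OF continuous_map_compose[OF continuous_map_fst urep(1)] cont_inv]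
          continuous_right_mult[OF g0c], of "ltop L"] by (simp add: o_def)
      have 2: "continuous_map ?T (ltop L) (\<lambda>q. inv (snd q))"
        using continuous_map_compose[OF continuous_map_snd cont_inv, of "top_of_set neg"] by (simp add: o_def)
      have "continuous_map ?T (prod_topology (ltop L) (ltop L)) (\<lambda>q. (inv (urep (fst q)) \<otimes> g0, inv (snd q)))"
        using 1 2 by (simp add: continuous_map_pairedI)
      from continuous_map_compose[OF this cont_mult] show ?thesis
        by (rule continuous_map_eq) (auto simp: f_def)
    qed
    have cn: "compactin (top_of_set neg) (neg \<inter> cball 0 1)"
    proof -
      have "compact (cball (0::'e) 1 \<inter> neg)"
        by (rule compact_Int_closed[OF finite_dimensional_compact_cball[OF fd] finite_dimensional_closed_subspace[OF fd part_subspace]])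
      then show ?thesis by (simp add: compactin_subtopology Int_commute)
    qed
    have cS: "compactin (ltop L) S"
      unfolding S_def by (rule image_compactin[OF _ cf]) (simp add: compactin_Times cn K)
    have Sf: "g \<in> S \<longleftrightarrow> (\<exists>y p. y \<in> neg \<and> norm y \<le> 1 \<and> p \<in> PP \<and> p \<in> \<sigma> ` cball 0 R \<and> g = inv (urep y) \<otimes> g0 \<otimes> inv p)" for g
    proof -
      have "g \<in> f ` ((neg \<inter> cball 0 1) \<times> (PP \<inter> KR)) \<longleftrightarrow>
        (\<exists>y p. y \<in> neg \<and> norm y \<le> 1 \<and> p \<in> PP \<and> p \<in> KR \<and> g = inv (urep y) \<otimes> g0 \<otimes> inv p)" for KR
        unfolding f_def by force
      then show ?thesis unfolding S_def K_def by blast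
    qed
    have SG: "S \<subseteq> G"
    proof
      fix g assume "g \<in> S"
      then obtain y p where "y \<in> neg" "p \<in> PP" "g = inv (urep y) \<otimes> g0 \<otimes> inv p" unfolding Sf by blast
      then show "g \<in> G" using G_mult G_inv RmD(1)[OF urep(2)] parabolic_G g0 by simp
    qed
    have "\<one> \<in> \<sigma> ` cball 0 R" using R(1) by (intro image_eqI[of _ _ 0]) auto
    then have "g0 \<in> S" unfolding Sf using g0c subspace_0[OF part_subspace] subgroup.one_closed[OF parabolic_subgroup]
      by (intro exI[of _ 0] exI[of _ \<one>]) (simp add: urep_zero)
    moreover have "\<forall>\<^sub>F s in at_right 0. ex s (p1 w) \<otimes> g \<otimes> ex s (p2 w) \<in> S"
      if g: "g \<in> S" "g \<in> D0" "norm (\<psi> g) < \<delta>" and w: "w \<in> lg" for g w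
    proof -
      obtain y p where yp: "y \<in> neg" "norm y \<le> 1" "p \<in> PP" "p \<in> \<sigma> ` cball 0 R" "g = inv (urep y) \<otimes> g0 \<otimes> inv p"
        using g(1) unfolding Sf by blast
      define u where "u = urep y"
      have u: "u \<in> Rm \<beta>" "Ad L u \<beta> = \<beta> + y" unfolding u_def using urep yp(1) by auto
      note c = Rm_carrier[OF u(1)] G_carrier[OF parabolic_G[OF yp(3)]] g0c
      have "urep y \<otimes> g \<otimes> p = g0" unfolding yp(5) u_def[symmetric] using c by (simp add: m_assoc cancel_inv)
      \<comment> \<open>The strict inequalities ensure that small moves of the parameters stay in
        the compact range.\<close>
      then have bd: "norm y < 1" "p \<in> D0" "norm (\<psi> p) < R"
        using \<delta>1(2)[rule_format, of g g0 y p] g yp W(3) g0 \<delta>(3) by fastforce+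
      define a where "a s = u \<otimes> ex s (proj (\<lambda>c. c < 0) w)" for s
      define ys where "ys s = Ad L (a s) \<beta> - \<beta>" for s
      define ps where "ps s = ex s (w - proj (\<lambda>c. c < 0) w) \<otimes> p" for s
      have aR: "a s \<in> Rm \<beta>" for s unfolding a_def
        by (intro Rm_mult u(1) Exp_neg_Rm subspace_scale[OF part_subspace] proj_part)
      have ys: "ys s \<in> neg" for s unfolding ys_def by (rule Rm_beta[OF aR])
      \<comment> \<open>The moved left factor is again a value of \<open>urep\<close>, since an
        element of R^- is determined by its action on \<open>\<beta>\<close>.\<close>
      have ura: "urep (ys s) = a s" for s
        by (rule Rm_eqI[OF urep(2)[OF ys] aR]) (simp add: urep(3)[OF ys], simp add: ys_def)
      have w0: "w - proj (\<lambda>c. c < 0) w \<in> pt (\<lambda>c. c \<ge> 0)"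
        by (rule partI[OF subspace_diff[OF lg_subspace w proj_lg]]) (auto simp: IP.IP_diff proj_coord)
      have psP: "ps s \<in> PP" for s unfolding ps_def
        by (intro subgroup.m_closed[OF parabolic_subgroup] Exp_nonneg_parabolic subspace_scale[OF part_subspace] w0 yp(3))
      have eq: "ex s (p1 w) \<otimes> g \<otimes> ex s (p2 w) = inv (urep (ys s)) \<otimes> g0 \<otimes> inv (ps s)" for s
      proof -
        have "ex s (p1 w) = inv (ex s (proj (\<lambda>c. c < 0) w))"
          "ex s (p2 w) = inv (ex s (w - proj (\<lambda>c. c < 0) w))"
          unfolding p1_def p2_def scaleR_minus_right Exp_neg by simp_all
        then show ?thesis unfolding ura a_def ps_def yp(5) u_def[symmetric] using c by (simp add: inv_mult_group m_assoc)
      qed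
      have "((\<lambda>s. Ad L (a s) \<beta> - \<beta>) \<longlongrightarrow> Ad L (u \<otimes> ex 0 (proj (\<lambda>c. c < 0) w)) \<beta> - \<beta>) (at_right 0)"
        unfolding a_def by (intro tendsto_diff Ad_tendsto tendsto_const limitin_mult limitin_constL limitin_Exp tendsto_intros c)
      then have "(ys \<longlongrightarrow> y) (at_right 0)" unfolding ys_def using c u(2) by simp
      then have e1: "\<forall>\<^sub>F s in at_right 0. norm (ys s) < 1" using order_tendstoD(2)[OF tendsto_norm] bd(1) by blast
      have "limL ps (ex 0 (w - proj (\<lambda>c. c < 0) w) \<otimes> p) (at_right 0)"
        unfolding ps_def by (intro limitin_mult limitin_constL limitin_Exp tendsto_intros c)
      then have "limL ps p (at_right 0)" using c by simp
      then have e2: "\<forall>\<^sub>F s in at_right 0. ps s \<in> D0" "((\<lambda>s. \<psi> (ps s)) \<longlongrightarrow> \<psi> p) (at_right 0)"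
        unfolding limitin_D0[OF bd(2)] by auto
      show ?thesis
        using e1 e2(1) order_tendstoD(2)[OF tendsto_norm[OF e2(2)] bd(3)]
      proof eventually_elim
        case (elim s)
        have "ps s \<in> \<sigma> ` cball 0 R" using elim sigma_psi[of "ps s"] by (intro image_eqI[of _ _ "\<psi> (ps s)"]) auto
        then show ?case unfolding Sf eq using ys[of s] psP[of s] elim(1) less_imp_le by blast
      qed
    qed
    moreover have "g0 \<in> D0" "norm (\<psi> g0) < \<delta>" using g0 W(3) by auto
    ultimately have "\<one> \<in> S" using \<delta>0(2)[rule_format, OF \<delta>(1,2) compactin_imp_closedin[OF Hausdorff cS] SG] by blast
    then obtain y p where yp: "y \<in> neg" "p \<in> PP" "\<one> = inv (urep y) \<otimes> g0 \<otimes> inv p" unfolding Sf by blast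
    note c = Rm_carrier[OF urep(2)[OF yp(1)]] G_carrier[OF parabolic_G[OF yp(2)]] g0c
    have "urep y \<otimes> p = urep y \<otimes> (inv (urep y) \<otimes> g0 \<otimes> inv p) \<otimes> p" using yp(3) c by simp
    also have "\<dots> = g0" using c by (simp add: m_assoc cancel_inv)
    finally have "g0 = urep y \<otimes> p" ..
    then show ?thesis unfolding Omega_RmP using urep(2)[OF yp(1)] yp(2) by blast
  qed
  then show ?thesis using W by blast
qed

end

context complex_lie_gp
begin

text \<open>The neighbourhood from \<open>invariant_near_one\<close> is translated to each point, so
  \<open>D\<close> is both open and closed in \<open>H\<close>.\<close>

lemma invariant_open:
  assumes H: "closedin (ltop L) H" "subgroup H L" and D: "closedin (ltop L) D" "D \<subseteq> H"
    and inv: "\<And>w d. w \<in> lie_algebra L H ==> d \<in> D ==> Exp w \<otimes> d \<in> D"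
  shows "openin (subtopology (ltop L) H) D"
proof -
  obtain W where W: "openin (ltop L) W" "\<one> \<in> W" "\<forall>g\<in>W \<inter> H. \<forall>d\<in>D. g \<otimes> d \<in> D"
    by (rule invariant_near_one[OF H D(1) inv])
  have "\<exists>T. openin (subtopology (ltop L) H) T \<and> d \<in> T \<and> T \<subseteq> D" if d: "d \<in> D" for d
  proof -
    have dH: "d \<in> H" using d D(2) by blast
    have dc: "d \<in> carrier L" using subgroup.mem_carrier[OF H(2) dH] .
    define V where "V = {g \<in> topspace (ltop L). g \<otimes> inv d \<in> W}"
    have V: "openin (ltop L) V" unfolding V_def
      by (rule openin_continuous_map_preimage[OF continuous_right_mult[OF inv_closed[OF dc]] W(1)])
    have "d \<in> V" unfolding V_def using dc W(2) carrier[symmetric] by simp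
    moreover have "g \<in> D" if g: "g \<in> V \<inter> H" for g
    proof -
      have gc: "g \<in> carrier L" using g subgroup.mem_carrier[OF H(2)] by blast
      have "g \<otimes> inv d \<in> W \<inter> H" using g dH subgroup.m_closed[OF H(2)] subgroup.m_inv_closed[OF H(2)] unfolding V_def by blast
      then have "g \<otimes> inv d \<otimes> d \<in> D" using W(3) d by blast
      then show ?thesis using gc dc by (simp add: m_assoc)
    qed
    ultimately show ?thesis using V dH by (intro exI[of _ "V \<inter> H"]) (auto simp: openin_subtopology)
  qed
  then show ?thesis using openin_subopen[of "subtopology (ltop L) H" D] by blast
qed

text \<open>The component is closed, and left multiplication by exponentials moves its points along
  paths inside \<open>H\<close>, so \<open>invariant_open\<close> applies.\<close>

lemma identity_component_open:
  assumes H: "closedin (ltop L) H" "subgroup H L"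
  shows "openin (subtopology (ltop L) H) (connected_component_of_set (subtopology (ltop L) H) \<one>)"
proof (rule invariant_open[OF H])
  let ?T = "subtopology (ltop L) H"
  show "closedin (ltop L) (connected_component_of_set ?T \<one>)"
    using closedin_connected_component_of[of ?T \<one>] closedin_trans_full H(1) by blast
  show "connected_component_of_set ?T \<one> \<subseteq> H"
    using connected_component_of_subset_topspace[of ?T \<one>] by auto
  fix w d assume w: "w \<in> lie_algebra L H" and d: "d \<in> connected_component_of_set ?T \<one>"
  have dH: "d \<in> H" using d connected_component_of_subset_topspace[of ?T \<one>] by auto
  have dc: "d \<in> carrier L" using subgroup.mem_carrier[OF H(2) dH] .
  define \<gamma> where "\<gamma> t = ex t w \<otimes> d" for t :: real
  have "continuous_map (top_of_set UNIV) (ltop L) \<gamma>"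
    unfolding \<gamma>_def by (intro continuous_map_top_of_setI limitin_mult limitin_Exp limitin_constL dc tendsto_intros)
  moreover have "\<gamma> t \<in> H" for t
    unfolding \<gamma>_def using subgroup.m_closed[OF H(2) lie_algebra_Exp[OF lie_algebra_scale[OF w]] dH] .
  ultimately have "continuous_map euclideanreal ?T \<gamma>" by (auto simp: continuous_map_in_subtopology)
  then have "connectedin ?T (\<gamma> ` UNIV)"
    by (rule connectedin_continuous_map_image) (simp add: connectedin_absolute flip: connectedin_topspace)
  then have "connected_component_of ?T (\<gamma> 0) (\<gamma> 1)"
    unfolding connected_component_of_def by blast
  moreover have "\<gamma> 0 = d" "\<gamma> 1 = Exp w \<otimes> d" unfolding \<gamma>_def using dc by auto
  ultimately show "Exp w \<otimes> d \<in> connected_component_of_set ?T \<one>"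
    using d connected_component_of_trans by fastforce
qed

end

section \<open>Density of the big cell\<close>

context graded
begin

lemma Cent_closed: "closedin (ltop L) (Cent \<beta>)"
proof -
  have "closedin (ltop L) {g \<in> topspace (ltop L). Ad L g \<beta> \<in> {\<beta>}}"
    by (rule closedin_continuous_map_preimage[OF continuous_map_Ad]) simp
  from closedin_Int[OF G_closed this] show ?thesis
    by (rule back_subst[of "closedin (ltop L)"]) (use closedin_subset[OF G_closed] in \<open>auto simp: Cent_def\<close>)
qed

text \<open>The defining equation of \<open>\<Omega>\<close> in coordinates: \<open>z b\<close> is a
  coordinate of \<open>x\<close> if the weight of \<open>b\<close> is positive and of
  \<open>y\<close> if it is negative; each \<open>e\<close> gives one equation.\<close>

lemma Omega_system:
  assumes g: "g \<in> G"
  shows "g \<in> \<Omega> \<longleftrightarrow> (\<exists>z. \<forall>e\<in>B. (\<Sum>b\<in>{b\<in>B. ev b \<noteq> 0}. (if ev b > 0 then IP (Ad L g b) e else - IP b e) * z b)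
     = IP \<beta> e - IP (Ad L g \<beta>) e)"
proof
  note gc = G_carrier[OF g]
  have sp: "(\<Sum>b\<in>{b\<in>B. ev b \<noteq> 0}. (if ev b > 0 then IP (Ad L g b) e else - IP b e) * z b)
     = IP (Ad L g (\<Sum>b\<in>{b\<in>B. ev b > 0}. z b *\<^sub>R b)) e - IP (\<Sum>b\<in>{b\<in>B. ev b < 0}. z b *\<^sub>R b) e" for e z
  proof -
    have "{b\<in>B. ev b \<noteq> 0} = {b\<in>B. ev b > 0} \<union> {b\<in>B. ev b < 0}" by auto
    then have "(\<Sum>b\<in>{b\<in>B. ev b \<noteq> 0}. (if ev b > 0 then IP (Ad L g b) e else - IP b e) * z b)
      = (\<Sum>b\<in>{b\<in>B. ev b > 0}. (if ev b > 0 then IP (Ad L g b) e else - IP b e) * z b)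
      + (\<Sum>b\<in>{b\<in>B. ev b < 0}. (if ev b > 0 then IP (Ad L g b) e else - IP b e) * z b)"
      using B_fin by (simp only:) (intro sum.union_disjoint, auto)
    also have "\<dots> = (\<Sum>b\<in>{b\<in>B. ev b > 0}. z b * IP (Ad L g b) e) + (\<Sum>b\<in>{b\<in>B. ev b < 0}. - (z b * IP b e))"
      by (intro arg_cong2[where f = "(+)"] sum.cong) auto
    also have "\<dots> = IP (Ad L g (\<Sum>b\<in>{b\<in>B. ev b > 0}. z b *\<^sub>R b)) e - IP (\<Sum>b\<in>{b\<in>B. ev b < 0}. z b *\<^sub>R b) e"
      by (simp add: linear_sum[OF Ad_linear[OF gc]] linear_scale[OF Ad_linear[OF gc]] IP.IP_sum IP.IP_scale_left sum_negf)
    finally show ?thesis .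
  qed
  {
    assume "g \<in> \<Omega>"
    then obtain x y where x: "x \<in> pos" and y: "y \<in> neg" and e: "Ad L g (\<beta> + x) = \<beta> + y" unfolding \<Omega>_def by blast
    define z where "z b = (if ev b > 0 then IP x b else IP y b)" for b
    have "(\<Sum>b\<in>{b\<in>B. ev b > 0}. z b *\<^sub>R b) = proj (\<lambda>c. c > 0) x" "(\<Sum>b\<in>{b\<in>B. ev b < 0}. z b *\<^sub>R b) = proj (\<lambda>c. c < 0) y"
      unfolding proj_def z_def by (auto intro: sum.cong)
    moreover have "proj (\<lambda>c. c > 0) x = x" "proj (\<lambda>c. c < 0) y = y"
      using part_lg[OF x] part_lg[OF y] part_coord[OF x] part_coord[OF y] by (auto intro!: coord_eqI proj_lg simp: proj_coord)
    moreover have "IP (Ad L g x) d - IP y d = IP \<beta> d - IP (Ad L g \<beta>) d" for d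
    proof -
      have "Ad L g x - y = \<beta> - Ad L g \<beta>" using e by (simp add: linear_add[OF Ad_linear[OF gc]] algebra_simps)
      then show ?thesis by (metis IP.IP_diff(1))
    qed
    ultimately have "\<forall>e\<in>B. (\<Sum>b\<in>{b\<in>B. ev b \<noteq> 0}. (if ev b > 0 then IP (Ad L g b) e else - IP b e) * z b)
     = IP \<beta> e - IP (Ad L g \<beta>) e" unfolding sp by simp
    then show "\<exists>z. \<forall>e\<in>B. (\<Sum>b\<in>{b\<in>B. ev b \<noteq> 0}. (if ev b > 0 then IP (Ad L g b) e else - IP b e) * z b)
     = IP \<beta> e - IP (Ad L g \<beta>) e" by blast
  next
    assume "\<exists>z. \<forall>e\<in>B. (\<Sum>b\<in>{b\<in>B. ev b \<noteq> 0}. (if ev b > 0 then IP (Ad L g b) e else - IP b e) * z b)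
     = IP \<beta> e - IP (Ad L g \<beta>) e"
    then obtain z where z: "\<And>e. e \<in> B ==> IP (Ad L g (\<Sum>b\<in>{b\<in>B. ev b > 0}. z b *\<^sub>R b)) e - IP (\<Sum>b\<in>{b\<in>B. ev b < 0}. z b *\<^sub>R b) e
       = IP \<beta> e - IP (Ad L g \<beta>) e" unfolding sp by blast
    define x y where "x = (\<Sum>b\<in>{b\<in>B. ev b > 0}. z b *\<^sub>R b)" and "y = (\<Sum>b\<in>{b\<in>B. ev b < 0}. z b *\<^sub>R b)"
    have bp: "b \<in> pt P" if "b \<in> B" "P (ev b)" for b P
      by (rule partI) (use that B_lg B_on in \<open>auto simp: IP.orthonormal_def\<close>)
    have x: "x \<in> pos" unfolding x_def by (intro subspace_sum[OF part_subspace] subspace_scale[OF part_subspace] bp) auto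
    have y: "y \<in> neg" unfolding y_def by (intro subspace_sum[OF part_subspace] subspace_scale[OF part_subspace] bp) auto
    have "Ad L g (\<beta> + x) = \<beta> + y"
    proof (rule coord_eqI)
      show "Ad L g (\<beta> + x) \<in> lg" "\<beta> + y \<in> lg"
        by (intro Ad_lg[OF g] subspace_add[OF lg_subspace] beta_lg part_lg[OF x], intro subspace_add[OF lg_subspace] beta_lg part_lg[OF y])
      fix b assume "b \<in> B"
      then show "IP (Ad L g (\<beta> + x)) b = IP (\<beta> + y) b"
        using z[of b] unfolding x_def[symmetric] y_def[symmetric] by (simp add: linear_add[OF Ad_linear[OF gc]] IP.IP_add_left)
    qed
    then show "g \<in> \<Omega>" unfolding \<Omega>_def using g x y by blast
  }
qed

text \<open>The cell is stable under R^- on the left and P on the right, so after conjugation by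
  \<open>u\<close> only a neighbourhood of the identity matters.\<close>

lemma Omega_left_near:
  assumes g: "g \<in> \<Omega>" and w: "w \<in> lg"
  obtains t0 where "t0 > 0" "\<forall>t. \<bar>t\<bar> < t0 --> ex t w \<otimes> g \<in> \<Omega>"
proof -
  obtain W where W: "openin (ltop L) W" "\<one> \<in> W" "W \<inter> G \<subseteq> \<Omega>" using Omega_near_one by blast
  obtain u p where u: "u \<in> Rm \<beta>" and p: "p \<in> PP" and gup: "g = u \<otimes> p" using g unfolding Omega_RmP by blast
  note c = Rm_carrier[OF u] G_carrier[OF parabolic_G[OF p]]
  define v where "v = Ad L (inv u) w"
  have v: "v \<in> lg" unfolding v_def by (rule Ad_lg[OF G_inv[OF RmD(1)[OF u]] w])
  have ev: "ex t v = inv u \<otimes> ex t w \<otimes> u" for t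
    unfolding v_def using c by (simp add: Ad_Exp_scale)
  have "limL (\<lambda>t::real. ex t v) (ex 0 v) (nhds 0)"
    by (intro limitin_Exp tendsto_intros) (simp add: filterlim_def)
  then have "\<forall>\<^sub>F t::real in nhds 0. ex t v \<in> W" using W(1,2) unfolding limitin_def by simp
  then obtain t0 where t0: "t0 > 0" "\<And>t. \<bar>t\<bar> < t0 ==> ex t v \<in> W"
    unfolding eventually_nhds_metric by (auto simp: dist_real_def)
  have "ex t w \<otimes> g \<in> \<Omega>" if t: "\<bar>t\<bar> < t0" for t
  proof -
    have "ex t v \<in> \<Omega>" using t0(2)[OF t] Exp_lg[OF lg_scale[OF v]] W(3) by blast
    then obtain u' p' where u': "u' \<in> Rm \<beta>" and p': "p' \<in> PP" and e: "ex t v = u' \<otimes> p'" unfolding Omega_RmP by blast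
    note c' = Rm_carrier[OF u'] G_carrier[OF parabolic_G[OF p']]
    have "ex t w \<otimes> g = u \<otimes> ex t v \<otimes> p" unfolding gup ev using c by (simp add: m_assoc cancel_inv)
    also have "\<dots> = (u \<otimes> u') \<otimes> (p' \<otimes> p)" unfolding e using c c' by (simp add: m_assoc)
    finally show ?thesis unfolding Omega_RmP
      using Rm_mult[OF u u'] subgroup.m_closed[OF parabolic_subgroup p' p] by blast
  qed
  then show ?thesis using that t0(1) by blast
qed

text \<open>Along \<open>ex t w \<otimes> g\<close> the system has entire coefficients and is
  solvable for small \<open>t\<close>. By \<open>entire_system\<close> it is solvable wherever a
  certain nonzero entire function does not vanish, in particular for some \<open>t\<close>
  arbitrarily close to 1.\<close>

lemma Omega_left_closure:
  assumes g: "g \<in> \<Omega>" and w: "w \<in> lg"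
  shows "Exp w \<otimes> g \<in> ltop L closure_of \<Omega>"
proof -
  note gG = Omega_G[OF g]
  note gc = G_carrier[OF gG]
  obtain t0 where t0: "t0 > 0" "\<forall>t. \<bar>t\<bar> < t0 --> ex t w \<otimes> g \<in> \<Omega>" by (rule Omega_left_near[OF g w])
  define A where "A t e b = (if ev b > 0 then IP (Ad L (ex t w \<otimes> g) b) e else - IP b e)" for t e b
  define c where "c t e = IP \<beta> e - IP (Ad L (ex t w \<otimes> g) \<beta>) e" for t e
  have EG: "ex t w \<otimes> g \<in> G" for t by (intro G_mult Exp_lg lg_scale w gG)
  have sys: "ex t w \<otimes> g \<in> \<Omega> \<longleftrightarrow> (\<exists>z. \<forall>e\<in>B. (\<Sum>b\<in>{b\<in>B. ev b \<noteq> 0}. A t e b * z b) = c t e)" for t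
    unfolding Omega_system[OF EG] A_def c_def ..
  have er: "entire_real (\<lambda>t. IP (Ad L (ex t w \<otimes> g) v) e)" if v: "v \<in> lg" for v e
    using entire_real_Ad_Exp[OF w Ad_lg[OF gG v], of e] gc by (simp add: Ad_mult)
  have "\<exists>\<theta>. entire_real \<theta> \<and> (\<exists>t. \<theta> t \<noteq> 0) \<and>
      (\<forall>t. \<theta> t \<noteq> 0 --> (\<exists>z. \<forall>e\<in>B. (\<Sum>b\<in>{b\<in>B. ev b \<noteq> 0}. A t e b * z b) = c t e))"
  proof (rule entire_system[OF _ t0(1)])
    show "finite {b\<in>B. ev b \<noteq> 0}" using B_fin by simp
    show "entire_real (\<lambda>t. A t e b)" if "e \<in> B" "b \<in> {b\<in>B. ev b \<noteq> 0}" for e b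
      unfolding A_def using that B_lg by (cases "ev b > 0") (auto intro: er entire_real_const)
    show "entire_real (\<lambda>t. c t e)" if "e \<in> B" for e
      unfolding c_def by (intro entire_real_diff entire_real_const er beta_lg)
    show "\<exists>z. \<forall>e\<in>B. (\<Sum>b\<in>{b\<in>B. ev b \<noteq> 0}. A t e b * z b) = c t e" if "\<bar>t\<bar> < t0" for t
      using t0(2) that sys by blast
  qed
  then obtain \<theta> where \<theta>: "entire_real \<theta>" "\<exists>t. \<theta> t \<noteq> 0" "\<And>t. \<theta> t \<noteq> 0 ==> ex t w \<otimes> g \<in> \<Omega>"
    unfolding sys[symmetric] by blast
  show ?thesis
    unfolding in_closure_of
  proof (intro conjI allI impI)
    show "Exp w \<otimes> g \<in> topspace (ltop L)" unfolding carrier[symmetric] using gc by simp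
    fix T assume T: "Exp w \<otimes> g \<in> T \<and> openin (ltop L) T"
    have "limL (\<lambda>t::real. ex t w \<otimes> g) (ex 1 w \<otimes> g) (nhds 1)"
      by (intro limitin_mult limitin_Exp limitin_constL gc tendsto_intros) (simp add: filterlim_def)
    then have "\<forall>\<^sub>F t::real in nhds 1. ex t w \<otimes> g \<in> T" using T unfolding limitin_def by simp
    then obtain d where d: "d > 0" "\<And>t. \<bar>t - 1\<bar> < d ==> ex t w \<otimes> g \<in> T"
      unfolding eventually_nhds_metric by (auto simp: dist_real_def)
    have "\<exists>t. \<bar>t - 1\<bar> < d \<and> \<theta> t \<noteq> 0"
    proof (rule ccontr)
      assume no: "\<not> (\<exists>t. \<bar>t - 1\<bar> < d \<and> \<theta> t \<noteq> 0)"
      have "\<theta> s = 0" if "1 - d < s" "s < 1 + d" for s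
      proof -
        have "\<bar>s - 1\<bar> < d" using that by linarith
        then show ?thesis using no by blast
      qed
      then have "\<theta> s = 0" for s using entire_real_zero[OF \<theta>(1), of "1 - d" "1 + d"] d(1) by simp
      then show False using \<theta>(2) by blast
    qed
    then show "\<exists>y. y \<in> \<Omega> \<and> y \<in> T" using d(2) \<theta>(3) by blast
  qed
qed

text \<open>The closure is stable under left multiplication by exponentials, hence open and closed
  in the connected group \<open>G\<close>.\<close>

lemma Omega_dense: "ltop L closure_of \<Omega> = G"
proof -
  let ?D = "ltop L closure_of \<Omega>"
  have DG: "?D \<subseteq> G" by (rule closure_of_minimal[OF _ G_closed]) (auto dest: Omega_G)
  have "openin (subtopology (ltop L) G) ?D"
  proof (rule invariant_open[OF G_closed G_subgroup closedin_closure_of DG])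
    fix w d assume w: "w \<in> lg" and d: "d \<in> ?D"
    have "(\<lambda>g. Exp w \<otimes> g) ` ?D \<subseteq> ltop L closure_of ((\<lambda>g. Exp w \<otimes> g) ` \<Omega>)"
      by (rule continuous_map_image_closure_subset[OF continuous_left_mult]) simp
    also have "\<dots> \<subseteq> ?D" by (rule closure_of_minimal) (use Omega_left_closure[OF _ w] in auto)
    finally show "Exp w \<otimes> d \<in> ?D" using d by blast
  qed
  moreover have "closedin (subtopology (ltop L) G) ?D"
    using closedin_subset_topspace[OF closedin_closure_of DG] .
  moreover have "connected_space (subtopology (ltop L) G)" using connected_G unfolding connectedin_def by blast
  moreover have "topspace (subtopology (ltop L) G) = G" using closedin_subset[OF G_closed] by auto
  moreover have "\<one> \<in> ?D"
  proof -
    have "\<one> \<in> \<Omega>" using Omega_near_one G_one by blast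
    then show ?thesis using closure_of_subset[of \<Omega> "ltop L"] Omega_G closedin_subset[OF G_closed] by blast
  qed
  ultimately show ?thesis unfolding connected_space_clopen_in by blast
qed

end

section \<open>Gradient maps and compact orbits\<close>

locale lie_action = complex_lie_gp L
  for L :: "('g, 'e::real_normed_vector) lie_group" (structure) +
  fixes Z :: "('z, 'f::real_normed_vector) cmanifold" and act :: "'g => 'z => 'z"
  assumes Z: "complex_manifold Z" and action: "holomorphic_action L Z act"
begin

abbreviation TZ :: "'z set" where "TZ \<equiv> topspace (mtop Z)"

lemma group_action: "group_action L TZ act"
  and holo_act: "holomorphic_map (prod_manifold (mfd L) Z) Z (\<lambda>(g, z). act g z)"
  using action unfolding holomorphic_action_def by blast+

lemma act_in [simp]: "g \<in> carrier L ==> z \<in> TZ ==> act g z \<in> TZ"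
  using group_action.element_image[OF group_action] by blast

lemma act_mult: "g \<in> carrier L ==> h \<in> carrier L ==> z \<in> TZ ==> act (g \<otimes> h) z = act g (act h z)"
  using group_action.composition_rule[OF group_action] by blast

lemma act_one [simp]: "z \<in> TZ ==> act \<one> z = z"
  using group_action.id_eq_one[OF group_action] by (metis restrict_apply')

lemma act_inv: "g \<in> carrier L ==> z \<in> TZ ==> act (inv g) (act g z) = z"
  using act_mult[of "inv g" g z] by simp

lemma cont_act: "continuous_map (prod_topology (ltop L) (mtop Z)) (mtop Z) (\<lambda>(g, z). act g z)"
  using smooth_map_continuous[OF conjunct1[OF holo_act[unfolded holomorphic_map_def]]] by (simp add: prod_manifold_def)

lemma limitin_act:
  assumes "limL f a F" "limitin (mtop Z) g b F"
  shows "limitin (mtop Z) (\<lambda>n. act (f n) (g n)) (act a b) F"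
proof -
  have "limitin (prod_topology (ltop L) (mtop Z)) (\<lambda>n. (f n, g n)) (a, b) F"
    using assms by (simp add: limitin_pairwise o_def)
  from continuous_map_limit[OF cont_act this] show ?thesis by (simp add: o_def)
qed

lemma Z_chart: "c \<in> atlas Z ==> topological_chart (mtop Z) c"
  using complex_manifold_chart[OF Z] .

lemma Z_Hausdorff: "Hausdorff_space (mtop Z)"
  using Z unfolding complex_manifold_def by blast

lemma complex_diff_act:
  assumes "g \<in> carrier L" "z \<in> TZ"
  shows "complex_diff_at (mfd L) Z (\<lambda>g. act g z) g" "complex_diff_at Z Z (act g) z"
  using holomorphic_map_slice[OF mfd Z Z holo_act, of g z] assms carrier by simp_all

abbreviation fv :: "'e => ('z, 'f) chart => 'z => 'f" where "fv \<equiv> fundamental_vector L act"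

text \<open>\<open>D\<close> is the derivative of the orbit map at the identity, complex linear
  because the action is holomorphic.\<close>

lemma fundamental_vector_linear:
  assumes c: "c \<in> atlas Z" "z \<in> fst c"
  obtains D where "linear D" "\<forall>\<xi>. ((\<lambda>t. snd c (act (ex t \<xi>) z)) has_vector_derivative D \<xi>) (at 0)"
    "\<forall>\<xi>. D (i_lie L \<xi>) = i_mult Z (D \<xi>)"
proof -
  have z: "z \<in> TZ" using c openin_subset Z_chart[OF c(1)] unfolding topological_chart_def by blast
  from complex_diff_act(1)[OF one_closed z] obtain D where
    D: "(local_rep (id_chart L) c (\<lambda>g. act g z) has_derivative D) (at (\<phi> \<one>))"
      "\<forall>v. D (i_mult (mfd L) v) = i_mult Z (D v)"
    unfolding complex_diff_at_def using id_chart_atlas one_D0 c z act_one by metis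
  have "((\<lambda>t. snd c (act (ex t \<xi>) z)) has_vector_derivative D \<xi>) (at 0)" for \<xi>
  proof (rule complex_diff_at_curve[OF D(1) _ Exp_has_vector_derivative _ id_chart one_D0])
    show "ex 0 \<xi> = \<one>" by simp
    show "\<forall>\<^sub>F t in at 0. ex t \<xi> \<in> D0" by (rule Exp_D0_eventually)
  qed
  then show ?thesis using that D has_derivative_linear[OF D(1)] by blast
qed

lemma fundamental_vector:
  assumes c: "c \<in> atlas Z" "z \<in> fst c"
  shows "((\<lambda>t. snd c (act (ex t \<xi>) z)) has_vector_derivative fv \<xi> c z) (at 0)"
    and "fv (i_lie L \<xi>) c z = i_mult Z (fv \<xi> c z)" and "fv (- \<xi>) c z = - fv \<xi> c z"
proof -
  obtain D where D: "linear D" "\<forall>\<xi>. ((\<lambda>t. snd c (act (ex t \<xi>) z)) has_vector_derivative D \<xi>) (at 0)"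
    "\<forall>\<xi>. D (i_lie L \<xi>) = i_mult Z (D \<xi>)" by (rule fundamental_vector_linear[OF c])
  have fvD: "fv \<xi> c z = D \<xi>" for \<xi>
    unfolding fundamental_vector_def using D(2) vector_derivative_at by blast
  show "((\<lambda>t. snd c (act (ex t \<xi>) z)) has_vector_derivative fv \<xi> c z) (at 0)"
    "fv (i_lie L \<xi>) c z = i_mult Z (fv \<xi> c z)" "fv (- \<xi>) c z = - fv \<xi> c z"
    unfolding fvD using D linear_neg[OF D(1)] by auto
qed

lemma act_Exp_limitin: "z \<in> TZ ==> limitin (mtop Z) (\<lambda>t. act (ex t \<xi>) z) (act (ex s \<xi>) z) (nhds s)"
  by (intro limitin_act limitin_Exp tendsto_intros) (simp_all add: filterlim_def)

lemma act_Exp_add: "z \<in> TZ ==> act (ex (s + t) \<xi>) z = act (ex s \<xi>) (act (ex t \<xi>) z)"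
  by (simp add: Exp_add act_mult)

text \<open>The velocity at time \<open>s\<close> is the image of the velocity at time 0 under the
  derivative of \<open>act (ex s \<xi>)\<close>, so it vanishes throughout; the curve is locally
  constant in charts, hence constant.\<close>

lemma zero_vector_fixed:
  assumes c: "c \<in> atlas Z" "z \<in> fst c" and 0: "fv \<xi> c z = 0"
  shows "act (ex t \<xi>) z = z"
proof -
  have z: "z \<in> TZ" using c openin_subset Z_chart[OF c(1)] unfolding topological_chart_def by blast
  define \<gamma> where "\<gamma> t = act (ex t \<xi>) z" for t
  have \<gamma>in: "\<gamma> t \<in> TZ" for t unfolding \<gamma>_def using z by simp
  have deriv: "((\<lambda>t. snd d (\<gamma> t)) has_vector_derivative 0) (at s)" if d: "d \<in> atlas Z" "\<gamma> s \<in> fst d" for d s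
  proof (rule has_vector_derivative_shift)
    from complex_diff_act(2)[OF Exp_carrier z, of "s *\<^sub>R \<xi>"] obtain D where
      D: "(local_rep c d (act (ex s \<xi>)) has_derivative D) (at (snd c z))"
      unfolding complex_diff_at_def using c d unfolding \<gamma>_def by blast
    have "((\<lambda>h. snd d (act (ex s \<xi>) (\<gamma> h))) has_vector_derivative D 0) (at 0)"
    proof (rule complex_diff_at_curve[OF D _ _ _ Z_chart[OF c(1)] c(2)])
      show "\<gamma> 0 = z" unfolding \<gamma>_def using z by simp
      show "((\<lambda>h. snd c (\<gamma> h)) has_vector_derivative 0) (at 0)" using fundamental_vector(1)[OF c, of \<xi>] unfolding \<gamma>_def 0 .
      have "limitin (mtop Z) \<gamma> z (nhds 0)" using act_Exp_limitin[OF z, of \<xi> 0] z unfolding \<gamma>_def by simp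
      then have "\<forall>\<^sub>F h in nhds 0. \<gamma> h \<in> fst c"
        using c Z_chart[OF c(1)] unfolding limitin_def topological_chart_def by blast
      then show "\<forall>\<^sub>F h in at 0. \<gamma> h \<in> fst c" unfolding at_within_def by (rule filter_leD[rotated]) simp
    qed
    moreover have "act (ex s \<xi>) (\<gamma> h) = \<gamma> (s + h)" for h unfolding \<gamma>_def by (simp add: act_Exp_add z)
    ultimately show "((\<lambda>h. snd d (\<gamma> (s + h))) has_vector_derivative 0) (at 0)"
      using has_derivative_linear[OF D] linear_0 by fastforce
  qed
  have loc: "\<exists>e>0. \<forall>r. \<bar>r - s\<bar> < e --> \<gamma> r = \<gamma> s" for s
  proof -
    obtain d where d: "d \<in> atlas Z" "\<gamma> s \<in> fst d" using complex_manifold_chart_at[OF Z \<gamma>in] by blast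
    have "\<forall>\<^sub>F r in nhds s. \<gamma> r \<in> fst d"
      using act_Exp_limitin[OF z, of \<xi> s] d Z_chart[OF d(1)] unfolding limitin_def topological_chart_def \<gamma>_def by blast
    then obtain e where e: "e > 0" "\<And>r. dist r s < e ==> \<gamma> r \<in> fst d" unfolding eventually_nhds_metric by blast
    have "\<gamma> r = \<gamma> s" if r: "\<bar>r - s\<bar> < e" for r
    proof -
      have "\<exists>k. \<forall>x\<in>ball s e. snd d (\<gamma> x) = k"
      proof (rule has_derivative_zero_constant)
        fix x assume "x \<in> ball s e"
        then have "\<gamma> x \<in> fst d" using e(2) by (simp add: dist_commute)
        from deriv[OF d(1) this] show "((\<lambda>x. snd d (\<gamma> x)) has_derivative (\<lambda>h. 0)) (at x within ball s e)"
          unfolding has_vector_derivative_def by (auto intro: has_derivative_at_withinI)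
      qed simp
      then obtain k where k: "\<forall>x\<in>ball s e. snd d (\<gamma> x) = k" by blast
      have "r \<in> ball s e" "s \<in> ball s e" using r e(1) by (auto simp: dist_real_def abs_minus_commute)
      then have "snd d (\<gamma> r) = snd d (\<gamma> s)" using k by simp
      then show ?thesis
        using inj_onD[OF topological_chart_inj[OF Z_chart[OF d(1)]]] d(2) e(2)[of r] r by (simp add: dist_real_def)
    qed
    then show ?thesis using e(1) by blast
  qed
  have "\<forall>\<^sub>F r in at s. \<gamma> s = \<gamma> r" for s
    using loc[of s] unfolding eventually_at by (metis dist_real_def)
  then have "\<gamma> t = \<gamma> 0" by (intro connected_local_const[of "UNIV :: real set"]) auto
  then show ?thesis unfolding \<gamma>_def using z by simp
qed

end

section \<open>The function \<open>f\<close> and its gradient flow\<close>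

locale ham = graded L U G ip \<beta> B ev + lie_action L Z act
  for L :: "('g, 'e::real_normed_vector) lie_group" (structure) and U G ip \<beta> B ev
    and Z :: "('z, 'f::real_normed_vector) cmanifold" and act +
  fixes \<omega> :: "('z, 'f) two_form" and \<mu> :: "'z => 'e => real"
  assumes kaehler: "kaehler_manifold Z \<omega>" and momentum: "momentum_map L U Z \<omega> act \<mu>"
begin

text \<open>With this sign \<open>f\<close>, the momentum component along - i \<beta>, is the
  \<beta>-component of the gradient map and increases along the flow of
  \<open>\<beta>\<close>.\<close>

definition \<eta> :: 'e where "\<eta> = - J \<beta>"
definition f :: "'z => real" where "f z = \<mu> z \<eta>"

lemma eta_lu: "\<eta> \<in> lu" and beta_eta: "\<beta> = J \<eta>"
proof -
  obtain \<xi> where "\<xi> \<in> lu" "\<beta> = J \<xi>" using beta_Jlu by blast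
  then show "\<eta> \<in> lu" "\<beta> = J \<eta>" unfolding \<eta>_def by (simp_all add: J)
qed

lemma mu_chart:
  assumes "\<xi> \<in> lu" "c \<in> atlas Z" "z \<in> fst c"
  shows "((\<lambda>y. \<mu> (inv_into (fst c) (snd c) y) \<xi>) has_derivative (\<lambda>v. \<omega> c (snd c z) (fv \<xi> c z) v)) (at (snd c z))"
proof -
  have "smooth_on (snd c ` fst c) (\<lambda>y. \<mu> (inv_into (fst c) (snd c) y) \<xi>)"
    using momentum assms(1,2) unfolding momentum_map_def by blast
  then have "Ck_on (Suc 0) (snd c ` fst c) (\<lambda>y. \<mu> (inv_into (fst c) (snd c) y) \<xi>)" unfolding smooth_on_def by blast
  then have "(\<lambda>y. \<mu> (inv_into (fst c) (snd c) y) \<xi>) differentiable (at (snd c z))" using assms(3) by auto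
  then have "((\<lambda>y. \<mu> (inv_into (fst c) (snd c) y) \<xi>) has_derivative frechet_derivative (\<lambda>y. \<mu> (inv_into (fst c) (snd c) y) \<xi>) (at (snd c z))) (at (snd c z))"
    unfolding frechet_derivative_works .
  moreover have "frechet_derivative (\<lambda>y. \<mu> (inv_into (fst c) (snd c) y) \<xi>) (at (snd c z)) = (\<lambda>v. \<omega> c (snd c z) (fv \<xi> c z) v)"
  proof
    fix v show "frechet_derivative (\<lambda>y. \<mu> (inv_into (fst c) (snd c) y) \<xi>) (at (snd c z)) v = \<omega> c (snd c z) (fv \<xi> c z) v"
      using momentum assms unfolding momentum_map_def by blast
  qed
  ultimately show ?thesis by simp
qed

lemma mu_derivative:
  assumes \<xi>: "\<xi> \<in> lu" and c: "c \<in> atlas Z" "z \<in> fst c"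
  shows "((\<lambda>t. \<mu> (act (ex t \<zeta>) z) \<xi>) has_real_derivative \<omega> c (snd c z) (fv \<xi> c z) (fv \<zeta> c z)) (at 0)"
proof -
  have z: "z \<in> TZ" using c openin_subset Z_chart[OF c(1)] unfolding topological_chart_def by blast
  have z0: "act (ex 0 \<zeta>) z = z" using z by simp
  have "(((\<lambda>y. \<mu> (inv_into (fst c) (snd c) y) \<xi>) \<circ> (\<lambda>t. snd c (act (ex t \<zeta>) z)))
    has_vector_derivative \<omega> c (snd c z) (fv \<xi> c z) (fv \<zeta> c z)) (at 0)"
    by (rule vector_derivative_diff_chain_within[where S = UNIV and f' = "fv \<zeta> c z" and g' = "\<lambda>v. \<omega> c (snd c z) (fv \<xi> c z) v", simplified])
      (use fundamental_vector(1)[OF c, of \<zeta>] has_derivative_at_withinI[OF mu_chart[OF \<xi> c]] z in auto)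
  moreover have "\<forall>\<^sub>F t in nhds 0. ((\<lambda>y. \<mu> (inv_into (fst c) (snd c) y) \<xi>) \<circ> (\<lambda>t. snd c (act (ex t \<zeta>) z))) t
     = \<mu> (act (ex t \<zeta>) z) \<xi>"
  proof -
    have "\<forall>\<^sub>F t in nhds 0. act (ex t \<zeta>) z \<in> fst c"
      using act_Exp_limitin[OF z, of \<zeta> 0] c Z_chart[OF c(1)] unfolding z0 limitin_def topological_chart_def by blast
    then show ?thesis by eventually_elim (simp add: topological_chart_inv[OF Z_chart[OF c(1)]])
  qed
  then have "\<forall>\<^sub>F t in at 0. ((\<lambda>y. \<mu> (inv_into (fst c) (snd c) y) \<xi>) \<circ> (\<lambda>t. snd c (act (ex t \<zeta>) z))) t
     = \<mu> (act (ex t \<zeta>) z) \<xi>"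
    unfolding at_within_def by (rule filter_leD[rotated]) simp
  ultimately show ?thesis
    unfolding has_real_derivative_iff_has_vector_derivative has_vector_derivative_def
    by (rule has_derivative_transform_eventually) (use c z in \<open>simp_all add: topological_chart_inv[OF Z_chart[OF c(1)]]\<close>)
qed

lemma mu_derivative_at:
  assumes \<xi>: "\<xi> \<in> lu" and z: "z \<in> TZ" and c: "c \<in> atlas Z" "act (ex s \<zeta>) z \<in> fst c"
  shows "((\<lambda>t. \<mu> (act (ex t \<zeta>) z) \<xi>) has_real_derivative
    \<omega> c (snd c (act (ex s \<zeta>) z)) (fv \<xi> c (act (ex s \<zeta>) z)) (fv \<zeta> c (act (ex s \<zeta>) z))) (at s)"
  unfolding has_real_derivative_iff_has_vector_derivative
proof (rule has_vector_derivative_shift)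
  have "act (ex (s + h) \<zeta>) z = act (ex h \<zeta>) (act (ex s \<zeta>) z)" for h
    using act_Exp_add[OF z, of h s \<zeta>] by (simp add: add.commute)
  then show "((\<lambda>h. \<mu> (act (ex (s + h) \<zeta>) z) \<xi>) has_vector_derivative
    \<omega> c (snd c (act (ex s \<zeta>) z)) (fv \<xi> c (act (ex s \<zeta>) z)) (fv \<zeta> c (act (ex s \<zeta>) z))) (at 0)"
    using mu_derivative[OF \<xi> c, of \<zeta>] unfolding has_real_derivative_iff_has_vector_derivative by simp
qed

lemma omega_facts:
  assumes "c \<in> atlas Z" "y \<in> snd c ` fst c"
  shows "linear (\<lambda>v. \<omega> c y v w)" "\<omega> c y v w = - \<omega> c y w v" "v \<noteq> 0 ==> \<omega> c y v (i_mult Z v) > 0"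
  using kaehler assms unfolding kaehler_manifold_def by blast+

text \<open>The field of \<open>\<eta>\<close> is - J times the field of \<open>\<beta>\<close>. So
  the derivative of \<open>f\<close> along the flow of \<open>\<beta>\<close> is the squared length
  of the latter field.\<close>

lemma omega_eta_beta:
  assumes c: "c \<in> atlas Z" "z \<in> fst c"
  shows "\<omega> c (snd c z) (fv \<eta> c z) (fv \<beta> c z) = \<omega> c (snd c z) (fv \<beta> c z) (i_mult Z (fv \<beta> c z))"
proof -
  have "fv \<eta> c z = - i_mult Z (fv \<beta> c z)" unfolding \<eta>_def fundamental_vector(2,3)[OF c] ..
  then show ?thesis
    using omega_facts(2)[OF c(1) imageI[OF c(2)], of "fv \<beta> c z" "i_mult Z (fv \<beta> c z)"] linear_neg[OF omega_facts(1)[OF c(1) imageI[OF c(2)]]] by simp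
qed

lemma f_derivative:
  assumes z: "z \<in> TZ"
  obtains d where "((\<lambda>t. f (act (ex t \<beta>) z)) has_real_derivative d) (at s)" "d \<ge> 0"
    "d = 0 ==> \<forall>t. act (ex t \<beta>) (act (ex s \<beta>) z) = act (ex s \<beta>) z"
proof -
  let ?w = "act (ex s \<beta>) z"
  obtain c where c: "c \<in> atlas Z" "?w \<in> fst c" using complex_manifold_chart_at[OF Z act_in[OF Exp_carrier z]] by blast
  define b where "b = fv \<beta> c ?w"
  define d where "d = \<omega> c (snd c ?w) b (i_mult Z b)"
  have 1: "((\<lambda>t. f (act (ex t \<beta>) z)) has_real_derivative d) (at s)"
    using mu_derivative_at[OF eta_lu z c] unfolding f_def d_def b_def omega_eta_beta[OF c] .
  have 2: "d > 0" if "b \<noteq> 0" unfolding d_def by (rule omega_facts(3)[OF c(1) imageI[OF c(2)] that])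
  have 3: "d = 0" if "b = 0" unfolding d_def that using linear_0[OF omega_facts(1)[OF c(1) imageI[OF c(2)]]] by simp
  show ?thesis
  proof (rule that[OF 1])
    show "d \<ge> 0" using 2 3 by (cases "b = 0") auto
    assume "d = 0"
    then have "b = 0" using 2 by fastforce
    then show "\<forall>t. act (ex t \<beta>) ?w = ?w" using zero_vector_fixed[OF c] unfolding b_def by blast
  qed
qed

lemma f_mono:
  assumes z: "z \<in> TZ" and st: "s \<le> t"
  shows "f (act (ex s \<beta>) z) \<le> f (act (ex t \<beta>) z)"
proof (rule DERIV_nonneg_imp_nondecreasing[OF st])
  fix x show "\<exists>y. ((\<lambda>t. f (act (ex t \<beta>) z)) has_real_derivative y) (at x) \<and> 0 \<le> y"
    by (rule f_derivative[OF z, of x]) blast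
qed

definition Fix :: "'z set" where "Fix = {z \<in> TZ. \<forall>t. act (ex t \<beta>) z = z}"

lemma FixD: "z \<in> Fix ==> z \<in> TZ" "z \<in> Fix ==> act (ex t \<beta>) z = z"
  unfolding Fix_def by auto

lemma maximal_Fix:
  assumes z: "z \<in> TZ" and max: "\<And>t. f (act (ex t \<beta>) z) \<le> f z"
  shows "z \<in> Fix"
proof -
  have z0: "act (ex 0 \<beta>) z = z" using z by simp
  show ?thesis
  proof (rule f_derivative[OF z, of 0])
    fix d assume d: "((\<lambda>t. f (act (ex t \<beta>) z)) has_real_derivative d) (at 0)"
      "d = 0 ==> \<forall>t. act (ex t \<beta>) (act (ex 0 \<beta>) z) = act (ex 0 \<beta>) z"
    have "d = 0" by (rule DERIV_local_max[OF d(1), of 1]) (use max z0 in auto)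
    from d(2)[OF this] show ?thesis using z unfolding Fix_def z0 by blast
  qed
qed

lemma f_continuous: "continuous_map (mtop Z) euclideanreal f"
  unfolding continuous_map_atin limitin_canonical_iff
proof
  fix z assume z: "z \<in> TZ"
  obtain c where c: "c \<in> atlas Z" "z \<in> fst c" using complex_manifold_chart_at[OF Z z] by blast
  note tc = Z_chart[OF c(1)]
  have 1: "((\<lambda>y. \<mu> (inv_into (fst c) (snd c) y) \<eta>) \<longlongrightarrow> \<mu> (inv_into (fst c) (snd c) (snd c z)) \<eta>) (nhds (snd c z))"
    by (rule tendsto_at_iff_tendsto_nhds[THEN iffD1, of "\<lambda>y. \<mu> (inv_into (fst c) (snd c) y) \<eta>"])
      (use has_derivative_continuous[OF mu_chart[OF eta_lu c]] in \<open>simp add: continuous_within\<close>)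
  have l: "(\<forall>\<^sub>F w in atin (mtop Z) z. w \<in> fst c) \<and> ((\<lambda>w. snd c w) \<longlongrightarrow> snd c z) (atin (mtop Z) z)"
    using limitin_ident[OF z] unfolding topological_chart_limitin[OF tc c(2)] .
  have "((\<lambda>w. \<mu> (inv_into (fst c) (snd c) (snd c w)) \<eta>) \<longlongrightarrow> \<mu> z \<eta>) (atin (mtop Z) z)"
    using filterlim_compose[OF 1 conjunct2[OF l]] c(2) by (simp add: topological_chart_inv[OF tc])
  moreover have "\<forall>\<^sub>F w in atin (mtop Z) z. \<mu> (inv_into (fst c) (snd c) (snd c w)) \<eta> = f w"
    using conjunct1[OF l] by eventually_elim (simp add: topological_chart_inv[OF tc] f_def)
  ultimately show "(f \<longlongrightarrow> f z) (atin (mtop Z) z)" unfolding f_def by (rule Lim_transform_eventually)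
qed

lemma f_limit: "limitin (mtop Z) g z F ==> ((\<lambda>n. f (g n)) \<longlongrightarrow> f z) F"
  using continuous_map_limit[OF f_continuous] by (simp add: o_def)

lemma Cent_Fix:
  assumes h: "h \<in> carrier L" "Ad L h \<beta> = \<beta>" and z: "z \<in> Fix"
  shows "act h z \<in> Fix"
proof -
  note zT = FixD(1)[OF z]
  have "act (ex t \<beta>) (act h z) = act h z" for t
  proof -
    have "ex t \<beta> = h \<otimes> ex t \<beta> \<otimes> inv h" using Ad_Exp_scale[OF h(1), of t \<beta>] h(2) by simp
    then have "ex t \<beta> \<otimes> h = h \<otimes> ex t \<beta>" using h(1) by (metis Exp_carrier inv_solve_right m_closed)
    then have "act (ex t \<beta>) (act h z) = act h (act (ex t \<beta>) z)"
      using h(1) zT by (metis Exp_carrier act_mult)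
    then show ?thesis using FixD(2)[OF z] by simp
  qed
  then show ?thesis unfolding Fix_def using h(1) zT by simp
qed

text \<open>The centraliser may be disconnected, so \<open>h\<close> is split by the polar
  decomposition, and both factors turn out to centralise \<open>\<beta>\<close>. Along
  \<open>ex s \<alpha>\<close> the derivative of \<open>f\<close> is 0 because the field of
  \<open>\<eta>\<close> vanishes on \<open>Fix\<close>; for the factor \<open>k\<close> equivariance
  of \<open>\<mu>\<close> applies.\<close>

lemma f_Cent:
  assumes h: "h \<in> Cent \<beta>" and z: "z \<in> Fix"
  shows "f (act h z) = f z"
proof -
  note zT = FixD(1)[OF z]
  obtain k \<alpha> where k: "k \<in> G \<inter> U" and \<alpha>: "\<alpha> \<in> lp" and hk: "h = k \<otimes> Exp \<alpha>" by (rule polar[OF CentD(1)[OF h]])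
  have kc: "k \<in> carrier L" using k U_carrier by blast
  have "Ad L k (Ad L (Exp \<alpha>) \<beta>) = \<beta>" using CentD(2)[OF h] kc unfolding hk by (simp add: Ad_mult)
  then have e: "Ad L (Exp \<alpha>) \<beta> = Ad L (inv k) \<beta>" using Ad_inv(1)[OF kc, of "Ad L (Exp \<alpha>) \<beta>"] by simp
  have kU: "inv k \<in> U" using subgroup.m_inv_closed[OF U_subgroup] k by blast
  have "Ad L (Exp \<alpha>) \<beta> \<in> J ` lu" unfolding e by (rule Ad_Jlu[OF kU beta_Jlu])
  from Ad_Exp_Jlu_fixed[OF lp_Jlu[OF \<alpha>] beta_Jlu this] have br: "bracket \<alpha> \<beta> = 0" .
  note fx = bracket_zero_imp_fixed[OF br]
  have kfx: "Ad L (inv k) \<beta> = \<beta>" using e fx[of 1] by simp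
  have wF: "act (ex s \<alpha>) z \<in> Fix" for s by (rule Cent_Fix[OF Exp_carrier fx z])
  have "((\<lambda>s. f (act (ex s \<alpha>) z)) has_real_derivative 0) (at s)" for s
  proof -
    let ?w = "act (ex s \<alpha>) z"
    obtain c where c: "c \<in> atlas Z" "?w \<in> fst c" using complex_manifold_chart_at[OF Z FixD(1)[OF wF[of s]]] by blast
    have "((\<lambda>t. snd c (act (ex t \<beta>) ?w)) has_vector_derivative 0) (at 0)"
      unfolding FixD(2)[OF wF] by simp
    then have "fv \<beta> c ?w = 0" unfolding fundamental_vector_def by (rule vector_derivative_at)
    then have "fv \<eta> c ?w = 0" unfolding \<eta>_def fundamental_vector(2,3)[OF c] using i_mult_facts(3)[OF Z] by simp
    then have "\<omega> c (snd c ?w) (fv \<eta> c ?w) (fv \<alpha> c ?w) = 0" using linear_0[OF omega_facts(1)[OF c(1) imageI[OF c(2)]]] by simp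
    then show ?thesis using mu_derivative_at[OF eta_lu zT c] unfolding f_def by simp
  qed
  then have "f (act (ex 1 \<alpha>) z) = f (act (ex 0 \<alpha>) z)" by (intro DERIV_isconst_all) auto
  then have 1: "f (act (Exp \<alpha>) z) = f z" using zT by simp
  have "f (act h z) = \<mu> (act k (act (Exp \<alpha>) z)) \<eta>" unfolding hk f_def using kc zT by (simp add: act_mult)
  also have "\<dots> = \<mu> (act (Exp \<alpha>) z) (Ad L (inv k) \<eta>)"
    using momentum k eta_lu zT unfolding momentum_map_def by auto
  also have "Ad L (inv k) \<eta> = \<eta>"
  proof -
    have "Ad L (inv k) (J \<eta>) = J \<eta>" using kfx unfolding beta_eta[symmetric] .
    then have "J (Ad L (inv k) \<eta>) = J \<eta>" using Ad_has_derivative(2)[OF inv_closed[OF kc]] by simp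
    then have "J (J (Ad L (inv k) \<eta>)) = J (J \<eta>)" by simp
    then show ?thesis by (simp add: J)
  qed
  finally show ?thesis using 1 unfolding f_def by simp
qed

end

text \<open>A finite subcover by nonempty disjoint sets already contains all of them; each is the
  complement of the open union of the others, hence compact.\<close>

lemma finite_disjoint_open_cover:
  assumes Q: "compactin X (\<Union>\<C>)" and op: "\<And>C. C \<in> \<C> ==> openin (subtopology X (\<Union>\<C>)) C" "{} \<notin> \<C>"
    and dis: "\<And>C D. C \<in> \<C> ==> D \<in> \<C> ==> C \<inter> D \<noteq> {} ==> C = D"
  shows "finite \<C>" and "C \<in> \<C> ==> compactin X C"
proof -
  let ?T = "subtopology X (\<Union>\<C>)"
  have cT: "compactin ?T (\<Union>\<C>)" using Q by (simp add: compactin_subtopology)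
  have "\<exists>\<F>. finite \<F> \<and> \<F> \<subseteq> \<C> \<and> \<Union>\<C> \<subseteq> \<Union>\<F>"
    by (rule compactinD[OF cT op(1)]) auto
  then obtain \<F> where F: "finite \<F>" "\<F> \<subseteq> \<C>" "\<Union>\<C> \<subseteq> \<Union>\<F>" by (elim exE conjE)
  have "C \<in> \<F>" if C: "C \<in> \<C>" for C
  proof -
    have "C \<noteq> {}" using C op(2) by metis
    then obtain c where "c \<in> C" by blast
    then obtain D where "D \<in> \<F>" "c \<in> D" using F(3) C by blast
    then show ?thesis using dis[of C D] C F(2) \<open>c \<in> C\<close> by blast
  qed
  then have "\<C> \<subseteq> \<F>" by (rule subsetI)
  then show "finite \<C>" by (rule finite_subset[OF _ F(1)])
  assume C: "C \<in> \<C>"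
  have tT: "topspace ?T = \<Union>\<C>" using compactin_subset_topspace[OF Q] by auto
  have "C = topspace ?T - \<Union>(\<C> - {C})"
  proof
    show "C \<subseteq> topspace ?T - \<Union>(\<C> - {C})"
    proof
      fix c assume c: "c \<in> C"
      have "c \<notin> D" if "D \<in> \<C> - {C}" for D
      proof
        assume "c \<in> D"
        then have "C \<inter> D \<noteq> {}" using c by auto
        then show False using dis[OF C, of D] that by simp
      qed
      then show "c \<in> topspace ?T - \<Union>(\<C> - {C})" unfolding tT using c C by auto
    qed
    show "topspace ?T - \<Union>(\<C> - {C}) \<subseteq> C" unfolding tT by auto
  qed
  moreover have "openin ?T (\<Union>(\<C> - {C}))" using op(1) by (intro openin_Union) auto
  ultimately have "closedin ?T C" by (metis closedin_diff closedin_topspace)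
  then have "compactin ?T C"
    using closed_compactin[OF cT] C by blast
  then show "compactin X C" by (simp add: compactin_subtopology)
qed

section \<open>Orbit maps onto compact orbits\<close>

context lie_action
begin

lemma continuous_act_left: "g \<in> carrier L ==> continuous_map (mtop Z) (mtop Z) (act g)"
  using continuous_map_compose[OF _ cont_act, of "mtop Z" "\<lambda>z. (g, z)"] carrier
  by (simp add: o_def continuous_map_pairwise)

lemma continuous_orbit: "z \<in> TZ ==> continuous_map (ltop L) (mtop Z) (\<lambda>g. act g z)"
  using continuous_map_compose[OF _ cont_act, of "ltop L" "\<lambda>g. (g, z)"]
  by (simp add: o_def continuous_map_pairwise)

text \<open>A compact orbit is a Baire space, covered by countably many translates of a compact neighbourhood.\<close>

lemma orbit_map_open:
  assumes H: "closedin (ltop L) H" "subgroup H L" and z: "z \<in> TZ"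
    and Y: "compactin (mtop Z) ((\<lambda>h. act h z) ` H)" and W: "openin (ltop L) W" "\<one> \<in> W"
  obtains V where "openin (mtop Z) V" "z \<in> V" "V \<inter> (\<lambda>h. act h z) ` H \<subseteq> (\<lambda>h. act h z) ` (W \<inter> H)"
proof -
  define Y' where "Y' = (\<lambda>h. act h z) ` H"
  note Hc = subgroup.mem_carrier[OF H(2)] and Hm = subgroup.m_closed[OF H(2)] and Hi = subgroup.m_inv_closed[OF H(2)]
  have Y'T: "Y' \<subseteq> TZ" unfolding Y'_def using z Hc by auto
  let ?T = "subtopology (mtop Z) Y'"
  have cT: "compact_space ?T" using Y unfolding Y'_def compactin_subspace by blast
  have hT: "Hausdorff_space ?T" by (rule Hausdorff_space_subtopology[OF Z_Hausdorff])
  have reg: "regular_space ?T" using compact_Hausdorff_imp_regular_space[OF cT hT] .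
  have lc: "locally_compact_space ?T" using compact_imp_locally_compact_space[OF cT] .
  obtain R where R: "R > 0" "cball 0 R \<subseteq> E0" "\<forall>r\<le>R. compactin (ltop L) (\<sigma> ` cball 0 r)" by (rule compact_chart_ball)
  have "(fst \<longlongrightarrow> (0::'e)) (nhds (0::'e, 0::'e))" "(snd \<longlongrightarrow> (0::'e)) (nhds (0::'e, 0::'e))"
    using tendsto_fst[OF filterlim_ident[of "nhds (0::'e, 0::'e)"]] tendsto_snd[OF filterlim_ident[of "nhds (0::'e, 0::'e)"]] by simp_all
  then have "limL (\<lambda>q. inv (\<sigma> (fst q)) \<otimes> \<sigma> (snd q)) (inv (\<sigma> (fst (0, 0))) \<otimes> \<sigma> (snd (0, 0))) (nhds (0, 0))"
    by (intro limitin_mult limitin_inv limitin_sigma) (simp_all add: zero_E0)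
  then have "\<forall>\<^sub>F q in nhds (0, 0). inv (\<sigma> (fst q)) \<otimes> \<sigma> (snd q) \<in> W" using W by (auto dest!: limitinD[OF _ W(1)])
  then obtain r0 where r0: "r0 > 0" "\<forall>q. dist q (0, 0) < r0 --> inv (\<sigma> (fst q)) \<otimes> \<sigma> (snd q) \<in> W"
    unfolding eventually_nhds_metric by blast
  define r where "r = min (r0/3) R"
  have r: "r > 0" "r \<le> R" "2 * r < r0" unfolding r_def using r0(1) R(1) by auto
  \<comment> \<open>A compact neighbourhood of the identity in \<open>H\<close> whose quotients
    \<open>inv a \<otimes> b\<close> lie in \<open>W\<close>.\<close>
  define C where "C = \<sigma> ` cball 0 r \<inter> H"
  have C: "compactin (ltop L) C" unfolding C_def using compact_Int_closedin[OF R(3)[rule_format, OF r(2)] H(1)] .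
  have CW: "inv a \<otimes> b \<in> W \<inter> H" if ab: "a \<in> C" "b \<in> C" for a b
  proof -
    obtain x y where xy: "x \<in> cball 0 r" "y \<in> cball 0 r" "a = \<sigma> x" "b = \<sigma> y" using ab unfolding C_def by blast
    have "dist (x, y) (0, 0) \<le> norm x + norm y" using norm_Pair_le[of x y] by (simp add: dist_norm)
    then have "dist (x, y) (0, 0) < r0" using xy r(3) by simp
    then have "inv a \<otimes> b \<in> W" using r0(2) xy by fastforce
    then show ?thesis using ab Hm Hi unfolding C_def by blast
  qed
  obtain N where N: "openin (ltop L) N" "\<one> \<in> N" "\<forall>g\<in>N. g \<in> D0 \<and> norm (\<psi> g) < r" using near_one_D0[OF r(1)] by blast
  have NC: "N \<inter> H \<subseteq> C"
  proof
    fix g assume g: "g \<in> N \<inter> H"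
    then have "g = \<sigma> (\<psi> g)" "norm (\<psi> g) \<le> r" using N(3) sigma_psi by fastforce+
    then have "g \<in> \<sigma> ` cball 0 r" by force
    then show "g \<in> C" unfolding C_def using g by blast
  qed
  define tr where "tr s = {g \<in> topspace (ltop L). inv s \<otimes> g \<in> N}" for s
  have tr: "openin (ltop L) (tr s)" "s \<in> tr s" if "s \<in> H" for s
  proof -
    have sc: "s \<in> carrier L" using Hc[OF that] .
    show "openin (ltop L) (tr s)" unfolding tr_def
      by (rule openin_continuous_map_preimage[OF continuous_left_mult[OF inv_closed[OF sc]] N(1)])
    show "s \<in> tr s" unfolding tr_def carrier[symmetric] using sc N(2) by simp
  qed
  have "Lindelof_space (subtopology (ltop L) H)"
    by (rule second_countable_imp_Lindelof_space[OF second_countable_subtopology[OF second_countable_L]])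
  then have "\<exists>\<V>. countable \<V> \<and> \<V> \<subseteq> tr ` H \<and> H \<subseteq> \<Union>\<V>"
    unfolding Lindelof_space_subtopology_subset[OF closedin_subset[OF H(1)]] using tr by (elim allE[of _ "tr ` H"] impE) auto
  then obtain \<V> where \<V>: "countable \<V>" "\<V> \<subseteq> tr ` H" "H \<subseteq> \<Union>\<V>" by (elim exE conjE)
  obtain S where S: "countable S" "S \<subseteq> H" "\<V> = tr ` S" using \<V>(1,2) countable_subset_image[of \<V> tr H] by auto
  define M where "M s = (\<lambda>h. act (s \<otimes> h) z) ` C" for s
  have Ms: "closedin ?T (M s)" "M s \<subseteq> Y'" if "s \<in> S" for s
  proof -
    have sc: "s \<in> carrier L" using that S(2) Hc by blast
    have "continuous_map (ltop L) (mtop Z) (\<lambda>h. act (s \<otimes> h) z)"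
      using continuous_map_compose[OF continuous_left_mult[OF sc] continuous_orbit[OF z]] by (simp add: o_def)
    then have "compactin (mtop Z) (M s)" unfolding M_def by (rule image_compactin[OF C])
    moreover show MY: "M s \<subseteq> Y'" unfolding M_def Y'_def C_def using that S(2) Hm by blast
    ultimately show "closedin ?T (M s)" using closedin_subset_topspace compactin_imp_closedin[OF Z_Hausdorff] by blast
  qed
  have UM: "\<Union>(M ` S) = Y'"
  proof
    show "\<Union>(M ` S) \<subseteq> Y'" using Ms by blast
    show "Y' \<subseteq> \<Union>(M ` S)"
    proof
      fix y assume "y \<in> Y'"
      then obtain h where h: "h \<in> H" "y = act h z" unfolding Y'_def by blast
      then obtain s where s: "s \<in> S" "h \<in> tr s" using \<V>(3) S(3) by blast
      have sH: "s \<in> H" using s S(2) by blast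
      have "inv s \<otimes> h \<in> C" using s(2) NC Hm[OF Hi[OF sH] h(1)] unfolding tr_def by blast
      moreover have "s \<otimes> (inv s \<otimes> h) = h" using Hc[OF sH] Hc[OF h(1)] by (simp add: cancel_inv)
      ultimately have "y \<in> M s" unfolding M_def h(2) by (metis image_eqI)
      then show "y \<in> \<Union>(M ` S)" using s(1) by blast
    qed
  qed
  have "\<exists>s\<in>S. ?T interior_of (M s) \<noteq> {}"
  proof (rule ccontr)
    assume "\<not> (\<exists>s\<in>S. ?T interior_of (M s) \<noteq> {})"
    then have no: "?T interior_of (M s) = {}" if "s \<in> S" for s using that by simp
    have "?T interior_of \<Union>(M ` S) = {}"
    proof (rule Baire_category_alt)
      show "completely_metrizable_space ?T \<or> locally_compact_space ?T \<and> regular_space ?T" using reg lc by simp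
      show "countable (M ` S)" using S(1) by simp
      show "closedin ?T T \<and> ?T interior_of T = {}" if "T \<in> M ` S" for T using that Ms(1) no by auto
    qed
    moreover have "topspace ?T = Y'" using Y'T by auto
    ultimately have "Y' = {}" unfolding UM by (metis interior_of_topspace)
    then show False unfolding Y'_def using subgroup.one_closed[OF H(2)] by blast
  qed
  then obtain s y where s: "s \<in> S" and y: "y \<in> ?T interior_of (M s)" by blast
  have sH: "s \<in> H" using s S(2) by blast
  have "openin ?T (?T interior_of (M s))" by (rule openin_interior_of)
  then obtain V' where V': "openin (mtop Z) V'" "?T interior_of (M s) = V' \<inter> Y'" unfolding openin_subtopology by blast
  have "y \<in> M s" by (rule subsetD[OF interior_of_subset y])
  then obtain c where c: "c \<in> C" "y = act (s \<otimes> c) z" unfolding M_def by blast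
  have cH: "c \<in> H" using c unfolding C_def by blast
  have scH: "s \<otimes> c \<in> H" using Hm[OF sH cH] .
  \<comment> \<open>The interior point \<open>y\<close> is moved back to \<open>z\<close> by the
    group element that produced it.\<close>
  define V where "V = {w \<in> TZ. act (s \<otimes> c) w \<in> V'}"
  show ?thesis
  proof
    show "openin (mtop Z) V" unfolding V_def
      by (rule openin_continuous_map_preimage[OF continuous_act_left[OF Hc[OF scH]] V'(1)])
    show "z \<in> V" unfolding V_def using z y c(2) V'(2) by blast
    show "V \<inter> (\<lambda>h. act h z) ` H \<subseteq> (\<lambda>h. act h z) ` (W \<inter> H)"
    proof
      fix w assume w: "w \<in> V \<inter> (\<lambda>h. act h z) ` H"
      then obtain h where h: "h \<in> H" "w = act h z" by blast
      have "act (s \<otimes> c) w = act (s \<otimes> c \<otimes> h) z" unfolding h(2) using act_mult[OF Hc[OF scH] Hc[OF h(1)] z] by simp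
      then have "act (s \<otimes> c) w \<in> Y'" unfolding Y'_def using Hm[OF scH h(1)] by blast
      then have "act (s \<otimes> c) w \<in> ?T interior_of (M s)" using w unfolding V'(2) V_def by simp
      then have "act (s \<otimes> c) w \<in> M s" by (rule subsetD[OF interior_of_subset])
      then obtain c' where c': "c' \<in> C" "act (s \<otimes> c) w = act (s \<otimes> c') z" unfolding M_def by blast
      have c'H: "c' \<in> H" using c' unfolding C_def by blast
      have wT: "w \<in> TZ" using w unfolding V_def by blast
      have "w = act (inv (s \<otimes> c)) (act (s \<otimes> c) w)" using act_inv[OF Hc[OF scH] wT] by simp
      also have "\<dots> = act (inv (s \<otimes> c) \<otimes> (s \<otimes> c')) z"
        unfolding c'(2) using act_mult[OF inv_closed[OF Hc[OF scH]] Hc[OF Hm[OF sH c'H]] z] by simp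
      also have "inv (s \<otimes> c) \<otimes> (s \<otimes> c') = inv c \<otimes> c'"
        using Hc[OF sH] Hc[OF cH] Hc[OF c'H] by (simp add: inv_mult_group m_assoc cancel_inv)
      finally show "w \<in> (\<lambda>h. act h z) ` (W \<inter> H)" using CW[OF c(1) c'(1)] by blast
    qed
  qed
qed

end

context compatible_pair
begin

text \<open>\<open>Ad L k\<close> is an isometry of \<open>IP\<close>, which is equivalent to the
  norm.\<close>

lemma Ad_U_bounded: "\<exists>C>0. \<forall>k\<in>U. \<forall>v. norm (Ad L k v) \<le> C * norm v"
proof -
  obtain m where m: "m > 0" "\<forall>x. IP x x \<ge> m * (norm x)\<^sup>2" by (rule IP.IP_lower_bound)
  obtain K where K: "K > 0" "\<And>x y. \<bar>IP x y\<bar> \<le> norm x * norm y * K"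
    using bounded_bilinear.pos_bounded[OF IP.bounded_bilinear_IP] by auto
  define C where "C = sqrt (K / m)"
  have C: "C > 0" "C\<^sup>2 = K / m" unfolding C_def using K m by auto
  have "norm (Ad L k v) \<le> C * norm v" if k: "k \<in> U" for k v
  proof (rule power2_le_imp_le)
    have "m * (norm (Ad L k v))\<^sup>2 \<le> IP v v" using m(2) IP_Ad[OF k, of v v] by metis
    also have "\<dots> \<le> K * (norm v)\<^sup>2" using K(2)[of v v] by (simp add: power2_eq_square mult_ac)
    finally have "(norm (Ad L k v))\<^sup>2 \<le> K * (norm v)\<^sup>2 / m" using m(1) by (simp add: pos_le_divide_eq mult.commute)
    then show "(norm (Ad L k v))\<^sup>2 \<le> (C * norm v)\<^sup>2" unfolding power_mult_distrib C(2) by simp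
    show "0 \<le> C * norm v" using C(1) by simp
  qed
  then show ?thesis using C(1) by blast
qed

end

section \<open>From compact P-orbits to compact G-orbits\<close>

context ham
begin

definition KK :: "'g set" where "KK = G \<inter> U"

lemma KK_compact: "compactin (ltop L) KK"
  unfolding KK_def by (rule closed_Int_compactin[OF G_closed U_compact])

lemma KK_subgroup: "subgroup KK L"
  unfolding KK_def by (rule subgroups_Inter_pair[OF G_subgroup U_subgroup])

lemma KKD: "k \<in> KK ==> k \<in> G" "k \<in> KK ==> k \<in> U" "k \<in> KK ==> k \<in> carrier L"
  unfolding KK_def using G_carrier by auto

lemma lp_Ad: "k \<in> KK ==> \<alpha> \<in> lp ==> Ad L k \<alpha> \<in> lp"
  unfolding p_part_def using Ad_lg Ad_Jlu KKD by blast

definition PX :: "'z => 'z set" where "PX x = (\<lambda>p. act p x) ` PP"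
definition GX :: "'z => 'z set" where "GX x = (\<lambda>g. act g x) ` G"
text \<open>K P x, the candidate for the whole \<open>G\<close>-orbit, compact together with P
  x.\<close>

definition KPX :: "'z => 'z set" where "KPX x = (\<lambda>(k, q). act k q) ` (KK \<times> PX x)"

lemma PP_carrier: "p \<in> PP ==> p \<in> carrier L"
  using parabolic_G G_carrier by blast

lemma PX_step: "x \<in> TZ ==> p \<in> PP ==> q \<in> PX x ==> act p q \<in> PX x"
proof -
  assume x: "x \<in> TZ" and p: "p \<in> PP" and "q \<in> PX x"
  then obtain p' where p': "p' \<in> PP" "q = act p' x" unfolding PX_def by blast
  have "act p q = act (p \<otimes> p') x" unfolding p'(2) using act_mult[OF PP_carrier[OF p] PP_carrier[OF p'(1)] x] by simp
  then show ?thesis unfolding PX_def using subgroup.m_closed[OF parabolic_subgroup p p'(1)] by blast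
qed

lemma PX_TZ: "x \<in> TZ ==> q \<in> PX x ==> q \<in> TZ"
  unfolding PX_def using PP_carrier by auto

lemma KPX_TZ: "x \<in> TZ ==> z \<in> KPX x ==> z \<in> TZ"
  unfolding KPX_def using PX_TZ KKD by auto

lemma KPX_compact:
  assumes "x \<in> TZ" "compactin (mtop Z) (PX x)" shows "compactin (mtop Z) (KPX x)"
  unfolding KPX_def by (rule image_compactin[OF _ cont_act]) (simp add: compactin_Times KK_compact assms)

lemma KPX_K: "x \<in> TZ ==> k \<in> KK ==> z \<in> KPX x ==> act k z \<in> KPX x"
proof -
  assume x: "x \<in> TZ" and k: "k \<in> KK" and "z \<in> KPX x"
  then obtain k' q where q: "k' \<in> KK" "q \<in> PX x" "z = act k' q" unfolding KPX_def by auto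
  have "act k z = act (k \<otimes> k') q" unfolding q(3) using act_mult[OF KKD(3)[OF k] KKD(3)[OF q(1)] PX_TZ[OF x q(2)]] by simp
  moreover have "k \<otimes> k' \<in> KK" by (rule subgroup.m_closed[OF KK_subgroup k q(1)])
  ultimately show ?thesis unfolding KPX_def using q(2) by force
qed

text \<open>At \<open>z = act k q\<close> the decomposition of \<pp> is applied to the direction
  conjugated back by \<open>k\<close>, so that its two parts act through K and through P. The bound
  is uniform because \<open>Ad\<close> is uniformly bounded on \<open>U\<close>.\<close>

lemma KPX_direction:
  assumes x: "x \<in> TZ" and \<alpha>: "\<alpha> \<in> lp"
  obtains C where "C \<ge> 0" "\<forall>z\<in>KPX x. \<exists>\<kappa> \<pi>. norm \<kappa> \<le> C \<and> norm \<pi> \<le> C \<and> \<kappa> + \<pi> = \<alpha> \<and>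
    (\<forall>h. act (ex h \<kappa> \<otimes> ex h \<pi>) z \<in> KPX x)"
proof -
  obtain CA where CA: "CA > 0" "\<forall>k\<in>U. \<forall>v. norm (Ad L k v) \<le> CA * norm v" using Ad_U_bounded by blast
  have kl: "linear kap"
  proof (rule linearI)
    show "kap (a + b) = kap a + kap b" for a b unfolding kap_def linear_add[OF proj_linear] by simp
    show "kap (r *\<^sub>R a) = r *\<^sub>R kap a" for r a unfolding kap_def linear_scale[OF proj_linear] by (simp add: scaleR_diff_right)
  qed
  obtain Ck where Ck: "Ck > 0" "\<And>v. norm (kap v) \<le> norm v * Ck"
    using bounded_linear.pos_bounded[OF finite_dimensional_bounded_linear[OF fd kl]] by blast
  define C where "C = CA * (CA * norm \<alpha> * Ck) + norm \<alpha>"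
  have C0: "CA * (CA * norm \<alpha> * Ck) \<ge> 0" using CA(1) Ck(1) by simp
  have "\<exists>\<kappa> \<pi>. norm \<kappa> \<le> C \<and> norm \<pi> \<le> C \<and> \<kappa> + \<pi> = \<alpha> \<and>
    (\<forall>h. act (ex h \<kappa> \<otimes> ex h \<pi>) z \<in> KPX x)" if z: "z \<in> KPX x" for z
  proof -
    obtain k q where kq: "k \<in> KK" "q \<in> PX x" "z = act k q" using z unfolding KPX_def by auto
    have qT: "q \<in> TZ" by (rule PX_TZ[OF x kq(2)])
    note kc = KKD(3)[OF kq(1)]
    have ki: "inv k \<in> KK" by (rule subgroup.m_inv_closed[OF KK_subgroup kq(1)])
    define \<alpha>' where "\<alpha>' = Ad L (inv k) \<alpha>"
    have \<alpha>': "\<alpha>' \<in> lp" unfolding \<alpha>'_def by (rule lp_Ad[OF ki \<alpha>])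
    note dec = p_decompose[OF \<alpha>']
    define \<kappa> \<pi> where "\<kappa> = Ad L k (kap \<alpha>')" and "\<pi> = Ad L k (\<alpha>' - kap \<alpha>')"
    have "\<kappa> + \<pi> = Ad L k \<alpha>'" unfolding \<kappa>_def \<pi>_def linear_add[OF Ad_linear[OF kc], symmetric] by simp
    also have "\<dots> = \<alpha>" unfolding \<alpha>'_def using Ad_inv(2)[OF kc] .
    finally have sum: "\<kappa> + \<pi> = \<alpha>" .
    have n\<kappa>: "norm \<kappa> \<le> CA * (CA * norm \<alpha> * Ck)"
    proof -
      have "norm \<kappa> \<le> CA * norm (kap \<alpha>')" unfolding \<kappa>_def using CA(2) KKD(2)[OF kq(1)] by blast
      also have "\<dots> \<le> CA * (norm \<alpha>' * Ck)" using CA(1) Ck(2) by (intro mult_left_mono) auto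
      also have "\<dots> \<le> CA * (CA * norm \<alpha> * Ck)"
        unfolding \<alpha>'_def using CA Ck(1) KKD(2)[OF ki] by (intro mult_left_mono mult_right_mono) auto
      finally show ?thesis .
    qed
    have "\<pi> = \<alpha> - \<kappa>" using sum by (simp add: algebra_simps)
    then have "norm \<pi> \<le> norm \<alpha> + norm \<kappa>" using norm_triangle_ineq4 by metis
    then have nn: "norm \<kappa> \<le> C" "norm \<pi> \<le> C" unfolding C_def using n\<kappa> norm_ge_zero[of \<alpha>] by linarith+
    have "act (ex h \<kappa> \<otimes> ex h \<pi>) z \<in> KPX x" for h
    proof -
      have e: "ex h \<kappa> = k \<otimes> ex h (kap \<alpha>') \<otimes> inv k" "ex h \<pi> = k \<otimes> ex h (\<alpha>' - kap \<alpha>') \<otimes> inv k"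
        unfolding \<kappa>_def \<pi>_def using kc by (simp_all add: Ad_Exp_scale)
      have "ex h \<kappa> \<otimes> ex h \<pi> \<otimes> k = k \<otimes> ex h (kap \<alpha>') \<otimes> ex h (\<alpha>' - kap \<alpha>')"
        unfolding e using kc by (simp add: m_assoc cancel_inv)
      moreover have "act (ex h \<kappa> \<otimes> ex h \<pi>) z = act (ex h \<kappa> \<otimes> ex h \<pi> \<otimes> k) q"
        unfolding kq(3) using kc qT by (simp add: act_mult)
      ultimately have a: "act (ex h \<kappa> \<otimes> ex h \<pi>) z = act (k \<otimes> ex h (kap \<alpha>')) (act (ex h (\<alpha>' - kap \<alpha>')) q)"
        using kc qT by (simp add: act_mult)
      have "ex h (\<alpha>' - kap \<alpha>') \<in> PP"
        by (rule Exp_nonneg_parabolic[OF subspace_scale[OF part_subspace dec(2)]])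
      then have 1: "act (ex h (\<alpha>' - kap \<alpha>')) q \<in> PX x" using PX_step[OF x _ kq(2)] by blast
      have "ex h (kap \<alpha>') \<in> KK" unfolding KK_def using dec(1) lie_algebra_Exp[OF lie_algebra_scale] by blast
      then have "k \<otimes> ex h (kap \<alpha>') \<in> KK" by (rule subgroup.m_closed[OF KK_subgroup kq(1)])
      then show ?thesis unfolding a KPX_def using 1 by force
    qed
    then show ?thesis using nn sum by blast
  qed
  moreover have "C \<ge> 0" unfolding C_def using C0 by simp
  ultimately show ?thesis using that by blast
qed

text \<open>The curve \<open>exp (t \<alpha>) z\<close> is a limit of polygons in the compact set \<open>K P x\<close>, each step moving by an element
  of \<open>k exp (\<kk>) exp (\<gg>\<^sub>\<ge>\<^sub>0) k\<^sup>-\<^sup>1\<close>.\<close>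

lemma KPX_Exp:
  assumes x: "x \<in> TZ" and cpt: "compactin (mtop Z) (PX x)" and \<alpha>: "\<alpha> \<in> lp" and z: "z \<in> KPX x"
  shows "act (Exp \<alpha>) z \<in> KPX x"
proof -
  obtain C where C: "C \<ge> 0" "\<forall>z\<in>KPX x. \<exists>\<kappa> \<pi>. norm \<kappa> \<le> C \<and> norm \<pi> \<le> C \<and> \<kappa> + \<pi> = \<alpha> \<and>
    (\<forall>h. act (ex h \<kappa> \<otimes> ex h \<pi>) z \<in> KPX x)" by (rule KPX_direction[OF x \<alpha>])
  obtain kk where kk: "\<forall>z\<in>KPX x. \<exists>\<pi>. norm (kk z) \<le> C \<and> norm \<pi> \<le> C \<and> kk z + \<pi> = \<alpha> \<and>
    (\<forall>h. act (ex h (kk z) \<otimes> ex h \<pi>) z \<in> KPX x)" using bchoice[OF C(2)] by (elim exE)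
  obtain pp where kp: "\<forall>z\<in>KPX x. norm (kk z) \<le> C \<and> norm (pp z) \<le> C \<and> kk z + pp z = \<alpha> \<and>
    (\<forall>h. act (ex h (kk z) \<otimes> ex h (pp z)) z \<in> KPX x)" using bchoice[OF kk] by (elim exE)
  define h where "h n = 1 / real (Suc n)" for n
  define w where "w n i = ((\<lambda>y. act (ex (h n) (kk y) \<otimes> ex (h n) (pp y)) y) ^^ i) z" for n i
  have w: "w n i \<in> KPX x" for n i unfolding w_def by (induction i) (use z kp in auto)
  \<comment> \<open>The inverse of the step at \<open>w n i\<close>. Inverses multiply in the order
    of \<open>gprod\<close> and lead from \<open>w n i\<close> back to \<open>z\<close>.\<close>
  define g where "g n i = ex (h n) (- pp (w n i)) \<otimes> ex (h n) (- kk (w n i))" for n i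
  have gc: "g n i \<in> carrier L" for n i unfolding g_def by simp
  have ginv: "inv (g n i) = ex (h n) (kk (w n i)) \<otimes> ex (h n) (pp (w n i))" for n i
  proof -
    have "ex (h n) (- v) = inv (ex (h n) v)" for v using Exp_neg[of "h n *\<^sub>R v"] by simp
    then show ?thesis unfolding g_def by (simp add: inv_mult_group)
  qed
  have ws: "w n (Suc i) = act (inv (g n i)) (w n i)" for n i unfolding ginv w_def by simp
  have gw: "act (gprod (g n) i) (w n i) = z" for n i
  proof (induction i)
    case 0
    then show ?case using KPX_TZ[OF x z] by (simp add: w_def)
  next
    case (Suc i)
    have pc: "gprod (g n) i \<in> carrier L" using gprod_closed gc by blast
    note wT = KPX_TZ[OF x w[of n i]]
    have "act (g n i) (act (inv (g n i)) (w n i)) = w n i" using act_inv[OF inv_closed[OF gc[of n i]] wT] gc by simp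
    then have "act (gprod (g n) (Suc i)) (w n (Suc i)) = act (gprod (g n) i) (w n i)"
      unfolding ws using pc gc wT by (simp add: act_mult)
    then show ?case using Suc by simp
  qed
  have h: "\<And>n. h n > 0" "h \<longlonglongrightarrow> 0" unfolding h_def using LIMSEQ_Suc[OF lim_const_over_n[of 1]] by simp_all
  then have ev: "\<forall>\<^sub>F n in sequentially. h n > 0" by simp
  have k: "norm (- kk (w n i)) \<le> C" "norm (- pp (w n i)) \<le> C" "- pp (w n i) + - kk (w n i) = - \<alpha>" for n i
    using kp[rule_format, OF w[of n i]] by auto
  \<comment> \<open>The decomposition changes from point to point, but its two parts always add up
    to the same direction, here with reversed sign.\<close>
  have "tang sequentially (\<lambda>n. {..<Suc n}) h g (\<lambda>n i. - pp (w n i) + - kk (w n i))"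
    unfolding g_def by (rule tang_mult[OF Exp_tang[OF h(2) ev k(2)] Exp_tang[OF h(2) ev k(1)] h(2) ev k(2,1)])
  then have "tang sequentially (\<lambda>n. {..<Suc n}) h g (\<lambda>_ _. - \<alpha>)" unfolding k(3) .
  from product_limit[OF ops_Exp h zero_le_one _ this]
  have lim: "limL (\<lambda>n. gprod (g n) (Suc n)) (Exp (- \<alpha>)) sequentially" unfolding h_def by simp
  have "limitin (mtop Z) (\<lambda>n. act (inv (gprod (g n) (Suc n))) z) (act (inv (Exp (- \<alpha>))) z) sequentially"
    by (intro limitin_act limitin_inv lim) (use KPX_TZ[OF x z] in simp)
  moreover have "act (inv (gprod (g n) (Suc n))) z = w n (Suc n)" for n
  proof -
    have pc: "gprod (g n) (Suc n) \<in> carrier L" using gprod_closed gc by blast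
    show ?thesis using act_inv[OF pc KPX_TZ[OF x w[of n "Suc n"]]] gw[of n "Suc n"] by simp
  qed
  moreover have "inv (Exp (- \<alpha>)) = Exp \<alpha>" using Exp_neg[of "- \<alpha>"] by simp
  ultimately have l: "limitin (mtop Z) (\<lambda>n. w n (Suc n)) (act (Exp \<alpha>) z) sequentially" by simp
  have cl: "closedin (mtop Z) (KPX x)" by (rule compactin_imp_closedin[OF Z_Hausdorff KPX_compact[OF x cpt]])
  show ?thesis
    by (rule limitin_closedin[OF l cl]) (use w in auto)
qed

text \<open>K P x is stable under K and exp(\<pp>), hence under \<open>G\<close> by the polar
  decomposition.\<close>

lemma GX_compact:
  assumes x: "x \<in> TZ" and cpt: "compactin (mtop Z) (PX x)"
  shows "compactin (mtop Z) (GX x)"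
proof -
  have "x \<in> PX x" unfolding PX_def using x subgroup.one_closed[OF parabolic_subgroup] by force
  then have xK: "x \<in> KPX x" unfolding KPX_def using subgroup.one_closed[OF KK_subgroup] x by force
  have "GX x = KPX x"
  proof
    show "GX x \<subseteq> KPX x"
    proof
      fix z assume "z \<in> GX x"
      then obtain g where g: "g \<in> G" "z = act g x" unfolding GX_def by blast
      obtain k \<alpha> where k: "k \<in> G \<inter> U" "\<alpha> \<in> lp" "g = k \<otimes> Exp \<alpha>" by (rule polar[OF g(1)])
      have kK: "k \<in> KK" using k(1) unfolding KK_def .
      have "z = act k (act (Exp \<alpha>) x)" unfolding g(2) k(3) using KKD(3)[OF kK] x by (simp add: act_mult)
      then show "z \<in> KPX x" using KPX_K[OF x kK KPX_Exp[OF x cpt k(2) xK]] by simp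
    qed
    show "KPX x \<subseteq> GX x"
    proof
      fix z assume "z \<in> KPX x"
      then obtain k p where kp: "k \<in> KK" "p \<in> PP" "z = act k (act p x)" unfolding KPX_def PX_def by auto
      then have "z = act (k \<otimes> p) x" using act_mult[OF KKD(3)[OF kp(1)] PP_carrier[OF kp(2)] x] by simp
      then show "z \<in> GX x" unfolding GX_def using G_mult[OF KKD(1)[OF kp(1)] parabolic_G[OF kp(2)]] by blast
    qed
  qed
  then show ?thesis using KPX_compact[OF x cpt] by simp
qed

end

section \<open>The maximum set and its orbits\<close>

context ham
begin

definition CX :: "'z => 'z set" where "CX x = (\<lambda>h. act h x) ` Cent \<beta>"
definition MX :: "'z set => 'z set" where "MX Y = {p \<in> Y. \<forall>z\<in>Y. f z \<le> f p}"

lemma GX_TZ: "x \<in> TZ ==> GX x \<subseteq> TZ"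
  unfolding GX_def using G_carrier by auto

lemma subgroup_orbit_eq:
  assumes H: "subgroup H L" and x: "x \<in> TZ" and z: "z \<in> (\<lambda>h. act h x) ` H"
  shows "(\<lambda>h. act h z) ` H = (\<lambda>h. act h x) ` H"
proof -
  note Hc = subgroup.mem_carrier[OF H] and Hm = subgroup.m_closed[OF H] and Hi = subgroup.m_inv_closed[OF H]
  obtain k where k: "k \<in> H" "z = act k x" using z by blast
  show ?thesis
  proof
    show "(\<lambda>h. act h z) ` H \<subseteq> (\<lambda>h. act h x) ` H"
    proof
      fix y assume "y \<in> (\<lambda>h. act h z) ` H"
      then obtain h where h: "h \<in> H" "y = act h z" by blast
      have "y = act (h \<otimes> k) x" unfolding h(2) k(2) using act_mult[OF Hc[OF h(1)] Hc[OF k(1)] x] by simp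
      then show "y \<in> (\<lambda>h. act h x) ` H" using Hm[OF h(1) k(1)] by blast
    qed
    show "(\<lambda>h. act h x) ` H \<subseteq> (\<lambda>h. act h z) ` H"
    proof
      fix y assume "y \<in> (\<lambda>h. act h x) ` H"
      then obtain h where h: "h \<in> H" "y = act h x" by blast
      have "act (h \<otimes> inv k) z = act h x"
        unfolding k(2) using Hc[OF h(1)] Hc[OF k(1)] x by (simp add: act_mult act_inv)
      then have "y = act (h \<otimes> inv k) z" unfolding h(2) ..
      then show "y \<in> (\<lambda>h. act h z) ` H" using Hm[OF h(1) Hi[OF k(1)]] by blast
    qed
  qed
qed

lemma subgroup_orbit_refl: "subgroup H L ==> x \<in> TZ ==> x \<in> (\<lambda>h. act h x) ` H"
  using subgroup.one_closed[of H L] act_one[of x] by (metis image_eqI)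

lemma act_cj: "g \<in> carrier L ==> z \<in> TZ ==> act (ex t \<beta>) (act g z) = act (cj \<beta> t g) (act (ex t \<beta>) z)"
  unfolding cj_def Exp_neg_scale by (simp flip: act_mult add: m_assoc)

text \<open>For time tending to minus infinity \<open>act n z\<close> flows to \<open>z\<close>, and
  \<open>f\<close> increases along the flow, so \<open>f z \<le> f (act n z)\<close>. With the upper
  bound, \<open>act n z\<close> is maximal along its own flow line, hence fixed, hence equal to its
  limit \<open>z\<close>.\<close>

lemma Rm_pos_fixes:
  assumes z: "z \<in> Fix" and n: "n \<in> Rm (- \<beta>)" and max: "\<And>t. f (act (ex t \<beta>) (act n z)) \<le> f z"
  shows "act n z = z"
proof -
  note zT = FixD(1)[OF z] and nc = Rm_carrier[OF n]
  have nT: "act n z \<in> TZ" using nc zT by simp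
  have "limitin (mtop Z) (\<lambda>t. act (cj \<beta> t n) z) (act \<one> z) at_bot"
    by (intro limitin_act) (use n Rm_minus_limitin zT in auto)
  then have lim: "limitin (mtop Z) (\<lambda>t. act (ex t \<beta>) (act n z)) z at_bot"
    using zT FixD(2)[OF z] by (simp add: act_cj[OF nc zT])
  have "\<forall>\<^sub>F t in at_bot. f (act (ex t \<beta>) (act n z)) \<le> f (act n z)"
    using eventually_le_at_bot[of 0]
  proof eventually_elim
    case (elim t)
    then show ?case using f_mono[OF nT elim] nT by simp
  qed
  from tendsto_upperbound[OF f_limit[OF lim] this] have "f z \<le> f (act n z)" by simp
  then have "act n z \<in> Fix" using max by (intro maximal_Fix[OF nT]) (blast intro: order_trans)
  then have "limitin (mtop Z) (\<lambda>t::real. act n z) z at_bot" using lim FixD(2) by simp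
  moreover have "limitin (mtop Z) (\<lambda>t::real. act n z) (act n z) at_bot" using nT by simp
  ultimately show ?thesis
    using limitin_Hausdorff_unique[OF _ _ _ Z_Hausdorff] trivial_limit_at_bot_linorder by blast
qed

lemma flow_limit:
  assumes u: "u \<in> Rm \<beta>" and z: "z \<in> Fix"
  shows "limitin (mtop Z) (\<lambda>t. act (ex t \<beta>) (act u z)) z at_top"
proof -
  note zT = FixD(1)[OF z] and uc = Rm_carrier[OF u]
  have "limitin (mtop Z) (\<lambda>t. act (cj \<beta> t u) z) (act \<one> z) at_top"
    by (intro limitin_act RmD(2)[OF u]) (use zT in simp)
  then show ?thesis using zT FixD(2)[OF z] by (simp add: act_cj[OF uc zT])
qed

text \<open>A fixed point \<open>w\<close> near \<open>z\<close> is \<open>act u (act h z)\<close>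
  with \<open>u\<close> in R^- and \<open>h\<close> in the centraliser, as the R^+ factor fixes
  \<open>z\<close>. The flow of \<open>\<beta>\<close> fixes \<open>w\<close> and moves it towards
  \<open>act h z\<close>, so the two agree.\<close>

lemma orbit_Fix_open:
  assumes z: "z \<in> Fix" and cpt: "compactin (mtop Z) (GX z)" and n: "\<And>n. n \<in> Rm (- \<beta>) ==> act n z = z"
  obtains V where "openin (mtop Z) V" "z \<in> V" "V \<inter> GX z \<inter> Fix \<subseteq> CX z"
proof -
  note zT = FixD(1)[OF z]
  obtain W where W: "openin (ltop L) W" "\<one> \<in> W" "W \<inter> G \<subseteq> \<Omega>" using Omega_near_one by blast
  obtain V where V: "openin (mtop Z) V" "z \<in> V" "V \<inter> (\<lambda>h. act h z) ` G \<subseteq> (\<lambda>h. act h z) ` (W \<inter> G)"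
    by (rule orbit_map_open[OF G_closed G_subgroup zT cpt[unfolded GX_def] W(1,2)])
  have "w \<in> CX z" if w: "w \<in> V \<inter> GX z \<inter> Fix" for w
  proof -
    obtain g where g: "g \<in> W \<inter> G" "w = act g z" using w V(3) unfolding GX_def by blast
    then have "g \<in> \<Omega>" using W(3) by blast
    then obtain u h n where u: "u \<in> Rm \<beta>" and h: "h \<in> Cent \<beta>" and nn: "n \<in> Rm (- \<beta>)" and guhn: "g = u \<otimes> h \<otimes> n"
      unfolding Omega_iff by blast
    note c = Rm_carrier[OF u] Cent_carrier[OF h] Rm_carrier[OF nn]
    have hF: "act h z \<in> Fix" by (rule Cent_Fix[OF c(2) CentD(2)[OF h] z])
    have wu: "w = act u (act h z)" unfolding g(2) guhn using c zT n[OF nn] by (simp add: act_mult)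
    have wF: "w \<in> Fix" using w by blast
    have "limitin (mtop Z) (\<lambda>t. act (ex t \<beta>) w) (act h z) at_top"
      unfolding wu by (rule flow_limit[OF u hF])
    then have 1: "limitin (mtop Z) (\<lambda>t::real. w) (act h z) at_top" unfolding FixD(2)[OF wF] .
    have 2: "limitin (mtop Z) (\<lambda>t::real. w) w at_top" using FixD(1)[OF wF] by simp
    have "w = act h z" by (rule limitin_Hausdorff_unique[OF 2 1 _ Z_Hausdorff]) simp
    then show ?thesis unfolding CX_def using h by blast
  qed
  then show ?thesis using that V(1,2) by blast
qed

text \<open>At a maximum R^+ acts trivially, so the P-orbit reduces to the orbit of the centraliser,
  on which \<open>f\<close> is constant.\<close>

lemma max_facts:
  assumes x: "x \<in> TZ" and z: "z \<in> MX (GX x)"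
  shows "z \<in> Fix" and "n \<in> Rm (- \<beta>) ==> act n z = z" and "CX z \<subseteq> MX (GX x)" and "PX z = CX z" and "GX z = GX x"
proof -
  have zG: "z \<in> GX x" and max: "\<And>y. y \<in> GX x ==> f y \<le> f z" using z unfolding MX_def by auto
  have zT: "z \<in> TZ" using zG GX_TZ[OF x] by blast
  show GG: "GX z = GX x" unfolding GX_def by (rule subgroup_orbit_eq[OF G_subgroup x zG[unfolded GX_def]])
  have inG: "act g z \<in> GX x" if g: "g \<in> G" for g
  proof -
    have "act g z \<in> GX z" unfolding GX_def using g by blast
    then show ?thesis unfolding GG .
  qed
  show zF: "z \<in> Fix" by (rule maximal_Fix[OF zT max[OF inG[OF Exp_beta_G]]])
  show nz: "act n z = z" if n: "n \<in> Rm (- \<beta>)" for n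
  proof (rule Rm_pos_fixes[OF zF n])
    fix t
    have "act (ex t \<beta>) (act n z) = act (ex t \<beta> \<otimes> n) z" using zT Rm_carrier[OF n] by (simp add: act_mult)
    then show "f (act (ex t \<beta>) (act n z)) \<le> f z" using max[OF inG[OF G_mult[OF Exp_beta_G RmD(1)[OF n]]]] by simp
  qed
  show "CX z \<subseteq> MX (GX x)"
  proof
    fix w assume "w \<in> CX z"
    then obtain h where h: "h \<in> Cent \<beta>" "w = act h z" unfolding CX_def by blast
    have "f w = f z" unfolding h(2) by (rule f_Cent[OF h(1) zF])
    then show "w \<in> MX (GX x)" unfolding MX_def using max inG[OF CentD(1)[OF h(1)]] h(2) by simp
  qed
  show "PX z = CX z"
  proof
    show "PX z \<subseteq> CX z"
    proof
      fix w assume "w \<in> PX z"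
      then obtain p where p: "p \<in> PP" "w = act p z" unfolding PX_def by blast
      obtain h n where hn: "h \<in> Cent \<beta>" "n \<in> Rm (- \<beta>)" "p = h \<otimes> n" using p(1) unfolding parabolic_iff by blast
      have "w = act h z" unfolding p(2) hn(3) using act_mult[OF Cent_carrier[OF hn(1)] Rm_carrier[OF hn(2)] zT] nz[OF hn(2)] by simp
      then show "w \<in> CX z" unfolding CX_def using hn(1) by blast
    qed
    show "CX z \<subseteq> PX z"
    proof
      fix w assume "w \<in> CX z"
      then obtain h where h: "h \<in> Cent \<beta>" "w = act h z" unfolding CX_def by blast
      have "h = h \<otimes> \<one>" using Cent_carrier[OF h(1)] by simp
      then have "h \<in> PP" unfolding parabolic_iff using h(1) Rm_one by blast
      then show "w \<in> PX z" unfolding PX_def h(2) by blast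
    qed
  qed
qed

lemma CX_open:
  assumes x: "x \<in> TZ" and cpt: "compactin (mtop Z) (GX x)" and z: "z \<in> MX (GX x)"
  shows "openin (subtopology (mtop Z) (MX (GX x))) (CX z)"
proof -
  note m = max_facts[OF x]
  have zT: "z \<in> TZ" using FixD(1)[OF m(1)[OF z]] .
  have "\<exists>T. openin (subtopology (mtop Z) (MX (GX x))) T \<and> w \<in> T \<and> T \<subseteq> CX z" if w: "w \<in> CX z" for w
  proof -
    have wM: "w \<in> MX (GX x)" using m(3)[OF z] w by blast
    have CC: "CX w = CX z" unfolding CX_def by (rule subgroup_orbit_eq[OF Cent_subgroup zT w[unfolded CX_def]])
    obtain V where V: "openin (mtop Z) V" "w \<in> V" "V \<inter> GX w \<inter> Fix \<subseteq> CX w"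
      by (rule orbit_Fix_open[OF m(1)[OF wM] _ m(2)[OF wM]]) (use cpt m(5)[OF wM] in auto)
    have "MX (GX x) \<subseteq> GX w \<inter> Fix" using m(1) m(5)[OF wM] unfolding MX_def by auto
    then have "V \<inter> MX (GX x) \<subseteq> CX z" using V(3) CC by blast
    then show ?thesis using V(1,2) wM by (intro exI[of _ "V \<inter> MX (GX x)"]) (auto simp: openin_subtopology)
  qed
  then show ?thesis using openin_subopen[of "subtopology (mtop Z) (MX (GX x))" "CX z"] by blast
qed

lemma f_attains_max:
  assumes "compactin (mtop Z) S" "S \<noteq> {}"
  obtains m where "m \<in> S" "\<forall>y\<in>S. f y \<le> f m"
proof -
  have "compactin euclideanreal (f ` S)" by (rule image_compactin[OF assms(1) f_continuous])
  then have "compact (f ` S)" by simp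
  from compact_attains_sup[OF this] assms(2) obtain y where y: "y \<in> f ` S" "\<forall>t\<in>f ` S. t \<le> y" by auto
  then obtain m where "m \<in> S" "y = f m" by blast
  then show ?thesis using y(2) that by blast
qed

lemma MX_compact:
  assumes x: "x \<in> TZ" and cpt: "compactin (mtop Z) (GX x)"
  shows "compactin (mtop Z) (MX (GX x))" and "MX (GX x) \<noteq> {}"
proof -
  have "GX x \<noteq> {}" unfolding GX_def using subgroup_orbit_refl[OF G_subgroup x] by blast
  then obtain m where m: "m \<in> GX x" "\<forall>y\<in>GX x. f y \<le> f m" by (rule f_attains_max[OF cpt])
  then show "MX (GX x) \<noteq> {}" unfolding MX_def by blast
  have "MX (GX x) = {z \<in> TZ. f z \<in> {f m..}} \<inter> GX x"
    unfolding MX_def using m GX_TZ[OF x] by (auto intro: order_trans)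
  moreover have "closedin (mtop Z) {z \<in> TZ. f z \<in> {f m..}}"
    by (rule closedin_continuous_map_preimage[OF f_continuous]) simp
  ultimately show "compactin (mtop Z) (MX (GX x))" using closed_Int_compactin[OF _ cpt] by simp
qed

lemma CX_self: "z \<in> TZ ==> z \<in> CX z"
  unfolding CX_def by (rule subgroup_orbit_refl[OF Cent_subgroup])

text \<open>The orbits of the centraliser are disjoint nonempty open subsets covering the compact
  maximum set.\<close>

lemma max_set_orbits:
  assumes x: "x \<in> TZ" and cpt: "compactin (mtop Z) (GX x)"
  shows "finite (PX ` MX (GX x))" and "\<Union>(PX ` MX (GX x)) = MX (GX x)"
    and "z \<in> MX (GX x) ==> compactin (mtop Z) (PX z)"
proof -
  let ?M = "MX (GX x)"
  note m = max_facts[OF x]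
  have MT: "z \<in> TZ" if "z \<in> ?M" for z using FixD(1)[OF m(1)[OF that]] .
  have PC: "PX ` ?M = CX ` ?M" using m(4) by auto
  have U: "\<Union>(CX ` ?M) = ?M" using m(3) CX_self[OF MT] by blast
  have disj: "C = D" if C: "C \<in> CX ` ?M" and D: "D \<in> CX ` ?M" and CD: "C \<inter> D \<noteq> {}" for C D
  proof -
    obtain z w y where z: "z \<in> ?M" "C = CX z" and w: "w \<in> ?M" "D = CX w" and y: "y \<in> C" "y \<in> D" using C D CD by blast
    have "CX y = CX z" unfolding CX_def by (rule subgroup_orbit_eq[OF Cent_subgroup MT[OF z(1)]]) (use y z CX_def in auto)
    moreover have "CX y = CX w" unfolding CX_def by (rule subgroup_orbit_eq[OF Cent_subgroup MT[OF w(1)]]) (use y w CX_def in auto)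
    ultimately show ?thesis using z w by simp
  qed
  have op: "openin (subtopology (mtop Z) (\<Union>(CX ` ?M))) C" if "C \<in> CX ` ?M" for C
    unfolding U using that CX_open[OF x cpt] by blast
  have ne: "{} \<notin> CX ` ?M" using CX_self[OF MT] by blast
  have cU: "compactin (mtop Z) (\<Union>(CX ` ?M))" unfolding U by (rule MX_compact(1)[OF x cpt])
  show "finite (PX ` ?M)" unfolding PC by (rule finite_disjoint_open_cover(1)[OF cU op ne disj])
  show "\<Union>(PX ` ?M) = ?M" unfolding PC U ..
  assume z: "z \<in> ?M"
  show "compactin (mtop Z) (PX z)"
    unfolding m(4)[OF z] by (rule finite_disjoint_open_cover(2)[OF cU op ne disj]) (use z in auto)
qed

text \<open>Let \<open>q\<close> maximise \<open>f\<close> on P x. For \<open>g\<close> in the big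
  cell the upward flow takes \<open>act g q\<close> to \<open>act h q\<close> with \<open>h\<close>
  in the centraliser, where \<open>f\<close> has the value \<open>f q\<close>. So
  \<open>f (act g q) \<le> f q\<close> on the cell, and by density on \<open>G\<close>.\<close>

lemma compact_parabolic_orbit_max:
  assumes x: "x \<in> TZ" and cpt: "compactin (mtop Z) (PX x)"
  obtains q where "q \<in> MX (GX x)" "PX x = PX q"
proof -
  have PPx: "\<And>z. z \<in> PX x ==> PX z = PX x" unfolding PX_def by (rule subgroup_orbit_eq[OF parabolic_subgroup x])
  have "PX x \<noteq> {}" unfolding PX_def using subgroup_orbit_refl[OF parabolic_subgroup x] by blast
  then obtain q where q: "q \<in> PX x" "\<forall>y\<in>PX x. f y \<le> f q" by (rule f_attains_max[OF cpt])
  have qT: "q \<in> TZ" by (rule PX_TZ[OF x q(1)])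
  have bP: "ex t \<beta> \<in> PP" for t
    by (rule Exp_nonneg_parabolic[OF subspace_scale[OF part_subspace part_mono[OF beta_pt]]]) simp
  have nP: "n \<in> PP" if "n \<in> Rm (- \<beta>)" for n
  proof -
    have "n = \<one> \<otimes> n" using Rm_carrier[OF that] by simp
    then show ?thesis unfolding parabolic_iff using that subgroup.one_closed[OF Cent_subgroup] by blast
  qed
  have qF: "q \<in> Fix" by (rule maximal_Fix[OF qT q(2)[rule_format, OF PX_step[OF x bP q(1)]]])
  have nq: "act n q = q" if n: "n \<in> Rm (- \<beta>)" for n
    by (rule Rm_pos_fixes[OF qF n q(2)[rule_format, OF PX_step[OF x bP PX_step[OF x nP[OF n] q(1)]]]])
  have fO: "f (act g q) \<le> f q" if g: "g \<in> \<Omega>" for g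
  proof -
    obtain u h n where u: "u \<in> Rm \<beta>" and h: "h \<in> Cent \<beta>" and nn: "n \<in> Rm (- \<beta>)" and guhn: "g = u \<otimes> h \<otimes> n"
      using g unfolding Omega_iff by blast
    note c = Rm_carrier[OF u] Cent_carrier[OF h] Rm_carrier[OF nn]
    have hF: "act h q \<in> Fix" by (rule Cent_Fix[OF c(2) CentD(2)[OF h] qF])
    have gu: "act g q = act u (act h q)" unfolding guhn using c qT nq[OF nn] by (simp add: act_mult)
    have gT: "act g q \<in> TZ" unfolding gu using c qT by simp
    have lim: "((\<lambda>t. f (act (ex t \<beta>) (act g q))) \<longlongrightarrow> f (act h q)) at_top"
      unfolding gu by (rule f_limit[OF flow_limit[OF u hF]])
    have "\<forall>\<^sub>F t in at_top. f (act g q) \<le> f (act (ex t \<beta>) (act g q))"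
      using eventually_ge_at_top[of 0]
    proof eventually_elim
      case (elim t)
      then show ?case using f_mono[OF gT elim] gT by simp
    qed
    from tendsto_lowerbound[OF lim this] have "f (act g q) \<le> f (act h q)" by simp
    then show ?thesis using f_Cent[OF h qF] by simp
  qed
  have fG: "f (act g q) \<le> f q" if g: "g \<in> G" for g
  proof -
    have "continuous_map (ltop L) euclideanreal (\<lambda>g. f (act g q))"
      using continuous_map_compose[OF continuous_orbit[OF qT] f_continuous] by (simp add: o_def)
    then have "closedin (ltop L) {g \<in> topspace (ltop L). f (act g q) \<in> {..f q}}"
      by (rule closedin_continuous_map_preimage) simp
    then have "ltop L closure_of \<Omega> \<subseteq> {g \<in> topspace (ltop L). f (act g q) \<in> {..f q}}"
      by (rule closure_of_minimal[rotated]) (use fO Omega_G closedin_subset[OF G_closed] in auto)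
    then show ?thesis using g unfolding Omega_dense by auto
  qed
  have "PX x \<subseteq> GX x" unfolding PX_def GX_def using parabolic_G by blast
  then have qG: "q \<in> GX x" using q(1) by blast
  have GG: "GX q = GX x" unfolding GX_def by (rule subgroup_orbit_eq[OF G_subgroup x qG[unfolded GX_def]])
  have "f y \<le> f q" if "y \<in> GX q" for y using that fG unfolding GX_def by auto
  then have "q \<in> MX (GX x)" unfolding MX_def GG using qG by blast
  then show ?thesis using that PPx[OF q(1)] by simp
qed

text \<open>P x is open and closed in the maximum set, hence a union of components. Each component
  is open in the compact set P x, because the identity component of the centraliser is open and has
  connected orbits; so there are finitely many.\<close>

lemma parabolic_orbit_components:
  assumes x: "x \<in> TZ" and cpt: "compactin (mtop Z) (PX x)"
  shows "\<exists>\<C>. finite \<C> \<and> \<C> \<subseteq> connected_components_of (subtopology (mtop Z) (MX (GX x))) \<and> PX x = \<Union>\<C>"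
proof -
  let ?M = "MX (GX x)"
  let ?T = "subtopology (mtop Z) ?M"
  note Gc = GX_compact[OF x cpt]
  note m = max_facts[OF x]
  obtain q where q: "q \<in> ?M" "PX x = PX q" by (rule compact_parabolic_orbit_max[OF x cpt])
  define Q where "Q = PX x"
  have QC: "Q = CX q" unfolding Q_def using q m(4) by simp
  have QM: "Q \<subseteq> ?M" unfolding QC by (rule m(3)[OF q(1)])
  have Qc: "compactin (mtop Z) Q" unfolding Q_def by (rule cpt)
  have MT: "z \<in> TZ" if "z \<in> ?M" for z using FixD(1)[OF m(1)[OF that]] .
  have tT: "topspace ?T = ?M" using MT by auto
  have Qop: "openin ?T Q" unfolding QC by (rule CX_open[OF x Gc q(1)])
  have Qcl: "closedin ?T Q" by (rule closedin_subset_topspace[OF compactin_imp_closedin[OF Z_Hausdorff Qc] QM])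
  define \<C> where "\<C> = {C \<in> connected_components_of ?T. C \<inter> Q \<noteq> {}}"
  have CQ: "C \<subseteq> Q" if C: "C \<in> \<C>" for C
    using connectedin_clopen_cases[OF connectedin_connected_components_of Qcl Qop, of C] C unfolding \<C>_def disjnt_def by auto
  have U: "\<Union>\<C> = Q"
  proof
    show "\<Union>\<C> \<subseteq> Q" using CQ by blast
    show "Q \<subseteq> \<Union>\<C>"
    proof
      fix z assume z: "z \<in> Q"
      then have "z \<in> \<Union>(connected_components_of ?T)" unfolding Union_connected_components_of tT using QM by blast
      then show "z \<in> \<Union>\<C>" unfolding \<C>_def using z by blast
    qed
  qed
  define A where "A = connected_component_of_set (subtopology (ltop L) (Cent \<beta>)) \<one>"
  obtain T where T: "openin (ltop L) T" "A = T \<inter> Cent \<beta>"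
    using identity_component_open[OF Cent_closed Cent_subgroup] unfolding A_def openin_subtopology by blast
  have "\<one> \<in> topspace (subtopology (ltop L) (Cent \<beta>))"
    using subgroup.one_closed[OF Cent_subgroup] one_closed unfolding carrier by simp
  then have A1: "\<one> \<in> A" unfolding A_def by (simp add: connected_component_of_refl)
  have Acon: "connectedin (ltop L) A"
    using connectedin_connected_component_of[of "subtopology (ltop L) (Cent \<beta>)" \<one>] unfolding A_def connectedin_subtopology by blast
  have op: "openin (subtopology (mtop Z) (\<Union>\<C>)) C" if C: "C \<in> \<C>" for C
  proof -
    have "\<exists>V. openin (subtopology (mtop Z) Q) V \<and> w \<in> V \<and> V \<subseteq> C" if w: "w \<in> C" for w
    proof -
      have wQ: "w \<in> Q" using CQ[OF C] w by blast
      have wM: "w \<in> ?M" using wQ QM by blast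
      note wT = MT[OF wM]
      have CC: "CX w = Q" unfolding QC CX_def
        by (rule subgroup_orbit_eq[OF Cent_subgroup MT[OF q(1)]]) (use wQ QC CX_def in auto)
      obtain V where V: "openin (mtop Z) V" "w \<in> V" "V \<inter> (\<lambda>h. act h w) ` Cent \<beta> \<subseteq> (\<lambda>h. act h w) ` (T \<inter> Cent \<beta>)"
        by (rule orbit_map_open[OF Cent_closed Cent_subgroup wT _ T(1)]) (use Qc CC A1 T(2) CX_def in auto)
      have Aw: "(\<lambda>h. act h w) ` A \<subseteq> Q" unfolding T(2) CC[symmetric] CX_def by blast
      have "connectedin (mtop Z) ((\<lambda>h. act h w) ` A)"
        by (rule connectedin_continuous_map_image[OF continuous_orbit[OF wT] Acon])
      then have "connectedin ?T ((\<lambda>h. act h w) ` A)" unfolding connectedin_subtopology using Aw QM by blast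
      moreover have "w \<in> (\<lambda>h. act h w) ` A" using A1 act_one[OF wT] by (metis image_eqI)
      ultimately have "(\<lambda>h. act h w) ` A \<subseteq> C"
        using connected_components_of_maximal[of C ?T] C w unfolding \<C>_def disjnt_def by blast
      then have "V \<inter> Q \<subseteq> C" using V(3) unfolding T(2) CC[symmetric] CX_def by blast
      then show ?thesis using V(1,2) wQ by (intro exI[of _ "V \<inter> Q"]) (auto simp: openin_subtopology)
    qed
    then show ?thesis unfolding U using openin_subopen[of "subtopology (mtop Z) Q" C] by blast
  qed
  have "finite \<C>"
  proof (rule finite_disjoint_open_cover(1)[OF _ op])
    show "compactin (mtop Z) (\<Union>\<C>)" unfolding U by (rule Qc)
    show "{} \<notin> \<C>" unfolding \<C>_def by auto
    show "C = D" if "C \<in> \<C>" "D \<in> \<C>" "C \<inter> D \<noteq> {}" for C D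
      using connected_components_of_disjoint[of C ?T D] that unfolding \<C>_def disjnt_def by auto
  qed
  moreover have "\<C> \<subseteq> connected_components_of ?T" unfolding \<C>_def by blast
  ultimately show ?thesis using U unfolding Q_def by metis
qed

end

lemma orbit_carrier_update: "orbit (L\<lparr>carrier := H\<rparr>) act x = (\<lambda>h. act h x) ` H"
  unfolding orbit_def by auto

theorem theorem1:
  fixes L :: "('g, 'e::real_normed_vector) lie_group"
    and U G :: "'g set"
    and Z :: "('z, 'f::real_normed_vector) cmanifold"
    and \<omega> :: "('z, 'f) two_form"
    and act :: "'g \<Rightarrow> 'z \<Rightarrow> 'z"
    and \<mu> :: "'z \<Rightarrow> 'e \<Rightarrow> real"
    and ip :: "'e \<Rightarrow> 'e \<Rightarrow> real"
    and \<mu>p :: "'z \<Rightarrow> 'e"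
    and X :: "'z set"
    and \<beta> :: 'e
  assumes "complexification L U"
    and "compatible_subgroup L U G" and "connectedin (ltop L) G"
    and "kaehler_manifold Z \<omega>"
    and "holomorphic_action L Z act"
    and "\<forall>u\<in>U. preserves_form Z \<omega> (act u)"
    and "momentum_map L U Z \<omega> act \<mu>"
    and "invariant_inner_product L U ip"
    and "gradient_map L U G Z \<mu> ip \<mu>p"
    and "locally_closed_submanifold Z X"
    and "\<forall>g\<in>G. \<forall>x\<in>X. act g x \<in> X"
    and "\<beta> \<in> p_part L U G"
  shows "(\<forall>x\<in>X. compactin (mtop Z) (sub_orbit L (parabolic_plus L G \<beta>) act x) \<longrightarrow>
            compactin (mtop Z) (sub_orbit L G act x) \<and>
            (\<exists>\<C>. finite \<C> \<and>
               \<C> \<subseteq> connected_components_of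
                     (subtopology (mtop Z) (max_set L ip \<mu>p \<beta> (sub_orbit L G act x))) \<and>
               sub_orbit L (parabolic_plus L G \<beta>) act x = \<Union>\<C>))
       \<and> (\<forall>\<O>\<in>compact_orbits L G Z act X.
            \<exists>\<F>. finite \<F> \<and> \<F> \<subseteq> compact_orbits L (parabolic_plus L G \<beta>) Z act X \<and>
               max_set L ip \<mu>p \<beta> \<O> = \<Union>\<F>)
       \<and> compact_orbits L G Z act X \<lesssim> compact_orbits L (parabolic_plus L G \<beta>) Z act X"
proof -
  have lie: "complex_lie_group L" using assms(1) unfolding complexification_def by blast
  have "compatible_pair L U G ip" by unfold_locales (fact lie assms(1-3) assms(8))+
  then obtain B ev where gr: "graded L U G ip \<beta> B ev" by (rule compatible_pair.graded_exists[OF _ assms(12)])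
  have Zc: "complex_manifold Z" using assms(4) unfolding kaehler_manifold_def by blast
  interpret ham L U G ip \<beta> B ev Z act \<omega> \<mu>
    by (intro ham.intro lie_action.intro gr complex_lie_gp.intro lie lie_action_axioms.intro Zc assms(5) ham_axioms.intro assms(4,7))
  have XT: "X \<subseteq> TZ" using assms(10) openin_subset unfolding locally_closed_submanifold_def by blast
  have so: "sub_orbit L G act x = GX x" "sub_orbit L PP act x = PX x" for x
    unfolding sub_orbit_def orbit_carrier_update GX_def PX_def by simp_all
  have GXX: "GX x \<subseteq> X" if "x \<in> X" for x using assms(11) that unfolding GX_def by blast
  have ms: "max_set L ip \<mu>p \<beta> Y = MX Y" if "Y \<subseteq> TZ" for Y
  proof -
    have "transported_ip L ip (\<mu>p z) \<beta> = f z" if "z \<in> TZ" for z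
      using assms(9,12) that unfolding gradient_map_def f_def \<eta>_def by blast
    then show ?thesis using that unfolding max_set_def MX_def by (auto simp: subset_iff)
  qed
  have co: "compact_orbits L G Z act X = {Y \<in> GX ` X. compactin (mtop Z) Y}"
    "compact_orbits L PP Z act X = {Y \<in> PX ` X. compactin (mtop Z) Y}"
    unfolding compact_orbits_def orbits_def orbit_carrier_update GX_def PX_def by auto
  have MXX: "MX (GX x) \<subseteq> X" if "x \<in> X" for x using GXX[OF that] unfolding MX_def by blast
  have 1: "compactin (mtop Z) (sub_orbit L G act x) \<and>
      (\<exists>\<C>. finite \<C> \<and> \<C> \<subseteq> connected_components_of (subtopology (mtop Z) (max_set L ip \<mu>p \<beta> (sub_orbit L G act x))) \<and>
         sub_orbit L PP act x = \<Union>\<C>)"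
    if x: "x \<in> X" and c: "compactin (mtop Z) (sub_orbit L PP act x)" for x
  proof -
    have xT: "x \<in> TZ" using x XT by blast
    show ?thesis
      using GX_compact[OF xT c[unfolded so]] parabolic_orbit_components[OF xT c[unfolded so]]
      unfolding so ms[OF GX_TZ[OF xT]] by blast
  qed
  have 2: "\<exists>\<F>. finite \<F> \<and> \<F> \<subseteq> compact_orbits L PP Z act X \<and> max_set L ip \<mu>p \<beta> Y = \<Union>\<F>"
    if Y: "Y \<in> compact_orbits L G Z act X" for Y
  proof -
    obtain x where x: "x \<in> X" "Y = GX x" and c: "compactin (mtop Z) (GX x)" using Y unfolding co by blast
    have xT: "x \<in> TZ" using x XT by blast
    show ?thesis unfolding x(2) ms[OF GX_TZ[OF xT]] co
      using max_set_orbits[OF xT c] MXX[OF x(1)] by (intro exI[of _ "PX ` MX (GX x)"]) auto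
  qed
  have 3: "compact_orbits L G Z act X \<lesssim> compact_orbits L PP Z act X"
  proof -
    \<comment> \<open>Any compact P-orbit in the maximum set of \<open>Y\<close> serves; it
      determines \<open>Y\<close> because distinct \<open>G\<close>-orbits are disjoint.\<close>
    have ex: "\<exists>Q. Q \<in> compact_orbits L PP Z act X \<and> Q \<subseteq> Y \<and> Q \<noteq> {}" if Y: "Y \<in> compact_orbits L G Z act X" for Y
    proof -
      obtain x where x: "x \<in> X" "Y = GX x" and c: "compactin (mtop Z) (GX x)" using Y unfolding co by blast
      have xT: "x \<in> TZ" using x XT by blast
      obtain z where z: "z \<in> MX (GX x)" using MX_compact(2)[OF xT c] by blast
      have "PX z \<subseteq> Y" using max_facts(3,4)[OF xT z] unfolding x(2) MX_def by auto
      moreover have "PX z \<noteq> {}" unfolding max_facts(4)[OF xT z] using CX_self FixD(1)[OF max_facts(1)[OF xT z]] by blast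
      moreover have "PX z \<in> compact_orbits L PP Z act X" unfolding co using max_set_orbits(3)[OF xT c z] MXX[OF x(1)] z by blast
      ultimately show ?thesis by blast
    qed
    obtain F where F: "\<And>Y. Y \<in> compact_orbits L G Z act X ==> F Y \<in> compact_orbits L PP Z act X \<and> F Y \<subseteq> Y \<and> F Y \<noteq> {}"
      using ex by metis
    have "inj_on F (compact_orbits L G Z act X)"
    proof (rule inj_onI)
      fix Y Y' assume Y: "Y \<in> compact_orbits L G Z act X" "Y' \<in> compact_orbits L G Z act X" and e: "F Y = F Y'"
      obtain w where w: "w \<in> Y" "w \<in> Y'" using F[OF Y(1)] F[OF Y(2)] e by blast
      obtain x x' where x: "x \<in> X" "Y = GX x" and x': "x' \<in> X" "Y' = GX x'" using Y unfolding co by blast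
      have "GX w = GX x" unfolding GX_def by (rule subgroup_orbit_eq[OF G_subgroup]) (use x XT w GX_def in auto)
      moreover have "GX w = GX x'" unfolding GX_def by (rule subgroup_orbit_eq[OF G_subgroup]) (use x' XT w GX_def in auto)
      ultimately show "Y = Y'" using x x' by simp
    qed
    moreover have "F ` compact_orbits L G Z act X \<subseteq> compact_orbits L PP Z act X" using F by blast
    ultimately show ?thesis unfolding lepoll_def by blast
  qed
  show ?thesis by (intro conjI[OF _ conjI[OF _ 3]] ballI impI; rule 1 2; assumption)
qed

end
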